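(* Consider the SOS model with spin values $\{0,1,2\}$ (i.e. $m=2$) on the Cayley tree $\Gamma^2$ of order two, with parameter $\theta=\exp(J\beta)>0$, and let $\mu_1,\dots,\mu_7$ be the translation-invariant splitting Gibbs measures (TISGMs) defined in the context. There exist $\theta_c\ (\approx 0.1414)$ and $$\theta_c'=\frac13\left(\sqrt[3]{26+6\sqrt{33}}-\frac{8}{\sqrt[3]{26+6\sqrt{33}}}-1\right)\ (\approx 0.2956)$$ such that the following assertions hold. I. (Existence) 1) If $\theta>\theta_c'$ then there exists a unique TISGM, $\mu_1$. 2) If $\theta=\theta_c'$ then there are exactly three TISGMs, $\mu_i$, $i=1,4,6$. 3) If $\theta_c<\theta<\theta_c'$ then there are exactly five TISGMs, $\mu_i$, $i=1,4,5,6,7$. 4) If $\theta=\theta_c$ then there are exactly six TISGMs, $\mu_i$, $i=1,3,4,5,6,7$. 5) If $\theta<\theta_c$ then there are exactly seven TISGMs, $\mu_i$, $i=1,2,3,4,5,6,7$. II. (Extremality in the set of all Gibbs measures of the model at the given $\theta$) a) There are values $\bar\theta\ (\approx 2.655)$ and $\bar{\bar\theta}\ (\approx 2.8765)$ such that $\mu_1$ is extreme if $\theta<\bar\theta$ and is non-extreme if $\theta>\bar{\bar\theta}$. b) The measures $\mu_2$ and $\mu_3$ are non-extreme (for all $\theta$ for which they exist). c) There are values $\theta^*\ (\approx 0.17172)$ and $\theta^{**}\ (\approx 0.26586)$ such that the measures $\mu_5$ and $\mu_6$ are non-extreme if $\theta<\theta^*$ and are extreme if $\theta>\theta^{**}$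 (for $\theta$ for which they exist). d) The measures $\mu_4$ and $\mu_7$ are extreme (for all $\theta$ for which they exist).
   Context: The Cayley tree $\Gamma^k=(V,L)$ of order $k$ is the infinite tree in which every vertex has exactly $k+1$ neighbours; here $k=2$. Fix a root $x^0\in V$; $W_n$ is the set of vertices at graph distance $n$ from $x^0$, $V_n=\bigcup_{j\le n}W_j$, and for $x\in W_n$, $S(x)$ is the set of neighbours of $x$ in $W_{n+1}$. SOS model: spin space $\Phi=\{0,1,2\}$, configurations $\sigma\in\Phi^V$, formal Hamiltonian $H(\sigma)=-J\sum_{\langle x,y\rangle\in L}|\sigma(x)-\sigma(y)|$ with $J\in\mathbb R$, inverse temperature $\beta>0$, $\theta=\exp(J\beta)$ ($\theta<1$ is ferromagnetic, $\theta>1$ antiferromagnetic). A Gibbs measure is a probability measure on $\Phi^V$ satisfying the DLR equations for $\beta H$. The Gibbs measures form a non-empty convex compact set; a Gibbs measure is extreme if it is an extreme point of this set (the set of all Gibbs measures, including non-translation-invariant ones), and non-extreme otherwise. Splitting Gibbs measures: for a function $x\mapsto h_x=(h_{0,x},h_{1,x},h_{2,x})\in\mathbb R^3$, $x\in V\setminus\{x^0\}$, and $n\ge1$ let $\mu^{(n)}$ be the probability distribution on $\Phi^{V_n}$ with $\mu^{(n)}(\sigma_n)=Z_n^{-1}\exp\big(-\beta H(\sigma_n)+\sum_{x\in W_n}h_{\sigma_n(x),x}\big)$, where $H(\sigma_n)$ sums over the edges within $V_n$. If these are compatible (the marginal of $\mu^{(n)}$ on $\Phi^{V_{n-1}}$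 is $\mu^{(n-1)}$ for all $n\ge 2$), the unique probability measure $\mu$ on $\Phi^V$ with marginals $\mu^{(n)}$ on $\Phi^{V_n}$ is called a splitting Gibbs measure (SGM). A TISGM is an SGM for which $h_x$ can be taken independent of $x$ (modulo adding constants to the vector $h_x$, which does not change $\mu^{(n)}$). Normalizing $h_{2}=0$ and setting $x=\sqrt{e^{h_0}}>0$, $y=\sqrt{e^{h_1}}>0$, the TISGMs correspond to the solutions $(x,y)$, $x,y>0$, of $$x=\frac{x^2+\theta y^2+\theta^2}{\theta^2x^2+\theta y^2+1},\qquad y=\frac{\theta x^2+y^2+\theta}{\theta^2x^2+\theta y^2+1}.$$ The measure $\mu_i$ is the TISGM corresponding to the solution $v_i=(x_i,y_i)$, where: - $x_1=x_2=x_3=1$ and $y_1,y_2,y_3$ are the real roots of $\theta y^3-y^2+(\theta^2+1)y-2\theta=0$: for $\theta<\theta_c$ there are three, $y_3<y_2<y_1$; for $\theta=\theta_c$ there are two distinct ones, the larger being $y_1$ and the smaller being $y_2=y_3$ (so $\mu_2=\mu_3$); for $\theta>\theta_c$ there is only one, $y_1$. - For $\theta\le\theta_c'$, with $\xi_{1}=\frac{1-3\theta^2-\sqrt{(\theta-1)(\theta^3+\theta^2+3\theta-1)}}{2\theta^2}$ and $\xi_2=\frac{1-3\theta^2+\sqrt{(\theta-1)(\theta^3+\theta^2+3\theta-1)}}{2\theta^2}$, set $x_4=\frac12(\xi_2-\sqrt{\xi_2^2-4})$, $x_5=\frac12(\xi_1-\sqrt{\xi_1^2-4})$, $x_6=\frac12(\xi_1+\sqrt{\xi_1^2-4})$,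 $x_7=\frac12(\xi_2+\sqrt{\xi_2^2-4})$ and $y_i=\frac1{\sqrt\theta}\sqrt{(1-\theta^2)x_i-\theta^2(x_i^2+1)}$, $i=4,5,6,7$ (at $\theta=\theta_c'$ one has $\xi_1=\xi_2$, so $\mu_4=\mu_5$ and $\mu_6=\mu_7$). The symbol $\approx$ indicates the approximate numerical value of the constant to the printed digits. *)

theory Defs
  imports "HOL-Probability.Probability"
begin

text \<open>The vertex set is the whole type \<open>'v\<close>; an undirected edge is represented by both of
  its orientations in the relation \<open>L\<close>.\<close>

definition path_between :: "'v rel \<Rightarrow> 'v \<Rightarrow> 'v \<Rightarrow> 'v list \<Rightarrow> bool" where
  "path_between L x y p \<longleftrightarrow>
     p \<noteq> [] \<and> hd p = x \<and> last p = y \<and> distinct p \<and> successively (\<lambda>u v. (u, v) \<in> L) p"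

definition tree :: "'v rel \<Rightarrow> bool" where
  "tree L \<longleftrightarrow> sym L \<and> irrefl L \<and> (\<forall>x y. \<exists>!p. path_between L x y p)"

definition cayley_tree :: "nat \<Rightarrow> 'v rel \<Rightarrow> bool" where
  "cayley_tree k L \<longleftrightarrow> infinite (UNIV :: 'v set) \<and> tree L \<and> (\<forall>x. card (L `` {x}) = k + 1)"

definition graph_dist :: "'v rel \<Rightarrow> 'v \<Rightarrow> 'v \<Rightarrow> nat" where
  "graph_dist L x y = (LEAST n. (x, y) \<in> L ^^ n)"

definition Wn :: "'v rel \<Rightarrow> 'v \<Rightarrow> nat \<Rightarrow> 'v set" where
  "Wn L x0 n = {x. graph_dist L x0 x = n}"

definition Vn :: "'v rel \<Rightarrow> 'v \<Rightarrow> nat \<Rightarrow> 'v set" where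
  "Vn L x0 n = (\<Union>j\<le>n. Wn L x0 j)"

definition spins :: "nat set" where
  "spins = {0, 1, 2}"

definition config_space :: "('v \<Rightarrow> nat) measure" where
  "config_space = (\<Pi>\<^sub>M x\<in>UNIV. count_space spins)"

text \<open>\<open>B\<close> is a symmetric set of oriented edges, in which every undirected edge occurs twice;
  hence the division by 2.\<close>

definition energy :: "real \<Rightarrow> 'v rel \<Rightarrow> ('v \<Rightarrow> nat) \<Rightarrow> real" where
  "energy J B \<sigma> = - J * ((\<Sum>(x, y)\<in>B. \<bar>real (\<sigma> x) - real (\<sigma> y)\<bar>) / 2)"

text \<open>The Gibbsian specification: the kernel of the finite volume \<open>\<Lambda>\<close> evaluated at the event
  \<open>A\<close>, given the configuration \<open>\<omega>\<close> outside \<open>\<Lambda>\<close>. The energy involves all edges that meet \<open>\<Lambda>\<close>.\<close>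

definition local_weight ::
  "real \<Rightarrow> real \<Rightarrow> 'v rel \<Rightarrow> 'v set \<Rightarrow> ('v \<Rightarrow> nat) \<Rightarrow> real" where
  "local_weight J \<beta> L \<Lambda> \<sigma> = exp (- \<beta> * energy J (L \<inter> (\<Lambda> \<times> UNIV \<union> UNIV \<times> \<Lambda>)) \<sigma>)"

definition gibbs_kernel ::
  "real \<Rightarrow> real \<Rightarrow> 'v rel \<Rightarrow> 'v set \<Rightarrow> ('v \<Rightarrow> nat) \<Rightarrow> ('v \<Rightarrow> nat) set \<Rightarrow> real" where
  "gibbs_kernel J \<beta> L \<Lambda> \<omega> A =
     (\<Sum>\<zeta>\<in>\<Lambda> \<rightarrow>\<^sub>E spins. local_weight J \<beta> L \<Lambda> (override_on \<omega> \<zeta> \<Lambda>) * indicator A (override_on \<omega> \<zeta> \<Lambda>))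
     / (\<Sum>\<zeta>\<in>\<Lambda> \<rightarrow>\<^sub>E spins. local_weight J \<beta> L \<Lambda> (override_on \<omega> \<zeta> \<Lambda>))"

definition gibbs_measure :: "real \<Rightarrow> real \<Rightarrow> 'v rel \<Rightarrow> ('v \<Rightarrow> nat) measure \<Rightarrow> bool" where
  "gibbs_measure J \<beta> L \<mu> \<longleftrightarrow>
     prob_space \<mu> \<and> sets \<mu> = sets config_space \<and>
     (\<forall>\<Lambda> A. finite \<Lambda> \<longrightarrow> A \<in> sets config_space \<longrightarrow>
        measure \<mu> A = (\<integral>\<omega>. gibbs_kernel J \<beta> L \<Lambda> \<omega> A \<partial>\<mu>))"

definition extreme_gibbs :: "real \<Rightarrow> real \<Rightarrow> 'v rel \<Rightarrow> ('v \<Rightarrow> nat) measure \<Rightarrow> bool" where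
  "extreme_gibbs J \<beta> L \<mu> \<longleftrightarrow>
     gibbs_measure J \<beta> L \<mu> \<and>
     (\<forall>\<nu>\<^sub>1 \<nu>\<^sub>2 t. gibbs_measure J \<beta> L \<nu>\<^sub>1 \<longrightarrow> gibbs_measure J \<beta> L \<nu>\<^sub>2 \<longrightarrow> 0 < t \<longrightarrow> t < 1 \<longrightarrow>
        (\<forall>A\<in>sets config_space. measure \<mu> A = t * measure \<nu>\<^sub>1 A + (1 - t) * measure \<nu>\<^sub>2 A) \<longrightarrow>
        \<nu>\<^sub>1 = \<nu>\<^sub>2)"

definition non_extreme_gibbs :: "real \<Rightarrow> real \<Rightarrow> 'v rel \<Rightarrow> ('v \<Rightarrow> nat) measure \<Rightarrow> bool" where
  "non_extreme_gibbs J \<beta> L \<mu> \<longleftrightarrow> gibbs_measure J \<beta> L \<mu> \<and> \<not> extreme_gibbs J \<beta> L \<mu>"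

text \<open>For the function \<open>h\<close>, \<open>h x i\<close> is the field of spin \<open>i\<close> at vertex \<open>x\<close>. Only
  the spins \<open>i \<in> {0, 1, 2}\<close> and the vertices \<open>x \<noteq> x0\<close> matter, as the measures below are used
  for \<open>n \<ge> 1\<close> only. Configurations on \<open>V\<^sub>n\<close> are extensional functions on \<open>V\<^sub>n\<close>, and a
  probability distribution on the finite set of them is given by its mass function.\<close>

definition vol_weight ::
  "real \<Rightarrow> real \<Rightarrow> 'v rel \<Rightarrow> 'v \<Rightarrow> ('v \<Rightarrow> nat \<Rightarrow> real) \<Rightarrow> nat \<Rightarrow> ('v \<Rightarrow> nat) \<Rightarrow> real" where
  "vol_weight J \<beta> L x0 h n \<sigma> =
     exp (- \<beta> * energy J (L \<inter> (Vn L x0 n \<times> Vn L x0 n)) \<sigma> + (\<Sum>x\<in>Wn L x0 n. h x (\<sigma> x)))"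

definition vol_prob ::
  "real \<Rightarrow> real \<Rightarrow> 'v rel \<Rightarrow> 'v \<Rightarrow> ('v \<Rightarrow> nat \<Rightarrow> real) \<Rightarrow> nat \<Rightarrow> ('v \<Rightarrow> nat) \<Rightarrow> real" where
  "vol_prob J \<beta> L x0 h n \<sigma> =
     vol_weight J \<beta> L x0 h n \<sigma> / (\<Sum>\<omega>\<in>Vn L x0 n \<rightarrow>\<^sub>E spins. vol_weight J \<beta> L x0 h n \<omega>)"

definition compatible :: "real \<Rightarrow> real \<Rightarrow> 'v rel \<Rightarrow> 'v \<Rightarrow> ('v \<Rightarrow> nat \<Rightarrow> real) \<Rightarrow> bool" where
  "compatible J \<beta> L x0 h \<longleftrightarrow>
     (\<forall>n\<ge>2. \<forall>\<sigma>\<in>Vn L x0 (n - 1) \<rightarrow>\<^sub>E spins.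
        (\<Sum>\<omega> | \<omega> \<in> Vn L x0 n \<rightarrow>\<^sub>E spins \<and> restrict \<omega> (Vn L x0 (n - 1)) = \<sigma>. vol_prob J \<beta> L x0 h n \<omega>)
        = vol_prob J \<beta> L x0 h (n - 1) \<sigma>)"

definition splitting_gibbs ::
  "real \<Rightarrow> real \<Rightarrow> 'v rel \<Rightarrow> 'v \<Rightarrow> ('v \<Rightarrow> nat \<Rightarrow> real) \<Rightarrow> ('v \<Rightarrow> nat) measure \<Rightarrow> bool" where
  "splitting_gibbs J \<beta> L x0 h \<mu> \<longleftrightarrow>
     compatible J \<beta> L x0 h \<and> prob_space \<mu> \<and> sets \<mu> = sets config_space \<and>
     (\<forall>n\<ge>1. \<forall>\<sigma>\<in>Vn L x0 n \<rightarrow>\<^sub>E spins.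
        measure \<mu> {\<omega>\<in>space \<mu>. restrict \<omega> (Vn L x0 n) = \<sigma>} = vol_prob J \<beta> L x0 h n \<sigma>)"

definition TISGM :: "real \<Rightarrow> real \<Rightarrow> 'v rel \<Rightarrow> 'v \<Rightarrow> ('v \<Rightarrow> nat) measure \<Rightarrow> bool" where
  "TISGM J \<beta> L x0 \<mu> \<longleftrightarrow> (\<exists>h. splitting_gibbs J \<beta> L x0 (\<lambda>_. h) \<mu>)"

definition TISGM_at ::
  "real \<Rightarrow> real \<Rightarrow> 'v rel \<Rightarrow> 'v \<Rightarrow> real \<times> real \<Rightarrow> ('v \<Rightarrow> nat) measure" where
  "TISGM_at J \<beta> L x0 v =
     (THE \<mu>. \<exists>h. h 2 = 0 \<and> v = (sqrt (exp (h 0)), sqrt (exp (h 1))) \<and>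
                 splitting_gibbs J \<beta> L x0 (\<lambda>_. h) \<mu>)"

definition cubic_roots :: "real \<Rightarrow> real set" where
  "cubic_roots \<theta> = {y. \<theta> * y^3 - y^2 + (\<theta>^2 + 1) * y - 2 * \<theta> = 0}"

definition \<xi>\<^sub>1 :: "real \<Rightarrow> real" where
  "\<xi>\<^sub>1 \<theta> = (1 - 3 * \<theta>^2 - sqrt ((\<theta> - 1) * (\<theta>^3 + \<theta>^2 + 3 * \<theta> - 1))) / (2 * \<theta>^2)"

definition \<xi>\<^sub>2 :: "real \<Rightarrow> real" where
  "\<xi>\<^sub>2 \<theta> = (1 - 3 * \<theta>^2 + sqrt ((\<theta> - 1) * (\<theta>^3 + \<theta>^2 + 3 * \<theta> - 1))) / (2 * \<theta>^2)"

definition y_of :: "real \<Rightarrow> real \<Rightarrow> real" where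
  "y_of \<theta> x = 1 / sqrt \<theta> * sqrt ((1 - \<theta>^2) * x - \<theta>^2 * (x^2 + 1))"

text \<open>The solutions 1, 2, 3 use the largest, the second largest and the smallest real root of the
  cubic; when it has just two distinct roots, the latter two coincide. When it has only one root,
  the values at 2 and 3 are not meaningful. Likewise the values at 4 to 7 are meaningful only as
  long as the square roots have nonnegative arguments.\<close>

definition sol :: "real \<Rightarrow> nat \<Rightarrow> real \<times> real" where
  "sol \<theta> i =
     (let R = cubic_roots \<theta>;
          x4 = (\<xi>\<^sub>2 \<theta> - sqrt ((\<xi>\<^sub>2 \<theta>)^2 - 4)) / 2;
          x5 = (\<xi>\<^sub>1 \<theta> - sqrt ((\<xi>\<^sub>1 \<theta>)^2 - 4)) / 2;
          x6 = (\<xi>\<^sub>1 \<theta> + sqrt ((\<xi>\<^sub>1 \<theta>)^2 - 4)) / 2;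
          x7 = (\<xi>\<^sub>2 \<theta> + sqrt ((\<xi>\<^sub>2 \<theta>)^2 - 4)) / 2
      in if i = 1 then (1, Max R)
         else if i = 2 then (1, Max (R - {Max R}))
         else if i = 3 then (1, Min R)
         else if i = 4 then (x4, y_of \<theta> x4)
         else if i = 5 then (x5, y_of \<theta> x5)
         else if i = 6 then (x6, y_of \<theta> x6)
         else (x7, y_of \<theta> x7))"

definition \<mu>_sos :: "'v rel \<Rightarrow> 'v \<Rightarrow> real \<Rightarrow> real \<Rightarrow> nat \<Rightarrow> ('v \<Rightarrow> nat) measure" where
  "\<mu>_sos L x0 J \<beta> i = TISGM_at J \<beta> L x0 (sol (exp (J * \<beta>)) i)"

text \<open>\<open>c\<close> is the value of \<open>a\<close> rounded to \<open>d\<close> decimal places.\<close>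

definition rounds_to :: "real \<Rightarrow> nat \<Rightarrow> real \<Rightarrow> bool" where
  "rounds_to a d c \<longleftrightarrow> \<bar>a - c\<bar> \<le> (1 / 10^d) / 2"

end

theory Submission
  imports Defs
begin

text \<open>A splitting Gibbs measure with constant field is a Markov chain indexed by the tree, so everything
  depends on the transition matrix \<open>P\<close> attached to a solution \<open>(x, y)\<close>. The solutions with \<open>x = 1\<close>
  are the roots of a cubic, the others come from a quadratic equation in \<open>(1 + x)\<^sup>2 / x\<close>.

  Non-extremality (Kesten--Stigum): if \<open>P f = \<lambda> f\<close> with \<open>\<lambda> \<noteq> 1\<close> and \<open>2 \<lambda>\<^sup>2 > 1\<close>, then the normalised sums of \<open>f\<close> over
  the spheres form an \<open>L\<^sup>2\<close>-bounded martingale whose limit is a non-constant tail random variable.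

  Extremality: on configurations up to the sphere at distance \<open>n\<close>, changing one boundary spin changes a conditional
  probability near the root by at most \<open>C \<gamma>\<^sup>n\<close>, and along the chain a Lipschitz function of a
  spin contracts by \<open>\<kappa>\<close>. Summing over the \<open>2\<^sup>n\<close> boundary sites, the conditional
  probability has variance of order \<open>(2 \<kappa> \<gamma>)\<^sup>n\<close>; if \<open>2 \<kappa> \<gamma> < 1\<close>, the boundary is
  asymptotically irrelevant, also for every Gibbs measure dominated by a multiple of the chain.
  For the symmetric solutions and the solutions 4 and 7 the discrete metric on the spins suffices, for the solutions
  5 and 6 a weighted metric is needed.\<close>

section \<open>The rooted Cayley tree\<close>

text \<open>The two directions of the extremality criterion see different data. From the boundary
  inwards the boundary condition is arbitrary, so \<gamma> must hold uniformly in all incoming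
  messages; the only a priori information is that for \<theta> \<le> 1 a message cannot starve the
  middle spin, and the solutions 5 and 6 depend on it. Outwards only the transition matrix of the
  chosen solution matters; it gives \<kappa>. The growth 2^n enters once and not squared: a
  conditional probability G of an event of probability p has variance p (E(G | event) - p), so one
  descent of G from the sphere is enough and no pairs of boundary sites are compared. The
  extremality thresholds are prescribed only up to rounding. Explicit rationals are chosen for them,
  and the slack they leave admits polynomial certificates over the rationals. The nested radicals of
  the solutions never enter the estimates: a root is located by the sign of its polynomial at an
  explicit test point.\<close>

locale cayley2 =
  fixes L :: "'v rel" and x0 :: 'v
  assumes cayley: "cayley_tree 2 L"
begin

abbreviation "W \<equiv> Wn L x0"
abbreviation "V \<equiv> Vn L x0"

definition rpath :: "'v \<Rightarrow> 'v list" where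
  "rpath v = (THE p. path_between L x0 v p)"

definition lev :: "'v \<Rightarrow> nat" where
  "lev v = length (rpath v) - 1"

definition par :: "'v \<Rightarrow> 'v" where
  "par v = last (butlast (rpath v))"

definition ch :: "'v \<Rightarrow> 'v set" where
  "ch v = {c. c \<noteq> x0 \<and> par c = v}"

lemma L_sym: "(u, v) \<in> L \<Longrightarrow> (v, u) \<in> L"
  using cayley unfolding cayley_tree_def tree_def sym_def by blast

lemma L_irrefl: "(u, u) \<notin> L"
  using cayley unfolding cayley_tree_def tree_def irrefl_def by blast

lemma path_unique: "\<exists>!p. path_between L x y p"
  using cayley unfolding cayley_tree_def tree_def by blast

lemma card_nbrs: "card (L `` {v}) = 3"
  using cayley unfolding cayley_tree_def by simp

lemma rpath: "path_between L x0 v (rpath v)"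
  unfolding rpath_def by (rule theI', rule path_unique)

lemma rpath_eqI: "path_between L x0 v p \<Longrightarrow> rpath v = p"
  using rpath path_unique by blast

lemma rpath_root: "rpath x0 = [x0]"
  by (rule rpath_eqI) (simp add: path_between_def)

lemma rpath_ne: "rpath v \<noteq> []"
  using rpath[of v] by (simp add: path_between_def)

lemma last_rpath: "last (rpath v) = v"
  using rpath[of v] by (simp add: path_between_def)

text \<open>If \<open>v\<close> is off the path to \<open>u\<close>, appending \<open>v\<close>
  gives a path to \<open>v\<close>. Otherwise the path to \<open>u\<close> is cut at
  \<open>v\<close> and the edge leads back to \<open>u\<close> at once. Both times uniqueness of
  paths identifies the result.\<close>

lemma adj_cases:
  assumes "(u, v) \<in> L"
  shows "rpath v = rpath u @ [v] \<or> rpath u = rpath v @ [u]"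
proof (cases "v \<in> set (rpath u)")
  case False
  have "path_between L x0 v (rpath u @ [v])"
    using rpath[of u] False assms by (auto simp: path_between_def successively_append_iff)
  then show ?thesis using rpath_eqI by blast
next
  case True
  then obtain ys zs where e: "rpath u = ys @ v # zs" by (auto simp: in_set_conv_decomp)
  have "u \<noteq> v" using assms L_irrefl by blast
  then have zs: "zs \<noteq> []" using e last_rpath[of u] by auto
  have p: "path_between L x0 u (ys @ v # zs)" using rpath[of u] e by simp
  then have pv: "path_between L x0 v (ys @ [v])"
    by (cases ys) (auto simp: path_between_def successively_append_iff successively_Cons hd_append
        split: if_splits)
  \<comment> \<open>\<open>u\<close> lies in the part that is cut off, so it may be appended to the
    part ending in \<open>v\<close>.\<close>
  have "last zs = u" using p zs by (simp add: path_between_def)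
  then have "u \<in> set zs" using zs by auto
  then have "u \<notin> set (ys @ [v])" using p by (auto simp: path_between_def)
  then have "path_between L x0 u ((ys @ [v]) @ [u])"
    using pv assms L_sym unfolding path_between_def
    by (auto simp: successively_append_iff hd_append)
  then show ?thesis using rpath_eqI pv by metis
qed

lemma rpath_par:
  assumes "v \<noteq> x0"
  shows "rpath v = rpath (par v) @ [v]" and "(par v, v) \<in> L"
proof -
  let ?q = "butlast (rpath v)"
  have e: "rpath v = ?q @ [v]" using rpath_ne last_rpath by (metis append_butlast_last_id)
  have ne: "?q \<noteq> []"
  proof
    assume "?q = []"
    then have "rpath v = [v]" using e by simp
    then show False using rpath[of v] assms by (simp add: path_between_def)
  qed
  have p: "path_between L x0 v (?q @ [v])" using rpath[of v] e by simp
  then have "path_between L x0 (last ?q) ?q" using ne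
    by (auto simp: path_between_def successively_append_iff hd_append)
  then have "rpath (par v) = ?q" unfolding par_def by (rule rpath_eqI)
  then show "rpath v = rpath (par v) @ [v]" using e by simp
  show "(par v, v) \<in> L" using p ne unfolding par_def
    by (auto simp: path_between_def successively_append_iff)
qed

lemma lev_root [simp]: "lev x0 = 0"
  by (simp add: lev_def rpath_root)

lemma lev_par: "v \<noteq> x0 \<Longrightarrow> lev v = Suc (lev (par v))"
  using rpath_par(1)[of v] rpath_ne[of "par v"] unfolding lev_def by simp

lemma lev_0_iff: "lev v = 0 \<longleftrightarrow> v = x0"
  by (metis lev_par lev_root nat.distinct(1))

text \<open>From here on an edge is named by its endpoint farther from the root; this replaces the
  symmetric relation \<open>L\<close> in all products over edges.\<close>

lemma edge_iff: "(u, v) \<in> L \<longleftrightarrow> (v \<noteq> x0 \<and> u = par v) \<or> (u \<noteq> x0 \<and> v = par u)"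
proof
  assume "(u, v) \<in> L"
  from adj_cases[OF this] show "(v \<noteq> x0 \<and> u = par v) \<or> (u \<noteq> x0 \<and> v = par u)"
  proof
    assume a: "rpath v = rpath u @ [v]"
    then have "v \<noteq> x0" using rpath_root rpath_ne[of u] by auto
    moreover have "par v = u" unfolding par_def a by (simp add: last_rpath)
    ultimately show ?thesis by simp
  next
    assume a: "rpath u = rpath v @ [u]"
    then have "u \<noteq> x0" using rpath_root rpath_ne[of v] by auto
    moreover have "par u = v" unfolding par_def a by (simp add: last_rpath)
    ultimately show ?thesis by simp
  qed
next
  assume "(v \<noteq> x0 \<and> u = par v) \<or> (u \<noteq> x0 \<and> v = par u)"
  then show "(u, v) \<in> L" using rpath_par(2) L_sym by blast
qed

lemma lev_walk: "(x0, v) \<in> L ^^ n \<Longrightarrow> lev v \<le> n"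
proof (induction n arbitrary: v)
  case (Suc n)
  then obtain u where u: "(x0, u) \<in> L ^^ n" "(u, v) \<in> L" by auto
  then have "lev u \<le> n" using Suc.IH by blast
  moreover have "lev v \<le> Suc (lev u)"
    using u(2) lev_par[of u] lev_par[of v] unfolding edge_iff by auto
  ultimately show ?case by simp
qed simp

lemma walk_lev: "(x0, v) \<in> L ^^ lev v"
proof (induction "lev v" arbitrary: v)
  case 0
  then show ?case using lev_0_iff[of v] by simp
next
  case (Suc n)
  have "v \<noteq> x0" using Suc(2) by auto
  then have v: "lev v = Suc (lev (par v))" and e: "(par v, v) \<in> L"
    using lev_par rpath_par(2) by blast+
  then have "(x0, par v) \<in> L ^^ lev (par v)" using Suc by auto
  then show ?case using e unfolding v by auto
qed

lemma graph_dist_lev: "graph_dist L x0 v = lev v"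
  unfolding graph_dist_def
  by (rule Least_equality) (use walk_lev lev_walk in auto)

lemma W_iff [simp]: "v \<in> W n \<longleftrightarrow> lev v = n"
  by (simp add: Wn_def graph_dist_lev)

lemma V_iff [simp]: "v \<in> V n \<longleftrightarrow> lev v \<le> n"
  by (auto simp: Vn_def)

lemma ch_iff [simp]: "c \<in> ch v \<longleftrightarrow> c \<noteq> x0 \<and> par c = v"
  by (simp add: ch_def)

lemma nbrs: "L `` {v} = ch v \<union> (if v = x0 then {} else {par v})"
proof (rule set_eqI)
  fix u
  have "u \<in> L `` {v} \<longleftrightarrow> (v, u) \<in> L" by simp
  also have "\<dots> \<longleftrightarrow> (u \<noteq> x0 \<and> v = par u) \<or> (v \<noteq> x0 \<and> u = par v)" by (rule edge_iff)
  also have "\<dots> \<longleftrightarrow> u \<in> ch v \<union> (if v = x0 then {} else {par v})"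
    by (cases "v = x0") auto
  finally show "u \<in> L `` {v} \<longleftrightarrow> u \<in> ch v \<union> (if v = x0 then {} else {par v})" .
qed

lemma finite_ch [simp]: "finite (ch v)"
proof -
  have "finite (L `` {v})" by (rule ccontr) (use card_nbrs[of v] in simp)
  then show ?thesis unfolding nbrs by (rule finite_subset[rotated]) (rule Un_upper1)
qed

text \<open>Only the root lacks a parent and so has three children. This exception is why many
  statements below start at sphere \<open>Suc n\<close> and why cubes appear at the root.\<close>

lemma card_ch: "card (ch v) = (if v = x0 then 3 else 2)"
proof -
  have n: "par v \<notin> ch v" if "v \<noteq> x0"
  proof
    assume "par v \<in> ch v"
    then have "lev (par v) = Suc (lev v)" using lev_par[of "par v"] by simp
    then show False using lev_par[OF that] by simp
  qed
  show ?thesis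
  proof (cases "v = x0")
    case True
    then show ?thesis using card_nbrs[of v] unfolding nbrs by simp
  next
    case False
    then have "card (insert (par v) (ch v)) = 3" using card_nbrs[of v] unfolding nbrs by simp
    then show ?thesis using n[OF False] False by simp
  qed
qed

lemma W_0: "W 0 = {x0}"
  by (auto simp: lev_0_iff)

lemma V_0: "V 0 = {x0}"
  by (auto simp: lev_0_iff)

lemma lev_Suc_iff: "lev c = Suc n \<longleftrightarrow> c \<noteq> x0 \<and> lev (par c) = n"
  using lev_par[of c] by (cases "c = x0") auto

lemma W_Suc: "W (Suc n) = (\<Union>v\<in>W n. ch v)"
  by (auto simp: lev_Suc_iff)

lemma par_W: "c \<in> W (Suc n) \<Longrightarrow> par c \<in> W n"
  by (simp add: lev_Suc_iff)

lemma V_Suc: "V (Suc n) = V n \<union> W (Suc n)"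
  by auto

lemma V_W_disj: "V n \<inter> W (Suc n) = {}"
  by auto

lemma W_sub_V: "n \<le> m \<Longrightarrow> W n \<subseteq> V m"
  by auto

lemma V_mono: "n \<le> m \<Longrightarrow> V n \<subseteq> V m"
  by auto

lemma finite_W [simp]: "finite (W n)"
proof (induction n)
  case 0 then show ?case unfolding W_0 by simp
next
  case (Suc n) then show ?case unfolding W_Suc by simp
qed

lemma finite_V [simp]: "finite (V n)"
  by (simp add: Vn_def)

lemma card_W: "card (W (Suc n)) = 3 * 2 ^ n"
proof (induction n)
  case 0
  show ?case unfolding W_Suc W_0 by (simp add: card_ch)
next
  case (Suc n)
  have "card (W (Suc (Suc n))) = (\<Sum>v\<in>W (Suc n). card (ch v))"
    unfolding W_Suc[of "Suc n"] by (rule card_UN_disjoint) auto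
  also have "\<dots> = (\<Sum>v\<in>W (Suc n). 2)"
    by (rule sum.cong) (auto simp: card_ch)
  finally show ?case using Suc by simp
qed

lemma prod_W_Suc: "(\<Prod>c\<in>W (Suc n). f c) = (\<Prod>v\<in>W n. \<Prod>c\<in>ch v. f c)"
  unfolding W_Suc by (rule prod.UNION_disjoint) auto

end

section \<open>Cylinder events\<close>

lemma sum_PiE_Un:
  fixes g :: "('a \<Rightarrow> 'b) \<Rightarrow> ('a \<Rightarrow> 'b) \<Rightarrow> 'c::comm_monoid_add"
  assumes "A \<inter> B = {}"
  shows "(\<Sum>\<sigma>\<in>PiE (A \<union> B) S. g (restrict \<sigma> A) (restrict \<sigma> B))
       = (\<Sum>\<zeta>\<in>PiE A S. \<Sum>\<eta>\<in>PiE B S. g \<zeta> \<eta>)"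
proof -
  have "(\<Sum>\<sigma>\<in>PiE (A \<union> B) S. g (restrict \<sigma> A) (restrict \<sigma> B))
      = (\<Sum>(\<zeta>, \<eta>)\<in>PiE A S \<times> PiE B S. g \<zeta> \<eta>)"
    by (rule sum.reindex_bij_witness[where j = "\<lambda>\<sigma>. (restrict \<sigma> A, restrict \<sigma> B)" and i = "merge A B"])
       (use assms in \<open>auto simp: PiE_iff fun_eq_iff merge_def restrict_def extensional_def\<close>)
  then show ?thesis by (simp add: sum.cartesian_product)
qed

lemma sum_PiE_insert:
  fixes g :: "('a \<Rightarrow> 'b) \<Rightarrow> 'c::comm_monoid_add"
  assumes "a \<notin> A"
  shows "(\<Sum>\<sigma>\<in>PiE (insert a A) S. g \<sigma>) = (\<Sum>j\<in>S a. \<Sum>\<zeta>\<in>PiE A S. g (\<zeta>(a := j)))"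
proof -
  have "(\<Sum>\<sigma>\<in>PiE (insert a A) S. g \<sigma>) = (\<Sum>(j, \<zeta>)\<in>S a \<times> PiE A S. g (\<zeta>(a := j)))"
    unfolding PiE_insert_eq
    by (subst sum.reindex) (use inj_combinator[OF assms, of S] in \<open>auto simp: comp_def case_prod_unfold inj_on_def fun_eq_iff\<close>)
  then show ?thesis by (simp add: sum.cartesian_product)
qed

abbreviation cfg :: "'v set \<Rightarrow> ('v \<Rightarrow> nat) set" where
  "cfg S \<equiv> PiE S (\<lambda>_. spins)"

lemma finite_spins [simp]: "finite spins"
  by (simp add: spins_def)

lemma spins_ne [simp]: "spins \<noteq> {}"
  by (simp add: spins_def)

lemma spins_mem [simp]: "0 \<in> spins" "1 \<in> spins" "2 \<in> spins" "Suc 0 \<in> spins"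
  by (simp_all add: spins_def)

lemma sum_spins: "(\<Sum>j\<in>spins. f j) = f 0 + f 1 + f (2::nat)" for f :: "nat \<Rightarrow> real"
  by (simp add: spins_def)

lemma ball_spins: "(\<forall>i\<in>spins. Q i) \<longleftrightarrow> Q 0 \<and> Q 1 \<and> Q 2"
  by (simp add: spins_def)

lemma spins_cases: "i \<in> spins \<Longrightarrow> i = 0 \<or> i = 1 \<or> i = 2"
  by (auto simp: spins_def)

lemma finite_cfg [simp]: "finite S \<Longrightarrow> finite (cfg S)"
  by (simp add: finite_PiE)

lemma cfg_D: "\<sigma> \<in> cfg S \<Longrightarrow> v \<in> S \<Longrightarrow> \<sigma> v \<in> spins"
  by (auto simp: PiE_iff)

lemma restrict_cfg: "\<sigma> \<in> cfg S \<Longrightarrow> T \<subseteq> S \<Longrightarrow> restrict \<sigma> T \<in> cfg T"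
  by (auto simp: PiE_iff)

lemma space_config: "space config_space = {\<omega>. \<forall>v. \<omega> v \<in> spins}"
  by (auto simp: config_space_def space_PiM PiE_iff)

lemma restrict_space_cfg: "\<omega> \<in> space config_space \<Longrightarrow> restrict \<omega> S \<in> cfg S"
  by (auto simp: space_config PiE_iff)

text \<open>Meant for \<eta> extensional on \<open>S\<close>; for any other \<eta> the event is
  empty.\<close>

definition cyl :: "'v set \<Rightarrow> ('v \<Rightarrow> nat) \<Rightarrow> ('v \<Rightarrow> nat) set" where
  "cyl S \<eta> = {\<omega> \<in> space config_space. restrict \<omega> S = \<eta>}"

lemma coord_measurable: "(\<lambda>\<omega>. \<omega> v) \<in> measurable config_space (count_space spins)"
  unfolding config_space_def by (rule measurable_component_singleton) simp

lemma sets_coord: "{\<omega> \<in> space config_space. \<omega> v = s} \<in> sets config_space"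
proof -
  have "{\<omega> \<in> space config_space. \<omega> v = s} = (\<lambda>\<omega>. \<omega> v) -` ({s} \<inter> spins) \<inter> space config_space"
    by (auto simp: space_config)
  moreover have "\<dots> \<in> sets config_space"
    by (rule measurable_sets[OF coord_measurable]) simp
  ultimately show ?thesis by simp
qed

lemma sets_cyl [simp, intro]:
  assumes "finite S" shows "cyl S \<eta> \<in> sets config_space"
proof (cases "\<eta> \<in> extensional S")
  case True
  have "cyl S \<eta> = {\<omega> \<in> space config_space. \<forall>v\<in>S. \<omega> v = \<eta> v}"
    using True by (auto simp: cyl_def fun_eq_iff extensional_def)
  moreover have "{\<omega> \<in> space config_space. \<forall>v\<in>S. \<omega> v = \<eta> v} \<in> sets config_space"
    by (intro sets.sets_Collect_finite_All sets_coord assms)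
  ultimately show ?thesis by simp
next
  case False
  then have "cyl S \<eta> = {}" by (auto simp: cyl_def)
  then show ?thesis by simp
qed

lemma UN_cyl: "(\<Union>\<eta>\<in>cfg S. cyl S \<eta>) = space config_space"
  using restrict_space_cfg by (fastforce simp: cyl_def)

lemma disjoint_cyl: "disjoint_family_on (cyl S) X"
  by (auto simp: disjoint_family_on_def cyl_def)

locale config_prob = prob_space \<mu> for \<mu> :: "('v \<Rightarrow> nat) measure" +
  assumes sets_\<mu> [measurable_cong, simp]: "sets \<mu> = sets config_space"
begin

lemma space_\<mu> [simp]: "space \<mu> = space config_space"
  by (rule sets_eq_imp_space_eq) simp

lemma sum_cyl: "finite S \<Longrightarrow> (\<Sum>\<eta>\<in>cfg S. prob (cyl S \<eta>)) = 1"
  using finite_measure_finite_Union[of "cfg S" "cyl S"] UN_cyl[of S] prob_space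
  by (auto simp: disjoint_cyl)

text \<open>Exactly one cylinder over \<open>S\<close> contains \<omega>, so a function of finitely
  many spins is simple and its integral is a finite sum.\<close>

lemma fin_dep_eq:
  assumes "finite S" "\<omega> \<in> space config_space"
  shows "f (restrict \<omega> S) = (\<Sum>\<eta>\<in>cfg S. f \<eta> * indicator (cyl S \<eta>) \<omega> :: real)"
proof -
  have "(\<Sum>\<eta>\<in>cfg S. f \<eta> * indicator (cyl S \<eta>) \<omega>) = (\<Sum>\<eta>\<in>cfg S. if \<eta> = restrict \<omega> S then f \<eta> else 0)"
    by (rule sum.cong) (use assms in \<open>auto simp: cyl_def indicator_def\<close>)
  then show ?thesis using assms(1) restrict_space_cfg[OF assms(2), of S]
    by (simp only: sum.delta finite_cfg if_True)
qed

lemma fin_dep_integral: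
  assumes "finite S"
  shows "integrable \<mu> (\<lambda>\<omega>. f (restrict \<omega> S) :: real)"
    and "(\<integral>\<omega>. f (restrict \<omega> S) \<partial>\<mu>) = (\<Sum>\<eta>\<in>cfg S. f \<eta> * prob (cyl S \<eta>))"
proof -
  have i: "integrable \<mu> (\<lambda>\<omega>. f \<eta> * indicator (cyl S \<eta>) \<omega>)" for \<eta>
    using assms by (intro integrable_mult_right integrable_real_indicator) (auto simp: emeasure_eq_measure)
  have "integrable \<mu> (\<lambda>\<omega>. \<Sum>\<eta>\<in>cfg S. f \<eta> * indicator (cyl S \<eta>) \<omega>)"
    using i by (intro Bochner_Integration.integrable_sum)
  then show "integrable \<mu> (\<lambda>\<omega>. f (restrict \<omega> S))"
    using fin_dep_eq[OF assms, of _ f] by (subst Bochner_Integration.integrable_cong) auto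
  have "(\<integral>\<omega>. f (restrict \<omega> S) \<partial>\<mu>) = (\<integral>\<omega>. (\<Sum>\<eta>\<in>cfg S. f \<eta> * indicator (cyl S \<eta>) \<omega>) \<partial>\<mu>)"
    using fin_dep_eq[OF assms, of _ f] by (intro Bochner_Integration.integral_cong) auto
  also have "\<dots> = (\<Sum>\<eta>\<in>cfg S. f \<eta> * prob (cyl S \<eta>))"
    using i assms by (subst Bochner_Integration.integral_sum) auto
  finally show "(\<integral>\<omega>. f (restrict \<omega> S) \<partial>\<mu>) = (\<Sum>\<eta>\<in>cfg S. f \<eta> * prob (cyl S \<eta>))" .
qed

end

section \<open>Cylinders over balls generate the product sigma-algebra\<close>

context cayley2
begin

text \<open>The lower bound \<open>N\<close> is there because splitting measures prescribe marginals
  for n \<ge> 1 only and because the DLR equations are checked on balls much larger than the finite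
  volume. The empty set makes the family stable under intersection.\<close>

definition cyls :: "nat \<Rightarrow> ('v \<Rightarrow> nat) set set" where
  "cyls N = insert {} {cyl (V n) \<tau> | n \<tau>. N \<le> n \<and> \<tau> \<in> cfg (V n)}"

lemma cyl_V_Int:
  assumes "n \<le> m"
  shows "cyl (V n) \<tau> \<inter> cyl (V m) \<tau>' = (if restrict \<tau>' (V n) = \<tau> then cyl (V m) \<tau>' else {})"
proof -
  have "restrict (restrict \<omega> (V m)) (V n) = restrict \<omega> (V n)" for \<omega> :: "'v \<Rightarrow> nat"
    using V_mono[OF assms] by (simp add: restrict_restrict Int_absorb1)
  then show ?thesis unfolding cyl_def by auto
qed

text \<open>Balls are nested, so two cylinders over them are nested or disjoint.\<close>

lemma Int_stable_cyls: "Int_stable (cyls N)"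
proof (rule Int_stableI)
  fix A B assume A: "A \<in> cyls N" and B: "B \<in> cyls N"
  have *: "cyl (V n) \<tau> \<inter> cyl (V m) \<tau>' \<in> cyls N"
    if "N \<le> n" "N \<le> m" "\<tau> \<in> cfg (V n)" "\<tau>' \<in> cfg (V m)" for n m \<tau> \<tau>'
  proof (cases "n \<le> m")
    case True
    then show ?thesis using that cyl_V_Int[OF True, of \<tau> \<tau>'] unfolding cyls_def by auto
  next
    case False
    then show ?thesis using that cyl_V_Int[of m n \<tau>' \<tau>] unfolding cyls_def
      by (auto simp: Int_commute)
  qed
  show "A \<inter> B \<in> cyls N"
  proof (cases "A = {} \<or> B = {}")
    case True
    then show ?thesis by (auto simp: cyls_def)
  next
    case False
    then obtain n \<tau> m \<tau>' where "A = cyl (V n) \<tau>" "N \<le> n" "\<tau> \<in> cfg (V n)"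
      "B = cyl (V m) \<tau>'" "N \<le> m" "\<tau>' \<in> cfg (V m)"
      using A B unfolding cyls_def by blast
    then show ?thesis using * by simp
  qed
qed

lemma cyls_sets: "cyls N \<subseteq> sets config_space"
  by (auto simp: cyls_def)

text \<open>An event about one vertex is a finite union of cylinders over any ball containing the
  vertex. The ball may be taken large, hence every \<open>N\<close> gives the same
  sigma-algebra.\<close>

lemma sigma_cyls: "sigma_sets (space config_space) (cyls N) = sets config_space"
proof
  show "sigma_sets (space config_space) (cyls N) \<subseteq> sets config_space"
    using cyls_sets by (rule sets.sigma_sets_subset)
  have sp: "space config_space = (\<Pi>\<^sub>E i\<in>(UNIV::'v set). space (count_space spins))"
    by (simp add: config_space_def space_PiM)
  have gen: "sets (config_space :: ('v \<Rightarrow> nat) measure) = sigma_sets (space config_space)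
      {{f \<in> space config_space. f i \<in> A} |i A. i \<in> (UNIV :: 'v set) \<and> A \<in> sets (count_space spins)}"
    unfolding sp unfolding config_space_def by (rule sets_PiM_single)
  have c: "{f \<in> space config_space. f v \<in> A} \<in> sigma_sets (space config_space) (cyls N)"
    if "A \<in> sets (count_space spins)" for v :: 'v and A
  proof -
    define n where "n = max N (lev v)"
    have v: "v \<in> V n" by (simp add: n_def)
    have "{f \<in> space config_space. f v \<in> A} = (\<Union>\<tau>\<in>{\<tau> \<in> cfg (V n). \<tau> v \<in> A}. cyl (V n) \<tau>)"
      using v restrict_space_cfg[of _ "V n"] by (auto simp: cyl_def)
    also have "\<dots> \<in> sigma_sets (space config_space) (cyls N)"
    proof (rule sigma_sets_UNION)
      show "countable (cyl (V n) ` {\<tau> \<in> cfg (V n). \<tau> v \<in> A})"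
        by (intro countable_finite finite_imageI) simp
      fix B assume "B \<in> cyl (V n) ` {\<tau> \<in> cfg (V n). \<tau> v \<in> A}"
      then have "B \<in> cyls N" unfolding cyls_def n_def by auto
      then show "B \<in> sigma_sets (space config_space) (cyls N)" by blast
    qed
    finally show ?thesis .
  qed
  show "sets config_space \<subseteq> sigma_sets (space config_space) (cyls N)"
    unfolding gen
  proof (rule sigma_sets_mono, rule subsetI)
    fix B :: "('v \<Rightarrow> nat) set"
    assume "B \<in> {{f \<in> space config_space. f i \<in> A} |i A. i \<in> UNIV \<and> A \<in> sets (count_space spins)}"
    then show "B \<in> sigma_sets (space config_space) (cyls N)" using c by blast
  qed
qed

lemma cyls_subset_Pow: "cyls N \<subseteq> Pow (space config_space)"
  using cyls_sets sets.space_closed by blast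

text \<open>Uniqueness on a generating pi-system; the finitely many cylinders of level
  \<open>N\<close> already cover the space.\<close>

lemma config_prob_eqI:
  assumes "config_prob \<mu>" "config_prob \<nu>"
    and eq: "\<And>n \<tau>. N \<le> n \<Longrightarrow> \<tau> \<in> cfg (V n) \<Longrightarrow> measure \<mu> (cyl (V n) \<tau>) = measure \<nu> (cyl (V n) \<tau>)"
  shows "\<mu> = \<nu>"
proof -
  interpret m: config_prob \<mu> by fact
  interpret n: config_prob \<nu> by fact
  have u: "(\<Union>\<tau>\<in>cfg (V N). cyl (V N) \<tau>) = space config_space" by (rule UN_cyl)
  show ?thesis
  proof (rule measure_eqI_generator_eq_countable[where E = "cyls N" and \<Omega> = "space config_space"
        and A = "cyl (V N) ` cfg (V N)"])
    show "Int_stable (cyls N)" by (rule Int_stable_cyls)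
    show "cyls N \<subseteq> Pow (space config_space)" by (rule cyls_subset_Pow)
    show "emeasure \<mu> X = emeasure \<nu> X" if "X \<in> cyls N" for X
      using that eq unfolding cyls_def by (auto simp: m.emeasure_eq_measure n.emeasure_eq_measure)
    show "sets \<mu> = sigma_sets (space config_space) (cyls N)" by (simp add: sigma_cyls)
    show "sets \<nu> = sigma_sets (space config_space) (cyls N)" by (simp add: sigma_cyls)
    show "cyl (V N) ` cfg (V N) \<subseteq> cyls N" by (auto simp: cyls_def)
    show "\<Union> (cyl (V N) ` cfg (V N)) = space config_space" using u .
    show "countable (cyl (V N) ` cfg (V N))" by (intro countable_finite finite_imageI) simp
    show "emeasure \<mu> a \<noteq> \<infinity>" if "a \<in> cyl (V N) ` cfg (V N)" for a by (simp add: m.emeasure_eq_measure)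
  qed
qed

end

section \<open>Tree-indexed Markov chains\<close>

locale tree_chain = cayley2 L x0 for L :: "'v rel" and x0 +
  fixes \<pi> :: "nat \<Rightarrow> real" and P :: "nat \<Rightarrow> nat \<Rightarrow> real"
  assumes \<pi>_nonneg: "i \<in> spins \<Longrightarrow> 0 \<le> \<pi> i"
    and P_nonneg: "i \<in> spins \<Longrightarrow> j \<in> spins \<Longrightarrow> 0 \<le> P i j"
    and \<pi>_sum: "(\<Sum>i\<in>spins. \<pi> i) = 1"
    and P_sum: "i \<in> spins \<Longrightarrow> (\<Sum>j\<in>spins. P i j) = 1"
begin

definition pr :: "nat \<Rightarrow> ('v \<Rightarrow> nat) \<Rightarrow> real" where
  "pr n \<tau> = \<pi> (\<tau> x0) * (\<Prod>v\<in>V n - {x0}. P (\<tau> (par v)) (\<tau> v))"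

lemma V_par: "v \<in> V n \<Longrightarrow> v \<noteq> x0 \<Longrightarrow> par v \<in> V n"
  using lev_par[of v] by simp

lemma pr_0: "pr 0 \<tau> = \<pi> (\<tau> x0)"
  by (simp add: pr_def V_0)

lemma pr_restrict:
  assumes "V n \<subseteq> S" shows "pr n (restrict \<tau> S) = pr n \<tau>"
proof -
  have m: "v \<in> S" if "lev v \<le> n" for v using assms that by auto
  have "P (restrict \<tau> S (par v)) (restrict \<tau> S v) = P (\<tau> (par v)) (\<tau> v)" if "v \<in> V n - {x0}" for v
    using that V_par[of v n] m by simp
  then show ?thesis unfolding pr_def using m[of x0] by simp
qed

lemma pr_Suc: "pr (Suc n) \<tau> = pr n \<tau> * (\<Prod>c\<in>W (Suc n). P (\<tau> (par c)) (\<tau> c))"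
proof -
  have "V (Suc n) - {x0} = (V n - {x0}) \<union> W (Suc n)" by auto
  moreover have "(\<Prod>v\<in>(V n - {x0}) \<union> W (Suc n). P (\<tau> (par v)) (\<tau> v))
      = (\<Prod>v\<in>V n - {x0}. P (\<tau> (par v)) (\<tau> v)) * (\<Prod>c\<in>W (Suc n). P (\<tau> (par c)) (\<tau> c))"
    by (rule prod.union_disjoint) auto
  ultimately show ?thesis unfolding pr_def by (simp add: mult.assoc)
qed

text \<open>Independent variables, one for each vertex and each possible spin of its parent; the
  chain is a deterministic function of them, so it comes from a product measure rather than a
  projective limit. An index outside \<open>spins\<close> gets the law \<pi> merely to keep every
  factor a probability measure.\<close>

definition noise :: "'v \<times> nat \<Rightarrow> nat measure" where
  "noise = (\<lambda>(v, i). point_measure spins (\<lambda>j. ennreal (if v = x0 \<or> i \<notin> spins then \<pi> j else P i j)))"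

text \<open>The first argument is the depth of the recursion and is meaningful when it equals
  \<open>lev v\<close>. The root reads a coordinate with the dummy parent spin 0.\<close>

primrec spin_at :: "nat \<Rightarrow> 'v \<Rightarrow> ('v \<times> nat \<Rightarrow> nat) \<Rightarrow> nat" where
  "spin_at 0 v U = U (x0, 0)"
| "spin_at (Suc n) v U = U (v, spin_at n (par v) U)"

lemma prob_space_noise: "prob_space (noise p)"
proof (cases p)
  case (Pair v i)
  show ?thesis
  proof (rule prob_spaceI)
    have "emeasure (noise p) spins = (\<Sum>j\<in>spins. ennreal (if v = x0 \<or> i \<notin> spins then \<pi> j else P i j))"
      unfolding noise_def Pair by (simp add: emeasure_point_measure_finite)
    also have "\<dots> = ennreal (\<Sum>j\<in>spins. if v = x0 \<or> i \<notin> spins then \<pi> j else P i j)"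
      by (rule sum_ennreal) (use \<pi>_nonneg P_nonneg in auto)
    also have "\<dots> = 1" using \<pi>_sum P_sum[of i] by (cases "v = x0 \<or> i \<notin> spins") auto
    finally show "emeasure (noise p) (space (noise p)) = 1"
      by (simp add: noise_def Pair space_point_measure)
  qed
qed

lemma sets_noise [simp]: "sets (noise p) = Pow spins"
  by (cases p) (simp add: noise_def sets_point_measure)

lemma space_noise [simp]: "space (noise p) = spins"
  by (cases p) (simp add: noise_def space_point_measure)

lemma noise_singleton:
  assumes "j \<in> spins"
  shows "measure (noise (v, i)) {j} = (if v = x0 \<or> i \<notin> spins then \<pi> j else P i j)"
proof -
  have "emeasure (noise (v, i)) {j} = ennreal (if v = x0 \<or> i \<notin> spins then \<pi> j else P i j)"
    unfolding noise_def using assms by (simp add: emeasure_point_measure_finite)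
  then show ?thesis using assms \<pi>_nonneg P_nonneg unfolding measure_def by auto
qed

lemma spin_at_spins:
  "U \<in> space (Pi\<^sub>M UNIV noise) \<Longrightarrow> spin_at n v U \<in> spins"
  by (cases n) (auto simp: space_PiM PiE_iff)

lemma spin_at_measurable: "spin_at n v \<in> measurable (Pi\<^sub>M UNIV noise) (count_space spins)"
proof (induction n arbitrary: v)
  case 0
  have "(\<lambda>U. U (x0, 0)) \<in> measurable (Pi\<^sub>M UNIV noise) (noise (x0, 0))"
    by (rule measurable_component_singleton) simp
  then show ?case by (simp add: measurable_cong_sets[OF refl, of "noise (x0,0)" "count_space spins"])
next
  case (Suc n)
  have c: "(\<lambda>U. U (v, i)) \<in> measurable (Pi\<^sub>M UNIV noise) (count_space spins)" for i
    using measurable_component_singleton[of "(v, i)" UNIV noise]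
    by (simp add: measurable_cong_sets[OF refl, of "noise (v,i)" "count_space spins"])
  have "(\<lambda>U. (\<lambda>i U. U (v, i)) (spin_at n (par v) U) U) \<in> measurable (Pi\<^sub>M UNIV noise) (count_space spins)"
    by (rule measurable_compose_countable'[where I = spins]) (use c Suc in \<open>auto intro: countable_finite\<close>)
  then show ?case by simp
qed

text \<open>Once the target \<tau> is fixed the parents' spins are known, so the recursion unfolds
  into one condition on one coordinate per vertex: the event is a rectangle.\<close>

lemma spins_of_noise:
  assumes "\<tau> \<in> cfg (V n)"
  shows "(\<forall>v\<in>V n. spin_at (lev v) v U = \<tau> v) \<longleftrightarrow>
    (\<forall>v\<in>V n. U (v, if v = x0 then 0 else \<tau> (par v)) = \<tau> v)" (is "?A \<longleftrightarrow> ?B")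
proof
  assume A: ?A
  show ?B
  proof
    fix v assume v: "v \<in> V n"
    show "U (v, if v = x0 then 0 else \<tau> (par v)) = \<tau> v"
    proof (cases "v = x0")
      case True
      have "spin_at (lev x0) x0 U = \<tau> x0" using A by (rule bspec) simp
      then show ?thesis using True by simp
    next
      case False
      then have "spin_at (lev (par v)) (par v) U = \<tau> (par v)" using A V_par[OF v] by blast
      moreover have "spin_at (lev v) v U = \<tau> v" using A v by blast
      ultimately show ?thesis using False lev_par[OF False] by simp
    qed
  qed
next
  assume B: ?B
  have "lev v \<le> n \<Longrightarrow> spin_at (lev v) v U = \<tau> v" for v
  proof (induction "lev v" arbitrary: v)
    case 0
    then have "v = x0" using lev_0_iff[of v] by simp
    moreover have "U (x0, if x0 = x0 then 0 else \<tau> (par x0)) = \<tau> x0" using B by (rule bspec) simp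
    ultimately show ?case by simp
  next
    case (Suc k)
    then have "v \<noteq> x0" by auto
    moreover from this have l: "lev v = Suc (lev (par v))" by (rule lev_par)
    moreover have "spin_at (lev (par v)) (par v) U = \<tau> (par v)" using Suc l by auto
    moreover have "v \<in> V n" using Suc by simp
    ultimately show ?case using B by (auto simp del: V_iff)
  qed
  then show ?A by simp
qed

lemma chain_exists:
  "\<exists>\<mu>. config_prob \<mu> \<and> (\<forall>n. \<forall>\<tau>\<in>cfg (V n). measure \<mu> (cyl (V n) \<tau>) = pr n \<tau>)"
proof -
  interpret N: product_prob_space noise UNIV
    by (intro product_prob_spaceI prob_space_noise)
  define \<Phi> where "\<Phi> = (\<lambda>U v. spin_at (lev v) v U)"
  have \<Phi>: "\<Phi> \<in> measurable (Pi\<^sub>M UNIV noise) config_space"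
    unfolding config_space_def \<Phi>_def
    by (rule measurable_PiM_single') (use spin_at_measurable in \<open>auto simp: spin_at_spins\<close>)
  define \<mu> where "\<mu> = distr (Pi\<^sub>M UNIV noise) config_space \<Phi>"
  have p: "config_prob \<mu>"
    unfolding config_prob_def config_prob_axioms_def \<mu>_def
    using N.P.prob_space_distr[OF \<Phi>] by simp
  moreover have "measure \<mu> (cyl (V n) \<tau>) = pr n \<tau>" if t: "\<tau> \<in> cfg (V n)" for n \<tau>
  proof -
    \<comment> \<open>One coordinate for each vertex of the ball; they are distinct, hence
      independent.\<close>
    define idx where "idx = (\<lambda>v. (v, if v = x0 then 0 else \<tau> (par v)))"
    have inj: "inj_on idx (V n)" by (auto simp: inj_on_def idx_def)
    have ext: "restrict f (V n) = \<tau> \<longleftrightarrow> (\<forall>v\<in>V n. f v = \<tau> v)" for f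
      using t by (auto simp: fun_eq_iff PiE_iff extensional_def)
    have "\<Phi> -` cyl (V n) \<tau> \<inter> space (Pi\<^sub>M UNIV noise)
        = {U \<in> space (Pi\<^sub>M UNIV noise). \<forall>v\<in>V n. spin_at (lev v) v U = \<tau> v}"
      using measurable_space[OF \<Phi>] unfolding cyl_def ext by (auto simp: \<Phi>_def)
    also have "\<dots> = {U \<in> space (Pi\<^sub>M UNIV noise). \<forall>p\<in>idx ` V n. U p \<in> {\<tau> (fst p)}}"
      using spins_of_noise[OF t] by (auto simp: idx_def)
    also have "\<dots> = prod_emb UNIV noise (idx ` V n) (Pi\<^sub>E (idx ` V n) (\<lambda>p. {\<tau> (fst p)}))"
      unfolding prod_emb_def by (auto simp: space_PiM PiE_iff)
    finally have "measure \<mu> (cyl (V n) \<tau>)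
        = measure (Pi\<^sub>M UNIV noise) (prod_emb UNIV noise (idx ` V n) (Pi\<^sub>E (idx ` V n) (\<lambda>p. {\<tau> (fst p)})))"
      unfolding \<mu>_def using \<Phi> by (simp add: measure_distr)
    also have "\<dots> = (\<Prod>p\<in>idx ` V n. measure (noise p) {\<tau> (fst p)})"
      using t by (intro N.measure_PiM_emb) (auto simp: idx_def PiE_iff)
    also have "\<dots> = (\<Prod>v\<in>V n. measure (noise (idx v)) {\<tau> v})"
      by (subst prod.reindex[OF inj]) (simp add: idx_def)
    also have "\<dots> = (\<Prod>v\<in>V n. if v = x0 then \<pi> (\<tau> v) else P (\<tau> (par v)) (\<tau> v))"
      by (rule prod.cong) (use t V_par[of _ n] in \<open>auto simp: idx_def noise_singleton PiE_iff\<close>)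
    also have "\<dots> = pr n \<tau>"
      unfolding pr_def
      by (subst prod.remove[where x = x0]) (auto intro!: prod.cong)
    finally show ?thesis .
  qed
  ultimately show ?thesis by blast
qed

definition chain_measure :: "('v \<Rightarrow> nat) measure" where
  "chain_measure = (SOME \<mu>. config_prob \<mu> \<and> (\<forall>n. \<forall>\<tau>\<in>cfg (V n). measure \<mu> (cyl (V n) \<tau>) = pr n \<tau>))"

lemma chain_measure:
  shows "config_prob chain_measure"
    and "\<tau> \<in> cfg (V n) \<Longrightarrow> measure chain_measure (cyl (V n) \<tau>) = pr n \<tau>"
  using someI_ex[OF chain_exists] unfolding chain_measure_def by blast+

sublocale C: config_prob chain_measure
  by (rule chain_measure)

lemma chain_measure_eqI:
  assumes "config_prob \<mu>" "\<And>n \<tau>. N \<le> n \<Longrightarrow> \<tau> \<in> cfg (V n) \<Longrightarrow> measure \<mu> (cyl (V n) \<tau>) = pr n \<tau>"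
  shows "\<mu> = chain_measure"
  by (rule config_prob_eqI[OF assms(1) chain_measure(1), of N]) (simp add: assms(2) chain_measure(2))

lemma chain_integral:
  "(\<integral>\<omega>. f (restrict \<omega> (V n)) \<partial>chain_measure) = (\<Sum>\<tau>\<in>cfg (V n). pr n \<tau> * f \<tau>)"
  by (simp add: C.fin_dep_integral chain_measure mult.commute del: V_iff cong: sum.cong)

lemma sum_pr: "(\<Sum>\<tau>\<in>cfg (V n). pr n \<tau>) = 1"
  using C.sum_cyl[of "V n"] chain_measure(2) by simp

text \<open>The Markov property: given the ball, the spins of the next sphere are independent, with
  the laws in the rows of their parents' spins.\<close>

lemma sum_pr_Suc:
  "(\<Sum>\<tau>\<in>cfg (V (Suc n)). pr (Suc n) \<tau> * g (restrict \<tau> (V n)) (restrict \<tau> (W (Suc n))))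
   = (\<Sum>\<zeta>\<in>cfg (V n). pr n \<zeta> * (\<Sum>\<eta>\<in>cfg (W (Suc n)). (\<Prod>c\<in>W (Suc n). P (\<zeta> (par c)) (\<eta> c)) * g \<zeta> \<eta>))"
proof -
  define G where "G = (\<lambda>\<zeta> \<eta>. pr n \<zeta> * ((\<Prod>c\<in>W (Suc n). P (\<zeta> (par c)) (\<eta> c)) * g \<zeta> \<eta>))"
  have "pr (Suc n) \<tau> * g (restrict \<tau> (V n)) (restrict \<tau> (W (Suc n)))
     = G (restrict \<tau> (V n)) (restrict \<tau> (W (Suc n)))" for \<tau>
  proof -
    have "(\<Prod>c\<in>W (Suc n). P (restrict \<tau> (V n) (par c)) (restrict \<tau> (W (Suc n)) c))
        = (\<Prod>c\<in>W (Suc n). P (\<tau> (par c)) (\<tau> c))"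
      by (rule prod.cong) (auto simp: lev_Suc_iff)
    then show ?thesis by (simp add: G_def pr_Suc pr_restrict mult.assoc del: restrict_apply)
  qed
  then have "(\<Sum>\<tau>\<in>cfg (V (Suc n)). pr (Suc n) \<tau> * g (restrict \<tau> (V n)) (restrict \<tau> (W (Suc n))))
      = (\<Sum>\<tau>\<in>cfg (V n \<union> W (Suc n)). G (restrict \<tau> (V n)) (restrict \<tau> (W (Suc n))))"
    by (simp only: V_Suc)
  also have "\<dots> = (\<Sum>\<zeta>\<in>cfg (V n). \<Sum>\<eta>\<in>cfg (W (Suc n)). G \<zeta> \<eta>)"
    by (rule sum_PiE_Un[OF V_W_disj])
  finally show ?thesis by (simp only: G_def sum_distrib_left)
qed

end

section \<open>The Gibbsian specification\<close>

text \<open>The exponent is the distance of the spins. A natural power keeps all sums over spins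
  polynomial in \<theta>.\<close>

definition wt :: "real \<Rightarrow> nat \<Rightarrow> nat \<Rightarrow> real" where
  "wt \<theta> i j = \<theta> ^ (if i \<le> j then j - i else i - j)"

lemma wt_pos: "0 < \<theta> \<Longrightarrow> 0 < wt \<theta> i j"
  by (simp add: wt_def)

lemma wt_sym: "wt \<theta> i j = wt \<theta> j i"
  by (simp add: wt_def)

lemma wt_exp: "wt (exp a) i j = exp (a * \<bar>real i - real j\<bar>)"
proof (cases "i \<le> j")
  case True
  then have "\<bar>real i - real j\<bar> = real (j - i)" by simp
  then show ?thesis using True by (simp add: wt_def exp_of_nat_mult[symmetric] mult.commute)
next
  case False
  then have "\<bar>real i - real j\<bar> = real (i - j)" by simp
  then show ?thesis using False by (simp add: wt_def exp_of_nat_mult[symmetric] mult.commute)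
qed

context cayley2
begin

definition edgew :: "real \<Rightarrow> 'v set \<Rightarrow> ('v \<Rightarrow> nat) \<Rightarrow> real" where
  "edgew \<theta> E \<sigma> = (\<Prod>v\<in>E. wt \<theta> (\<sigma> v) (\<sigma> (par v)))"

lemma edgew_pos: "0 < \<theta> \<Longrightarrow> 0 < edgew \<theta> E \<sigma>"
  unfolding edgew_def by (intro prod_pos) (simp add: wt_pos)

lemma edgew_cong:
  "(\<And>v. v \<in> E \<Longrightarrow> \<sigma> v = \<sigma>' v \<and> \<sigma> (par v) = \<sigma>' (par v)) \<Longrightarrow> edgew \<theta> E \<sigma> = edgew \<theta> E \<sigma>'"
  unfolding edgew_def by (rule prod.cong) auto

lemma exp_energy:
  assumes "finite E" "x0 \<notin> E"
    and B: "B = (\<lambda>v. (v, par v)) ` E \<union> (\<lambda>v. (par v, v)) ` E"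
  shows "exp (- \<beta> * energy J B \<sigma>) = edgew (exp (J * \<beta>)) E \<sigma>"
proof -
  \<comment> \<open>By the levels no pair is both child-to-parent and parent-to-child, so every edge
    is counted exactly twice, which the halving in \<open>energy\<close> undoes.\<close>
  have disj: "(\<lambda>v. (v, par v)) ` E \<inter> (\<lambda>v. (par v, v)) ` E = {}"
  proof -
    have False if "v \<in> E" "u \<in> E" "v = par u" "par v = u" for u v
    proof -
      have "v \<noteq> x0" "u \<noteq> x0" using that assms(2) by auto
      then have "lev v = Suc (lev (par v))" "lev u = Suc (lev (par u))" by (simp_all only: lev_par not_False_eq_True)
      then have "lev v = Suc (lev u)" "lev u = Suc (lev v)" unfolding that(4) that(3)[symmetric] .
      then show False by simp
    qed
    then show ?thesis by blast
  qed
  have "(\<Sum>(x, y)\<in>B. \<bar>real (\<sigma> x) - real (\<sigma> y)\<bar>)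
      = (\<Sum>(x, y)\<in>(\<lambda>v. (v, par v)) ` E. \<bar>real (\<sigma> x) - real (\<sigma> y)\<bar>)
        + (\<Sum>(x, y)\<in>(\<lambda>v. (par v, v)) ` E. \<bar>real (\<sigma> x) - real (\<sigma> y)\<bar>)"
    unfolding B using assms(1) disj by (intro sum.union_disjoint) auto
  also have "\<dots> = 2 * (\<Sum>v\<in>E. \<bar>real (\<sigma> v) - real (\<sigma> (par v))\<bar>)"
    by (subst (1 2) sum.reindex) (auto simp: inj_on_def abs_minus_commute)
  finally have "- \<beta> * energy J B \<sigma> = (\<Sum>v\<in>E. J * \<beta> * \<bar>real (\<sigma> v) - real (\<sigma> (par v))\<bar>)"
    by (simp add: energy_def sum_distrib_left mult_ac)
  then show ?thesis by (simp add: edgew_def wt_exp exp_sum[OF assms(1)])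
qed

text \<open>The edges that meet \<Lambda>, each named by its endpoint farther from the root.\<close>

definition touch :: "'v set \<Rightarrow> 'v set" where
  "touch \<Lambda> = {v. v \<noteq> x0 \<and> (v \<in> \<Lambda> \<or> par v \<in> \<Lambda>)}"

lemma finite_touch: "finite \<Lambda> \<Longrightarrow> finite (touch \<Lambda>)"
proof -
  assume "finite \<Lambda>"
  then have "finite (\<Lambda> \<union> (\<Union>v\<in>\<Lambda>. ch v))" by auto
  moreover have "touch \<Lambda> \<subseteq> \<Lambda> \<union> (\<Union>v\<in>\<Lambda>. ch v)" by (auto simp: touch_def)
  ultimately show ?thesis by (rule finite_subset[rotated])
qed

lemma par_edges:
  assumes "\<And>u v. v \<noteq> x0 \<Longrightarrow> u = par v \<Longrightarrow> (v, u) \<in> R \<longleftrightarrow> v \<in> E"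
    and "\<And>u v. v \<noteq> x0 \<Longrightarrow> u = par v \<Longrightarrow> (u, v) \<in> R \<longleftrightarrow> v \<in> E"
    and "x0 \<notin> E"
  shows "L \<inter> R = (\<lambda>v. (v, par v)) ` E \<union> (\<lambda>v. (par v, v)) ` E"
proof (rule set_eqI)
  fix p :: "'v \<times> 'v"
  obtain a b where p: "p = (a, b)" by fastforce
  have 1: "p \<in> (\<lambda>v. (v, par v)) ` E \<longleftrightarrow> a \<in> E \<and> b = par a"
    and 2: "p \<in> (\<lambda>v. (par v, v)) ` E \<longleftrightarrow> b \<in> E \<and> a = par b" unfolding p by auto
  show "p \<in> L \<inter> R \<longleftrightarrow> p \<in> (\<lambda>v. (v, par v)) ` E \<union> (\<lambda>v. (par v, v)) ` E"
    unfolding Int_iff Un_iff 1 2 unfolding p edge_iff using assms by metis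
qed

lemma local_weight_eq:
  assumes "finite \<Lambda>"
  shows "local_weight J \<beta> L \<Lambda> \<sigma> = edgew (exp (J * \<beta>)) (touch \<Lambda>) \<sigma>"
  unfolding local_weight_def
proof (rule exp_energy)
  show "finite (touch \<Lambda>)" by (rule finite_touch[OF assms])
  show "x0 \<notin> touch \<Lambda>" by (simp add: touch_def)
  show "L \<inter> (\<Lambda> \<times> UNIV \<union> UNIV \<times> \<Lambda>) = (\<lambda>v. (v, par v)) ` touch \<Lambda> \<union> (\<lambda>v. (par v, v)) ` touch \<Lambda>"
    by (rule par_edges) (auto simp: touch_def)
qed

lemma vol_weight_eq:
  "vol_weight J \<beta> L x0 h n \<sigma> = edgew (exp (J * \<beta>)) (V n - {x0}) \<sigma> * (\<Prod>x\<in>W n. exp (h x (\<sigma> x)))"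
proof -
  have B: "L \<inter> (V n \<times> V n) = (\<lambda>v. (v, par v)) ` (V n - {x0}) \<union> (\<lambda>v. (par v, v)) ` (V n - {x0})"
  proof -
    have "lev (par v) \<le> n" if "lev v \<le> n" "v \<noteq> x0" for v
      using lev_par[OF that(2)] that(1) by simp
    then show ?thesis by (intro par_edges) auto
  qed
  show ?thesis
    unfolding vol_weight_def exp_add using exp_energy[OF _ _ B, of \<beta> J \<sigma>] by (simp add: exp_sum)
qed

lemma touch_V: "touch (V n) = V (Suc n) - {x0}"
proof -
  have "lev v \<le> n \<or> lev (par v) \<le> n \<longleftrightarrow> lev v \<le> Suc n" if "v \<noteq> x0" for v
    using lev_par[OF that] by auto
  then have "v \<in> touch (V n) \<longleftrightarrow> v \<in> V (Suc n) - {x0}" for v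
    unfolding touch_def by auto
  then show ?thesis by blast
qed

end

lemma override_space:
  "\<omega> \<in> space config_space \<Longrightarrow> \<zeta> \<in> cfg \<Lambda> \<Longrightarrow> override_on \<omega> \<zeta> \<Lambda> \<in> space config_space"
  by (auto simp: space_config override_on_def PiE_iff)

lemma override_measurable:
  assumes "\<zeta> \<in> cfg \<Lambda>"
  shows "(\<lambda>\<omega>. override_on \<omega> \<zeta> \<Lambda>) \<in> measurable config_space config_space"
proof -
  have "(\<lambda>\<omega>. override_on \<omega> \<zeta> \<Lambda> v) \<in> measurable config_space (count_space spins)" for v
    using assms coord_measurable[of v] by (cases "v \<in> \<Lambda>") (auto simp: override_on_def PiE_iff)
  then have "(\<lambda>\<omega>. override_on \<omega> \<zeta> \<Lambda>) \<in> measurable config_space (\<Pi>\<^sub>M x\<in>UNIV. count_space spins)"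
    by (intro measurable_PiM_single') (use assms in \<open>auto simp: space_config override_on_def PiE_iff\<close>)
  then show ?thesis by (simp add: config_space_def)
qed

lemma sums_indicator_disjoint:
  assumes "disjoint_family A"
  shows "(\<lambda>i. indicator (A i) x :: real) sums indicator (\<Union>i. A i) x"
proof (cases "\<exists>j. x \<in> A j")
  case True
  then obtain j where j: "x \<in> A j" by blast
  have "indicator (A i) x = (if i = j then 1 else 0 :: real)" for i
    using assms j by (auto simp: disjoint_family_on_def indicator_def)
  then show ?thesis using j sums_single[of j "\<lambda>_. 1::real"] by (auto simp: indicator_def)
next
  case False
  then show ?thesis by (auto simp: indicator_def)
qed

context cayley2
begin

context
  fixes J \<beta> \<theta> :: real
  assumes \<theta>: "\<theta> = exp (J * \<beta>)"
begin

lemma \<theta>_pos: "0 < \<theta>"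
  by (simp add: \<theta>)

abbreviation kern :: "'v set \<Rightarrow> ('v \<Rightarrow> nat) \<Rightarrow> ('v \<Rightarrow> nat) set \<Rightarrow> real" where
  "kern \<equiv> gibbs_kernel J \<beta> L"

definition knorm :: "'v set \<Rightarrow> ('v \<Rightarrow> nat) \<Rightarrow> real" where
  "knorm \<Lambda> \<omega> = (\<Sum>\<zeta>\<in>cfg \<Lambda>. edgew \<theta> (touch \<Lambda>) (override_on \<omega> \<zeta> \<Lambda>))"

lemma cfg_ne: "cfg \<Lambda> \<noteq> {}"
  by (simp add: PiE_eq_empty_iff)

lemma knorm_pos: "finite \<Lambda> \<Longrightarrow> 0 < knorm \<Lambda> \<omega>"
  unfolding knorm_def by (intro sum_pos) (auto simp: cfg_ne edgew_pos \<theta>_pos)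

lemma kern_eq:
  "finite \<Lambda> \<Longrightarrow> kern \<Lambda> \<omega> A = (\<Sum>\<zeta>\<in>cfg \<Lambda>. edgew \<theta> (touch \<Lambda>) (override_on \<omega> \<zeta> \<Lambda>) / knorm \<Lambda> \<omega>
      * indicator A (override_on \<omega> \<zeta> \<Lambda>))"
  unfolding gibbs_kernel_def knorm_def by (simp only: local_weight_eq \<theta>[symmetric] sum_divide_distrib times_divide_eq_left)

lemma kern_total: "finite \<Lambda> \<Longrightarrow> (\<Sum>\<zeta>\<in>cfg \<Lambda>. edgew \<theta> (touch \<Lambda>) (override_on \<omega> \<zeta> \<Lambda>) / knorm \<Lambda> \<omega>) = 1"
  using knorm_pos[of \<Lambda> \<omega>] by (simp add: sum_divide_distrib[symmetric] knorm_def[symmetric])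

lemma kern_nonneg: "finite \<Lambda> \<Longrightarrow> 0 \<le> kern \<Lambda> \<omega> A"
  unfolding kern_eq using knorm_pos[of \<Lambda> \<omega>] edgew_pos[OF \<theta>_pos]
  by (intro sum_nonneg mult_nonneg_nonneg divide_nonneg_nonneg) (auto intro: less_imp_le)

lemma kern_Compl:
  assumes "finite \<Lambda>" "\<omega> \<in> space config_space"
  shows "kern \<Lambda> \<omega> (space config_space - A) = 1 - kern \<Lambda> \<omega> A"
proof -
  have "kern \<Lambda> \<omega> (space config_space - A) + kern \<Lambda> \<omega> A
      = (\<Sum>\<zeta>\<in>cfg \<Lambda>. edgew \<theta> (touch \<Lambda>) (override_on \<omega> \<zeta> \<Lambda>) / knorm \<Lambda> \<omega>)"
    unfolding kern_eq[OF assms(1)] sum.distrib[symmetric]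
    by (rule sum.cong) (use override_space[OF assms(2)] in \<open>auto simp: indicator_def\<close>)
  then show ?thesis using kern_total[OF assms(1), of \<omega>] by simp
qed

lemma kern_le_1: "finite \<Lambda> \<Longrightarrow> \<omega> \<in> space config_space \<Longrightarrow> kern \<Lambda> \<omega> A \<le> 1"
  using kern_Compl[of \<Lambda> \<omega> A] kern_nonneg[of \<Lambda> \<omega> "space config_space - A"] by simp

lemma kern_sums:
  assumes "finite \<Lambda>" "disjoint_family A"
  shows "(\<lambda>i. kern \<Lambda> \<omega> (A i)) sums kern \<Lambda> \<omega> (\<Union>i. A i)"
  unfolding kern_eq[OF assms(1)]
  by (intro sums_sum sums_mult sums_indicator_disjoint assms(2))

text \<open>Properness of the kernel; it is what allows conditioning a Gibbs measure on a tail
  event.\<close>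

lemma kern_Int:
  assumes "finite \<Lambda>" "\<omega> \<in> space config_space"
    and "\<And>\<zeta>. \<zeta> \<in> cfg \<Lambda> \<Longrightarrow> override_on \<omega> \<zeta> \<Lambda> \<in> B \<longleftrightarrow> \<omega> \<in> B"
  shows "kern \<Lambda> \<omega> (A \<inter> B) = kern \<Lambda> \<omega> A * indicator B \<omega>"
  unfolding kern_eq[OF assms(1)] sum_distrib_right
  by (rule sum.cong) (use assms(3) in \<open>auto simp: indicator_def\<close>)

lemma edgew_measurable:
  assumes "finite E" shows "edgew \<theta> E \<in> borel_measurable config_space"
proof -
  have c: "(\<lambda>\<omega>. wt \<theta> (\<omega> u) (\<omega> v)) \<in> borel_measurable config_space" for u v :: 'v
  proof (rule measurable_compose_countable'[where I = spins and f = "\<lambda>i \<omega>. wt \<theta> i (\<omega> v)" and g = "\<lambda>\<omega>. \<omega> u"])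
    show "(\<lambda>\<omega>. wt \<theta> i (\<omega> v)) \<in> borel_measurable config_space" for i
      by (rule measurable_compose[OF coord_measurable]) simp
  qed (simp_all add: countable_finite coord_measurable)
  have "(\<lambda>\<omega>. \<Prod>v\<in>E. wt \<theta> (\<omega> v) (\<omega> (par v))) \<in> borel_measurable config_space"
    using c by (rule borel_measurable_prod)
  then show ?thesis by (simp add: edgew_def[abs_def])
qed

lemma kern_measurable:
  assumes "finite \<Lambda>" "A \<in> sets config_space"
  shows "(\<lambda>\<omega>. kern \<Lambda> \<omega> A) \<in> borel_measurable config_space"
proof -
  have e: "(\<lambda>\<omega>. edgew \<theta> (touch \<Lambda>) (override_on \<omega> \<zeta> \<Lambda>)) \<in> borel_measurable config_space"
    if "\<zeta> \<in> cfg \<Lambda>" for \<zeta>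
    using measurable_compose[OF override_measurable[OF that] edgew_measurable[OF finite_touch[OF assms(1)]]] .
  have i: "(\<lambda>\<omega>. indicator A (override_on \<omega> \<zeta> \<Lambda>) :: real) \<in> borel_measurable config_space"
    if "\<zeta> \<in> cfg \<Lambda>" for \<zeta>
    using measurable_compose[OF override_measurable[OF that] borel_measurable_indicator[OF assms(2)]] .
  have "(\<lambda>\<omega>. knorm \<Lambda> \<omega>) \<in> borel_measurable config_space"
    unfolding knorm_def using e by (rule borel_measurable_sum)
  then show ?thesis unfolding kern_eq[OF assms(1)]
    using e i by (intro borel_measurable_sum borel_measurable_times borel_measurable_divide)
qed

lemma gibbs_measure_iff:
  "gibbs_measure J \<beta> L \<mu> \<longleftrightarrow> config_prob \<mu> \<and>
     (\<forall>\<Lambda> A. finite \<Lambda> \<longrightarrow> A \<in> sets config_space \<longrightarrow> measure \<mu> A = (\<integral>\<omega>. kern \<Lambda> \<omega> A \<partial>\<mu>))"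
  unfolding gibbs_measure_def config_prob_def config_prob_axioms_def by blast

lemma kern_integrable:
  assumes "config_prob \<mu>" "finite \<Lambda>" "A \<in> sets config_space"
  shows "integrable \<mu> (\<lambda>\<omega>. kern \<Lambda> \<omega> A)"
proof -
  interpret config_prob \<mu> by fact
  have "(\<lambda>\<omega>. kern \<Lambda> \<omega> A) \<in> borel_measurable \<mu>" using kern_measurable[OF assms(2,3)] by simp
  moreover have "AE \<omega> in \<mu>. norm (kern \<Lambda> \<omega> A) \<le> 1"
    by (rule AE_I2) (use kern_nonneg[OF assms(2)] kern_le_1[OF assms(2)] in simp)
  ultimately show ?thesis by (intro integrable_const_bound)
qed

text \<open>Both sides are countably additive in \<open>A\<close>, so equality on a generating
  pi-system extends to all events.\<close>

lemma DLR_from_cylinders: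
  assumes "config_prob \<mu>" "finite \<Lambda>"
    and cyl: "\<And>n \<tau>. N \<le> n \<Longrightarrow> \<tau> \<in> cfg (V n) \<Longrightarrow>
       measure \<mu> (cyl (V n) \<tau>) = (\<integral>\<omega>. kern \<Lambda> \<omega> (cyl (V n) \<tau>) \<partial>\<mu>)"
    and A: "A \<in> sets config_space"
  shows "measure \<mu> A = (\<integral>\<omega>. kern \<Lambda> \<omega> A \<partial>\<mu>)"
proof -
  interpret config_prob \<mu> by fact
  note int = kern_integrable[OF assms(1,2)]
  from A have "A \<in> sigma_sets (space config_space) (cyls N)" by (simp add: sigma_cyls)
  then show ?thesis
  proof (induction rule: sigma_sets_induct_disjoint[OF Int_stable_cyls cyls_subset_Pow, consumes 1,
        case_names basic empty compl union])
    case (basic A)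
    then show ?case using cyl by (auto simp: cyls_def kern_eq[OF assms(2)])
  next
    case empty
    then show ?case by (simp add: kern_eq[OF assms(2)])
  next
    case (compl A)
    then have A: "A \<in> sets config_space" by (simp add: sigma_cyls)
    have "(\<integral>\<omega>. kern \<Lambda> \<omega> (space config_space - A) \<partial>\<mu>) = (\<integral>\<omega>. 1 - kern \<Lambda> \<omega> A \<partial>\<mu>)"
      by (rule Bochner_Integration.integral_cong) (use kern_Compl[OF assms(2)] in auto)
    also have "\<dots> = 1 - prob A" using int[OF A] compl(2) prob_space by simp
    also have "\<dots> = prob (space config_space - A)" using prob_compl[of A] A by simp
    finally show ?case by simp
  next
    case (union A)
    then have A: "A i \<in> sets config_space" for i by (auto simp: sigma_cyls)
    have s: "(\<lambda>i. kern \<Lambda> \<omega> (A i)) sums kern \<Lambda> \<omega> (\<Union>i. A i)" for \<omega>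
      by (rule kern_sums[OF assms(2) union(1)])
    have U: "(\<Union>i. A i) \<in> sets config_space" using A by (intro sets.countable_UN) auto
    \<comment> \<open>Dominated convergence with the constant 1: the partial sums are at most the
      kernel of the union.\<close>
    have "(\<lambda>n. \<integral>\<omega>. (\<Sum>i<n. kern \<Lambda> \<omega> (A i)) \<partial>\<mu>) \<longlonglongrightarrow> (\<integral>\<omega>. kern \<Lambda> \<omega> (\<Union>i. A i) \<partial>\<mu>)"
    proof (rule integral_dominated_convergence[where w = "\<lambda>_. 1"])
      show "(\<lambda>\<omega>. kern \<Lambda> \<omega> (\<Union>i. A i)) \<in> borel_measurable \<mu>" using kern_measurable[OF assms(2) U] by simp
      show "(\<lambda>\<omega>. \<Sum>i<n. kern \<Lambda> \<omega> (A i)) \<in> borel_measurable \<mu>" for n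
        using kern_measurable[OF assms(2) A] by (intro borel_measurable_sum) simp
      show "AE \<omega> in \<mu>. (\<lambda>n. \<Sum>i<n. kern \<Lambda> \<omega> (A i)) \<longlonglongrightarrow> kern \<Lambda> \<omega> (\<Union>i. A i)"
        using s by (intro AE_I2) (simp add: sums_def)
      show "AE \<omega> in \<mu>. norm (\<Sum>i<n. kern \<Lambda> \<omega> (A i)) \<le> 1" for n
      proof (rule AE_I2)
        fix \<omega> assume w: "\<omega> \<in> space \<mu>"
        have "(\<Sum>i<n. kern \<Lambda> \<omega> (A i)) \<le> kern \<Lambda> \<omega> (\<Union>i. A i)"
          using s[of \<omega>] kern_nonneg[OF assms(2)] sum_le_suminf[of "\<lambda>i. kern \<Lambda> \<omega> (A i)" "{..<n}"]
          by (auto simp: sums_iff)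
        also have "\<dots> \<le> 1" using w by (intro kern_le_1 assms) simp
        finally show "norm (\<Sum>i<n. kern \<Lambda> \<omega> (A i)) \<le> 1"
          using sum_nonneg[of "{..<n}" "\<lambda>i. kern \<Lambda> \<omega> (A i)"] kern_nonneg[OF assms(2)] by simp
      qed
    qed simp
    moreover have "(\<integral>\<omega>. (\<Sum>i<n. kern \<Lambda> \<omega> (A i)) \<partial>\<mu>) = (\<Sum>i<n. prob (A i))" for n
      using int[OF A] union(3) by (subst Bochner_Integration.integral_sum) auto
    moreover have "(\<lambda>n. \<Sum>i<n. prob (A i)) \<longlonglongrightarrow> prob (\<Union>i. A i)"
      using finite_measure_UNION[of A] A union(1) by (auto simp: sums_def)
    ultimately show ?case using LIMSEQ_unique by auto
  qed
qed

end

end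

section \<open>The DLR equations from the marginals on balls\<close>

context cayley2
begin

lemma finite_subset_V:
  assumes "finite \<Lambda>" shows "\<exists>N. \<Lambda> \<subseteq> V N"
proof -
  have "finite (lev ` \<Lambda>)" using assms by simp
  then obtain N where "\<forall>k\<in>lev ` \<Lambda>. k \<le> N" using finite_nat_set_iff_bounded_le by blast
  then show ?thesis by (intro exI[of _ N]) auto
qed

lemma edgew_Un: "finite A \<Longrightarrow> finite B \<Longrightarrow> A \<inter> B = {} \<Longrightarrow> edgew \<theta> (A \<union> B) \<sigma> = edgew \<theta> A \<sigma> * edgew \<theta> B \<sigma>"
  unfolding edgew_def by (rule prod.union_disjoint)

text \<open>For two configurations that agree off \<Lambda> the constant, the boundary weights and
  all edges away from \<Lambda> cancel in the quotient of the marginals. What remains is the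
  quotient of the weights on \<open>touch \<Lambda>\<close>, which is how the kernel is
  defined.\<close>

lemma gibbs_measureI:
  assumes \<theta>: "\<theta> = exp (J * \<beta>)" and "config_prob \<mu>"
    and marg: "\<And>n \<tau>. 1 \<le> n \<Longrightarrow> \<tau> \<in> cfg (V n) \<Longrightarrow>
      measure \<mu> (cyl (V n) \<tau>) = K n * edgew \<theta> (V n - {x0}) \<tau> * (\<Prod>v\<in>W n. b (\<tau> v))"
  shows "gibbs_measure J \<beta> L \<mu>"
  unfolding gibbs_measure_iff[OF \<theta>]
proof (intro conjI allI impI)
  show "config_prob \<mu>" by fact
  fix \<Lambda> :: "'v set" and A
  assume \<Lambda>: "finite \<Lambda>" and A: "A \<in> sets (config_space :: ('v \<Rightarrow> nat) measure)"
  interpret config_prob \<mu> by fact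
  obtain N where N: "\<Lambda> \<subseteq> V N" using finite_subset_V[OF \<Lambda>] by blast
  show "prob A = (\<integral>\<omega>. kern J \<beta> \<Lambda> \<omega> A \<partial>\<mu>)"
  proof (rule DLR_from_cylinders[OF \<theta> \<open>config_prob \<mu>\<close> \<Lambda> _ A, of "Suc N"])
    fix n \<tau> assume n: "Suc N \<le> n" and \<tau>: "\<tau> \<in> cfg (V n)"
    let ?T = "touch \<Lambda>"
    let ?o = "\<lambda>\<omega> \<zeta>. override_on \<omega> \<zeta> \<Lambda>"
    have Vn: "\<Lambda> \<subseteq> V n" using N n by fastforce
    \<comment> \<open>Here n > N matters: \<Lambda> stays off the sphere, so the boundary weights do
      not move, and all edges that meet \<Lambda> lie inside the ball.\<close>
    have Wn: "v \<notin> \<Lambda>" if "v \<in> W n" for v using N n that by fastforce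
    have T: "v \<in> V n - {x0}" "par v \<in> V n" if "v \<in> ?T" for v
    proof -
      have "v \<noteq> x0" "lev v \<le> N \<or> lev (par v) \<le> N" using that N by (auto simp: touch_def)
      then show "v \<in> V n - {x0}" "par v \<in> V n" using lev_par[of v] n by auto
    qed
    \<comment> \<open>The part of the weight that resampling inside \<Lambda> leaves alone.\<close>
    define R where "R = K n * edgew \<theta> (V n - {x0} - ?T) \<tau> * (\<Prod>v\<in>W n. b (\<tau> v))"
    have o_cfg: "?o \<tau> \<zeta> \<in> cfg (V n)" if "\<zeta> \<in> cfg \<Lambda>" for \<zeta>
      using that \<tau> Vn by (auto simp: PiE_iff override_on_def extensional_def)
    have m: "prob (cyl (V n) (?o \<tau> \<zeta>)) = R * edgew \<theta> ?T (?o \<tau> \<zeta>)" if "\<zeta> \<in> cfg \<Lambda>" for \<zeta>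
    proof -
      have "V n - {x0} = (V n - {x0} - ?T) \<union> ?T" using T by blast
      then have "edgew \<theta> (V n - {x0}) (?o \<tau> \<zeta>)
          = edgew \<theta> (V n - {x0} - ?T) (?o \<tau> \<zeta>) * edgew \<theta> ?T (?o \<tau> \<zeta>)"
        using edgew_Un[of "V n - {x0} - ?T" ?T \<theta>] finite_touch[OF \<Lambda>] by fastforce
      moreover have "edgew \<theta> (V n - {x0} - ?T) (?o \<tau> \<zeta>) = edgew \<theta> (V n - {x0} - ?T) \<tau>"
        by (rule edgew_cong) (auto simp: touch_def override_on_def)
      moreover have "(\<Prod>v\<in>W n. b (?o \<tau> \<zeta> v)) = (\<Prod>v\<in>W n. b (\<tau> v))"
        by (rule prod.cong) (use Wn in \<open>auto simp: override_on_def\<close>)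
      ultimately show ?thesis using marg[OF _ o_cfg[OF that]] n by (simp add: R_def mult_ac)
    qed
    let ?\<tau> = "restrict \<tau> \<Lambda>"
    have \<tau>': "?\<tau> \<in> cfg \<Lambda>" by (rule restrict_cfg[OF \<tau> Vn])
    have o\<tau>: "?o \<tau> ?\<tau> = \<tau>" by (auto simp: override_on_def)
    \<comment> \<open>A cylinder over the ball selects a single inner configuration and forces
      \<omega> to agree with \<tau> on the rest of the ball, so the kernel is a function of the
      spins in \<open>V n\<close>.\<close>
    define k where "k = (\<lambda>\<eta> :: 'v \<Rightarrow> nat. if \<forall>v\<in>V n - \<Lambda>. \<eta> v = \<tau> v then edgew \<theta> ?T \<tau> / knorm \<theta> \<Lambda> \<tau> else 0)"
    have kern_k: "kern J \<beta> \<Lambda> \<omega> (cyl (V n) \<tau>) = k (restrict \<omega> (V n))"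
      if w: "\<omega> \<in> space config_space" for \<omega>
    proof -
      have cyl_iff: "?o \<omega> \<zeta> \<in> cyl (V n) \<tau> \<longleftrightarrow> (\<forall>v\<in>V n - \<Lambda>. \<omega> v = \<tau> v) \<and> \<zeta> = ?\<tau>"
        if z: "\<zeta> \<in> cfg \<Lambda>" for \<zeta>
      proof -
        have "?o \<omega> \<zeta> \<in> cyl (V n) \<tau> \<longleftrightarrow> (\<forall>v\<in>V n. ?o \<omega> \<zeta> v = \<tau> v)"
          using \<tau> override_space[OF w z] by (auto simp: cyl_def fun_eq_iff PiE_iff extensional_def)
        also have "\<dots> \<longleftrightarrow> (\<forall>v\<in>V n - \<Lambda>. \<omega> v = \<tau> v) \<and> (\<forall>v\<in>\<Lambda>. \<zeta> v = \<tau> v)"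
          using Vn by (auto simp: override_on_def)
        also have "(\<forall>v\<in>\<Lambda>. \<zeta> v = \<tau> v) \<longleftrightarrow> \<zeta> = ?\<tau>"
          using z by (auto simp: fun_eq_iff PiE_iff extensional_def)
        finally show ?thesis .
      qed
      show ?thesis
      proof (cases "\<forall>v\<in>V n - \<Lambda>. \<omega> v = \<tau> v")
        case True
        have e: "edgew \<theta> ?T (?o \<omega> \<zeta>) = edgew \<theta> ?T (?o \<tau> \<zeta>)" for \<zeta>
          by (rule edgew_cong) (use True T in \<open>auto simp: override_on_def\<close>)
        have "knorm \<theta> \<Lambda> \<omega> = knorm \<theta> \<Lambda> \<tau>" unfolding knorm_def[OF \<theta>] e ..
        then have "kern J \<beta> \<Lambda> \<omega> (cyl (V n) \<tau>)
          = (\<Sum>\<zeta>\<in>cfg \<Lambda>. if \<zeta> = ?\<tau> then edgew \<theta> ?T (?o \<tau> \<zeta>) / knorm \<theta> \<Lambda> \<tau> else 0)"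
          unfolding kern_eq[OF \<theta> \<Lambda>] e
          by (intro sum.cong refl) (use cyl_iff True in \<open>auto simp: indicator_def\<close>)
        also have "\<dots> = edgew \<theta> ?T \<tau> / knorm \<theta> \<Lambda> \<tau>" using \<tau>' \<Lambda> by (simp add: o\<tau> del: restrict_PiE)
        finally show ?thesis using True by (simp add: k_def)
      next
        case False
        have "indicator (cyl (V n) \<tau>) (?o \<omega> \<zeta>) = (0::real)" if "\<zeta> \<in> cfg \<Lambda>" for \<zeta>
          using cyl_iff[OF that] False by (auto simp: indicator_def)
        moreover have "k (restrict \<omega> (V n)) = 0" using False by (auto simp: k_def)
        ultimately show ?thesis unfolding kern_eq[OF \<theta> \<Lambda>] by simp
      qed
    qed
    have inj: "inj_on (?o \<tau>) (cfg \<Lambda>)"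
    proof (rule inj_onI)
      fix \<zeta> \<zeta>' assume z: "\<zeta> \<in> cfg \<Lambda>" "\<zeta>' \<in> cfg \<Lambda>" and eq: "?o \<tau> \<zeta> = ?o \<tau> \<zeta>'"
      have "\<zeta> v = \<zeta>' v" if "v \<in> \<Lambda>" for v using fun_cong[OF eq, of v] that by simp
      then show "\<zeta> = \<zeta>'" using z by (intro PiE_ext) auto
    qed
    have img: "?o \<tau> ` cfg \<Lambda> = {\<eta> \<in> cfg (V n). \<forall>v\<in>V n - \<Lambda>. \<eta> v = \<tau> v}"
    proof (intro equalityI subsetI)
      fix \<eta> assume e: "\<eta> \<in> {\<eta> \<in> cfg (V n). \<forall>v\<in>V n - \<Lambda>. \<eta> v = \<tau> v}"
      have "\<eta> = ?o \<tau> (restrict \<eta> \<Lambda>)"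
      proof (rule ext)
        fix v show "\<eta> v = ?o \<tau> (restrict \<eta> \<Lambda>) v"
        proof (cases "v \<in> V n")
          case False
          then have "\<eta> v = undefined" "\<tau> v = undefined" using e \<tau> PiE_arb by fast+
          then show ?thesis by (simp add: override_on_def)
        qed (use e in \<open>auto simp: override_on_def\<close>)
      qed
      moreover have "restrict \<eta> \<Lambda> \<in> cfg \<Lambda>" using e Vn by (intro restrict_cfg) auto
      ultimately show "\<eta> \<in> ?o \<tau> ` cfg \<Lambda>" by blast
    next
      fix \<eta> assume "\<eta> \<in> ?o \<tau> ` cfg \<Lambda>"
      then show "\<eta> \<in> {\<eta> \<in> cfg (V n). \<forall>v\<in>V n - \<Lambda>. \<eta> v = \<tau> v}" using o_cfg by auto
    qed
    have "(\<integral>\<omega>. kern J \<beta> \<Lambda> \<omega> (cyl (V n) \<tau>) \<partial>\<mu>) = (\<integral>\<omega>. k (restrict \<omega> (V n)) \<partial>\<mu>)"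
      by (rule Bochner_Integration.integral_cong) (use kern_k in auto)
    also have "\<dots> = (\<Sum>\<eta>\<in>cfg (V n). k \<eta> * prob (cyl (V n) \<eta>))"
      by (rule fin_dep_integral) simp
    \<comment> \<open>Only configurations agreeing with \<tau> off \<Lambda> contribute. Summed over
      the inner configurations their weights rebuild the normaliser, which then cancels.\<close>
    also have "\<dots> = (\<Sum>\<eta>\<in>?o \<tau> ` cfg \<Lambda>. k \<eta> * prob (cyl (V n) \<eta>))"
      unfolding img by (rule sum.mono_neutral_right) (auto simp: k_def)
    also have "\<dots> = (\<Sum>\<zeta>\<in>cfg \<Lambda>. edgew \<theta> ?T \<tau> / knorm \<theta> \<Lambda> \<tau> * (R * edgew \<theta> ?T (?o \<tau> \<zeta>)))"
      by (subst sum.reindex[OF inj]) (auto intro!: sum.cong simp: m k_def)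
    also have "\<dots> = R * edgew \<theta> ?T \<tau> * knorm \<theta> \<Lambda> \<tau> / knorm \<theta> \<Lambda> \<tau>"
      unfolding knorm_def[OF \<theta>] sum_distrib_left sum_divide_distrib by (simp add: mult_ac)
    also have "\<dots> = R * edgew \<theta> ?T \<tau>" using knorm_pos[OF \<theta> \<Lambda>, of \<tau>] by simp
    also have "\<dots> = prob (cyl (V n) \<tau>)" using m[OF \<tau>'] by (simp add: o\<tau>)
    finally show "prob (cyl (V n) \<tau>) = (\<integral>\<omega>. kern J \<beta> \<Lambda> \<omega> (cyl (V n) \<tau>) \<partial>\<mu>)" ..
  qed
qed

end

section \<open>Translation-invariant splitting chains\<close>

text \<open>The message that a vertex with spin weights \<open>e\<close> sends to a neighbour of
  spin \<open>i\<close>.\<close>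

definition rowF :: "real \<Rightarrow> (nat \<Rightarrow> real) \<Rightarrow> nat \<Rightarrow> real" where
  "rowF \<theta> e i = (\<Sum>j\<in>spins. wt \<theta> i j * e j)"

definition tmat :: "real \<Rightarrow> (nat \<Rightarrow> real) \<Rightarrow> nat \<Rightarrow> nat \<Rightarrow> real" where
  "tmat \<theta> e i j = wt \<theta> i j * e j / rowF \<theta> e i"

text \<open>The root receives three messages, hence the cube. Lemma \<open>stationary\<close> shows
  that this is also the invariant law of \<open>tmat\<close>.\<close>

definition stat :: "real \<Rightarrow> (nat \<Rightarrow> real) \<Rightarrow> nat \<Rightarrow> real" where
  "stat \<theta> e i = rowF \<theta> e i ^ 3 / (\<Sum>j\<in>spins. rowF \<theta> e j ^ 3)"

text \<open>The square in \<open>fixed\<close> stands for the two children of a vertex off the root: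
  their messages reproduce the weights up to the factor \<open>C\<close>, that is, the field up to
  an additive constant.\<close>

locale tisgm = cayley2 L x0 for L :: "'v rel" and x0 +
  fixes \<theta> :: real and e :: "nat \<Rightarrow> real" and C :: real
  assumes \<theta>_pos': "0 < \<theta>"
    and e_pos: "i \<in> spins \<Longrightarrow> 0 < e i"
    and fixed: "i \<in> spins \<Longrightarrow> rowF \<theta> e i ^ 2 = C * e i"
begin

abbreviation "F \<equiv> rowF \<theta> e"

lemma F_pos: "0 < F i"
  unfolding rowF_def by (intro sum_pos) (auto simp: e_pos wt_pos \<theta>_pos')

lemma C_pos: "0 < C"
  using fixed[of 0] F_pos[of 0] e_pos[of 0] by (simp add: zero_less_mult_iff) (smt (verit) zero_less_power mult_nonpos_nonneg)

lemma S_pos: "0 < (\<Sum>j\<in>spins. F j ^ 3)"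
  by (intro sum_pos) (auto simp: F_pos)

lemma stat_pos: "0 < stat \<theta> e i"
  using F_pos S_pos by (simp add: stat_def)

lemma trans_pos: "j \<in> spins \<Longrightarrow> 0 < tmat \<theta> e i j"
  using F_pos[of i] by (simp add: tmat_def e_pos wt_pos \<theta>_pos')

lemma trans_sum: "(\<Sum>j\<in>spins. tmat \<theta> e i j) = 1"
  unfolding tmat_def sum_divide_distrib[symmetric] rowF_def[symmetric] using F_pos[of i] by simp

lemma stat_sum: "(\<Sum>j\<in>spins. stat \<theta> e j) = 1"
  unfolding stat_def sum_divide_distrib[symmetric] using S_pos by simp

sublocale tree_chain L x0 "stat \<theta> e" "tmat \<theta> e"
  by unfold_locales (auto simp: trans_sum stat_sum intro: less_imp_le[OF stat_pos] less_imp_le[OF trans_pos])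

text \<open>Reversibility: by \<open>fixed\<close>,
  \<open>stat \<theta> e i * tmat \<theta> e i j\<close> is proportional to
  \<open>e i * wt \<theta> i j * e j\<close>, which is symmetric in \<open>i\<close> and
  \<open>j\<close>.\<close>

lemma stationary:
  assumes "j \<in> spins" shows "(\<Sum>i\<in>spins. stat \<theta> e i * tmat \<theta> e i j) = stat \<theta> e j"
proof -
  let ?S = "\<Sum>j\<in>spins. F j ^ 3"
  have "stat \<theta> e i * tmat \<theta> e i j = C * e j / ?S * (wt \<theta> j i * e i)" if "i \<in> spins" for i
  proof -
    have "stat \<theta> e i * tmat \<theta> e i j = F i ^ 2 * wt \<theta> i j * e j / ?S"
      using F_pos[of i] by (simp add: stat_def tmat_def power3_eq_cube power2_eq_square)
    then show ?thesis by (simp add: fixed[OF that] wt_sym[of \<theta> i j] mult_ac)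
  qed
  then have "(\<Sum>i\<in>spins. stat \<theta> e i * tmat \<theta> e i j) = C * e j / ?S * F j"
    by (simp add: rowF_def sum_distrib_left)
  also have "\<dots> = stat \<theta> e j"
    unfolding stat_def fixed[OF assms, symmetric] by (simp add: power3_eq_cube power2_eq_square)
  finally show ?thesis .
qed

text \<open>The denominators telescope. At the root the three children cancel the cube in
  \<open>stat\<close>; on every later sphere the two children of a vertex cancel the weight
  \<open>e\<close> that the vertex carried while it was on the boundary.\<close>

lemma pr_edgew:
  "\<exists>K>0. \<forall>\<tau>\<in>cfg (V (Suc n)). pr (Suc n) \<tau> = K * edgew \<theta> (V (Suc n) - {x0}) \<tau> * (\<Prod>v\<in>W (Suc n). e (\<tau> v))"
proof (induction n)
  case 0
  let ?K = "1 / (\<Sum>j\<in>spins. F j ^ 3)"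
  have "pr (Suc 0) \<tau> = ?K * edgew \<theta> (V (Suc 0) - {x0}) \<tau> * (\<Prod>v\<in>W (Suc 0). e (\<tau> v))" for \<tau>
  proof -
    have V: "V (Suc 0) - {x0} = W (Suc 0)" by (auto simp: le_Suc_eq lev_0_iff)
    have "(\<Prod>c\<in>W (Suc 0). tmat \<theta> e (\<tau> (par c)) (\<tau> c))
       = (\<Prod>c\<in>W (Suc 0). wt \<theta> (\<tau> c) (\<tau> (par c)) * e (\<tau> c) / F (\<tau> x0))"
    proof (rule prod.cong[OF refl])
      fix c assume "c \<in> W (Suc 0)"
      then have "par c = x0" by (simp add: lev_Suc_iff lev_0_iff)
      then show "tmat \<theta> e (\<tau> (par c)) (\<tau> c) = wt \<theta> (\<tau> c) (\<tau> (par c)) * e (\<tau> c) / F (\<tau> x0)"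
        by (simp add: tmat_def wt_sym)
    qed
    also have "\<dots> = edgew \<theta> (W (Suc 0)) \<tau> * (\<Prod>v\<in>W (Suc 0). e (\<tau> v)) / F (\<tau> x0) ^ 3"
      by (simp add: prod_dividef prod.distrib edgew_def card_W del: W_iff)
    finally show ?thesis unfolding pr_Suc pr_0 V using F_pos[of "\<tau> x0"] by (simp add: stat_def)
  qed
  then show ?case using S_pos by (intro exI[of _ ?K]) simp
next
  case (Suc n)
  then obtain K where K: "K > 0"
    "\<forall>\<tau>\<in>cfg (V (Suc n)). pr (Suc n) \<tau> = K * edgew \<theta> (V (Suc n) - {x0}) \<tau> * (\<Prod>v\<in>W (Suc n). e (\<tau> v))"
    by blast
  \<comment> \<open>Two children divide by the square of the message, which is \<open>C\<close>
    times the parent's weight: the weight cancels and one factor \<open>C\<close> per vertex of the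
    old sphere remains.\<close>
  let ?K = "K / C ^ card (W (Suc n))"
  have "pr (Suc (Suc n)) \<tau> = ?K * edgew \<theta> (V (Suc (Suc n)) - {x0}) \<tau> * (\<Prod>v\<in>W (Suc (Suc n)). e (\<tau> v))"
    if \<tau>: "\<tau> \<in> cfg (V (Suc (Suc n)))" for \<tau>
  proof -
    let ?W = "W (Suc (Suc n))"
    have ep: "0 < e (\<tau> v)" if "v \<in> W (Suc n)" for v
      using \<tau> that by (intro e_pos) (auto simp: PiE_iff)
    have "pr (Suc n) \<tau> = pr (Suc n) (restrict \<tau> (V (Suc n)))" by (simp add: pr_restrict)
    also have "\<dots> = K * edgew \<theta> (V (Suc n) - {x0}) (restrict \<tau> (V (Suc n))) * (\<Prod>v\<in>W (Suc n). e (restrict \<tau> (V (Suc n)) v))"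
      using K(2) \<tau> by (intro bspec[OF K(2)] restrict_cfg) auto
    also have "edgew \<theta> (V (Suc n) - {x0}) (restrict \<tau> (V (Suc n))) = edgew \<theta> (V (Suc n) - {x0}) \<tau>"
      using V_par[of _ "Suc n"] by (intro edgew_cong) auto
    also have "(\<Prod>v\<in>W (Suc n). e (restrict \<tau> (V (Suc n)) v)) = (\<Prod>v\<in>W (Suc n). e (\<tau> v))"
      by (rule prod.cong) auto
    finally have 1: "pr (Suc n) \<tau> = K * edgew \<theta> (V (Suc n) - {x0}) \<tau> * (\<Prod>v\<in>W (Suc n). e (\<tau> v))" .
    have "(\<Prod>c\<in>?W. F (\<tau> (par c))) = (\<Prod>v\<in>W (Suc n). \<Prod>c\<in>ch v. F (\<tau> (par c)))"
      by (rule prod_W_Suc)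
    also have "\<dots> = (\<Prod>v\<in>W (Suc n). C * e (\<tau> v))"
    proof (rule prod.cong[OF refl])
      fix v assume v: "v \<in> W (Suc n)"
      then have "v \<noteq> x0" by auto
      have "(\<Prod>c\<in>ch v. F (\<tau> (par c))) = (\<Prod>c\<in>ch v. F (\<tau> v))" by (rule prod.cong) auto
      also have "\<dots> = F (\<tau> v) ^ 2" using \<open>v \<noteq> x0\<close> by (simp add: card_ch)
      also have "\<dots> = C * e (\<tau> v)" using \<tau> v by (intro fixed) (auto simp: PiE_iff)
      finally show "(\<Prod>c\<in>ch v. F (\<tau> (par c))) = C * e (\<tau> v)" .
    qed
    finally have 2: "(\<Prod>c\<in>?W. F (\<tau> (par c))) = C ^ card (W (Suc n)) * (\<Prod>v\<in>W (Suc n). e (\<tau> v))"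
      by (simp add: prod.distrib del: W_iff)
    have "(\<Prod>c\<in>?W. tmat \<theta> e (\<tau> (par c)) (\<tau> c))
        = edgew \<theta> ?W \<tau> * (\<Prod>v\<in>?W. e (\<tau> v)) / (\<Prod>c\<in>?W. F (\<tau> (par c)))"
      by (simp add: tmat_def prod_dividef prod.distrib edgew_def wt_sym del: W_iff)
    moreover have "edgew \<theta> (V (Suc (Suc n)) - {x0}) \<tau> = edgew \<theta> (V (Suc n) - {x0}) \<tau> * edgew \<theta> ?W \<tau>"
    proof -
      have "V (Suc (Suc n)) - {x0} = (V (Suc n) - {x0}) \<union> ?W" by auto
      moreover have "(V (Suc n) - {x0}) \<inter> ?W = {}" by auto
      ultimately show ?thesis by (simp add: edgew_Un del: W_iff V_iff)
    qed
    moreover have "(\<Prod>v\<in>W (Suc n). e (\<tau> v)) \<noteq> 0" using prod_pos[of "W (Suc n)" "\<lambda>v. e (\<tau> v)"] ep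
      by (metis less_irrefl)
    ultimately show ?thesis unfolding pr_Suc[of "Suc n"] 1 2 using C_pos
      by (simp del: prod_zero_iff W_iff V_iff)
  qed
  moreover have "?K > 0" using K(1) C_pos by simp
  ultimately show ?case by blast
qed

lemma pr_pos: "\<tau> \<in> cfg (V n) \<Longrightarrow> 0 < pr n \<tau>"
  unfolding pr_def using V_par[of _ n]
  by (intro mult_pos_pos prod_pos stat_pos trans_pos ballI) (auto simp: PiE_iff)

lemma gibbs_chain:
  assumes "\<theta> = exp (J * \<beta>)" shows "gibbs_measure J \<beta> L chain_measure"
proof -
  obtain K where K: "\<forall>n. \<forall>\<tau>\<in>cfg (V (Suc n)). pr (Suc n) \<tau>
      = K n * edgew \<theta> (V (Suc n) - {x0}) \<tau> * (\<Prod>v\<in>W (Suc n). e (\<tau> v))"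
    using pr_edgew by metis
  show ?thesis
  proof (rule gibbs_measureI[OF assms chain_measure(1), where K = "\<lambda>n. K (n - 1)" and b = e])
    fix n :: nat and \<tau> assume "1 \<le> n" and \<tau>: "\<tau> \<in> cfg (V n)"
    then obtain k where "n = Suc k" by (cases n) auto
    then show "measure chain_measure (cyl (V n) \<tau>) = K (n - 1) * edgew \<theta> (V n - {x0}) \<tau> * (\<Prod>v\<in>W n. e (\<tau> v))"
      using K \<tau> chain_measure(2)[OF \<tau>] by simp
  qed
qed

text \<open>The constant \<open>c\<close> accounts for adding a constant to the field; it cancels in
  the normalisation.\<close>

lemma vol_prob_pr:
  assumes "\<theta> = exp (J * \<beta>)" "c > 0" "\<And>i. i \<in> spins \<Longrightarrow> exp (h i) = c * e i" and \<tau>: "\<tau> \<in> cfg (V (Suc n))"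
  shows "vol_prob J \<beta> L x0 (\<lambda>_. h) (Suc n) \<tau> = pr (Suc n) \<tau>"
proof -
  obtain K where K: "K > 0" "\<forall>\<tau>\<in>cfg (V (Suc n)). pr (Suc n) \<tau>
      = K * edgew \<theta> (V (Suc n) - {x0}) \<tau> * (\<Prod>v\<in>W (Suc n). e (\<tau> v))"
    using pr_edgew by blast
  let ?c = "c ^ card (W (Suc n)) / K"
  have w: "vol_weight J \<beta> L x0 (\<lambda>_. h) (Suc n) \<tau> = ?c * pr (Suc n) \<tau>" if "\<tau> \<in> cfg (V (Suc n))" for \<tau>
  proof -
    have "(\<Prod>v\<in>W (Suc n). exp (h (\<tau> v))) = (\<Prod>v\<in>W (Suc n). c * e (\<tau> v))"
      using that by (intro prod.cong refl assms) (auto simp: PiE_iff)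
    then show ?thesis unfolding vol_weight_eq assms(1)[symmetric]
      using K that by (simp add: prod.distrib del: W_iff)
  qed
  have "(\<Sum>\<omega>\<in>cfg (V (Suc n)). vol_weight J \<beta> L x0 (\<lambda>_. h) (Suc n) \<omega>) = ?c"
  proof -
    have "(\<Sum>\<omega>\<in>cfg (V (Suc n)). vol_weight J \<beta> L x0 (\<lambda>_. h) (Suc n) \<omega>)
        = (\<Sum>\<omega>\<in>cfg (V (Suc n)). ?c * pr (Suc n) \<omega>)" by (rule sum.cong[OF refl w])
    then show ?thesis unfolding sum_distrib_left[symmetric] sum_pr by simp
  qed
  then show ?thesis unfolding vol_prob_def w[OF \<tau>] using assms(2) K(1) by simp
qed

lemma sum_pr_restrict:
  assumes \<sigma>: "\<sigma> \<in> cfg (V n)"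
  shows "(\<Sum>\<omega> | \<omega> \<in> cfg (V (Suc n)) \<and> restrict \<omega> (V n) = \<sigma>. pr (Suc n) \<omega>) = pr n \<sigma>"
proof -
  have "(\<Sum>\<omega> | \<omega> \<in> cfg (V (Suc n)) \<and> restrict \<omega> (V n) = \<sigma>. pr (Suc n) \<omega>)
      = (\<Sum>\<omega>\<in>cfg (V (Suc n)). pr (Suc n) \<omega> * (if restrict \<omega> (V n) = \<sigma> then 1 else 0))"
    by (rule sum.mono_neutral_cong_left) auto
  also have "\<dots> = (\<Sum>\<zeta>\<in>cfg (V n). pr n \<zeta> * (\<Sum>\<eta>\<in>cfg (W (Suc n)).
        (\<Prod>c\<in>W (Suc n). tmat \<theta> e (\<zeta> (par c)) (\<eta> c)) * (if \<zeta> = \<sigma> then 1 else 0)))"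
    by (rule sum_pr_Suc)
  also have "\<dots> = (\<Sum>\<zeta>\<in>cfg (V n). if \<zeta> = \<sigma> then pr n \<zeta> else 0)"
  proof (rule sum.cong[OF refl])
    fix \<zeta> assume "\<zeta> \<in> cfg (V n)"
    have "(\<Sum>\<eta>\<in>cfg (W (Suc n)). \<Prod>c\<in>W (Suc n). tmat \<theta> e (\<zeta> (par c)) (\<eta> c))
        = (\<Prod>c\<in>W (Suc n). \<Sum>j\<in>spins. tmat \<theta> e (\<zeta> (par c)) j)"
      by (rule prod_sum_PiE[symmetric]) auto
    then show "pr n \<zeta> * (\<Sum>\<eta>\<in>cfg (W (Suc n)).
        (\<Prod>c\<in>W (Suc n). tmat \<theta> e (\<zeta> (par c)) (\<eta> c)) * (if \<zeta> = \<sigma> then 1 else 0))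
        = (if \<zeta> = \<sigma> then pr n \<zeta> else 0)"
      by (cases "\<zeta> = \<sigma>") (simp_all add: trans_sum)
  qed
  also have "\<dots> = pr n \<sigma>" using \<sigma> by simp
  finally show ?thesis .
qed

lemma splitting_chain:
  assumes "\<theta> = exp (J * \<beta>)" "c > 0" "\<And>i. i \<in> spins \<Longrightarrow> exp (h i) = c * e i"
  shows "splitting_gibbs J \<beta> L x0 (\<lambda>_. h) \<mu> \<longleftrightarrow> \<mu> = chain_measure"
proof -
  have vp: "vol_prob J \<beta> L x0 (\<lambda>_. h) (Suc n) \<tau> = pr (Suc n) \<tau>" if "\<tau> \<in> cfg (V (Suc n))" for n \<tau>
    by (rule vol_prob_pr[OF assms(1,2) _ that]) (rule assms(3))
  have compat: "compatible J \<beta> L x0 (\<lambda>_. h)"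
    unfolding compatible_def
  proof (intro allI impI ballI)
    fix n :: nat and \<sigma> assume n: "2 \<le> n" and \<sigma>: "\<sigma> \<in> cfg (V (n - 1))"
    then obtain k where k: "n = Suc (Suc k)" by (metis add_2_eq_Suc' le_Suc_ex add.commute)
    have \<sigma>': "\<sigma> \<in> cfg (V (Suc k))" using \<sigma> by (simp add: k)
    have "(\<Sum>\<omega> | \<omega> \<in> cfg (V (Suc (Suc k))) \<and> restrict \<omega> (V (Suc k)) = \<sigma>. vol_prob J \<beta> L x0 (\<lambda>_. h) (Suc (Suc k)) \<omega>)
      = (\<Sum>\<omega> | \<omega> \<in> cfg (V (Suc (Suc k))) \<and> restrict \<omega> (V (Suc k)) = \<sigma>. pr (Suc (Suc k)) \<omega>)"
      by (rule sum.cong) (auto intro: vp)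
    then show "(\<Sum>\<omega> | \<omega> \<in> cfg (V n) \<and> restrict \<omega> (V (n - 1)) = \<sigma>. vol_prob J \<beta> L x0 (\<lambda>_. h) n \<omega>)
        = vol_prob J \<beta> L x0 (\<lambda>_. h) (n - 1) \<sigma>"
      using sum_pr_restrict[OF \<sigma>'] vp[OF \<sigma>'] by (simp add: k)
  qed
  have marg: "(\<forall>n\<ge>1. \<forall>\<sigma>\<in>cfg (V n). measure \<mu> (cyl (V n) \<sigma>) = vol_prob J \<beta> L x0 (\<lambda>_. h) n \<sigma>)
     \<longleftrightarrow> (\<forall>n\<ge>1. \<forall>\<sigma>\<in>cfg (V n). measure \<mu> (cyl (V n) \<sigma>) = pr n \<sigma>)" for \<mu>
  proof -
    have "vol_prob J \<beta> L x0 (\<lambda>_. h) n \<sigma> = pr n \<sigma>" if "1 \<le> n" "\<sigma> \<in> cfg (V n)" for n \<sigma>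
      using that vp[of \<sigma> "n - 1"] by simp
    then show ?thesis by auto
  qed
  show ?thesis
  proof
    assume s: "splitting_gibbs J \<beta> L x0 (\<lambda>_. h) \<mu>"
    then have c: "config_prob \<mu>"
      by (simp add: splitting_gibbs_def config_prob_def config_prob_axioms_def)
    then interpret config_prob \<mu> .
    have "\<forall>n\<ge>1. \<forall>\<sigma>\<in>cfg (V n). prob (cyl (V n) \<sigma>) = vol_prob J \<beta> L x0 (\<lambda>_. h) n \<sigma>"
      using s unfolding splitting_gibbs_def cyl_def by simp
    then show "\<mu> = chain_measure" unfolding marg by (intro chain_measure_eqI[OF c, of 1]) auto
  next
    assume \<mu>: "\<mu> = chain_measure"
    show "splitting_gibbs J \<beta> L x0 (\<lambda>_. h) \<mu>"
      unfolding splitting_gibbs_def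
    proof (intro conjI compat)
      show "prob_space \<mu>" "sets \<mu> = sets config_space" unfolding \<mu> by (simp_all add: C.prob_space_axioms)
      have "\<forall>n\<ge>1. \<forall>\<sigma>\<in>cfg (V n). measure \<mu> (cyl (V n) \<sigma>) = vol_prob J \<beta> L x0 (\<lambda>_. h) n \<sigma>"
        unfolding marg using chain_measure(2) by (simp add: \<mu>)
      then show "\<forall>n\<ge>1. \<forall>\<sigma>\<in>cfg (V n). measure \<mu> {\<omega> \<in> space \<mu>. restrict \<omega> (V n) = \<sigma>}
          = vol_prob J \<beta> L x0 (\<lambda>_. h) n \<sigma>" by (simp add: cyl_def \<mu>)
    qed
  qed
qed

end

section \<open>Splitting Gibbs measures and the fixed-point equations\<close>

definition FP :: "real \<Rightarrow> (real \<times> real) set" where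
  "FP \<theta> = {(x, y). 0 < x \<and> 0 < y
     \<and> x * (\<theta>^2 * x^2 + \<theta> * y^2 + 1) = x^2 + \<theta> * y^2 + \<theta>^2
     \<and> y * (\<theta>^2 * x^2 + \<theta> * y^2 + 1) = \<theta> * x^2 + y^2 + \<theta>}"

text \<open>The exponentials of the field in the normalisation \<open>h 2 = 0\<close>. Since
  \<open>x\<close> and \<open>y\<close> are their square roots, the ratios of the messages at a
  solution are \<open>x\<close> and \<open>y\<close> themselves.\<close>

definition wvec :: "real \<times> real \<Rightarrow> nat \<Rightarrow> real" where
  "wvec v i = (if i = 0 then (fst v)^2 else if i = 1 then (snd v)^2 else 1)"

lemma rowF_simps:
  "rowF \<theta> e 0 = e 0 + \<theta> * e 1 + \<theta>^2 * e 2"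
  "rowF \<theta> e 1 = \<theta> * e 0 + e 1 + \<theta> * e 2"
  "rowF \<theta> e (Suc 0) = \<theta> * e 0 + e 1 + \<theta> * e 2"
  "rowF \<theta> e 2 = \<theta>^2 * e 0 + \<theta> * e 1 + e 2"
  by (simp_all add: rowF_def sum_spins wt_def)

lemma FP_rowF:
  assumes "(x, y) \<in> FP \<theta>"
  shows "rowF \<theta> (wvec (x, y)) 0 = x * rowF \<theta> (wvec (x, y)) 2"
    and "rowF \<theta> (wvec (x, y)) 1 = y * rowF \<theta> (wvec (x, y)) 2"
    and "rowF \<theta> (wvec (x, y)) 2 = \<theta>^2 * x^2 + \<theta> * y^2 + 1"
  using assms by (simp_all add: FP_def rowF_simps wvec_def)

lemma ratio_cancel:
  fixes w x y z z' :: real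
  assumes "w * x / z = w * y / z'" "w \<noteq> 0" "z \<noteq> 0" "z' \<noteq> 0" "y \<noteq> 0"
  shows "x / y = z / z'"
  using assms by (simp add: field_simps)

context cayley2
begin

definition TM :: "real \<Rightarrow> real \<times> real \<Rightarrow> ('v \<Rightarrow> nat) measure" where
  "TM \<theta> v = tree_chain.chain_measure L x0 (stat \<theta> (wvec v)) (tmat \<theta> (wvec v))"

lemma tisgm_FP:
  assumes "0 < \<theta>" "v \<in> FP \<theta>"
  shows "tisgm L \<theta> (wvec v) (rowF \<theta> (wvec v) 2 ^ 2)"
proof unfold_locales
  obtain x y where v: "v = (x, y)" by fastforce
  show "0 < \<theta>" by fact
  fix i :: nat assume i: "i \<in> spins"
  show "0 < wvec v i" using assms(2) by (simp add: v FP_def wvec_def)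
  show "rowF \<theta> (wvec v) i ^ 2 = rowF \<theta> (wvec v) 2 ^ 2 * wvec v i"
    using spins_cases[OF i] FP_rowF(1,2)[OF assms(2)[unfolded v]]
    by (auto simp: v wvec_def power_mult_distrib)
qed

text \<open>Compatibility of levels 1 and 2, tested on the constant configurations of
  \<open>V 1\<close>, is enough. Six vertices on the second sphere against three on the first give
  the equality, over all spins, of the cubes of the squared message divided by the weight; cube
  roots of nonnegative reals are unique.\<close>

lemma splitting_fixed:
  assumes \<theta>: "\<theta> = exp (J * \<beta>)" and s: "splitting_gibbs J \<beta> L x0 (\<lambda>_. h) \<mu>"
  shows "\<exists>C. \<forall>i\<in>spins. rowF \<theta> (\<lambda>j. exp (h j)) i ^ 2 = C * exp (h i)"
proof -
  have \<theta>p: "0 < \<theta>" by (simp add: \<theta>)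
  let ?e = "\<lambda>j. exp (h j)"
  let ?F = "rowF \<theta> ?e"
  have Fp: "0 < ?F i" for i
    unfolding rowF_def by (intro sum_pos) (auto simp: wt_pos \<theta>p)
  let ?Z = "\<lambda>n. \<Sum>\<omega>\<in>cfg (V n). vol_weight J \<beta> L x0 (\<lambda>_. h) n \<omega>"
  have Zp: "0 < ?Z n" for n
    by (intro sum_pos) (auto simp: PiE_eq_empty_iff vol_weight_def)
  have W2: "W 2 = W (Suc (Suc 0))" by (simp add: numeral_2_eq_2)
  have "(?F i ^ 2 / ?e i) ^ 3 = ?Z 2 / ?Z 1" if i: "i \<in> spins" for i
  proof -
    define \<sigma> where "\<sigma> = restrict (\<lambda>_. i) (V 1)"
    have \<sigma>: "\<sigma> \<in> cfg (V 1)" using i by (auto simp: \<sigma>_def)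
    let ?w = "\<lambda>\<omega>. edgew \<theta> (V 1 - {x0}) \<sigma> * (\<Prod>c\<in>W 2. wt \<theta> i (\<omega> c) * ?e (\<omega> c))"
    have "(\<Sum>\<omega> | \<omega> \<in> cfg (V 2) \<and> restrict \<omega> (V 1) = \<sigma>. vol_weight J \<beta> L x0 (\<lambda>_. h) 2 \<omega>)
        = (\<Sum>\<omega> | \<omega> \<in> cfg (V 2) \<and> restrict \<omega> (V 1) = \<sigma>. ?w (restrict \<omega> (W 2)))"
    proof (rule sum.cong[OF refl])
      fix \<omega> assume w: "\<omega> \<in> {\<omega> \<in> cfg (V 2). restrict \<omega> (V 1) = \<sigma>}"
      have eq: "\<omega> v = \<sigma> v" "\<sigma> v = i" if v: "v \<in> V 1" for v
      proof -
        have "restrict \<omega> (V 1) v = \<sigma> v" using w by simp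
        then show "\<omega> v = \<sigma> v" using v by simp
        show "\<sigma> v = i" using v by (simp add: \<sigma>_def)
      qed
      have "V 2 - {x0} = (V 1 - {x0}) \<union> W 2" by auto
      moreover have "(V 1 - {x0}) \<inter> W 2 = {}" by auto
      ultimately have "edgew \<theta> (V 2 - {x0}) \<omega> = edgew \<theta> (V 1 - {x0}) \<omega> * edgew \<theta> (W 2) \<omega>"
        by (simp add: edgew_Un del: W_iff V_iff)
      moreover have "edgew \<theta> (V 1 - {x0}) \<omega> = edgew \<theta> (V 1 - {x0}) \<sigma>"
      proof (rule edgew_cong)
        fix v assume "v \<in> V 1 - {x0}"
        then have "v \<in> V 1" "par v \<in> V 1" using lev_par[of v] by auto
        then show "\<omega> v = \<sigma> v \<and> \<omega> (par v) = \<sigma> (par v)" using eq by blast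
      qed
      moreover have "edgew \<theta> (W 2) \<omega> * (\<Prod>c\<in>W 2. ?e (\<omega> c)) = (\<Prod>c\<in>W 2. wt \<theta> i (restrict \<omega> (W 2) c) * ?e (restrict \<omega> (W 2) c))"
        unfolding edgew_def prod.distrib[symmetric]
      proof (rule prod.cong[OF refl])
        fix c assume c: "c \<in> W 2"
        then have "par c \<in> V 1" using par_W[of c "Suc 0"] by (simp add: W2)
        then have "\<omega> (par c) = i" using eq by metis
        then show "wt \<theta> (\<omega> c) (\<omega> (par c)) * ?e (\<omega> c) = wt \<theta> i (restrict \<omega> (W 2) c) * ?e (restrict \<omega> (W 2) c)"
          using c by (simp add: wt_sym)
      qed
      ultimately show "vol_weight J \<beta> L x0 (\<lambda>_. h) 2 \<omega> = ?w (restrict \<omega> (W 2))"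
        unfolding vol_weight_eq \<theta>[symmetric] by (simp add: mult.assoc)
    qed
    also have "\<dots> = (\<Sum>\<omega>\<in>cfg (V 1 \<union> W 2). (if restrict \<omega> (V 1) = \<sigma> then ?w (restrict \<omega> (W 2)) else 0))"
    proof -
      have "V 2 = V 1 \<union> W 2" by auto
      then show ?thesis by (intro sum.mono_neutral_cong_left) (auto simp del: V_iff W_iff)
    qed
    also have "\<dots> = (\<Sum>\<zeta>\<in>cfg (V 1). \<Sum>\<eta>\<in>cfg (W 2). if \<zeta> = \<sigma> then ?w \<eta> else 0)"
      by (rule sum_PiE_Un) auto
    also have "\<dots> = (\<Sum>\<zeta>\<in>cfg (V 1). if \<zeta> = \<sigma> then \<Sum>\<eta>\<in>cfg (W 2). ?w \<eta> else 0)"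
      by (rule sum.cong) auto
    also have "\<dots> = (\<Sum>\<eta>\<in>cfg (W 2). ?w \<eta>)" using \<sigma> by simp
    also have "\<dots> = edgew \<theta> (V 1 - {x0}) \<sigma> * (\<Prod>c\<in>W 2. ?F i)"
      unfolding sum_distrib_left[symmetric] rowF_def
      by (subst prod_sum_PiE) auto
    also have "(\<Prod>c\<in>W 2. ?F i) = (?F i ^ 2) ^ 3"
      unfolding W2 by (simp add: card_W power_mult[symmetric] del: W_iff)
    finally have A: "(\<Sum>\<omega> | \<omega> \<in> cfg (V 2) \<and> restrict \<omega> (V 1) = \<sigma>. vol_weight J \<beta> L x0 (\<lambda>_. h) 2 \<omega>)
        = edgew \<theta> (V 1 - {x0}) \<sigma> * (?F i ^ 2) ^ 3" .
    have "(\<Prod>x\<in>W 1. ?e (\<sigma> x)) = (\<Prod>x\<in>W (Suc 0). ?e i)"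
      by (rule prod.cong) (auto simp: \<sigma>_def)
    also have "\<dots> = ?e i ^ 3" by (simp add: card_W del: W_iff)
    finally have B: "vol_weight J \<beta> L x0 (\<lambda>_. h) 1 \<sigma> = edgew \<theta> (V 1 - {x0}) \<sigma> * ?e i ^ 3"
      unfolding vol_weight_eq \<theta>[symmetric] by simp
    have "compatible J \<beta> L x0 (\<lambda>_. h)" using s by (simp add: splitting_gibbs_def)
    from this[unfolded compatible_def, rule_format, of 2 \<sigma>]
    have "(\<Sum>\<omega> | \<omega> \<in> cfg (V 2) \<and> restrict \<omega> (V 1) = \<sigma>. vol_prob J \<beta> L x0 (\<lambda>_. h) 2 \<omega>)
        = vol_prob J \<beta> L x0 (\<lambda>_. h) 1 \<sigma>" using \<sigma> by simp
    then have "edgew \<theta> (V 1 - {x0}) \<sigma> * (?F i ^ 2) ^ 3 / ?Z 2 = edgew \<theta> (V 1 - {x0}) \<sigma> * ?e i ^ 3 / ?Z 1"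
      unfolding vol_prob_def A[symmetric] B[symmetric] sum_divide_distrib .
    then show ?thesis unfolding power_divide
      by (rule ratio_cancel) (rule less_imp_neq[THEN not_sym] edgew_pos[OF \<theta>p] Zp zero_less_power exp_gt_zero)+
  qed
  then have eq: "(?F i ^ 2 / ?e i) ^ 3 = (?F 0 ^ 2 / ?e 0) ^ 3" if "i \<in> spins" for i
    using that by simp
  have "?F i ^ 2 / ?e i = ?F 0 ^ 2 / ?e 0" if "i \<in> spins" for i
    by (rule power_eq_imp_eq_base[OF eq[OF that]]) simp_all
  then have "?F i ^ 2 = ?F 0 ^ 2 / ?e 0 * ?e i" if "i \<in> spins" for i
    using that by (simp add: field_simps)
  then show ?thesis by blast
qed

lemma splitting_iff:
  assumes \<theta>: "\<theta> = exp (J * \<beta>)"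
  shows "splitting_gibbs J \<beta> L x0 (\<lambda>_. h) \<mu> \<longleftrightarrow>
    (\<exists>v\<in>FP \<theta>. (\<exists>c>0. \<forall>i\<in>spins. exp (h i) = c * wvec v i) \<and> \<mu> = TM \<theta> v)"
proof
  assume "\<exists>v\<in>FP \<theta>. (\<exists>c>0. \<forall>i\<in>spins. exp (h i) = c * wvec v i) \<and> \<mu> = TM \<theta> v"
  then obtain v c where v: "v \<in> FP \<theta>" "c > 0" "\<forall>i\<in>spins. exp (h i) = c * wvec v i" "\<mu> = TM \<theta> v" by blast
  have "0 < \<theta>" by (simp add: \<theta>)
  then interpret T: tisgm L x0 \<theta> "wvec v" "rowF \<theta> (wvec v) 2 ^ 2" using v(1) by (rule tisgm_FP)
  show "splitting_gibbs J \<beta> L x0 (\<lambda>_. h) \<mu>"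
    using T.splitting_chain[OF \<theta> v(2)] v(3,4) by (simp add: TM_def)
next
  assume s: "splitting_gibbs J \<beta> L x0 (\<lambda>_. h) \<mu>"
  let ?e = "\<lambda>j. exp (h j)"
  obtain C where C: "\<forall>i\<in>spins. rowF \<theta> ?e i ^ 2 = C * ?e i" using splitting_fixed[OF \<theta> s] by blast
  have \<theta>p: "0 < \<theta>" by (simp add: \<theta>)
  have Fp: "0 < rowF \<theta> ?e i" for i
    unfolding rowF_def by (intro sum_pos) (auto simp: wt_pos \<theta>p)
  define c where "c = ?e 2"
  have cp: "c > 0" by (simp add: c_def)
  define x where "x = sqrt (?e 0 / c)"
  define y where "y = sqrt (?e 1 / c)"
  have xy: "x > 0" "y > 0" "?e 0 = c * x^2" "?e 1 = c * y^2" using cp by (simp_all add: x_def y_def)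
  have ev: "\<forall>i\<in>spins. ?e i = c * wvec (x, y) i"
    using xy unfolding ball_spins by (simp add: wvec_def c_def)
  have F: "rowF \<theta> ?e i = c * rowF \<theta> (wvec (x, y)) i" for i
    unfolding rowF_def sum_distrib_left by (rule sum.cong) (use ev in auto)
  have Fp': "0 < rowF \<theta> (wvec (x, y)) i" for i using Fp[of i] cp unfolding F by (simp add: zero_less_mult_iff)
  have C2: "C * c = rowF \<theta> ?e 2 ^ 2" using C by (simp add: c_def)
  have C0: "C \<noteq> 0" using C2 Fp[of 2] by auto
  have "(rowF \<theta> ?e i / rowF \<theta> ?e 2) ^ 2 = ?e i / c" if "i \<in> spins" for i
    unfolding power_divide C2[symmetric] using C that C0 by simp
  then have "(rowF \<theta> (wvec (x, y)) i / rowF \<theta> (wvec (x, y)) 2) ^ 2 = wvec (x, y) i" if "i \<in> spins" for i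
    using that cp ev unfolding F by simp
  from this[of 0] this[of 1]
  have "rowF \<theta> (wvec (x, y)) 0 / rowF \<theta> (wvec (x, y)) 2 = x" "rowF \<theta> (wvec (x, y)) 1 / rowF \<theta> (wvec (x, y)) 2 = y"
    using xy Fp' by (auto simp: wvec_def power2_eq_iff_nonneg less_imp_le)
  then have "rowF \<theta> (wvec (x, y)) 0 = x * rowF \<theta> (wvec (x, y)) 2" "rowF \<theta> (wvec (x, y)) 1 = y * rowF \<theta> (wvec (x, y)) 2"
    using Fp'[of 2] by (auto simp: field_simps)
  then have FP: "(x, y) \<in> FP \<theta>" using xy by (simp add: FP_def rowF_simps wvec_def)
  interpret T: tisgm L x0 \<theta> "wvec (x, y)" "rowF \<theta> (wvec (x, y)) 2 ^ 2" using \<theta>p FP by (rule tisgm_FP)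
  have "\<mu> = TM \<theta> (x, y)" using T.splitting_chain[OF \<theta> cp] ev s by (simp add: TM_def)
  then show "\<exists>v\<in>FP \<theta>. (\<exists>c>0. \<forall>i\<in>spins. exp (h i) = c * wvec v i) \<and> \<mu> = TM \<theta> v"
    using FP ev cp by blast
qed

lemma exists_field:
  assumes "v \<in> FP \<theta>"
  shows "\<exists>h. h 2 = 0 \<and> v = (sqrt (exp (h 0)), sqrt (exp (h 1))) \<and> (\<forall>i\<in>spins. exp (h i) = wvec v i)"
proof -
  obtain x y where v: "v = (x, y)" "x > 0" "y > 0" using assms by (auto simp: FP_def)
  define h where "h = (\<lambda>i::nat. if i = 0 then ln (x^2) else if i = 1 then ln (y^2) else (0::real))"
  have e: "exp (h 0) = x^2" "exp (h 1) = y^2" "h 2 = 0" using v by (simp_all add: h_def)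
  then have "v = (sqrt (exp (h 0)), sqrt (exp (h 1)))" using v by simp
  moreover have "\<forall>i\<in>spins. exp (h i) = wvec v i" unfolding ball_spins using e v by (simp add: wvec_def)
  ultimately show ?thesis using e by blast
qed

lemma TISGM_set:
  assumes \<theta>: "\<theta> = exp (J * \<beta>)"
  shows "{\<mu>. TISGM J \<beta> L x0 \<mu>} = TM \<theta> ` FP \<theta>"
proof (intro equalityI subsetI)
  fix \<mu> assume "\<mu> \<in> {\<mu>. TISGM J \<beta> L x0 \<mu>}"
  then show "\<mu> \<in> TM \<theta> ` FP \<theta>" unfolding TISGM_def splitting_iff[OF \<theta>] by blast
next
  fix \<mu> assume "\<mu> \<in> TM \<theta> ` FP \<theta>"
  then obtain v where v: "v \<in> FP \<theta>" "\<mu> = TM \<theta> v" by blast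
  obtain h where "\<forall>i\<in>spins. exp (h i) = wvec v i" using exists_field[OF v(1)] by blast
  then have "\<exists>c>0. \<forall>i\<in>spins. exp (h i) = c * wvec v i" by (intro exI[of _ 1]) simp
  then show "\<mu> \<in> {\<mu>. TISGM J \<beta> L x0 \<mu>}" using v unfolding TISGM_def splitting_iff[OF \<theta>] by blast
qed

text \<open>The description fixes the field only on the three spins, so many functions
  \<open>h\<close> satisfy it; they all determine the same measure.\<close>

lemma TISGM_at_eq:
  assumes \<theta>: "\<theta> = exp (J * \<beta>)" and v: "v \<in> FP \<theta>"
  shows "TISGM_at J \<beta> L x0 v = TM \<theta> v"
  unfolding TISGM_at_def
proof (rule the_equality)
  obtain h where h: "h 2 = 0" "v = (sqrt (exp (h 0)), sqrt (exp (h 1)))" "\<forall>i\<in>spins. exp (h i) = wvec v i"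
    using exists_field[OF v] by blast
  then have "\<exists>c>0. \<forall>i\<in>spins. exp (h i) = c * wvec v i" by (intro exI[of _ 1]) simp
  then show "\<exists>h. h 2 = 0 \<and> v = (sqrt (exp (h 0)), sqrt (exp (h 1))) \<and> splitting_gibbs J \<beta> L x0 (\<lambda>_. h) (TM \<theta> v)"
    using h v unfolding splitting_iff[OF \<theta>] by blast
next
  fix \<mu> assume "\<exists>h. h 2 = 0 \<and> v = (sqrt (exp (h 0)), sqrt (exp (h 1))) \<and> splitting_gibbs J \<beta> L x0 (\<lambda>_. h) \<mu>"
  then obtain h where h: "h 2 = 0" "v = (sqrt (exp (h 0)), sqrt (exp (h 1)))" "splitting_gibbs J \<beta> L x0 (\<lambda>_. h) \<mu>" by blast
  then obtain v' c where v': "v' \<in> FP \<theta>" "\<forall>i\<in>spins. exp (h i) = c * wvec v' i" "\<mu> = TM \<theta> v'"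
    unfolding splitting_iff[OF \<theta>] by blast
  obtain x y where xy: "v' = (x, y)" "x > 0" "y > 0" using v'(1) by (auto simp: FP_def)
  have "exp (h 2) = c * wvec v' 2" using v'(2) by simp
  then have "c = 1" using h(1) by (simp add: wvec_def)
  moreover have "exp (h 0) = c * wvec v' 0" "exp (h 1) = c * wvec v' 1" using v'(2) by simp_all
  ultimately have "v = v'" using h(2) xy by (simp add: wvec_def)
  then show "\<mu> = TM \<theta> v" using v'(3) by simp
qed

text \<open>The probability that the root has spin 0 and its three neighbours have spin
  \<open>j\<close> is a factor independent of \<open>j\<close> times the cube of the transition
  probability from 0 to \<open>j\<close>. Ratios to \<open>j = 2\<close> recover the
  weights.\<close>

lemma inj_TM:
  assumes "0 < \<theta>" shows "inj_on (TM \<theta>) (FP \<theta>)"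
proof (rule inj_onI)
  fix v v' assume v: "v \<in> FP \<theta>" "v' \<in> FP \<theta>" and eq: "TM \<theta> v = TM \<theta> v'"
  interpret T: tisgm L x0 \<theta> "wvec v" "rowF \<theta> (wvec v) 2 ^ 2" using assms v(1) by (rule tisgm_FP)
  interpret T': tisgm L x0 \<theta> "wvec v'" "rowF \<theta> (wvec v') 2 ^ 2" using assms v(2) by (rule tisgm_FP)
  let ?t = "\<lambda>j. restrict (\<lambda>u. if u = x0 then 0 else j) (V (Suc 0))"
  have cfg: "?t j \<in> cfg (V (Suc 0))" if "j \<in> spins" for j using that by auto
  have prt: "tree_chain.pr L x0 \<pi> P (Suc 0) (?t j) = \<pi> 0 * P 0 j ^ 3" if "tree_chain L \<pi> P" for j \<pi> P
  proof -
    interpret c: tree_chain L x0 \<pi> P by fact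
    have "(\<Prod>c\<in>W (Suc 0). P (?t j (par c)) (?t j c)) = (\<Prod>c\<in>W (Suc 0). P 0 j)"
    proof (rule prod.cong[OF refl])
      fix c assume "c \<in> W (Suc 0)"
      then have "par c = x0" "c \<noteq> x0" "lev c = Suc 0" by (auto simp: lev_Suc_iff lev_0_iff)
      then show "P (?t j (par c)) (?t j c) = P 0 j" by simp
    qed
    then show ?thesis by (simp add: c.pr_Suc c.pr_0 card_W del: W_iff)
  qed
  have e: "stat \<theta> (wvec v) 0 * tmat \<theta> (wvec v) 0 j ^ 3 = stat \<theta> (wvec v') 0 * tmat \<theta> (wvec v') 0 j ^ 3"
    if j: "j \<in> spins" for j
    using T.chain_measure(2)[OF cfg[OF j]] T'.chain_measure(2)[OF cfg[OF j]] eq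
      prt[OF T.tree_chain_axioms] prt[OF T'.tree_chain_axioms] by (simp add: TM_def)
  have r: "(tmat \<theta> (wvec v) 0 j / tmat \<theta> (wvec v) 0 2) ^ 3 = (tmat \<theta> (wvec v') 0 j / tmat \<theta> (wvec v') 0 2) ^ 3"
    if j: "j \<in> spins" for j
  proof -
    have "tmat \<theta> (wvec v) 0 j ^ 3 / tmat \<theta> (wvec v) 0 2 ^ 3 = tmat \<theta> (wvec v') 0 j ^ 3 / tmat \<theta> (wvec v') 0 2 ^ 3"
    proof -
      let ?a = "stat \<theta> (wvec v) 0" and ?b = "stat \<theta> (wvec v') 0"
      have "?a \<noteq> 0" "?b \<noteq> 0" using T.stat_pos[of 0] T'.stat_pos[of 0] by auto
      then have "tmat \<theta> (wvec v) 0 j ^ 3 / tmat \<theta> (wvec v) 0 2 ^ 3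
            = (?a * tmat \<theta> (wvec v) 0 j ^ 3) / (?a * tmat \<theta> (wvec v) 0 2 ^ 3)"
        and "tmat \<theta> (wvec v') 0 j ^ 3 / tmat \<theta> (wvec v') 0 2 ^ 3
            = (?b * tmat \<theta> (wvec v') 0 j ^ 3) / (?b * tmat \<theta> (wvec v') 0 2 ^ 3)"
        by simp_all
      then show ?thesis unfolding e[OF j] e[OF spins_mem(3)] by simp
    qed
    then show ?thesis by (simp add: power_divide)
  qed
  have "tmat \<theta> (wvec v) 0 j / tmat \<theta> (wvec v) 0 2 = tmat \<theta> (wvec v') 0 j / tmat \<theta> (wvec v') 0 2"
    if j: "j \<in> spins" for j
  proof (rule power_eq_imp_eq_base[OF r[OF j]])
    show "0 \<le> tmat \<theta> (wvec v) 0 j / tmat \<theta> (wvec v) 0 2" "0 \<le> tmat \<theta> (wvec v') 0 j / tmat \<theta> (wvec v') 0 2"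
      using j by (simp_all add: less_imp_le[OF T.trans_pos] less_imp_le[OF T'.trans_pos])
  qed simp
  then have "wt \<theta> 0 j * wvec v j / (wt \<theta> 0 2 * wvec v 2) = wt \<theta> 0 j * wvec v' j / (wt \<theta> 0 2 * wvec v' 2)"
    if j: "j \<in> spins" for j
    using j T.F_pos[of 0] T'.F_pos[of 0] unfolding tmat_def by simp
  from this[of 0] this[of 1] have "wvec v 0 = wvec v' 0" "wvec v 1 = wvec v' 1"
    using assms by (simp_all add: wvec_def[of _ 2] wt_def)
  then show "v = v'" using v by (auto simp: FP_def wvec_def prod_eq_iff)
qed

end

section \<open>Non-extremality: the Kesten--Stigum criterion\<close>

text \<open>Summable first moments of the increments give almost sure convergence and also the
  majorant for dominated convergence: the modulus of \<open>X 0\<close> plus the sum of the moduli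
  of all increments.\<close>

lemma (in prob_space) fast_L1_limit:
  fixes X :: "nat \<Rightarrow> 'a \<Rightarrow> real" and h :: "'a \<Rightarrow> real"
  assumes X: "\<And>n. integrable M (X n)"
    and D: "\<And>n. (\<integral>\<omega>. \<bar>X (Suc n) \<omega> - X n \<omega>\<bar> \<partial>M) \<le> K * q ^ n" and q: "0 \<le> q" "q < 1"
    and h: "h \<in> borel_measurable M" "\<And>\<omega>. \<omega> \<in> space M \<Longrightarrow> \<bar>h \<omega>\<bar> \<le> B"
  shows "(\<lambda>n. \<integral>\<omega>. X n \<omega> * h \<omega> \<partial>M) \<longlonglongrightarrow> (\<integral>\<omega>. lim (\<lambda>n. X n \<omega>) * h \<omega> \<partial>M)"
    and "AE \<omega> in M. convergent (\<lambda>n. X n \<omega>)"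
proof -
  note [measurable] = borel_measurable_integrable[OF X] h(1)
  define d where "d = (\<lambda>n \<omega>. \<bar>X (Suc n) \<omega> - X n \<omega>\<bar>)"
  have d_int: "integrable M (d n)" for n
    unfolding d_def using X by (intro integrable_abs Bochner_Integration.integrable_diff)
  have d_nonneg: "0 \<le> d n \<omega>" for n \<omega> by (simp add: d_def)
  have K: "0 \<le> K"
  proof -
    have "0 \<le> expectation (d 0)" using d_nonneg by (intro integral_nonneg_AE) auto
    moreover have "expectation (d 0) \<le> K * q ^ 0" using D[of 0] unfolding d_def .
    ultimately show ?thesis by simp
  qed
  have geo: "summable (\<lambda>n. K * q ^ n)"
    using q by (intro summable_mult summable_geometric) auto
  have sum_int: "summable (\<lambda>n. \<integral>\<omega>. d n \<omega> \<partial>M)"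
  proof (rule summable_comparison_test'[OF geo])
    show "norm (\<integral>\<omega>. d n \<omega> \<partial>M) \<le> K * q ^ n" for n
    proof -
      have "0 \<le> expectation (d n)" using d_nonneg by (intro integral_nonneg_AE) auto
      then show ?thesis using D[of n] by (simp add: d_def)
    qed
  qed
  have "(\<integral>\<^sup>+\<omega>. (\<Sum>n. ennreal (d n \<omega>)) \<partial>M) = (\<Sum>n. \<integral>\<^sup>+\<omega>. ennreal (d n \<omega>) \<partial>M)"
    unfolding d_def by (rule nn_integral_suminf) measurable
  also have "\<dots> = (\<Sum>n. ennreal (\<integral>\<omega>. d n \<omega> \<partial>M))"
    using d_int d_nonneg by (simp add: nn_integral_eq_integral)
  also have "\<dots> = ennreal (\<Sum>n. \<integral>\<omega>. d n \<omega> \<partial>M)"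
    using sum_int d_nonneg by (intro suminf_ennreal2 integral_nonneg_AE) auto
  finally have fin: "(\<integral>\<^sup>+\<omega>. (\<Sum>n. ennreal (d n \<omega>)) \<partial>M) \<noteq> \<infinity>" by simp
  have "AE \<omega> in M. (\<Sum>n. ennreal (d n \<omega>)) \<noteq> \<infinity>"
    by (rule nn_integral_PInf_AE) (use fin in \<open>auto simp: d_def\<close>)
  then have d_summ: "AE \<omega> in M. summable (\<lambda>n. d n \<omega>)"
    by eventually_elim (auto intro: summable_suminf_not_top d_nonneg)
  have tele: "X n \<omega> = X 0 \<omega> + (\<Sum>i<n. X (Suc i) \<omega> - X i \<omega>)" for n \<omega>
    using sum_lessThan_telescope[of "\<lambda>i. X i \<omega>" n] by simp
  show conv: "AE \<omega> in M. convergent (\<lambda>n. X n \<omega>)"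
    using d_summ
  proof eventually_elim
    case (elim \<omega>)
    then have "summable (\<lambda>i. X (Suc i) \<omega> - X i \<omega>)"
      unfolding d_def by (rule summable_rabs_cancel)
    then have "(\<lambda>n. X 0 \<omega> + (\<Sum>i<n. X (Suc i) \<omega> - X i \<omega>)) \<longlonglongrightarrow> X 0 \<omega> + suminf (\<lambda>i. X (Suc i) \<omega> - X i \<omega>)"
      by (intro tendsto_add tendsto_const summable_LIMSEQ)
    then show ?case unfolding tele[symmetric] by (auto simp: convergent_def)
  qed
  have S_int: "integrable M (\<lambda>\<omega>. \<Sum>n. d n \<omega>)"
    by (rule integrable_suminf[OF d_int]) (use d_summ sum_int d_nonneg in \<open>auto simp: d_def\<close>)
  define w where "w = (\<lambda>\<omega>. B * (\<bar>X 0 \<omega>\<bar> + (\<Sum>n. d n \<omega>)))"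
  have w: "integrable M w"
    unfolding w_def using S_int X by (intro integrable_mult_right Bochner_Integration.integrable_add integrable_abs)
  show "(\<lambda>n. \<integral>\<omega>. X n \<omega> * h \<omega> \<partial>M) \<longlonglongrightarrow> (\<integral>\<omega>. lim (\<lambda>n. X n \<omega>) * h \<omega> \<partial>M)"
  proof (rule integral_dominated_convergence[OF _ _ w])
    show "(\<lambda>\<omega>. lim (\<lambda>n. X n \<omega>) * h \<omega>) \<in> borel_measurable M"
      by (intro borel_measurable_times borel_measurable_lim_metric) measurable
    show "(\<lambda>\<omega>. X n \<omega> * h \<omega>) \<in> borel_measurable M" for n by measurable
    show "AE \<omega> in M. (\<lambda>n. X n \<omega> * h \<omega>) \<longlonglongrightarrow> lim (\<lambda>n. X n \<omega>) * h \<omega>"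
      using conv by eventually_elim (intro tendsto_mult tendsto_const, simp add: convergent_LIMSEQ_iff)
    show "AE \<omega> in M. norm (X n \<omega> * h \<omega>) \<le> w \<omega>" for n
      using d_summ AE_space
    proof eventually_elim
      case (elim \<omega>)
      have "\<bar>X n \<omega>\<bar> \<le> \<bar>X 0 \<omega>\<bar> + (\<Sum>i<n. d i \<omega>)"
        unfolding tele[of n \<omega>] d_def by (intro order_trans[OF abs_triangle_ineq] add_left_mono sum_abs)
      also have "(\<Sum>i<n. d i \<omega>) \<le> (\<Sum>i. d i \<omega>)"
        using elim d_nonneg by (intro sum_le_suminf) auto
      finally have "\<bar>X n \<omega>\<bar> \<le> \<bar>X 0 \<omega>\<bar> + (\<Sum>i. d i \<omega>)" by simp
      then have "\<bar>X n \<omega>\<bar> * \<bar>h \<omega>\<bar> \<le> (\<bar>X 0 \<omega>\<bar> + (\<Sum>i. d i \<omega>)) * B"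
        using h(2)[OF elim(2)] by (intro mult_mono) auto
      then show ?case by (simp add: w_def abs_mult mult.commute)
    qed
  qed
qed

text \<open>Off one null set the truth of Y \<omega> \<le> c is the same for all \<omega>,
  simultaneously for every rational c; two different values of \<open>Y\<close> would be separated
  by a rational.\<close>

lemma (in prob_space) AE_const_of_zero_one:
  fixes Y :: "'a \<Rightarrow> real"
  assumes Y: "Y \<in> borel_measurable M"
    and zo: "\<And>c. prob {\<omega> \<in> space M. Y \<omega> \<le> c} = 0 \<or> prob {\<omega> \<in> space M. Y \<omega> \<le> c} = 1"
  shows "\<exists>c. AE \<omega> in M. Y \<omega> = c"
proof -
  define S where "S = {c \<in> \<rat>. prob {\<omega> \<in> space M. Y \<omega> \<le> c} = 1}"
  have ev: "{\<omega> \<in> space M. Y \<omega> \<le> c} \<in> events" for c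
    using Y by measurable
  have "AE \<omega> in M. Y \<omega> \<le> c \<longleftrightarrow> c \<in> S" if "c \<in> \<rat>" for c
  proof (cases "c \<in> S")
    case True
    then have "AE \<omega> in M. \<omega> \<in> {\<omega> \<in> space M. Y \<omega> \<le> c}"
      using ev by (subst prob_eq_1[symmetric]) (auto simp: S_def)
    then show ?thesis by (rule AE_mp) (rule AE_I2, use True in auto)
  next
    case False
    then have "prob {\<omega> \<in> space M. Y \<omega> \<le> c} = 0" using zo[of c] that by (auto simp: S_def)
    then have "AE \<omega> in M. \<omega> \<notin> {\<omega> \<in> space M. Y \<omega> \<le> c}"
      using ev prob_eq_0 by blast
    then show ?thesis by (rule AE_mp) (rule AE_I2, use False in auto)
  qed
  then have "AE \<omega> in M. \<forall>c\<in>\<rat>. Y \<omega> \<le> c \<longleftrightarrow> c \<in> S"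
    by (subst AE_ball_countable) (auto simp: countable_rat)
  then obtain N where N: "N \<in> null_sets M" "{\<omega> \<in> space M. \<not> (\<forall>c\<in>\<rat>. Y \<omega> \<le> c \<longleftrightarrow> c \<in> S)} \<subseteq> N"
    unfolding eventually_ae_filter by blast
  have "space M - N \<noteq> {}"
  proof
    assume "space M - N = {}"
    then have "space M = N" using N(1) sets.sets_into_space by blast
    then show False using N(1) emeasure_space_1 by auto
  qed
  then obtain \<omega>0 where w0: "\<omega>0 \<in> space M - N" by blast
  have "Y \<omega> = Y \<omega>0" if w: "\<omega> \<in> space M - N" for \<omega>
  proof (rule ccontr)
    assume ne: "Y \<omega> \<noteq> Y \<omega>0"
    have g: "\<forall>c\<in>\<rat>. Y \<omega> \<le> c \<longleftrightarrow> c \<in> S" "\<forall>c\<in>\<rat>. Y \<omega>0 \<le> c \<longleftrightarrow> c \<in> S"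
      using w w0 N(2) by blast+
    have "min (Y \<omega>) (Y \<omega>0) < max (Y \<omega>) (Y \<omega>0)" using ne by auto
    then obtain c where c: "c \<in> \<rat>" "min (Y \<omega>) (Y \<omega>0) < c" "c < max (Y \<omega>) (Y \<omega>0)"
      using Rats_dense_in_real by blast
    then have "Y \<omega> \<le> c \<longleftrightarrow> Y \<omega>0 \<le> c" using g by blast
    then show False using c by (auto simp: min_def max_def split: if_splits)
  qed
  then have "AE \<omega> in M. Y \<omega> = Y \<omega>0"
    using N(1) by (intro AE_I'[of N]) auto
  then show ?thesis by blast
qed

section \<open>Tail events and the decomposition of Gibbs measures\<close>

context cayley2
begin

text \<open>Invariance is pointwise and not merely almost sure, so that it can be used inside the
  kernel for each single \<omega>.\<close>

definition tail_event :: "('v \<Rightarrow> nat) set \<Rightarrow> bool" where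
  "tail_event B \<longleftrightarrow> B \<in> sets config_space \<and>
     (\<forall>\<Lambda> \<omega> \<zeta>. finite \<Lambda> \<longrightarrow> \<omega> \<in> space config_space \<longrightarrow> \<zeta> \<in> cfg \<Lambda> \<longrightarrow> (override_on \<omega> \<zeta> \<Lambda> \<in> B \<longleftrightarrow> \<omega> \<in> B))"

text \<open>The density of the conditioned measure depends on the tail only, so by properness it may
  be moved into the kernel.\<close>

lemma gibbs_conditioned:
  assumes \<theta>: "\<theta> = exp (J * \<beta>)" and g: "gibbs_measure J \<beta> L \<mu>" and B: "tail_event B" "measure \<mu> B > 0"
  shows "gibbs_measure J \<beta> L (uniform_measure \<mu> B)"
  unfolding gibbs_measure_iff[OF \<theta>]
proof (intro conjI allI impI)
  have c: "config_prob \<mu>" using g by (simp add: gibbs_measure_iff[OF \<theta>])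
  interpret config_prob \<mu> by (rule c)
  have B': "B \<in> sets config_space" using B(1) by (simp add: tail_event_def)
  have [measurable]: "B \<in> events" using B' by simp
  have em: "emeasure \<mu> B = ennreal (prob B)" by (simp add: emeasure_eq_measure)
  have "prob_space (uniform_measure \<mu> B)"
    using B(2) by (intro prob_space_uniform_measure) (auto simp: em)
  then show "config_prob (uniform_measure \<mu> B)"
    by (simp add: config_prob_def config_prob_axioms_def)
  fix \<Lambda> :: "'v set" and A assume \<Lambda>: "finite \<Lambda>" and A: "A \<in> sets (config_space :: ('v \<Rightarrow> nat) measure)"
  have [measurable]: "(\<lambda>\<omega>. kern J \<beta> \<Lambda> \<omega> A) \<in> borel_measurable \<mu>"
    using kern_measurable[OF \<theta> \<Lambda> A] by simp
  have "(\<integral>\<omega>. kern J \<beta> \<Lambda> \<omega> A \<partial>uniform_measure \<mu> B) = (\<integral>\<omega>. indicator B \<omega> / prob B * kern J \<beta> \<Lambda> \<omega> A \<partial>\<mu>)"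
  proof -
    have "uniform_measure \<mu> B = density \<mu> (\<lambda>\<omega>. ennreal (indicator B \<omega> / prob B))"
      unfolding uniform_measure_def em
      using B(2) by (intro density_cong) (auto simp: B' divide_ennreal[symmetric] ennreal_indicator[symmetric] simp del: ennreal_indicator)
    then show ?thesis using B' B(2) by (simp add: integral_density)
  qed
  also have "\<dots> = (\<integral>\<omega>. kern J \<beta> \<Lambda> \<omega> (A \<inter> B) \<partial>\<mu>) / prob B"
  proof -
    have "(\<integral>\<omega>. indicator B \<omega> / prob B * kern J \<beta> \<Lambda> \<omega> A \<partial>\<mu>) = (\<integral>\<omega>. kern J \<beta> \<Lambda> \<omega> (A \<inter> B) / prob B \<partial>\<mu>)"
    proof (rule Bochner_Integration.integral_cong[OF refl])
      fix \<omega> assume "\<omega> \<in> space \<mu>"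
      then have "kern J \<beta> \<Lambda> \<omega> (A \<inter> B) = kern J \<beta> \<Lambda> \<omega> A * indicator B \<omega>"
        using B(1) \<Lambda> by (intro kern_Int[OF \<theta> \<Lambda>]) (auto simp: tail_event_def)
      then show "indicator B \<omega> / prob B * kern J \<beta> \<Lambda> \<omega> A = kern J \<beta> \<Lambda> \<omega> (A \<inter> B) / prob B" by simp
    qed
    then show ?thesis by simp
  qed
  also have "\<dots> = prob (A \<inter> B) / prob B"
    using g \<Lambda> A B' by (simp add: gibbs_measure_iff[OF \<theta>] sets.Int)
  also have "\<dots> = measure (uniform_measure \<mu> B) A"
    using A B' B(2) by (subst measure_uniform_measure) (auto simp: em Int_commute)
  finally show "measure (uniform_measure \<mu> B) A = (\<integral>\<omega>. kern J \<beta> \<Lambda> \<omega> A \<partial>uniform_measure \<mu> B)" ..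
qed

lemma tail_event_Compl:
  assumes "tail_event B" shows "tail_event (space config_space - B)"
  using assms unfolding tail_event_def
  by (auto simp: override_space)

text \<open>The measure is the mixture of its conditionings on \<open>B\<close> and on the
  complement, and these two give \<open>B\<close> different probabilities.\<close>

lemma non_extremeI:
  assumes \<theta>: "\<theta> = exp (J * \<beta>)" and g: "gibbs_measure J \<beta> L \<mu>"
    and B: "tail_event B" "0 < measure \<mu> B" "measure \<mu> B < 1"
  shows "non_extreme_gibbs J \<beta> L \<mu>"
proof -
  have c: "config_prob \<mu>" using g by (simp add: gibbs_measure_iff[OF \<theta>])
  interpret config_prob \<mu> by (rule c)
  have B': "B \<in> sets config_space" using B(1) by (simp add: tail_event_def)
  let ?B = "space config_space - B"
  have pc: "prob ?B = 1 - prob B" using prob_compl[of B] B' by simp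
  let ?\<nu>1 = "uniform_measure \<mu> B" and ?\<nu>2 = "uniform_measure \<mu> ?B"
  have m: "measure (uniform_measure \<mu> D) A = prob (D \<inter> A) / prob D"
    if "D \<in> sets config_space" "A \<in> sets config_space" "prob D > 0" for D A
    using that by (subst measure_uniform_measure) (auto simp: emeasure_eq_measure)
  have "gibbs_measure J \<beta> L ?\<nu>1" by (rule gibbs_conditioned[OF \<theta> g B(1,2)])
  moreover have "gibbs_measure J \<beta> L ?\<nu>2"
    by (rule gibbs_conditioned[OF \<theta> g tail_event_Compl[OF B(1)]]) (use B(3) pc in simp)
  moreover have "prob A = prob B * measure ?\<nu>1 A + (1 - prob B) * measure ?\<nu>2 A"
    if A: "A \<in> sets config_space" for A
  proof -
    have "prob A = prob (B \<inter> A) + prob (?B \<inter> A)"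
    proof -
      have "A = (B \<inter> A) \<union> (?B \<inter> A)" using sets.sets_into_space[OF A] by auto
      then show ?thesis using finite_measure_Union[of "B \<inter> A" "?B \<inter> A"] A B' by auto
    qed
    then show ?thesis using m[of B A] m[of ?B A] A B' B pc by (simp add: sets.compl_sets)
  qed
  moreover have "?\<nu>1 \<noteq> ?\<nu>2"
  proof
    assume "?\<nu>1 = ?\<nu>2"
    then have "measure ?\<nu>1 B = measure ?\<nu>2 B" by simp
    then show False using m[of B B] m[of ?B B] B' B pc by (simp add: Diff_Int_distrib2)
  qed
  ultimately have "\<not> extreme_gibbs J \<beta> L \<mu>"
    unfolding extreme_gibbs_def using B(2,3) by blast
  then show ?thesis using g by (simp add: non_extreme_gibbs_def)
qed

end

section \<open>The martingale of an eigenfunction\<close>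

context cayley2
begin

lemma sum_W_Suc: "(\<Sum>c\<in>W (Suc n). g c) = (\<Sum>v\<in>W n. \<Sum>c\<in>ch v. g c)"
  for g :: "'v \<Rightarrow> real"
  unfolding W_Suc by (rule sum.UNION_disjoint) auto

text \<open>The parents run over spheres off the root, so each is counted exactly twice.\<close>

lemma sum_par: "(\<Sum>c\<in>W (Suc (Suc n)). g (par c)) = 2 * (\<Sum>v\<in>W (Suc n). g v)"
  for g :: "'v \<Rightarrow> real"
proof -
  have "(\<Sum>c\<in>W (Suc (Suc n)). g (par c)) = (\<Sum>v\<in>W (Suc n). \<Sum>c\<in>ch v. g (par c))"
    by (rule sum_W_Suc)
  also have "\<dots> = (\<Sum>v\<in>W (Suc n). 2 * g v)"
  proof (rule sum.cong[OF refl])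
    fix v assume "v \<in> W (Suc n)"
    then have "v \<noteq> x0" by auto
    have "(\<Sum>c\<in>ch v. g (par c)) = (\<Sum>c\<in>ch v. g v)" by (rule sum.cong) auto
    then show "(\<Sum>c\<in>ch v. g (par c)) = 2 * g v" using \<open>v \<noteq> x0\<close> by (simp add: card_ch)
  qed
  finally show ?thesis by (simp add: sum_distrib_left)
qed

end

context tisgm
begin

context
  fixes f :: "nat \<Rightarrow> real" and ev :: real
  assumes eig: "\<And>i. i \<in> spins \<Longrightarrow> (\<Sum>j\<in>spins. tmat \<theta> e i j * f j) = ev * f i"
begin

text \<open>The martingale difference carried by the vertex \<open>c\<close>: by the eigenvalue
  equation its mean given the parent's spin is zero.\<close>

definition X :: "'v \<Rightarrow> ('v \<Rightarrow> nat) \<Rightarrow> real" where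
  "X c \<omega> = f (\<omega> c) - ev * f (\<omega> (par c))"

abbreviation Ex :: "nat \<Rightarrow> (('v \<Rightarrow> nat) \<Rightarrow> real) \<Rightarrow> real" where
  "Ex n g \<equiv> \<Sum>\<tau>\<in>cfg (V n). pr n \<tau> * g \<tau>"

text \<open>Given the ball, the factors over the sphere are independent with mean zero. With
  \<open>A = 1\<close> and two vertices this is orthogonality; with one vertex and \<open>A\<close>
  the value of \<open>f\<close> at the root it says that the increments are uncorrelated with the
  root.\<close>

lemma Ex_X_zero:
  assumes S: "S \<subseteq> W (Suc n)" "S \<noteq> {}"
  shows "Ex (Suc n) (\<lambda>\<tau>. A (restrict \<tau> (V n)) * (\<Prod>c\<in>S. X c \<tau>)) = 0"
proof -
  let ?W = "W (Suc n)"
  let ?g = "\<lambda>\<zeta> \<eta>. A \<zeta> * (\<Prod>c\<in>S. f (\<eta> c) - ev * f (\<zeta> (par c)))"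
  have "(\<Prod>c\<in>S. X c \<tau>) = (\<Prod>c\<in>S. f (restrict \<tau> ?W c) - ev * f (restrict \<tau> (V n) (par c)))" for \<tau>
  proof (rule prod.cong[OF refl])
    fix c assume "c \<in> S"
    then have "c \<in> ?W" "par c \<in> V n" using S(1) by (auto simp: lev_Suc_iff)
    then show "X c \<tau> = f (restrict \<tau> ?W c) - ev * f (restrict \<tau> (V n) (par c))"
      unfolding X_def restrict_apply by simp
  qed
  then have "Ex (Suc n) (\<lambda>\<tau>. A (restrict \<tau> (V n)) * (\<Prod>c\<in>S. X c \<tau>))
      = Ex (Suc n) (\<lambda>\<tau>. ?g (restrict \<tau> (V n)) (restrict \<tau> ?W))" by (simp only:)
  also have "\<dots> = (\<Sum>\<zeta>\<in>cfg (V n). pr n \<zeta> * (\<Sum>\<eta>\<in>cfg ?W. (\<Prod>c\<in>?W. tmat \<theta> e (\<zeta> (par c)) (\<eta> c)) * ?g \<zeta> \<eta>))"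
    by (rule sum_pr_Suc)
  also have "\<dots> = (\<Sum>\<zeta>\<in>cfg (V n). 0)"
  proof (rule sum.cong[OF refl])
    fix \<zeta> assume \<zeta>: "\<zeta> \<in> cfg (V n)"
    let ?y = "\<lambda>c j. if c \<in> S then f j - ev * f (\<zeta> (par c)) else 1"
    have "(\<Sum>\<eta>\<in>cfg ?W. (\<Prod>c\<in>?W. tmat \<theta> e (\<zeta> (par c)) (\<eta> c)) * ?g \<zeta> \<eta>)
        = A \<zeta> * (\<Sum>\<eta>\<in>cfg ?W. \<Prod>c\<in>?W. tmat \<theta> e (\<zeta> (par c)) (\<eta> c) * ?y c (\<eta> c))"
    proof -
      have "(\<Prod>c\<in>S. f (\<eta> c) - ev * f (\<zeta> (par c))) = (\<Prod>c\<in>?W. ?y c (\<eta> c))" for \<eta>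
        using S(1) by (intro prod.mono_neutral_cong_left) auto
      then show ?thesis unfolding sum_distrib_left prod.distrib by (simp only: mult_ac)
    qed
    also have "(\<Sum>\<eta>\<in>cfg ?W. \<Prod>c\<in>?W. tmat \<theta> e (\<zeta> (par c)) (\<eta> c) * ?y c (\<eta> c))
        = (\<Prod>c\<in>?W. \<Sum>j\<in>spins. tmat \<theta> e (\<zeta> (par c)) j * ?y c j)"
      by (rule prod_sum_PiE[symmetric]) auto
    also have "\<dots> = 0"
    proof -
      obtain c where c: "c \<in> S" using S(2) by blast
      have sp: "\<zeta> (par c) \<in> spins" using c S(1) \<zeta> by (intro cfg_D[OF \<zeta>]) (auto simp: lev_Suc_iff)
      have "(\<Sum>j\<in>spins. tmat \<theta> e (\<zeta> (par c)) j * ?y c j)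
          = (\<Sum>j\<in>spins. tmat \<theta> e (\<zeta> (par c)) j * f j) - (\<Sum>j\<in>spins. tmat \<theta> e (\<zeta> (par c)) j) * (ev * f (\<zeta> (par c)))"
        using c by (simp add: right_diff_distrib sum_subtractf sum_distrib_right)
      also have "\<dots> = 0" by (simp add: eig[OF sp] trans_sum)
      finally have "(\<Sum>j\<in>spins. tmat \<theta> e (\<zeta> (par c)) j * ?y c j) = 0" .
      then have "\<exists>c\<in>?W. (\<Sum>j\<in>spins. tmat \<theta> e (\<zeta> (par c)) j * ?y c j) = 0"
        by (rule bexI) (use c S(1) in blast)
      then show ?thesis by (rule prod_zero[OF finite_W])
    qed
    finally show "pr n \<zeta> * (\<Sum>\<eta>\<in>cfg ?W. (\<Prod>c\<in>?W. tmat \<theta> e (\<zeta> (par c)) (\<eta> c)) * ?g \<zeta> \<eta>) = 0" by simp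
  qed
  finally show ?thesis by simp
qed

text \<open>One step doubles the number of vertices and multiplies the mean of \<open>f\<close> by
  \<open>ev\<close>, hence the normalisation. Index \<open>n\<close> belongs to sphere
  \<open>Suc n\<close>, so that all parents involved have two children.\<close>

definition Mf :: "nat \<Rightarrow> ('v \<Rightarrow> nat) \<Rightarrow> real" where
  "Mf n \<omega> = (\<Sum>v\<in>W (Suc n). f (\<omega> v)) / (2 * ev) ^ Suc n"

lemma Mf_diff:
  assumes "ev \<noteq> 0"
  shows "Mf (Suc n) \<omega> - Mf n \<omega> = (\<Sum>c\<in>W (Suc (Suc n)). X c \<omega>) / (2 * ev) ^ Suc (Suc n)"
proof -
  have "(\<Sum>c\<in>W (Suc (Suc n)). X c \<omega>)
      = (\<Sum>c\<in>W (Suc (Suc n)). f (\<omega> c)) - ev * (\<Sum>c\<in>W (Suc (Suc n)). f (\<omega> (par c)))"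
    unfolding X_def by (simp add: sum_subtractf sum_distrib_left)
  also have "\<dots> = (\<Sum>c\<in>W (Suc (Suc n)). f (\<omega> c)) - 2 * ev * (\<Sum>v\<in>W (Suc n). f (\<omega> v))"
    by (simp add: sum_par[of "\<lambda>v. f (\<omega> v)"] del: W_iff)
  finally show ?thesis unfolding Mf_def using assms by (simp add: diff_divide_distrib del: W_iff)
qed

text \<open>Differences at distinct vertices are uncorrelated, so only the diagonal terms remain,
  one for each of the 3 * 2^n vertices.\<close>

lemma Ex_sum_X_sq:
  assumes B: "\<And>i j. i \<in> spins \<Longrightarrow> j \<in> spins \<Longrightarrow> \<bar>f j - ev * f i\<bar> \<le> B"
  shows "Ex (Suc n) (\<lambda>\<tau>. (\<Sum>c\<in>W (Suc n). X c \<tau>)^2) \<le> 3 * 2 ^ n * B^2"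
proof -
  let ?W = "W (Suc n)"
  have "Ex (Suc n) (\<lambda>\<tau>. (\<Sum>c\<in>?W. X c \<tau>)^2) = (\<Sum>c\<in>?W. \<Sum>d\<in>?W. Ex (Suc n) (\<lambda>\<tau>. X c \<tau> * X d \<tau>))"
  proof -
    have "Ex (Suc n) (\<lambda>\<tau>. (\<Sum>c\<in>?W. X c \<tau>)^2)
        = (\<Sum>\<tau>\<in>cfg (V (Suc n)). \<Sum>c\<in>?W. \<Sum>d\<in>?W. pr (Suc n) \<tau> * (X c \<tau> * X d \<tau>))"
      unfolding power2_eq_square sum_product by (simp only: sum_distrib_left)
    also have "\<dots> = (\<Sum>c\<in>?W. \<Sum>\<tau>\<in>cfg (V (Suc n)). \<Sum>d\<in>?W. pr (Suc n) \<tau> * (X c \<tau> * X d \<tau>))"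
      by (rule sum.swap)
    also have "\<dots> = (\<Sum>c\<in>?W. \<Sum>d\<in>?W. Ex (Suc n) (\<lambda>\<tau>. X c \<tau> * X d \<tau>))"
      by (intro sum.cong refl sum.swap)
    finally show ?thesis .
  qed
  also have "\<dots> = (\<Sum>c\<in>?W. Ex (Suc n) (\<lambda>\<tau>. X c \<tau> * X c \<tau>))"
  proof (rule sum.cong[OF refl])
    fix c assume c: "c \<in> ?W"
    have "(\<Sum>d\<in>?W. Ex (Suc n) (\<lambda>\<tau>. X c \<tau> * X d \<tau>))
        = (\<Sum>d\<in>?W. if d = c then Ex (Suc n) (\<lambda>\<tau>. X c \<tau> * X c \<tau>) else 0)"
    proof (rule sum.cong[OF refl])
      fix d assume d: "d \<in> ?W"
      show "Ex (Suc n) (\<lambda>\<tau>. X c \<tau> * X d \<tau>) = (if d = c then Ex (Suc n) (\<lambda>\<tau>. X c \<tau> * X c \<tau>) else 0)"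
      proof (cases "d = c")
        case False
        then show ?thesis using Ex_X_zero[of "{c, d}" n "\<lambda>_. 1"] c d by simp
      qed simp
    qed
    then show "(\<Sum>d\<in>?W. Ex (Suc n) (\<lambda>\<tau>. X c \<tau> * X d \<tau>)) = Ex (Suc n) (\<lambda>\<tau>. X c \<tau> * X c \<tau>)"
      using c by (simp del: W_iff)
  qed
  also have "\<dots> \<le> (\<Sum>c\<in>?W. B^2)"
  proof (rule sum_mono)
    fix c assume c: "c \<in> ?W"
    have "Ex (Suc n) (\<lambda>\<tau>. X c \<tau> * X c \<tau>) \<le> Ex (Suc n) (\<lambda>\<tau>. B^2)"
    proof (rule sum_mono)
      fix \<tau> assume t: "\<tau> \<in> cfg (V (Suc n))"
      have "\<bar>X c \<tau>\<bar> \<le> B" unfolding X_def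
        using c par_W[of c n] by (intro B cfg_D[OF t]) auto
      then have "X c \<tau> * X c \<tau> \<le> B^2" using power_mono[of "\<bar>X c \<tau>\<bar>" B 2] by (simp add: power2_eq_square)
      then show "pr (Suc n) \<tau> * (X c \<tau> * X c \<tau>) \<le> pr (Suc n) \<tau> * B^2"
        using pr_pos[OF t] by (intro mult_left_mono) auto
    qed
    also have "\<dots> = B^2" by (simp add: sum_distrib_right[symmetric] sum_pr)
    finally show "Ex (Suc n) (\<lambda>\<tau>. X c \<tau> * X c \<tau>) \<le> B^2" .
  qed
  also have "\<dots> = 3 * 2 ^ n * B^2" by (simp add: card_W del: W_iff)
  finally show ?thesis .
qed

text \<open>The second moment of the increment is of order q^(2n) with q^2 = 1 / (2 ev^2). The
  inequality |x| \<le> s/2 + x^2/(2s) with s = q^n converts this into a first moment of order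
  q^n.\<close>

lemma Ex_abs_Mf_diff:
  assumes l: "1 < 2 * ev^2"
    and B: "\<And>i j. i \<in> spins \<Longrightarrow> j \<in> spins \<Longrightarrow> \<bar>f j - ev * f i\<bar> \<le> B"
  shows "Ex (Suc (Suc n)) (\<lambda>\<tau>. \<bar>Mf (Suc n) \<tau> - Mf n \<tau>\<bar>) \<le> (1/2 + 3 * B^2 / 4) * sqrt (1 / (2 * ev^2)) ^ n"
proof -
  define q where "q = sqrt (1 / (2 * ev^2))"
  have l0: "ev \<noteq> 0" using l by auto
  have q: "0 < q" "q \<le> 1" "q^2 = 1 / (2 * ev^2)" using l l0 by (auto simp: q_def)
  let ?N = "Suc (Suc n)" and ?Y = "\<lambda>\<tau>. \<Sum>c\<in>W (Suc (Suc n)). X c \<tau>"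
  let ?l = "(2 * ev) ^ Suc (Suc n)"
  have "Ex ?N (\<lambda>\<tau>. \<bar>Mf (Suc n) \<tau> - Mf n \<tau>\<bar>) \<le> Ex ?N (\<lambda>\<tau>. q^n / 2 + (?Y \<tau>)^2 * (1 / (?l^2 * (2 * q^n))))"
  proof (rule sum_mono)
    fix \<tau> assume t: "\<tau> \<in> cfg (V ?N)"
    have "\<bar>x\<bar> \<le> s / 2 + x^2 / (2 * s)" if "s > 0" for x s :: real
    proof -
      have "2 * \<bar>x\<bar> * s \<le> s^2 + x^2" using zero_le_power2[of "\<bar>x\<bar> - s"] by (simp add: power2_diff)
      then show ?thesis using that by (simp add: field_simps power2_eq_square)
    qed
    from this[of "q^n" "Mf (Suc n) \<tau> - Mf n \<tau>"]
    have "\<bar>Mf (Suc n) \<tau> - Mf n \<tau>\<bar> \<le> q^n / 2 + (?Y \<tau>)^2 * (1 / (?l^2 * (2 * q^n)))"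
      using q(1) unfolding Mf_diff[OF l0] by (simp add: power_divide)
    then show "pr ?N \<tau> * \<bar>Mf (Suc n) \<tau> - Mf n \<tau>\<bar> \<le> pr ?N \<tau> * (q^n / 2 + (?Y \<tau>)^2 * (1 / (?l^2 * (2 * q^n))))"
      using pr_pos[OF t] by (intro mult_left_mono) auto
  qed
  also have "\<dots> = q^n / 2 + Ex ?N (\<lambda>\<tau>. (?Y \<tau>)^2) * (1 / (?l^2 * (2 * q^n)))"
    unfolding distrib_left sum.distrib sum_distrib_right mult.assoc[symmetric]
    unfolding sum_distrib_right[symmetric] sum_pr by simp
  also have "\<dots> \<le> q^n / 2 + (3 * 2 ^ Suc n * B^2) * (1 / (?l^2 * (2 * q^n)))"
    using Ex_sum_X_sq[OF B, of "Suc n"] q(1) by (intro add_left_mono mult_right_mono) auto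
  also have "(3 * 2 ^ Suc n * B^2) * (1 / (?l^2 * (2 * q^n))) = 3 * B^2 / 4 * (q^2)^(Suc (Suc n)) / q^n"
  proof -
    have "?l^2 = (4 * ev^2) ^ Suc (Suc n)" 
    proof -
      have "?l^2 = ((2 * ev)^2) ^ Suc (Suc n)" by (simp only: power_mult[symmetric] mult.commute)
      then show ?thesis by (simp add: power_mult_distrib)
    qed
    moreover have "(q^2)^(Suc (Suc n)) = 2 ^ Suc (Suc n) / (4 * ev^2) ^ Suc (Suc n)"
    proof -
      have "1 / (2 * ev^2) = 2 / (4 * ev^2)" using l0 by (simp add: field_simps)
      then show ?thesis unfolding q(3) by (simp only: power_divide)
    qed
    ultimately show ?thesis by (simp add: mult_ac)
  qed
  also have "\<dots> = 3 * B^2 / 4 * (q^n * q^4)"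
    using q(1) by (simp add: power_mult[symmetric] field_simps power_add[symmetric] eval_nat_numeral)
  also have "\<dots> \<le> 3 * B^2 / 4 * (q^n * 1)"
    using q by (intro mult_left_mono power_le_one) auto
  finally show ?thesis unfolding q_def[symmetric] by (simp add: algebra_simps)
qed

lemma Ex_chain:
  assumes "\<And>\<omega>. g (restrict \<omega> (V n)) = g \<omega>"
  shows "integrable chain_measure g" "(\<integral>\<omega>. g \<omega> \<partial>chain_measure) = Ex n g"
  using chain_integral[of g n] C.fin_dep_integral(1)[of "V n" g] by (simp_all only: assms finite_V)

lemma Mf_restrict: "Suc n \<le> m \<Longrightarrow> Mf n (restrict \<omega> (V m)) = Mf n \<omega>"
  unfolding Mf_def by (intro arg_cong2[where f = "(/)"] sum.cong refl) auto

lemma stat_eig_zero: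
  assumes "ev \<noteq> 1" shows "(\<Sum>i\<in>spins. stat \<theta> e i * f i) = 0"
proof -
  have "ev * (\<Sum>i\<in>spins. stat \<theta> e i * f i) = (\<Sum>i\<in>spins. stat \<theta> e i * (\<Sum>j\<in>spins. tmat \<theta> e i j * f j))"
    unfolding sum_distrib_left[of ev] by (rule sum.cong) (simp_all add: eig)
  also have "\<dots> = (\<Sum>j\<in>spins. (\<Sum>i\<in>spins. stat \<theta> e i * tmat \<theta> e i j) * f j)"
    unfolding sum_distrib_left sum_distrib_right by (subst sum.swap) (simp add: mult_ac)
  also have "\<dots> = (\<Sum>j\<in>spins. stat \<theta> e j * f j)" by (rule sum.cong) (auto simp: stationary)
  finally show ?thesis using assms by simp
qed

text \<open>The limit of the martingale keeps a positive correlation with \<open>f\<close> at the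
  root, whose mean is zero; hence the limit is not constant and one of its sublevel sets is a tail
  event of intermediate probability.\<close>

lemma Kesten_Stigum:
  assumes \<theta>: "\<theta> = exp (J * \<beta>)"
    and f0: "\<exists>i\<in>spins. f i \<noteq> 0" and l1: "ev \<noteq> 1" and l: "1 < 2 * ev^2"
  shows "non_extreme_gibbs J \<beta> L chain_measure"
proof -
  let ?\<mu> = chain_measure
  let ?h = "\<lambda>\<omega>. f (\<omega> x0)"
  let ?Y = "\<lambda>\<omega>. lim (\<lambda>n. Mf n \<omega>)"
  have l0: "ev \<noteq> 0" using l by auto
  define B where "B = Max ((\<lambda>(i, j). \<bar>f j - ev * f i\<bar>) ` (spins \<times> spins))"
  have B: "\<bar>f j - ev * f i\<bar> \<le> B" if "i \<in> spins" "j \<in> spins" for i j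
    unfolding B_def using that by (intro Max_ge) auto
  define q where "q = sqrt (1 / (2 * ev^2))"
  have q: "0 \<le> q" "q < 1" using l l0 by (auto simp: q_def)
  have Mf_int: "integrable ?\<mu> (Mf n)" for n
    by (rule Ex_chain(1)[where n = "Suc n"]) (simp add: Mf_restrict)
  have D: "(\<integral>\<omega>. \<bar>Mf (Suc n) \<omega> - Mf n \<omega>\<bar> \<partial>?\<mu>) \<le> (1/2 + 3 * B^2 / 4) * q ^ n" for n
    using Ex_abs_Mf_diff[OF l B, of n] unfolding q_def
    by (subst Ex_chain(2)[where n = "Suc (Suc n)"]) (simp_all add: Mf_restrict)
  have h_fin: "?h (restrict \<omega> (V n)) = ?h \<omega>" for \<omega> n by simp
  have h_meas: "?h \<in> borel_measurable ?\<mu>"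
    using Ex_chain(1)[of ?h 0] h_fin by auto
  have h_bd: "\<bar>?h \<omega>\<bar> \<le> Max ((\<lambda>i. \<bar>f i\<bar>) ` spins)" if "\<omega> \<in> space ?\<mu>" for \<omega>
    using that by (intro Max_ge) (auto simp: space_config)
  have lim: "(\<lambda>n. \<integral>\<omega>. Mf n \<omega> * ?h \<omega> \<partial>?\<mu>) \<longlonglongrightarrow> (\<integral>\<omega>. ?Y \<omega> * ?h \<omega> \<partial>?\<mu>)"
    by (rule C.fast_L1_limit(1)) (rule Mf_int D q h_meas h_bd, assumption?)+
  have Mh: "(\<integral>\<omega>. Mf n \<omega> * ?h \<omega> \<partial>?\<mu>) = (\<integral>\<omega>. Mf 0 \<omega> * ?h \<omega> \<partial>?\<mu>)" for n
  proof (induction n)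
    case (Suc n)
    have int: "integrable ?\<mu> (\<lambda>\<omega>. Mf k \<omega> * ?h \<omega>)" for k
      by (rule Ex_chain(1)[where n = "Suc k"]) (simp add: Mf_restrict)
    have "(\<integral>\<omega>. Mf (Suc n) \<omega> * ?h \<omega> \<partial>?\<mu>) - (\<integral>\<omega>. Mf n \<omega> * ?h \<omega> \<partial>?\<mu>)
        = (\<integral>\<omega>. (Mf (Suc n) \<omega> - Mf n \<omega>) * ?h \<omega> \<partial>?\<mu>)"
      using int by (simp add: left_diff_distrib)
    also have "\<dots> = Ex (Suc (Suc n)) (\<lambda>\<tau>. (Mf (Suc n) \<tau> - Mf n \<tau>) * ?h \<tau>)"
      by (rule Ex_chain(2)) (simp add: Mf_restrict)
    also have "\<dots> = (\<Sum>c\<in>W (Suc (Suc n)). Ex (Suc (Suc n)) (\<lambda>\<tau>. f (restrict \<tau> (V (Suc n)) x0) * (\<Prod>c\<in>{c}. X c \<tau>)))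
        / (2 * ev) ^ Suc (Suc n)"
      unfolding Mf_diff[OF l0] sum_divide_distrib sum_distrib_right sum_distrib_left
      by (subst sum.swap) (simp add: mult_ac)
    also have "\<dots> = (\<Sum>c\<in>W (Suc (Suc n)). 0) / (2 * ev) ^ Suc (Suc n)"
      by (intro arg_cong2[where f = "(/)"] sum.cong refl Ex_X_zero) auto
    finally show ?case using Suc by simp
  qed simp
  \<comment> \<open>Each of the three children contributes \<open>ev\<close> times the value at the
    root plus a difference uncorrelated with it; division by \<open>2 * ev\<close> leaves the factor
    3/2.\<close>
  have "(\<integral>\<omega>. Mf 0 \<omega> * ?h \<omega> \<partial>?\<mu>) = Ex (Suc 0) (\<lambda>\<tau>. Mf 0 \<tau> * ?h \<tau>)"
    by (rule Ex_chain(2)) (simp add: Mf_restrict)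
  also have "\<dots> = Ex (Suc 0) (\<lambda>\<tau>. (\<Sum>c\<in>W (Suc 0). f (restrict \<tau> (V 0) x0) * (\<Prod>c\<in>{c}. X c \<tau>)) / (2 * ev)
      + 3/2 * (?h \<tau>)^2)"
  proof (rule sum.cong[OF refl])
    fix \<tau> assume "\<tau> \<in> cfg (V (Suc 0))"
    have "(\<Sum>c\<in>W (Suc 0). f (\<tau> c)) = (\<Sum>c\<in>W (Suc 0). X c \<tau> + ev * ?h \<tau>)"
      by (rule sum.cong) (auto simp: X_def lev_Suc_iff lev_0_iff)
    also have "\<dots> = (\<Sum>c\<in>W (Suc 0). X c \<tau>) + 3 * ev * ?h \<tau>"
      by (simp add: sum.distrib card_W del: W_iff)
    finally have "Mf 0 \<tau> * ?h \<tau> = ((\<Sum>c\<in>W (Suc 0). X c \<tau>) + 3 * ev * ?h \<tau>) / (2 * ev) * ?h \<tau>"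
      by (simp add: Mf_def del: W_iff)
    also have "\<dots> = (\<Sum>c\<in>W (Suc 0). ?h \<tau> * X c \<tau>) / (2 * ev) + 3/2 * (?h \<tau>)^2"
      using l0 by (simp add: sum_distrib_left[symmetric] field_simps power2_eq_square del: W_iff)
    finally show "pr (Suc 0) \<tau> * (Mf 0 \<tau> * ?h \<tau>) = pr (Suc 0) \<tau> *
        ((\<Sum>c\<in>W (Suc 0). f (restrict \<tau> (V 0) x0) * (\<Prod>c\<in>{c}. X c \<tau>)) / (2 * ev) + 3/2 * (?h \<tau>)^2)" by simp
  qed
  also have "\<dots> = (\<Sum>c\<in>W (Suc 0). Ex (Suc 0) (\<lambda>\<tau>. f (restrict \<tau> (V 0) x0) * (\<Prod>c\<in>{c}. X c \<tau>))) / (2 * ev)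
      + 3/2 * Ex (Suc 0) (\<lambda>\<tau>. (?h \<tau>)^2)"
    unfolding distrib_left sum.distrib sum_distrib_left sum_divide_distrib
    by (subst sum.swap) (simp add: mult_ac)
  also have "(\<Sum>c\<in>W (Suc 0). Ex (Suc 0) (\<lambda>\<tau>. f (restrict \<tau> (V 0) x0) * (\<Prod>c\<in>{c}. X c \<tau>))) = 0"
    by (intro sum.neutral ballI Ex_X_zero) auto
  finally have M0: "(\<integral>\<omega>. Mf 0 \<omega> * ?h \<omega> \<partial>?\<mu>) = 3/2 * Ex (Suc 0) (\<lambda>\<tau>. (?h \<tau>)^2)" by simp
  have pos: "Ex (Suc 0) (\<lambda>\<tau>. (?h \<tau>)^2) > 0"
  proof -
    obtain i where i: "i \<in> spins" "f i \<noteq> 0" using f0 by blast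
    let ?t = "restrict (\<lambda>_. i) (V (Suc 0))"
    have t: "?t \<in> cfg (V (Suc 0))" using i by auto
    show ?thesis
    proof (rule sum_pos2[OF _ t])
      show "0 < pr (Suc 0) ?t * (?h ?t)^2" using pr_pos[OF t] i by simp
      show "0 \<le> pr (Suc 0) \<tau> * (?h \<tau>)^2" if "\<tau> \<in> cfg (V (Suc 0))" for \<tau>
        using pr_pos[OF that] by simp
    qed simp
  qed
  have Y: "(\<integral>\<omega>. ?Y \<omega> * ?h \<omega> \<partial>?\<mu>) \<noteq> 0"
  proof -
    have "(\<lambda>n. \<integral>\<omega>. Mf n \<omega> * ?h \<omega> \<partial>?\<mu>) \<longlonglongrightarrow> (\<integral>\<omega>. Mf 0 \<omega> * ?h \<omega> \<partial>?\<mu>)"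
      by (rule Lim_transform_eventually[OF tendsto_const]) (rule always_eventually, rule allI, rule Mh[symmetric])
    from LIMSEQ_unique[OF lim this] show ?thesis using M0 pos by simp
  qed
  have hz: "(\<integral>\<omega>. ?h \<omega> \<partial>?\<mu>) = 0"
  proof -
    have "(\<integral>\<omega>. ?h \<omega> \<partial>?\<mu>) = Ex 0 ?h" by (rule Ex_chain(2)) simp
    also have "\<dots> = (\<Sum>j\<in>spins. stat \<theta> e j * f j)"
      unfolding V_0 using sum_PiE_insert[of x0 "{}" "\<lambda>\<tau>. pr 0 \<tau> * f (\<tau> x0)" "\<lambda>_. spins"] by (simp add: pr_0)
    finally show ?thesis using stat_eig_zero[OF l1] by simp
  qed
  have Ym: "?Y \<in> borel_measurable ?\<mu>"
    using Mf_int by (intro borel_measurable_lim_metric) auto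
  have "\<exists>c. \<not> (C.prob {\<omega> \<in> space ?\<mu>. ?Y \<omega> \<le> c} = 0 \<or> C.prob {\<omega> \<in> space ?\<mu>. ?Y \<omega> \<le> c} = 1)"
  proof (rule ccontr)
    assume "\<not> ?thesis"
    then obtain c where c: "AE \<omega> in ?\<mu>. ?Y \<omega> = c" using C.AE_const_of_zero_one[OF Ym] by blast
    have "(\<integral>\<omega>. ?Y \<omega> * ?h \<omega> \<partial>?\<mu>) = (\<integral>\<omega>. c * ?h \<omega> \<partial>?\<mu>)"
      using c Ym h_meas by (intro integral_cong_AE) (auto elim: eventually_mono)
    then show False using Y hz by simp
  qed
  then obtain c where c: "C.prob {\<omega> \<in> space ?\<mu>. ?Y \<omega> \<le> c} \<noteq> 0" "C.prob {\<omega> \<in> space ?\<mu>. ?Y \<omega> \<le> c} \<noteq> 1" by blast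
  let ?B = "{\<omega> \<in> space ?\<mu>. ?Y \<omega> \<le> c}"
  have Bs: "?B \<in> sets ?\<mu>" using Ym by measurable
  have tail: "tail_event ?B"
    unfolding tail_event_def
  proof (intro conjI allI impI)
    show "?B \<in> sets config_space" using Bs by simp
    fix \<Lambda> :: "'v set" and \<omega> \<zeta>
    assume \<Lambda>: "finite \<Lambda>" and w: "\<omega> \<in> space (config_space :: ('v \<Rightarrow> nat) measure)" and z: "\<zeta> \<in> cfg \<Lambda>"
    obtain N where N: "\<Lambda> \<subseteq> V N" using finite_subset_V[OF \<Lambda>] by blast
    \<comment> \<open>Far spheres do not meet \<Lambda>, so the two sequences agree eventually. Then
      \<open>lim\<close> agrees even where they diverge, because it is defined through the limits
      alone.\<close>
    have eq: "Mf n (override_on \<omega> \<zeta> \<Lambda>) = Mf n \<omega>" if "N \<le> n" for n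
      unfolding Mf_def using N that
    proof (intro arg_cong2[where f = "(/)"] sum.cong refl)
      fix v assume "v \<in> W (Suc n)"
      then have "v \<notin> \<Lambda>" using N that by (auto simp: subset_eq)
      then show "f (override_on \<omega> \<zeta> \<Lambda> v) = f (\<omega> v)" by simp
    qed
    have "(\<lambda>n. Mf n (override_on \<omega> \<zeta> \<Lambda>)) \<longlonglongrightarrow> l \<longleftrightarrow> (\<lambda>n. Mf n \<omega>) \<longlonglongrightarrow> l" for l
      by (rule tendsto_cong) (use eq in \<open>auto simp: eventually_at_top_linorder\<close>)
    then have "?Y (override_on \<omega> \<zeta> \<Lambda>) = ?Y \<omega>" by (simp add: lim_def)
    then show "override_on \<omega> \<zeta> \<Lambda> \<in> ?B \<longleftrightarrow> \<omega> \<in> ?B" using w override_space[OF w z] by simp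
  qed
  show ?thesis
  proof (rule non_extremeI[OF \<theta> gibbs_chain[OF \<theta>] tail])
    show "0 < C.prob ?B" using c(1) measure_nonneg[of ?\<mu> ?B] by linarith
    show "C.prob ?B < 1" using c(2) C.prob_le_1[of ?B] by linarith
  qed
qed

end

end

section \<open>Extremality: a contraction criterion\<close>

text \<open>Here \<open>b i\<close> is the weight that a vertex has spin \<open>i\<close> once one of its edges is removed, and \<open>q i\<close> the
  conditional expectation of an observable given that spin: seen through the removed edge, the
  dependence of the expectation on the spin shrinks by the factor \<open>\<gamma>\<close>.\<close>

definition up_contraction :: "real \<Rightarrow> (nat \<Rightarrow> nat \<Rightarrow> real) \<Rightarrow> real \<Rightarrow> bool" where
  "up_contraction \<theta> u \<gamma> \<longleftrightarrow> (\<forall>b q. (\<forall>i\<in>spins. 0 < b i) \<longrightarrow>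
     (\<theta> \<le> 1 \<longrightarrow> 16 * \<theta>^4 * (b 0 * b 2) \<le> (1 + \<theta>^2)^4 * (b 1)^2) \<longrightarrow>
     (\<forall>i\<in>spins. \<forall>j\<in>spins. \<bar>q i - q j\<bar> \<le> u i j) \<longrightarrow>
     (\<forall>s\<in>spins. \<forall>s'\<in>spins.
        \<bar>(\<Sum>i\<in>spins. wt \<theta> i s * b i * q i) / (\<Sum>i\<in>spins. wt \<theta> i s * b i)
         - (\<Sum>i\<in>spins. wt \<theta> i s' * b i * q i) / (\<Sum>i\<in>spins. wt \<theta> i s' * b i)\<bar> \<le> \<gamma> * u s s'))"

lemma up_contraction_scaled:
  assumes "up_contraction \<theta> u \<gamma>" "0 < \<epsilon>" "\<forall>i\<in>spins. 0 < b i"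
    "\<theta> \<le> 1 \<longrightarrow> 16 * \<theta>^4 * (b 0 * b 2) \<le> (1 + \<theta>^2)^4 * (b 1)^2"
    "\<And>i j. i \<in> spins \<Longrightarrow> j \<in> spins \<Longrightarrow> \<bar>q i - q j\<bar> \<le> \<epsilon> * u i j" "s \<in> spins" "s' \<in> spins"
  shows "\<bar>(\<Sum>i\<in>spins. wt \<theta> i s * b i * q i) / (\<Sum>i\<in>spins. wt \<theta> i s * b i)
         - (\<Sum>i\<in>spins. wt \<theta> i s' * b i * q i) / (\<Sum>i\<in>spins. wt \<theta> i s' * b i)\<bar> \<le> \<gamma> * \<epsilon> * u s s'"
proof -
  let ?q = "\<lambda>i. q i / \<epsilon>"
  let ?A = "\<lambda>q s. (\<Sum>i\<in>spins. wt \<theta> i s * b i * q i) / (\<Sum>i\<in>spins. wt \<theta> i s * b i)"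
  have "\<bar>?q i - ?q j\<bar> \<le> u i j" if "i \<in> spins" "j \<in> spins" for i j
    using assms(5)[OF that] assms(2) by (simp add: diff_divide_distrib[symmetric] divide_simps mult.commute)
  then have *: "\<bar>?A ?q s - ?A ?q s'\<bar> \<le> \<gamma> * u s s'"
    using assms(1)[unfolded up_contraction_def, rule_format, of b ?q s s'] assms(3,4,6,7) by blast
  have "?A q r = \<epsilon> * ?A ?q r" for r
    using assms(2) by (simp add: sum_distrib_left mult_ac)
  then have "\<bar>?A q s - ?A q s'\<bar> = \<epsilon> * \<bar>?A ?q s - ?A ?q s'\<bar>"
    using assms(2) by (simp only: right_diff_distrib[symmetric] abs_mult abs_of_pos)
  then show ?thesis using * assms(2) by (simp add: mult.assoc mult.left_commute)
qed

text \<open>Messages \<open>\<Sum>\<^sub>l wt \<theta> i l * R l\<close> cannot avoid the middle spin; the product of two of them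
  satisfies the condition on \<open>b\<close> in the definition of \<open>up_contraction\<close>.\<close>

lemma message_middle:
  fixes R :: "nat \<Rightarrow> real"
  assumes "0 < \<theta>" "\<theta> \<le> 1" "\<And>l. l \<in> spins \<Longrightarrow> 0 \<le> R l" and f: "\<And>i. f i = (\<Sum>l\<in>spins. wt \<theta> i l * R l)"
  shows "4 * \<theta>^2 * (f 0 * f 2) \<le> (1 + \<theta>^2)^2 * (f 1)^2"
proof -
  have R: "0 \<le> R 0" "0 \<le> R 1" "0 \<le> R 2" using assms(3) by auto
  have f0: "f 0 = R 0 + \<theta> * R 1 + \<theta>^2 * R 2" and f1: "f 1 = \<theta> * R 0 + R 1 + \<theta> * R 2"
    and f2: "f 2 = \<theta>^2 * R 0 + \<theta> * R 1 + R 2"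
    unfolding f sum_spins by (simp_all add: wt_def)
  \<comment> \<open>Sources at the outer spins contribute equally to both terms. Only the middle
    source leaves a surplus, nonnegative since \<theta> \<le> 1.\<close>
  have "(1 + \<theta>^2) * f 1 - \<theta> * (f 0 + f 2) = (1 - \<theta>^2) * R 1"
    unfolding f0 f1 f2 by (simp add: algebra_simps power2_eq_square)
  moreover have "0 \<le> (1 - \<theta>^2) * R 1" using R assms(1,2) by (simp add: power_le_one)
  ultimately have "\<theta> * (f 0 + f 2) \<le> (1 + \<theta>^2) * f 1" by linarith
  moreover have "0 \<le> \<theta> * (f 0 + f 2)" unfolding f0 f2 using R assms(1) by simp
  ultimately have "(\<theta> * (f 0 + f 2))^2 \<le> ((1 + \<theta>^2) * f 1)^2" by (intro power_mono)
  moreover have "4 * \<theta>^2 * (f 0 * f 2) \<le> (\<theta> * (f 0 + f 2))^2"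
  proof -
    have "0 \<le> \<theta>^2 * (f 0 - f 2)^2" by simp
    then show ?thesis by (simp add: power2_eq_square algebra_simps)
  qed
  ultimately show ?thesis by (simp add: power_mult_distrib)
qed

text \<open>Used as a boundary field, it pins the spin of a vertex to \<open>s\<close>.\<close>

definition dl :: "nat \<Rightarrow> nat \<Rightarrow> real" where
  "dl s j = (if j = s then 1 else 0)"

section \<open>Inwards: the influence of one boundary spin\<close>

context cayley2
begin

context
  fixes \<theta> :: real
  assumes \<theta>p: "0 < \<theta>"
begin

text \<open>An unnormalised expectation with weights on the sphere. Pinned boundary spins and the
  weights left by summing out outer layers are both of this form, which makes an induction over the
  layers possible.\<close>

definition Nf :: "nat \<Rightarrow> ('v \<Rightarrow> nat \<Rightarrow> real) \<Rightarrow> (('v \<Rightarrow> nat) \<Rightarrow> real) \<Rightarrow> real" where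
  "Nf n a g = (\<Sum>\<sigma>\<in>cfg (V n). g \<sigma> * edgew \<theta> (V n - {x0}) \<sigma> * (\<Prod>v\<in>W n. a v (\<sigma> v)))"

text \<open>The weights on a sphere after its children have been summed out: one step of the message
  recursion.\<close>

definition lift :: "('v \<Rightarrow> nat \<Rightarrow> real) \<Rightarrow> 'v \<Rightarrow> nat \<Rightarrow> real" where
  "lift a v i = (\<Prod>c\<in>ch v. \<Sum>j\<in>spins. wt \<theta> i j * a c j)"

definition dep :: "nat \<Rightarrow> (('v \<Rightarrow> nat) \<Rightarrow> real) \<Rightarrow> bool" where
  "dep n g \<longleftrightarrow> (\<forall>\<sigma>. g (restrict \<sigma> (V n)) = g \<sigma>)"

lemma dep_const: "dep n (\<lambda>_. c)"
  by (simp add: dep_def)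

lemma dep_mono: "dep m g \<Longrightarrow> m \<le> n \<Longrightarrow> dep n g"
  unfolding dep_def by (metis V_mono inf.absorb_iff2 restrict_restrict)

lemma edgew_V_Suc: "edgew \<theta> (V (Suc n) - {x0}) \<sigma> = edgew \<theta> (V n - {x0}) \<sigma> * edgew \<theta> (W (Suc n)) \<sigma>"
proof -
  have "V (Suc n) - {x0} = (V n - {x0}) \<union> W (Suc n)" by auto
  moreover have "(V n - {x0}) \<inter> W (Suc n) = {}" by auto
  ultimately show ?thesis by (simp add: edgew_Un del: W_iff V_iff)
qed

lemma edgew_restrict: "V n \<subseteq> S \<Longrightarrow> edgew \<theta> (V n - {x0}) (restrict \<sigma> S) = edgew \<theta> (V n - {x0}) \<sigma>"
proof (rule edgew_cong)
  fix v assume "V n \<subseteq> S" "v \<in> V n - {x0}"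
  moreover from this have "par v \<in> V n" using lev_par[of v] by auto
  ultimately show "restrict \<sigma> S v = \<sigma> v \<and> restrict \<sigma> S (par v) = \<sigma> (par v)" by auto
qed

lemma Nf_Suc:
  assumes "dep n g" shows "Nf (Suc n) a g = Nf n (lift a) g"
proof -
  let ?W = "W (Suc n)"
  let ?G = "\<lambda>\<zeta> \<eta>. g \<zeta> * edgew \<theta> (V n - {x0}) \<zeta> * (\<Prod>c\<in>?W. wt \<theta> (\<zeta> (par c)) (\<eta> c) * a c (\<eta> c))"
  have "Nf (Suc n) a g = (\<Sum>\<sigma>\<in>cfg (V n \<union> ?W). ?G (restrict \<sigma> (V n)) (restrict \<sigma> ?W))"
    unfolding Nf_def V_Suc[symmetric]
  proof (rule sum.cong[OF refl])
    fix \<sigma> assume "\<sigma> \<in> cfg (V (Suc n))"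
    have "(\<Prod>c\<in>?W. wt \<theta> (restrict \<sigma> (V n) (par c)) (restrict \<sigma> ?W c) * a c (restrict \<sigma> ?W c))
        = (\<Prod>c\<in>?W. wt \<theta> (\<sigma> (par c)) (\<sigma> c) * a c (\<sigma> c))"
      by (rule prod.cong) (auto simp: lev_Suc_iff)
    then show "g \<sigma> * edgew \<theta> (V (Suc n) - {x0}) \<sigma> * (\<Prod>v\<in>?W. a v (\<sigma> v)) = ?G (restrict \<sigma> (V n)) (restrict \<sigma> ?W)"
      using assms unfolding dep_def edgew_V_Suc
      by (simp add: edgew_restrict edgew_def[of _ "W (Suc n)"] prod.distrib wt_sym mult.assoc del: W_iff V_iff restrict_apply)
  qed
  also have "\<dots> = (\<Sum>\<zeta>\<in>cfg (V n). \<Sum>\<eta>\<in>cfg ?W. ?G \<zeta> \<eta>)"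
    by (rule sum_PiE_Un[OF V_W_disj])
  also have "\<dots> = (\<Sum>\<zeta>\<in>cfg (V n). g \<zeta> * edgew \<theta> (V n - {x0}) \<zeta> * (\<Prod>v\<in>W n. lift a v (\<zeta> v)))"
  proof (rule sum.cong[OF refl])
    fix \<zeta> assume "\<zeta> \<in> cfg (V n)"
    have "(\<Sum>\<eta>\<in>cfg ?W. \<Prod>c\<in>?W. wt \<theta> (\<zeta> (par c)) (\<eta> c) * a c (\<eta> c))
        = (\<Prod>c\<in>?W. \<Sum>j\<in>spins. wt \<theta> (\<zeta> (par c)) j * a c j)"
      by (rule prod_sum_PiE[symmetric]) auto
    also have "\<dots> = (\<Prod>v\<in>W n. lift a v (\<zeta> v))"
      unfolding prod_W_Suc lift_def by (intro prod.cong refl) auto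
    finally show "(\<Sum>\<eta>\<in>cfg ?W. ?G \<zeta> \<eta>) = g \<zeta> * edgew \<theta> (V n - {x0}) \<zeta> * (\<Prod>v\<in>W n. lift a v (\<zeta> v))"
      by (simp add: sum_distrib_left[symmetric])
  qed
  finally show ?thesis by (simp add: Nf_def)
qed

lemma Nf_linear:
  assumes v: "v \<in> W n"
  shows "Nf n (a(v := \<phi>)) g = (\<Sum>i\<in>spins. \<phi> i * Nf n (a(v := dl i)) g)"
proof -
  let ?w = "\<lambda>\<sigma>. g \<sigma> * edgew \<theta> (V n - {x0}) \<sigma>" and ?r = "\<lambda>\<sigma>. \<Prod>u\<in>W n - {v}. a u (\<sigma> u)"
  have p: "(\<Prod>u\<in>W n. (a(v := \<psi>)) u (\<sigma> u)) = \<psi> (\<sigma> v) * ?r \<sigma>" for \<psi> \<sigma>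
    using v by (subst prod.remove[OF _ v]) (auto intro!: prod.cong)
  have "Nf n (a(v := \<phi>)) g = (\<Sum>\<sigma>\<in>cfg (V n). \<Sum>i\<in>spins. \<phi> i * (?w \<sigma> * (dl i (\<sigma> v) * ?r \<sigma>)))"
    unfolding Nf_def p
  proof (rule sum.cong[OF refl])
    fix \<sigma> assume s: "\<sigma> \<in> cfg (V n)"
    have "\<sigma> v \<in> spins" using v by (intro cfg_D[OF s]) auto
    then have "(\<Sum>i\<in>spins. \<phi> i * (?w \<sigma> * (dl i (\<sigma> v) * ?r \<sigma>))) = (\<Sum>i\<in>spins. if i = \<sigma> v then \<phi> i * (?w \<sigma> * ?r \<sigma>) else 0)"
      by (intro sum.cong refl) (auto simp: dl_def)
    also have "\<dots> = \<phi> (\<sigma> v) * (?w \<sigma> * ?r \<sigma>)" using \<open>\<sigma> v \<in> spins\<close> by simp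
    finally show "?w \<sigma> * (\<phi> (\<sigma> v) * ?r \<sigma>) = (\<Sum>i\<in>spins. \<phi> i * (?w \<sigma> * (dl i (\<sigma> v) * ?r \<sigma>)))" by (simp add: mult_ac)
  qed
  also have "\<dots> = (\<Sum>i\<in>spins. \<Sum>\<sigma>\<in>cfg (V n). \<phi> i * (?w \<sigma> * (dl i (\<sigma> v) * ?r \<sigma>)))" by (rule sum.swap)
  also have "\<dots> = (\<Sum>i\<in>spins. \<phi> i * Nf n (a(v := dl i)) g)" unfolding Nf_def p sum_distrib_left ..
  finally show ?thesis .
qed

definition fld :: "('v \<Rightarrow> nat \<Rightarrow> real) \<Rightarrow> bool" where
  "fld a \<longleftrightarrow> (\<forall>v. (\<forall>i\<in>spins. 0 \<le> a v i) \<and> (\<exists>i\<in>spins. 0 < a v i))"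

lemma fld_sum_pos:
  assumes "fld a" shows "0 < (\<Sum>j\<in>spins. wt \<theta> i j * a c j)"
proof -
  obtain j where j: "j \<in> spins" "0 < a c j" using assms by (auto simp: fld_def)
  show ?thesis
    by (rule sum_pos2[OF _ j(1)]) (use assms j wt_pos[OF \<theta>p] in \<open>auto simp: fld_def less_imp_le\<close>)
qed

lemma lift_pos: "fld a \<Longrightarrow> 0 < lift a v i"
  unfolding lift_def by (intro prod_pos fld_sum_pos)

lemma fld_lift: "fld a \<Longrightarrow> fld (lift a)"
  unfolding fld_def[of "lift a"] using lift_pos spins_mem(1) less_imp_le by blast

lemma fld_upd: "fld a \<Longrightarrow> s \<in> spins \<Longrightarrow> fld (a(v := dl s))"
  unfolding fld_def by (auto simp: dl_def)

lemma Nf_nonneg: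
  assumes "fld a" "\<And>\<sigma>. 0 \<le> g \<sigma>" shows "0 \<le> Nf n a g"
  unfolding Nf_def
proof (intro sum_nonneg mult_nonneg_nonneg assms(2) prod_nonneg less_imp_le[OF edgew_pos[OF \<theta>p]] ballI)
  fix \<sigma> v assume s: "\<sigma> \<in> cfg (V n)" and v: "v \<in> W n"
  have "\<sigma> v \<in> spins" using v by (intro cfg_D[OF s]) auto
  then show "0 \<le> a v (\<sigma> v)" using assms(1) by (auto simp: fld_def)
qed

lemma Nf_pos:
  assumes "fld a" shows "0 < Nf n a (\<lambda>_. 1)"
proof -
  obtain s where s: "\<And>v. s v \<in> spins \<and> 0 < a v (s v)" using assms unfolding fld_def by metis
  let ?s = "restrict s (V n)"
  have t: "?s \<in> cfg (V n)" using s by auto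
  have nn: "0 \<le> 1 * edgew \<theta> (V n - {x0}) \<sigma> * (\<Prod>v\<in>W n. a v (\<sigma> v))" if sg: "\<sigma> \<in> cfg (V n)" for \<sigma>
  proof (intro mult_nonneg_nonneg prod_nonneg less_imp_le[OF edgew_pos[OF \<theta>p]] ballI)
    fix v assume v: "v \<in> W n"
    have "\<sigma> v \<in> spins" using v by (intro cfg_D[OF sg]) auto
    then show "0 \<le> a v (\<sigma> v)" using assms(1) by (auto simp: fld_def)
  qed simp
  show ?thesis unfolding Nf_def
  proof (rule sum_pos2[OF _ t _ nn])
    have "0 < (\<Prod>v\<in>W n. a v (?s v))" using s by (intro prod_pos ballI) auto
    then show "0 < 1 * edgew \<theta> (V n - {x0}) ?s * (\<Prod>v\<in>W n. a v (?s v))"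
      using edgew_pos[OF \<theta>p] by simp
  qed simp
qed

definition Qf :: "nat \<Rightarrow> ('v \<Rightarrow> nat \<Rightarrow> real) \<Rightarrow> (('v \<Rightarrow> nat) \<Rightarrow> real) \<Rightarrow> real" where
  "Qf n a g = Nf n a g / Nf n a (\<lambda>_. 1)"

lemma Nf_mono:
  assumes "fld a" "\<And>\<sigma>. g \<sigma> \<le> g' \<sigma>" shows "Nf n a g \<le> Nf n a g'"
proof -
  have "0 \<le> Nf n a (\<lambda>\<sigma>. g' \<sigma> - g \<sigma>)" using assms by (intro Nf_nonneg) auto
  also have "\<dots> = Nf n a g' - Nf n a g"
    unfolding Nf_def sum_subtractf[symmetric] by (simp add: algebra_simps)
  finally show ?thesis by simp
qed

lemma Qf_bounds:
  assumes "fld a" "\<And>\<sigma>. 0 \<le> g \<sigma>" "\<And>\<sigma>. g \<sigma> \<le> 1"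
  shows "0 \<le> Qf n a g" "Qf n a g \<le> 1"
  using Nf_nonneg[OF assms(1,2), of n] Nf_pos[OF assms(1), of n] Nf_mono[of a g "\<lambda>_. 1", OF assms(1,3), of n]
  by (auto simp: Qf_def)

lemma lift_upd:
  assumes "v \<in> W (Suc n)"
  shows "lift (a(v := \<phi>)) = (lift a)(par v := \<lambda>i. (\<Sum>j\<in>spins. wt \<theta> i j * \<phi> j)
      * (\<Prod>c\<in>ch (par v) - {v}. \<Sum>j\<in>spins. wt \<theta> i j * a c j))"
proof (intro ext)
  fix u i
  have v: "v \<in> ch (par v)" using assms by (auto simp: lev_Suc_iff)
  show "lift (a(v := \<phi>)) u i = ((lift a)(par v := \<lambda>i. (\<Sum>j\<in>spins. wt \<theta> i j * \<phi> j)
      * (\<Prod>c\<in>ch (par v) - {v}. \<Sum>j\<in>spins. wt \<theta> i j * a c j))) u i"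
  proof (cases "u = par v")
    case True
    then show ?thesis unfolding lift_def using v
      by (simp add: prod.remove[of _ v] del: ch_iff)
  next
    case False
    have "c \<noteq> v" if "c \<in> ch u" for c using that False by auto
    then show ?thesis using False unfolding lift_def
      by (auto intro!: prod.cong simp del: ch_iff)
  qed
qed

lemma sum_wt_dl: "s \<in> spins \<Longrightarrow> (\<Sum>j\<in>spins. wt \<theta> i j * dl s j) = wt \<theta> i s"
proof -
  assume s: "s \<in> spins"
  have "(\<Sum>j\<in>spins. wt \<theta> i j * dl s j) = (\<Sum>j\<in>spins. if j = s then wt \<theta> i j else 0)"
    by (rule sum.cong) (auto simp: dl_def)
  then show ?thesis using s by simp
qed

text \<open>After summing out the outer sphere a pinned leaf acts on its parent only through the
  edge weight; the siblings and the rest of the tree enter as weights that do not depend on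
  \<open>s\<close>.\<close>

lemma Nf_leaf:
  assumes v: "v \<in> W (Suc n)" and s: "s \<in> spins" and g: "dep n g"
  shows "Nf (Suc n) (a(v := dl s)) g = (\<Sum>i\<in>spins. wt \<theta> i s
      * (\<Prod>c\<in>ch (par v) - {v}. \<Sum>j\<in>spins. wt \<theta> i j * a c j) * Nf n ((lift a)(par v := dl i)) g)"
  unfolding Nf_Suc[OF g] lift_upd[OF v] sum_wt_dl[OF s]
  by (rule Nf_linear) (rule par_W[OF v])

text \<open>Induction over the layers between the leaf and the observed ball. The conditional
  expectation is an average of the values \<open>q\<close> at the parent with weights
  \<open>wt \<theta> i s * b i\<close>, and \<open>up_contraction\<close> compares these averages
  for \<open>s\<close> and \<open>s'\<close>. At the start the values lie in the unit interval, and
  \<open>u\<close> is at least 1 off the diagonal.\<close>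

lemma leaf_influence:
  assumes up: "up_contraction \<theta> u \<gamma>" and \<gamma>: "0 < \<gamma>"
    and u: "\<And>i j. i \<in> spins \<Longrightarrow> j \<in> spins \<Longrightarrow> 0 \<le> u i j"
      "\<And>i j. i \<in> spins \<Longrightarrow> j \<in> spins \<Longrightarrow> i \<noteq> j \<Longrightarrow> 1 \<le> u i j"
    and g: "dep m g" "\<And>\<sigma>. 0 \<le> g \<sigma>" "\<And>\<sigma>. g \<sigma> \<le> 1"
  shows "fld a \<Longrightarrow> v \<in> W (Suc (m + k)) \<Longrightarrow> s \<in> spins \<Longrightarrow> s' \<in> spins \<Longrightarrow>
    \<bar>Qf (Suc (m + k)) (a(v := dl s)) g - Qf (Suc (m + k)) (a(v := dl s')) g\<bar> \<le> \<gamma> ^ k * u s s'"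
proof (induction k arbitrary: a v s s')
  case 0
  have b: "0 \<le> Qf (Suc (m + 0)) (a(v := dl r)) g \<and> Qf (Suc (m + 0)) (a(v := dl r)) g \<le> 1" if "r \<in> spins" for r
    by (intro conjI Qf_bounds fld_upd 0(1) that g(2,3))
  show ?case
  proof (cases "s = s'")
    case True
    then show ?thesis using u(1)[OF 0(3,4)] by simp
  next
    case False
    have "\<bar>Qf (Suc (m + 0)) (a(v := dl s)) g - Qf (Suc (m + 0)) (a(v := dl s')) g\<bar> \<le> 1"
      using b[OF 0(3)] b[OF 0(4)] by linarith
    also have "1 \<le> \<gamma> ^ 0 * u s s'" using u(2)[OF 0(3,4) False] by simp
    finally show ?thesis .
  qed
next
  case (Suc k)
  let ?n = "Suc (m + k)"
  have v: "v \<in> W (Suc ?n)" using Suc.prems(2) by simp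
  have pv: "par v \<in> W ?n" by (rule par_W[OF v])
  let ?A = "lift a"
  have A: "fld ?A" by (rule fld_lift[OF Suc.prems(1)])
  \<comment> \<open>\<open>gg\<close> comes from the sibling and \<open>f\<close> from the rest of
    the tree. Both reach the parent through an edge, so \<open>message_middle\<close> holds for
    each; multiplying the two estimates yields the condition on \<open>b\<close> with its fourth
    powers.\<close>
  define gg where "gg = (\<lambda>i. \<Prod>c\<in>ch (par v) - {v}. \<Sum>j\<in>spins. wt \<theta> i j * a c j)"
  define f where "f = (\<lambda>i. Nf ?n (?A(par v := dl i)) (\<lambda>_. 1))"
  define q where "q = (\<lambda>i. Qf ?n (?A(par v := dl i)) g)"
  define b where "b = (\<lambda>i. gg i * f i)"
  have f_pos: "0 < f i" if "i \<in> spins" for i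
    unfolding f_def by (intro Nf_pos fld_upd A that)
  have gg_pos: "0 < gg i" for i
    unfolding gg_def by (intro prod_pos fld_sum_pos Suc.prems(1))
  have b_pos: "\<forall>i\<in>spins. 0 < b i" using f_pos gg_pos by (simp add: b_def)
  have Nq: "Nf ?n (?A(par v := dl i)) g = f i * q i" if "i \<in> spins" for i
    using f_pos[OF that] by (simp add: q_def Qf_def f_def)
  have dg: "dep ?n g" using g(1) by (rule dep_mono) simp
  have Q: "Qf (Suc ?n) (a(v := dl r)) g
      = (\<Sum>i\<in>spins. wt \<theta> i r * b i * q i) / (\<Sum>i\<in>spins. wt \<theta> i r * b i)" if r: "r \<in> spins" for r
  proof -
    have "Nf (Suc ?n) (a(v := dl r)) g = (\<Sum>i\<in>spins. wt \<theta> i r * b i * q i)"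
      unfolding Nf_leaf[OF v r dg] by (rule sum.cong) (auto simp: Nq b_def gg_def)
    moreover have "Nf (Suc ?n) (a(v := dl r)) (\<lambda>_. 1) = (\<Sum>i\<in>spins. wt \<theta> i r * b i)"
      unfolding Nf_leaf[OF v r dep_const] by (rule sum.cong) (auto simp: b_def f_def gg_def)
    ultimately show ?thesis by (simp add: Qf_def)
  qed
  have mid: "16 * \<theta>^4 * (b 0 * b 2) \<le> (1 + \<theta>^2)^4 * (b 1)^2" if t1: "\<theta> \<le> 1"
  proof -
    \<comment> \<open>Off the root there is exactly one sibling, hence exactly one message in
      \<open>gg\<close>.\<close>
    have "par v \<noteq> x0" using pv by auto
    then have "card (ch (par v)) = 2" by (simp add: card_ch)
    moreover have "v \<in> ch (par v)" using v by (auto simp: lev_Suc_iff)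
    ultimately have "card (ch (par v) - {v}) = 1" by simp
    then obtain y where y: "ch (par v) - {v} = {y}" by (auto simp: card_1_singleton_iff simp del: ch_iff)
    have "gg i = (\<Sum>j\<in>spins. wt \<theta> i j * a y j)" for i unfolding gg_def y by simp
    then have 1: "4 * \<theta>^2 * (gg 0 * gg 2) \<le> (1 + \<theta>^2)^2 * (gg 1)^2"
      using Suc.prems(1) by (intro message_middle[OF \<theta>p t1]) (auto simp: fld_def)
    \<comment> \<open>The source of the second message: the remaining tree as seen from the
      grandparent, whose edge to \<open>par v\<close> carries the message.\<close>
    define R where "R = (\<lambda>l. (\<Prod>c\<in>ch (par (par v)) - {par v}. \<Sum>j\<in>spins. wt \<theta> l j * ?A c j)
        * Nf (m + k) ((lift ?A)(par (par v) := dl l)) (\<lambda>_. 1))"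
    have Rn: "0 \<le> R l" if "l \<in> spins" for l
      unfolding R_def using fld_sum_pos[OF A] fld_upd[OF fld_lift[OF A] that]
      by (intro mult_nonneg_nonneg prod_nonneg Nf_nonneg) (auto intro: less_imp_le)
    have fR: "f i = (\<Sum>l\<in>spins. wt \<theta> i l * R l)" if "i \<in> spins" for i
      unfolding f_def Nf_leaf[OF pv that dep_const] R_def
      by (rule sum.cong) (auto simp: wt_sym[of \<theta> i] mult.assoc)
    have "4 * \<theta>^2 * ((\<Sum>l\<in>spins. wt \<theta> 0 l * R l) * (\<Sum>l\<in>spins. wt \<theta> 2 l * R l))
        \<le> (1 + \<theta>^2)^2 * (\<Sum>l\<in>spins. wt \<theta> 1 l * R l)^2"
      by (rule message_middle[OF \<theta>p t1 Rn, where f = "\<lambda>i. \<Sum>l\<in>spins. wt \<theta> i l * R l"]) auto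
    then have 2: "4 * \<theta>^2 * (f 0 * f 2) \<le> (1 + \<theta>^2)^2 * (f 1)^2" by (simp add: fR)
    have "(4 * \<theta>^2 * (gg 0 * gg 2)) * (4 * \<theta>^2 * (f 0 * f 2)) \<le> ((1 + \<theta>^2)^2 * (gg 1)^2) * ((1 + \<theta>^2)^2 * (f 1)^2)"
    proof (rule mult_mono[OF 1 2])
      show "0 \<le> 4 * \<theta>^2 * (f 0 * f 2)" using f_pos[of 0] f_pos[of 2] by simp
    qed simp
    moreover have "(1 + \<theta>^2)^4 * (b 1)^2 = ((1 + \<theta>^2)^2 * (gg 1)^2) * ((1 + \<theta>^2)^2 * (f 1)^2)"
    proof -
      have "(1 + \<theta>^2)^4 = (1 + \<theta>^2)^2 * (1 + \<theta>^2)^2" unfolding power_add[symmetric] by simp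
      then show ?thesis unfolding b_def by (simp only: power_mult_distrib mult_ac)
    qed
    moreover have "16 * \<theta>^4 * (b 0 * b 2) = (4 * \<theta>^2 * (gg 0 * gg 2)) * (4 * \<theta>^2 * (f 0 * f 2))"
      by (simp add: b_def power2_eq_square power4_eq_xxxx)
    ultimately show ?thesis by simp
  qed
  have IH: "\<bar>q i - q j\<bar> \<le> \<gamma> ^ k * u i j" if "i \<in> spins" "j \<in> spins" for i j
    unfolding q_def by (rule Suc.IH[OF A pv that])
  have "\<bar>Qf (Suc ?n) (a(v := dl s)) g - Qf (Suc ?n) (a(v := dl s')) g\<bar> \<le> \<gamma> * \<gamma> ^ k * u s s'"
    unfolding Q[OF Suc.prems(3)] Q[OF Suc.prems(4)]
    by (rule up_contraction_scaled[OF up _ b_pos _ IH]) (use \<gamma> mid Suc.prems in auto)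
  then show ?case by (simp only: add_Suc_right power_Suc)
qed

end

end

section \<open>Lipschitz functions of independent spins\<close>

definition Epr :: "'v set \<Rightarrow> ('v \<Rightarrow> nat \<Rightarrow> real) \<Rightarrow> (('v \<Rightarrow> nat) \<Rightarrow> real) \<Rightarrow> real" where
  "Epr I p G = (\<Sum>\<eta>\<in>cfg I. (\<Prod>c\<in>I. p c (\<eta> c)) * G \<eta>)"

definition prob_rows :: "'v set \<Rightarrow> ('v \<Rightarrow> nat \<Rightarrow> real) \<Rightarrow> bool" where
  "prob_rows I p \<longleftrightarrow> (\<forall>c\<in>I. (\<forall>j\<in>spins. 0 \<le> p c j) \<and> (\<Sum>j\<in>spins. p c j) = 1)"

definition site_lip :: "'v set \<Rightarrow> (nat \<Rightarrow> nat \<Rightarrow> real) \<Rightarrow> real \<Rightarrow> (('v \<Rightarrow> nat) \<Rightarrow> real) \<Rightarrow> bool" where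
  "site_lip I u \<epsilon> G \<longleftrightarrow> (\<forall>\<eta>\<in>cfg I. \<forall>v\<in>I. \<forall>s\<in>spins. \<forall>s'\<in>spins.
     \<bar>G (\<eta>(v := s)) - G (\<eta>(v := s'))\<bar> \<le> \<epsilon> * u s s')"

text \<open>The dual form of a contraction by \<open>\<kappa>\<close> of the rows of \<open>P\<close> in the Wasserstein distance of \<open>u\<close>.\<close>

definition down_contraction :: "(nat \<Rightarrow> nat \<Rightarrow> real) \<Rightarrow> (nat \<Rightarrow> nat \<Rightarrow> real) \<Rightarrow> real \<Rightarrow> bool" where
  "down_contraction P u \<kappa> \<longleftrightarrow> (\<forall>q. (\<forall>i\<in>spins. \<forall>j\<in>spins. \<bar>q i - q j\<bar> \<le> u i j) \<longrightarrow>
     (\<forall>s\<in>spins. \<forall>s'\<in>spins. \<bar>(\<Sum>j\<in>spins. P s j * q j) - (\<Sum>j\<in>spins. P s' j * q j)\<bar> \<le> \<kappa> * u s s'))"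

lemma down_contraction_scaled:
  assumes "down_contraction P u \<kappa>" "0 < \<epsilon>"
    "\<And>i j. i \<in> spins \<Longrightarrow> j \<in> spins \<Longrightarrow> \<bar>q i - q j\<bar> \<le> \<epsilon> * u i j" "s \<in> spins" "s' \<in> spins"
  shows "\<bar>(\<Sum>j\<in>spins. (P s j - P s' j) * q j)\<bar> \<le> \<kappa> * \<epsilon> * u s s'"
proof -
  let ?q = "\<lambda>i. q i / \<epsilon>"
  have "\<bar>?q i - ?q j\<bar> \<le> u i j" if "i \<in> spins" "j \<in> spins" for i j
    using assms(3)[OF that] assms(2) by (simp add: diff_divide_distrib[symmetric] divide_simps mult.commute)
  then have *: "\<bar>(\<Sum>j\<in>spins. P s j * ?q j) - (\<Sum>j\<in>spins. P s' j * ?q j)\<bar> \<le> \<kappa> * u s s'"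
    using assms(1)[unfolded down_contraction_def, rule_format, of ?q s s'] assms(4,5) by blast
  have "(\<Sum>j\<in>spins. (P s j - P s' j) * q j) = \<epsilon> * ((\<Sum>j\<in>spins. P s j * ?q j) - (\<Sum>j\<in>spins. P s' j * ?q j))"
    using assms(2) by (simp add: sum_subtractf[symmetric] sum_distrib_left algebra_simps)
  then have "\<bar>\<Sum>j\<in>spins. (P s j - P s' j) * q j\<bar> = \<epsilon> * \<bar>(\<Sum>j\<in>spins. P s j * ?q j) - (\<Sum>j\<in>spins. P s' j * ?q j)\<bar>"
    using assms(2) by (simp only: abs_mult abs_of_pos)
  then show ?thesis using * assms(2) by (simp add: mult.assoc mult.left_commute)
qed

lemma Epr_replace_one:
  assumes I: "finite I" "c \<in> I" and p: "prob_rows I p" and G: "site_lip I u \<epsilon> G"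
    and c: "\<And>q. (\<And>i j. i \<in> spins \<Longrightarrow> j \<in> spins \<Longrightarrow> \<bar>q i - q j\<bar> \<le> \<epsilon> * u i j) \<Longrightarrow>
        \<bar>\<Sum>j\<in>spins. (p c j - r j) * q j\<bar> \<le> \<delta>"
  shows "\<bar>Epr I p G - Epr I (p(c := r)) G\<bar> \<le> \<delta>"
proof -
  let ?I = "I - {c}"
  let ?w = "\<lambda>\<zeta>. \<Prod>d\<in>?I. p d (\<zeta> d)"
  have Ie: "insert c ?I = I" using I by blast
  have exp: "Epr I (p(c := t)) G = (\<Sum>\<zeta>\<in>cfg ?I. ?w \<zeta> * (\<Sum>j\<in>spins. t j * G (\<zeta>(c := j))))" for t
  proof -
    have "Epr I (p(c := t)) G = (\<Sum>j\<in>spins. \<Sum>\<zeta>\<in>cfg ?I. (\<Prod>d\<in>I. (p(c := t)) d ((\<zeta>(c := j)) d)) * G (\<zeta>(c := j)))"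
      unfolding Epr_def by (subst Ie[symmetric], rule sum_PiE_insert[of c ?I _ "\<lambda>_. spins"]) simp
    also have "\<dots> = (\<Sum>j\<in>spins. \<Sum>\<zeta>\<in>cfg ?I. ?w \<zeta> * (t j * G (\<zeta>(c := j))))"
    proof (intro sum.cong refl)
      fix j \<zeta>
      have "(\<Prod>d\<in>I. (p(c := t)) d ((\<zeta>(c := j)) d)) = t j * ?w \<zeta>"
        using I by (subst prod.remove[OF I]) (auto intro!: prod.cong)
      then show "(\<Prod>d\<in>I. (p(c := t)) d ((\<zeta>(c := j)) d)) * G (\<zeta>(c := j)) = ?w \<zeta> * (t j * G (\<zeta>(c := j)))" by simp
    qed
    also have "\<dots> = (\<Sum>\<zeta>\<in>cfg ?I. ?w \<zeta> * (\<Sum>j\<in>spins. t j * G (\<zeta>(c := j))))"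
      unfolding sum_distrib_left by (rule sum.swap)
    finally show ?thesis .
  qed
  have w: "0 \<le> ?w \<zeta>" if z: "\<zeta> \<in> cfg ?I" for \<zeta>
    using p cfg_D[OF z] by (intro prod_nonneg) (auto simp: prob_rows_def)
  have w1: "(\<Sum>\<zeta>\<in>cfg ?I. ?w \<zeta>) = 1"
    using p I by (subst prod_sum_PiE[symmetric]) (auto simp: prob_rows_def)
  have "Epr I p G - Epr I (p(c := r)) G
      = (\<Sum>\<zeta>\<in>cfg ?I. ?w \<zeta> * (\<Sum>j\<in>spins. (p c j - r j) * G (\<zeta>(c := j))))"
    using exp[of "p c"] exp[of r] by (simp add: sum_subtractf[symmetric] right_diff_distrib[symmetric] left_diff_distrib)
  also have "\<bar>\<dots>\<bar> \<le> (\<Sum>\<zeta>\<in>cfg ?I. ?w \<zeta> * \<delta>)"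
  proof (rule order_trans[OF sum_abs], rule sum_mono)
    fix \<zeta> assume z: "\<zeta> \<in> cfg ?I"
    have "\<bar>G (\<zeta>(c := i)) - G (\<zeta>(c := j))\<bar> \<le> \<epsilon> * u i j" if ij: "i \<in> spins" "j \<in> spins" for i j
    proof -
      \<comment> \<open>The value 0 at \<open>c\<close> is a placeholder that completes \<zeta> to a
        configuration on \<open>I\<close>; both updates overwrite it.\<close>
      have "\<zeta>(c := 0) \<in> cfg I" using z I(2) by (auto simp: PiE_iff extensional_def)
      then have "\<bar>G ((\<zeta>(c := 0))(c := i)) - G ((\<zeta>(c := 0))(c := j))\<bar> \<le> \<epsilon> * u i j"
        using G[unfolded site_lip_def] I(2) ij by blast
      then show ?thesis by simp
    qed
    then have "\<bar>\<Sum>j\<in>spins. (p c j - r j) * G (\<zeta>(c := j))\<bar> \<le> \<delta>" by (rule c)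
    then show "\<bar>?w \<zeta> * (\<Sum>j\<in>spins. (p c j - r j) * G (\<zeta>(c := j)))\<bar> \<le> ?w \<zeta> * \<delta>"
      using w[OF z] by (simp add: abs_mult mult_left_mono)
  qed
  also have "\<dots> = \<delta>" by (simp add: sum_distrib_right[symmetric] w1)
  finally show ?thesis .
qed

text \<open>A hybrid argument: the laws are exchanged one site at a time.\<close>

lemma Epr_replace:
  assumes I: "finite I" and S: "finite S" "S \<subseteq> I" and p: "prob_rows I p" "prob_rows I p'" and G: "site_lip I u \<epsilon> G"
    and c: "\<And>c q. c \<in> S \<Longrightarrow> (\<And>i j. i \<in> spins \<Longrightarrow> j \<in> spins \<Longrightarrow> \<bar>q i - q j\<bar> \<le> \<epsilon> * u i j) \<Longrightarrow>
        \<bar>\<Sum>j\<in>spins. (p c j - p' c j) * q j\<bar> \<le> \<delta>"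
  shows "\<bar>Epr I p G - Epr I (override_on p p' S) G\<bar> \<le> real (card S) * \<delta>"
  using S c
proof (induction S rule: finite_induct)
  case (insert a S)
  let ?p = "override_on p p' S"
  have pr: "prob_rows I ?p" using p by (auto simp: prob_rows_def override_on_def)
  have e: "override_on p p' (insert a S) = ?p(a := p' a)" by (auto simp: override_on_def fun_eq_iff)
  have "?p a = p a" using insert by (simp add: override_on_def)
  then have "\<bar>Epr I ?p G - Epr I (?p(a := p' a)) G\<bar> \<le> \<delta>"
    using insert.prems by (intro Epr_replace_one[OF I _ pr G]) auto
  moreover have "\<bar>Epr I p G - Epr I ?p G\<bar> \<le> real (card S) * \<delta>"
    by (rule insert.IH) (use insert.prems in auto)
  moreover have "real (card (insert a S)) * \<delta> = \<delta> + real (card S) * \<delta>"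
    using insert.hyps by (simp add: distrib_right)
  ultimately show ?case unfolding e by linarith
qed simp

lemma Epr_cong: "(\<And>c. c \<in> I \<Longrightarrow> p c = p' c) \<Longrightarrow> Epr I p G = Epr I p' G"
  unfolding Epr_def by (intro sum.cong refl arg_cong2[where f = "(*)"] prod.cong) auto

text \<open>The spins of one configuration are turned into those of the other one at a time.\<close>

lemma site_lip_osc:
  assumes I: "finite I" and G: "site_lip I u \<epsilon> G" and U: "\<And>i j. i \<in> spins \<Longrightarrow> j \<in> spins \<Longrightarrow> u i j \<le> U"
    and "0 \<le> \<epsilon>" "\<eta> \<in> cfg I" "\<eta>' \<in> cfg I"
  shows "\<bar>G \<eta> - G \<eta>'\<bar> \<le> real (card I) * (\<epsilon> * U)"
proof -
  have "\<bar>G \<eta> - G (override_on \<eta> \<eta>' S)\<bar> \<le> real (card S) * (\<epsilon> * U)" if "finite S" "S \<subseteq> I" for S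
    using that
  proof (induction S rule: finite_induct)
    case (insert a S)
    let ?o = "override_on \<eta> \<eta>' S"
    have a: "a \<in> I" using insert.prems by simp
    have o: "?o \<in> cfg I" using assms(5,6) insert.prems by (auto simp: PiE_iff override_on_def extensional_def)
    have sp: "?o a \<in> spins" "\<eta>' a \<in> spins" using cfg_D[OF o a] cfg_D[OF assms(6) a] .
    have "\<bar>G (?o(a := ?o a)) - G (?o(a := \<eta>' a))\<bar> \<le> \<epsilon> * u (?o a) (\<eta>' a)"
      using G[unfolded site_lip_def] o a sp by blast
    also have "\<dots> \<le> \<epsilon> * U" using U[OF sp] assms(4) by (rule mult_left_mono)
    finally have "\<bar>G ?o - G (?o(a := \<eta>' a))\<bar> \<le> \<epsilon> * U" by simp
    moreover have e: "override_on \<eta> \<eta>' (insert a S) = ?o(a := \<eta>' a)" by (auto simp: override_on_def fun_eq_iff)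
    moreover have "\<bar>G \<eta> - G ?o\<bar> \<le> real (card S) * (\<epsilon> * U)" using insert by simp
    moreover have "real (card (insert a S)) * (\<epsilon> * U) = \<epsilon> * U + real (card S) * (\<epsilon> * U)"
      using insert.hyps by (simp add: distrib_right)
    ultimately show ?case unfolding e by linarith
  qed simp
  from this[OF I] have "\<bar>G \<eta> - G (override_on \<eta> \<eta>' I)\<bar> \<le> real (card I) * (\<epsilon> * U)" by simp
  moreover have "override_on \<eta> \<eta>' I = \<eta>'"
    using assms(5,6) by (auto simp: override_on_def fun_eq_iff PiE_iff extensional_def)
  ultimately show ?thesis by simp
qed

section \<open>Outwards: Lipschitz functions along the chain\<close>

context tisgm
begin

abbreviation Ex' :: "nat \<Rightarrow> (('v \<Rightarrow> nat) \<Rightarrow> real) \<Rightarrow> real" where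
  "Ex' n g \<equiv> \<Sum>\<tau>\<in>cfg (V n). pr n \<tau> * g \<tau>"

definition down :: "nat \<Rightarrow> (('v \<Rightarrow> nat) \<Rightarrow> real) \<Rightarrow> ('v \<Rightarrow> nat) \<Rightarrow> real" where
  "down n G \<zeta> = Epr (W (Suc n)) (\<lambda>c. tmat \<theta> e (\<zeta> (par c))) G"

lemma down_restrict: "down n G (restrict \<zeta> (W n)) = down n G \<zeta>"
proof -
  have "(\<Prod>c\<in>W (Suc n). tmat \<theta> e (restrict \<zeta> (W n) (par c)) (\<eta> c)) = (\<Prod>c\<in>W (Suc n). tmat \<theta> e (\<zeta> (par c)) (\<eta> c))" for \<eta>
    by (rule prod.cong) (auto simp: lev_Suc_iff)
  then show ?thesis by (simp add: down_def Epr_def del: restrict_apply)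
qed

lemma Ex_down:
  assumes "dep n A"
  shows "Ex' (Suc n) (\<lambda>\<tau>. A \<tau> * G (restrict \<tau> (W (Suc n)))) = Ex' n (\<lambda>\<tau>. A \<tau> * down n G \<tau>)"
proof -
  have "Ex' (Suc n) (\<lambda>\<tau>. A \<tau> * G (restrict \<tau> (W (Suc n))))
      = Ex' (Suc n) (\<lambda>\<tau>. A (restrict \<tau> (V n)) * G (restrict \<tau> (W (Suc n))))"
    using assms by (simp add: dep_def[OF \<theta>_pos'])
  also have "\<dots> = Ex' n (\<lambda>\<tau>. A \<tau> * down n G \<tau>)"
    unfolding down_def Epr_def sum_distrib_left[of "A _"]
    using sum_pr_Suc[of n "\<lambda>\<zeta> \<eta>. A \<zeta> * G \<eta>"] by (simp add: mult.left_commute cong: sum.cong)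
  finally show ?thesis .
qed

text \<open>The spin at \<open>v\<close> enters only the laws of its two children, and each of the
  two exchanges costs a factor \<kappa>.\<close>

lemma site_lip_down:
  assumes dc: "down_contraction (tmat \<theta> e) u \<kappa>" and \<epsilon>: "0 < \<epsilon>" and G: "site_lip (W (Suc (Suc n))) u \<epsilon> G"
  shows "site_lip (W (Suc n)) u (2 * \<kappa> * \<epsilon>) (down (Suc n) G)"
  unfolding site_lip_def
proof (intro ballI)
  fix \<eta> v s s'
  assume \<eta>: "\<eta> \<in> cfg (W (Suc n))" and v: "v \<in> W (Suc n)" and s: "s \<in> spins" "s' \<in> spins"
  let ?I = "W (Suc (Suc n))"
  let ?p = "\<lambda>s c. tmat \<theta> e ((\<eta>(v := s)) (par c))"
  have sub: "ch v \<subseteq> ?I" using v by (auto simp: lev_Suc_iff[of _ "Suc n"])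
  have pr: "prob_rows ?I (?p s)" if "s \<in> spins" for s
    using trans_pos trans_sum by (auto simp: prob_rows_def less_imp_le)
  have "\<bar>Epr ?I (?p s) G - Epr ?I (override_on (?p s) (?p s') (ch v)) G\<bar> \<le> real (card (ch v)) * (\<kappa> * \<epsilon> * u s s')"
  proof (rule Epr_replace[OF finite_W finite_ch sub pr pr G])
    fix c q assume c: "c \<in> ch v" and q: "\<And>i j. i \<in> spins \<Longrightarrow> j \<in> spins \<Longrightarrow> \<bar>q i - q j\<bar> \<le> \<epsilon> * u i j"
    show "\<bar>\<Sum>j\<in>spins. (?p s c j - ?p s' c j) * q j\<bar> \<le> \<kappa> * \<epsilon> * u s s'"
      using down_contraction_scaled[OF dc \<epsilon> q s] c by simp
  qed (use s in auto)
  moreover have "Epr ?I (override_on (?p s) (?p s') (ch v)) G = Epr ?I (?p s') G"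
  proof (rule Epr_cong)
    fix c assume "c \<in> ?I"
    then have "c \<noteq> x0" by auto
    then show "override_on (?p s) (?p s') (ch v) c = ?p s' c" by (auto simp: override_on_def)
  qed
  moreover have "card (ch v) = 2" using v by (auto simp: card_ch)
  ultimately show "\<bar>down (Suc n) G (\<eta>(v := s)) - down (Suc n) G (\<eta>(v := s'))\<bar> \<le> 2 * \<kappa> * \<epsilon> * u s s'"
    by (simp add: down_def mult.assoc)
qed

text \<open>\<open>G'\<close> is the conditional expectation of \<open>G\<close> given sphere
  \<open>Suc m\<close>. It is characterised by its pairing with functions of the ball, which is all
  that the variance bound asks for.\<close>

lemma down_iterate:
  assumes dc: "down_contraction (tmat \<theta> e) u \<kappa>" and \<kappa>: "0 < \<kappa>"
  shows "0 < \<epsilon> \<Longrightarrow> site_lip (W (Suc m + k)) u \<epsilon> G \<Longrightarrow>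
    \<exists>G'. site_lip (W (Suc m)) u ((2 * \<kappa>) ^ k * \<epsilon>) G' \<and>
      (\<forall>A. dep (Suc m) A \<longrightarrow> Ex' (Suc m + k) (\<lambda>\<tau>. A \<tau> * G (restrict \<tau> (W (Suc m + k))))
         = Ex' (Suc m) (\<lambda>\<tau>. A \<tau> * G' (restrict \<tau> (W (Suc m)))))"
proof (induction k arbitrary: \<epsilon> G)
  case 0
  then show ?case by (intro exI[of _ G]) auto
next
  case (Suc k)
  have "site_lip (W (Suc m + k)) u (2 * \<kappa> * \<epsilon>) (down (Suc m + k) G)"
    using site_lip_down[OF dc Suc.prems(1), of "m + k" G] Suc.prems(2) by simp
  moreover have "0 < 2 * \<kappa> * \<epsilon>" using \<kappa> Suc.prems(1) by simp
  ultimately obtain G' where G': "site_lip (W (Suc m)) u ((2 * \<kappa>) ^ k * (2 * \<kappa> * \<epsilon>)) G'"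
    "\<forall>A. dep (Suc m) A \<longrightarrow> Ex' (Suc m + k) (\<lambda>\<tau>. A \<tau> * down (Suc m + k) G (restrict \<tau> (W (Suc m + k))))
         = Ex' (Suc m) (\<lambda>\<tau>. A \<tau> * G' (restrict \<tau> (W (Suc m))))"
    using Suc.IH by blast
  have "Ex' (Suc m + Suc k) (\<lambda>\<tau>. A \<tau> * G (restrict \<tau> (W (Suc m + Suc k))))
      = Ex' (Suc m) (\<lambda>\<tau>. A \<tau> * G' (restrict \<tau> (W (Suc m))))" if A: "dep (Suc m) A" for A
  proof -
    have "dep (Suc m + k) A" using A by (rule dep_mono[OF \<theta>_pos']) simp
    from Ex_down[OF this, of G]
    have "Ex' (Suc m + Suc k) (\<lambda>\<tau>. A \<tau> * G (restrict \<tau> (W (Suc m + Suc k))))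
        = Ex' (Suc m + k) (\<lambda>\<tau>. A \<tau> * down (Suc m + k) G \<tau>)" by (simp only: add_Suc_right)
    also have "\<dots> = Ex' (Suc m + k) (\<lambda>\<tau>. A \<tau> * down (Suc m + k) G (restrict \<tau> (W (Suc m + k))))"
      by (simp only: down_restrict)
    also have "\<dots> = Ex' (Suc m) (\<lambda>\<tau>. A \<tau> * G' (restrict \<tau> (W (Suc m))))"
      using G'(2) A by blast
    finally show ?thesis .
  qed
  moreover have "site_lip (W (Suc m)) u ((2 * \<kappa>) ^ Suc k * \<epsilon>) G'"
    using G'(1) by (simp only: power_Suc mult_ac)
  ultimately show ?case by blast
qed

end

section \<open>Conditional probabilities given a sphere, and their variance\<close>

context tisgm
begin

abbreviation "N\<theta> \<equiv> Nf \<theta>"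
abbreviation "Q\<theta> \<equiv> Qf \<theta>"

text \<open>Off the sphere the pinned value 0 is a default; it makes the field admissible at every
  vertex.\<close>

definition bd :: "nat \<Rightarrow> ('v \<Rightarrow> nat) \<Rightarrow> 'v \<Rightarrow> nat \<Rightarrow> real" where
  "bd n \<eta> = (\<lambda>v. dl (if v \<in> W n then \<eta> v else 0))"

lemma fld_bd: "\<eta> \<in> cfg (W n) \<Longrightarrow> fld (bd n \<eta>)"
  unfolding fld_def[OF \<theta>_pos'] bd_def dl_def by (auto simp: PiE_iff)

lemma bd_upd: "v \<in> W n \<Longrightarrow> bd n (\<eta>(v := s)) = (bd n \<eta>)(v := dl s)"
  by (auto simp: bd_def fun_eq_iff)

lemma Nf_bd:
  assumes \<eta>: "\<eta> \<in> cfg (W n)"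
  shows "N\<theta> n (bd n \<eta>) g = (\<Sum>\<sigma>\<in>cfg (V n). if restrict \<sigma> (W n) = \<eta> then g \<sigma> * edgew \<theta> (V n - {x0}) \<sigma> else 0)"
  unfolding Nf_def[OF \<theta>_pos']
proof (rule sum.cong[OF refl])
  fix \<sigma> assume "\<sigma> \<in> cfg (V n)"
  have eq: "restrict \<sigma> (W n) = \<eta> \<longleftrightarrow> (\<forall>v\<in>W n. \<sigma> v = \<eta> v)"
    using \<eta> by (auto simp: fun_eq_iff PiE_iff extensional_def)
  show "g \<sigma> * edgew \<theta> (V n - {x0}) \<sigma> * (\<Prod>v\<in>W n. bd n \<eta> v (\<sigma> v))
      = (if restrict \<sigma> (W n) = \<eta> then g \<sigma> * edgew \<theta> (V n - {x0}) \<sigma> else 0)"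
  proof (cases "\<forall>v\<in>W n. \<sigma> v = \<eta> v")
    case True
    then have "(\<Prod>v\<in>W n. bd n \<eta> v (\<sigma> v)) = 1" by (intro prod.neutral ballI) (simp add: bd_def dl_def)
    then show ?thesis using True unfolding eq by simp
  next
    case False
    then obtain v where "v \<in> W n" "\<sigma> v \<noteq> \<eta> v" by blast
    then have "(\<Prod>v\<in>W n. bd n \<eta> v (\<sigma> v)) = 0"
      by (intro prod_zero[OF finite_W] bexI[of _ v]) (simp_all add: bd_def dl_def)
    then show ?thesis using False unfolding eq by (simp only: mult_zero_right if_False)
  qed
qed

lemma Ex_boundary:
  "\<exists>K. \<forall>g H. Ex' (Suc n) (\<lambda>\<tau>. g \<tau> * H (restrict \<tau> (W (Suc n))))
    = (\<Sum>\<eta>\<in>cfg (W (Suc n)). K * (\<Prod>v\<in>W (Suc n). e (\<eta> v)) * H \<eta> * N\<theta> (Suc n) (bd (Suc n) \<eta>) g)"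
proof -
  let ?W = "W (Suc n)" and ?V = "V (Suc n)"
  obtain K where K: "\<forall>\<tau>\<in>cfg ?V. pr (Suc n) \<tau> = K * edgew \<theta> (?V - {x0}) \<tau> * (\<Prod>v\<in>?W. e (\<tau> v))"
    using pr_edgew[of n] by blast
  have "Ex' (Suc n) (\<lambda>\<tau>. g \<tau> * H (restrict \<tau> ?W))
      = (\<Sum>\<eta>\<in>cfg ?W. K * (\<Prod>v\<in>?W. e (\<eta> v)) * H \<eta> * N\<theta> (Suc n) (bd (Suc n) \<eta>) g)" for g H
  proof -
    let ?t = "\<lambda>\<eta> \<sigma>. K * (\<Prod>v\<in>?W. e (\<eta> v)) * H \<eta> * (g \<sigma> * edgew \<theta> (?V - {x0}) \<sigma>)"
    have "Ex' (Suc n) (\<lambda>\<tau>. g \<tau> * H (restrict \<tau> ?W))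
        = (\<Sum>\<sigma>\<in>cfg ?V. \<Sum>\<eta>\<in>cfg ?W. if restrict \<sigma> ?W = \<eta> then ?t \<eta> \<sigma> else 0)"
    proof (rule sum.cong[OF refl])
      fix \<sigma> assume s: "\<sigma> \<in> cfg ?V"
      have r: "restrict \<sigma> ?W \<in> cfg ?W" using s by (rule restrict_cfg) auto
      have "(\<Sum>\<eta>\<in>cfg ?W. if restrict \<sigma> ?W = \<eta> then ?t \<eta> \<sigma> else 0) = ?t (restrict \<sigma> ?W) \<sigma>"
        using r by (subst sum.delta') (simp_all only: finite_cfg finite_W if_True)
      moreover have "(\<Prod>v\<in>?W. e (restrict \<sigma> ?W v)) = (\<Prod>v\<in>?W. e (\<sigma> v))" by (rule prod.cong) auto
      ultimately show "pr (Suc n) \<sigma> * (g \<sigma> * H (restrict \<sigma> ?W))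
          = (\<Sum>\<eta>\<in>cfg ?W. if restrict \<sigma> ?W = \<eta> then ?t \<eta> \<sigma> else 0)"
        unfolding K[rule_format, OF s] by (simp only: mult_ac)
    qed
    also have "\<dots> = (\<Sum>\<eta>\<in>cfg ?W. \<Sum>\<sigma>\<in>cfg ?V. if restrict \<sigma> ?W = \<eta> then ?t \<eta> \<sigma> else 0)" by (rule sum.swap)
    also have "\<dots> = (\<Sum>\<eta>\<in>cfg ?W. K * (\<Prod>v\<in>?W. e (\<eta> v)) * H \<eta> * N\<theta> (Suc n) (bd (Suc n) \<eta>) g)"
    proof (rule sum.cong[OF refl])
      fix \<eta> assume "\<eta> \<in> cfg ?W"
      show "(\<Sum>\<sigma>\<in>cfg ?V. if restrict \<sigma> ?W = \<eta> then ?t \<eta> \<sigma> else 0)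
          = K * (\<Prod>v\<in>?W. e (\<eta> v)) * H \<eta> * N\<theta> (Suc n) (bd (Suc n) \<eta>) g"
        unfolding Nf_bd[OF \<open>\<eta> \<in> cfg ?W\<close>] sum_distrib_left
      proof (rule sum.cong[OF refl])
        fix \<sigma>
        show "(if restrict \<sigma> ?W = \<eta> then ?t \<eta> \<sigma> else 0) = K * (\<Prod>v\<in>?W. e (\<eta> v)) * H \<eta> *
            (if restrict \<sigma> ?W = \<eta> then g \<sigma> * edgew \<theta> (?V - {x0}) \<sigma> else 0)"
          by (cases "restrict \<sigma> ?W = \<eta>") (simp_all del: W_iff V_iff restrict_apply)
      qed
    qed
    finally show ?thesis .
  qed
  then show ?thesis by blast
qed

text \<open>For a fixed boundary configuration the chain weighs the interior by its edge weights up
  to a constant. So \<open>Qf\<close> with pinned boundary is the conditional expectation given the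
  sphere.\<close>

lemma Ex_Q:
  "Ex' (Suc n) (\<lambda>\<tau>. g \<tau> * H (restrict \<tau> (W (Suc n))))
   = Ex' (Suc n) (\<lambda>\<tau>. 1 * (Q\<theta> (Suc n) (bd (Suc n) (restrict \<tau> (W (Suc n)))) g * H (restrict \<tau> (W (Suc n)))))"
proof -
  let ?W = "W (Suc n)"
  obtain K where K: "\<And>g H. Ex' (Suc n) (\<lambda>\<tau>. g \<tau> * H (restrict \<tau> ?W))
    = (\<Sum>\<eta>\<in>cfg ?W. K * (\<Prod>v\<in>?W. e (\<eta> v)) * H \<eta> * N\<theta> (Suc n) (bd (Suc n) \<eta>) g)"
    using Ex_boundary[of n] by blast
  have "Ex' (Suc n) (\<lambda>\<tau>. g \<tau> * H (restrict \<tau> ?W))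
      = (\<Sum>\<eta>\<in>cfg ?W. K * (\<Prod>v\<in>?W. e (\<eta> v)) * (Q\<theta> (Suc n) (bd (Suc n) \<eta>) g * H \<eta>) * N\<theta> (Suc n) (bd (Suc n) \<eta>) (\<lambda>_. 1))"
    unfolding K
  proof (rule sum.cong[OF refl])
    fix \<eta> assume h: "\<eta> \<in> cfg ?W"
    have "N\<theta> (Suc n) (bd (Suc n) \<eta>) g = Q\<theta> (Suc n) (bd (Suc n) \<eta>) g * N\<theta> (Suc n) (bd (Suc n) \<eta>) (\<lambda>_. 1)"
      using Nf_pos[OF \<theta>_pos' fld_bd[OF h], of "Suc n"] by (simp add: Qf_def[OF \<theta>_pos'])
    then show "K * (\<Prod>v\<in>?W. e (\<eta> v)) * H \<eta> * N\<theta> (Suc n) (bd (Suc n) \<eta>) g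
        = K * (\<Prod>v\<in>?W. e (\<eta> v)) * (Q\<theta> (Suc n) (bd (Suc n) \<eta>) g * H \<eta>) * N\<theta> (Suc n) (bd (Suc n) \<eta>) (\<lambda>_. 1)"
      by simp
  qed
  also have "\<dots> = Ex' (Suc n) (\<lambda>\<tau>. 1 * (Q\<theta> (Suc n) (bd (Suc n) (restrict \<tau> ?W)) g * H (restrict \<tau> ?W)))"
    by (rule K[of "\<lambda>_. 1" "\<lambda>\<eta>. Q\<theta> (Suc n) (bd (Suc n) \<eta>) g * H \<eta>", symmetric])
  finally show ?thesis .
qed

definition cind :: "nat \<Rightarrow> ('v \<Rightarrow> nat) \<Rightarrow> ('v \<Rightarrow> nat) \<Rightarrow> real" where
  "cind m \<tau> \<sigma> = (if restrict \<sigma> (V m) = \<tau> then 1 else 0)"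

lemma dep_cind: "dep m (cind m \<tau>)"
  by (simp add: dep_def[OF \<theta>_pos'] cind_def)

lemma sum_override:
  assumes w: "\<omega> \<in> space config_space" and d: "\<And>\<sigma>. \<phi> (restrict \<sigma> (V (Suc n))) = \<phi> \<sigma>"
  shows "(\<Sum>\<zeta>\<in>cfg (V n). \<phi> (override_on \<omega> \<zeta> (V n)))
    = (\<Sum>\<sigma>\<in>cfg (V (Suc n)). if restrict \<sigma> (W (Suc n)) = restrict \<omega> (W (Suc n)) then \<phi> \<sigma> else (0::real))"
proof -
  let ?V = "V (Suc n)" and ?W = "W (Suc n)"
  have "(\<Sum>\<zeta>\<in>cfg (V n). \<phi> (override_on \<omega> \<zeta> (V n))) = (\<Sum>\<sigma>\<in>{\<sigma> \<in> cfg ?V. restrict \<sigma> ?W = restrict \<omega> ?W}. \<phi> \<sigma>)"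
  proof (rule sum.reindex_bij_witness[where i = "\<lambda>\<sigma>. restrict \<sigma> (V n)" and j = "\<lambda>\<zeta>. restrict (override_on \<omega> \<zeta> (V n)) ?V"])
    fix \<zeta> assume z: "\<zeta> \<in> cfg (V n)"
    show "restrict (restrict (override_on \<omega> \<zeta> (V n)) ?V) (V n) = \<zeta>"
      using z by (auto simp: fun_eq_iff override_on_def PiE_iff extensional_def)
    show "restrict (override_on \<omega> \<zeta> (V n)) ?V \<in> {\<sigma> \<in> cfg ?V. restrict \<sigma> ?W = restrict \<omega> ?W}"
      using z w by (auto simp: fun_eq_iff override_on_def PiE_iff space_config)
    show "\<phi> (restrict (override_on \<omega> \<zeta> (V n)) ?V) = \<phi> (override_on \<omega> \<zeta> (V n))" by (rule d)
  next
    fix \<sigma> assume s: "\<sigma> \<in> {\<sigma> \<in> cfg ?V. restrict \<sigma> ?W = restrict \<omega> ?W}"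
    show "restrict \<sigma> (V n) \<in> cfg (V n)" using s by (intro restrict_cfg[of \<sigma> ?V]) auto
    show "restrict (override_on \<omega> (restrict \<sigma> (V n)) (V n)) ?V = \<sigma>"
    proof (rule ext)
      fix v
      consider "v \<in> V n" | "v \<in> ?W" | "v \<notin> ?V" using V_Suc by blast
      then show "restrict (override_on \<omega> (restrict \<sigma> (V n)) (V n)) ?V v = \<sigma> v"
      proof cases
        case 1
        then show ?thesis by simp
      next
        case 2
        have "restrict \<sigma> ?W v = restrict \<omega> ?W v" using s by simp
        then show ?thesis using 2 by simp
      next
        case 3
        then have "\<sigma> v = undefined" using s PiE_arb by fastforce
        then show ?thesis using 3 by (simp only: restrict_apply if_False)
      qed
    qed
  qed
  also have "\<dots> = (\<Sum>\<sigma>\<in>cfg ?V. if restrict \<sigma> ?W = restrict \<omega> ?W then \<phi> \<sigma> else 0)"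
    by (rule sum.inter_filter) simp
  finally show ?thesis .
qed

text \<open>The edges that meet \<open>V n\<close> are those of \<open>V (Suc n)\<close>, and the
  sphere in between is the boundary condition. Through this identity the DLR equations of any Gibbs
  measure involve the same function of the sphere as the chain.\<close>

lemma kern_Q:
  assumes \<theta>: "\<theta> = exp (J * \<beta>)" and w: "\<omega> \<in> space config_space" and mn: "m \<le> n"
  shows "kern J \<beta> (V n) \<omega> (cyl (V m) \<tau>) = Q\<theta> (Suc n) (bd (Suc n) (restrict \<omega> (W (Suc n)))) (cind m \<tau>)"
proof -
  let ?W = "W (Suc n)" and ?V = "V (Suc n)"
  let ?\<eta> = "restrict \<omega> ?W"
  have h: "?\<eta> \<in> cfg ?W" by (rule restrict_space_cfg[OF w])
  have N: "N\<theta> (Suc n) (bd (Suc n) ?\<eta>) g = (\<Sum>\<zeta>\<in>cfg (V n). g (override_on \<omega> \<zeta> (V n)) * edgew \<theta> (?V - {x0}) (override_on \<omega> \<zeta> (V n)))"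
    if g: "dep (Suc n) g" for g
    unfolding Nf_bd[OF h]
  proof (rule sum_override[symmetric, OF w])
    fix \<sigma>
    show "g (restrict \<sigma> ?V) * edgew \<theta> (?V - {x0}) (restrict \<sigma> ?V) = g \<sigma> * edgew \<theta> (?V - {x0}) \<sigma>"
      using g edgew_restrict[OF \<theta>_pos' order_refl, of "Suc n" \<sigma>] by (simp add: dep_def[OF \<theta>_pos'])
  qed
  have d: "dep (Suc n) (cind m \<tau>)" using dep_cind by (rule dep_mono[OF \<theta>_pos']) (use mn in simp)
  have ind: "indicator (cyl (V m) \<tau>) (override_on \<omega> \<zeta> (V n)) = cind m \<tau> (override_on \<omega> \<zeta> (V n))"
    if "\<zeta> \<in> cfg (V n)" for \<zeta>
    using override_space[OF w that] by (simp add: cyl_def cind_def indicator_def)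
  have "kern J \<beta> (V n) \<omega> (cyl (V m) \<tau>)
      = (\<Sum>\<zeta>\<in>cfg (V n). cind m \<tau> (override_on \<omega> \<zeta> (V n)) * edgew \<theta> (?V - {x0}) (override_on \<omega> \<zeta> (V n))) / knorm \<theta> (V n) \<omega>"
    unfolding kern_eq[OF \<theta> finite_V] touch_V sum_divide_distrib
    by (rule sum.cong[OF refl]) (simp add: ind)
  also have "\<dots> = Q\<theta> (Suc n) (bd (Suc n) ?\<eta>) (cind m \<tau>)"
    unfolding Qf_def[OF \<theta>_pos'] N[OF d] N[OF dep_const[OF \<theta>_pos']] knorm_def[OF \<theta>] touch_V by simp
  finally show ?thesis .
qed

text \<open>The variance equals p times (G'(\<tau>) - p), where G' is the descent of the conditional
  probability to the inner sphere and p is its mean. The difference is at most the oscillation of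
  G', and each of the layers outside the ball has contributed one factor \<gamma> inwards and one
  factor 2 \<kappa> outwards, up to a fixed number of layers.\<close>

lemma Q_variance:
  fixes m k :: nat
  assumes up: "up_contraction \<theta> u \<gamma>" and dc: "down_contraction (tmat \<theta> e) u \<kappa>"
    and pos: "0 < \<gamma>" "0 < \<kappa>"
    and u: "\<And>i j. i \<in> spins \<Longrightarrow> j \<in> spins \<Longrightarrow> 0 \<le> u i j" "\<And>i j. i \<in> spins \<Longrightarrow> j \<in> spins \<Longrightarrow> u i j \<le> U"
      "\<And>i j. i \<in> spins \<Longrightarrow> j \<in> spins \<Longrightarrow> i \<noteq> j \<Longrightarrow> 1 \<le> u i j"
    and \<tau>: "\<tau> \<in> cfg (V (Suc m))"
  defines "n \<equiv> Suc m + k"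
  shows "Ex' (Suc n) (\<lambda>\<sigma>. (Q\<theta> (Suc n) (bd (Suc n) (restrict \<sigma> (W (Suc n)))) (cind (Suc m) \<tau>) - pr (Suc m) \<tau>)^2)
    \<le> real (card (W (Suc m))) * (((2 * \<kappa>) ^ Suc k * \<gamma> ^ k) * U)"
proof -
  let ?W = "W (Suc n)" and ?g = "cind (Suc m) \<tau>"
  let ?p = "pr (Suc m) \<tau>"
  define G where "G = (\<lambda>\<eta>. Q\<theta> (Suc n) (bd (Suc n) \<eta>) ?g)"
  have g01: "0 \<le> ?g \<sigma>" "?g \<sigma> \<le> 1" for \<sigma> by (simp_all add: cind_def)
  have "site_lip ?W u (\<gamma> ^ k) G"
    unfolding site_lip_def
  proof (intro ballI)
    fix \<eta> v s s' assume h: "\<eta> \<in> cfg ?W" and v: "v \<in> ?W" and s: "s \<in> spins" "s' \<in> spins"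
    have "\<bar>Q\<theta> (Suc (Suc m + k)) ((bd (Suc n) \<eta>)(v := dl s)) ?g - Q\<theta> (Suc (Suc m + k)) ((bd (Suc n) \<eta>)(v := dl s')) ?g\<bar> \<le> \<gamma> ^ k * u s s'"
      by (rule leaf_influence[OF \<theta>_pos' up pos(1) u(1) u(3) dep_cind g01 fld_bd[OF h] _ s]) (use v in \<open>auto simp only: n_def\<close>)
    then show "\<bar>G (\<eta>(v := s)) - G (\<eta>(v := s'))\<bar> \<le> \<gamma> ^ k * u s s'"
      unfolding G_def n_def bd_upd[OF v[unfolded n_def]] .
  qed
  then have "site_lip (W (Suc m + Suc k)) u (\<gamma> ^ k) G" by (simp only: n_def add_Suc_right)
  from down_iterate[OF dc pos(2) _ this] obtain G' where
    G': "site_lip (W (Suc m)) u ((2 * \<kappa>) ^ Suc k * \<gamma> ^ k) G'"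
    "\<And>A. dep (Suc m) A \<Longrightarrow> Ex' (Suc n) (\<lambda>\<tau>. A \<tau> * G (restrict \<tau> ?W)) = Ex' (Suc m) (\<lambda>\<tau>. A \<tau> * G' (restrict \<tau> (W (Suc m))))"
    using pos(1) unfolding n_def by (auto simp only: add_Suc_right zero_less_power)
  have Eg: "Ex' (Suc m) (\<lambda>\<sigma>. ?g \<sigma> * H \<sigma>) = ?p * H \<tau>" for H
  proof -
    have "Ex' (Suc m) (\<lambda>\<sigma>. ?g \<sigma> * H \<sigma>) = (\<Sum>\<sigma>\<in>cfg (V (Suc m)). if \<sigma> = \<tau> then ?p * H \<tau> else 0)"
    proof (rule sum.cong[OF refl])
      fix \<sigma> assume "\<sigma> \<in> cfg (V (Suc m))"
      then have "restrict \<sigma> (V (Suc m)) = \<sigma>" by (intro PiE_restrict)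
      then show "pr (Suc m) \<sigma> * (?g \<sigma> * H \<sigma>) = (if \<sigma> = \<tau> then ?p * H \<tau> else 0)" by (simp add: cind_def)
    qed
    then show ?thesis using \<tau> by (simp only: sum.delta finite_cfg finite_V if_True)
  qed
  have E1: "Ex' (Suc n) (\<lambda>\<sigma>. G (restrict \<sigma> ?W)) = ?p"
  proof -
    have "Ex' (Suc n) (\<lambda>\<sigma>. G (restrict \<sigma> ?W)) = Ex' (Suc n) (\<lambda>\<sigma>. ?g \<sigma> * 1)"
      using Ex_Q[of n ?g "\<lambda>_. 1"] by (simp add: G_def)
    also have "\<dots> = measure chain_measure (cyl (V (Suc m)) \<tau>)"
    proof -
      have "Ex' (Suc n) (\<lambda>\<sigma>. ?g \<sigma> * 1) = (\<integral>\<omega>. ?g \<omega> \<partial>chain_measure)"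
        using dep_mono[OF \<theta>_pos' dep_cind, of "Suc m" "Suc n" \<tau>] chain_integral[of ?g "Suc n"]
        by (simp add: dep_def[OF \<theta>_pos'] n_def)
      also have "\<dots> = (\<integral>\<omega>. indicator (cyl (V (Suc m)) \<tau>) \<omega> \<partial>chain_measure)"
        by (rule Bochner_Integration.integral_cong) (auto simp: cyl_def cind_def indicator_def)
      finally show ?thesis by simp
    qed
    finally show ?thesis using chain_measure(2)[OF \<tau>] by simp
  qed
  \<comment> \<open>\<open>G\<close> on the sphere is the conditional expectation of the indicator
    \<open>?g\<close>, so its second moment is the mean of \<open>?g\<close> times \<open>G\<close>,
    to which the descent applies.\<close>
  have E2: "Ex' (Suc n) (\<lambda>\<sigma>. G (restrict \<sigma> ?W) ^ 2) = ?p * G' (restrict \<tau> (W (Suc m)))"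
    using Ex_Q[of n ?g G] G'(2)[OF dep_cind] Eg[of "\<lambda>\<sigma>. G' (restrict \<sigma> (W (Suc m)))"]
    by (simp add: G_def power2_eq_square)
  have E3: "Ex' (Suc m) (\<lambda>\<sigma>. G' (restrict \<sigma> (W (Suc m)))) = ?p"
    using G'(2)[OF dep_const[OF \<theta>_pos', where c = 1]] E1 by simp
  have p: "0 < ?p" by (rule pr_pos[OF \<tau>])
  have p1: "?p \<le> 1" using chain_measure(2)[OF \<tau>] C.prob_le_1 by metis
  let ?B = "real (card (W (Suc m))) * (((2 * \<kappa>) ^ Suc k * \<gamma> ^ k) * U)"
  have "G' (restrict \<tau> (W (Suc m))) - ?p = Ex' (Suc m) (\<lambda>\<sigma>. G' (restrict \<tau> (W (Suc m))) - G' (restrict \<sigma> (W (Suc m))))"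
    by (simp only: right_diff_distrib sum_subtractf E3 sum_distrib_right[symmetric] sum_pr mult_1)
  also have "\<dots> \<le> Ex' (Suc m) (\<lambda>\<sigma>. ?B)"
  proof (rule sum_mono)
    fix \<sigma> assume s: "\<sigma> \<in> cfg (V (Suc m))"
    have "restrict \<tau> (W (Suc m)) \<in> cfg (W (Suc m))" "restrict \<sigma> (W (Suc m)) \<in> cfg (W (Suc m))"
      using W_sub_V[of "Suc m" "Suc m"] by (auto intro!: restrict_cfg[OF \<tau>] restrict_cfg[OF s] simp del: restrict_PiE)
    then have "\<bar>G' (restrict \<tau> (W (Suc m))) - G' (restrict \<sigma> (W (Suc m)))\<bar> \<le> ?B"
      using pos by (intro site_lip_osc[OF finite_W G'(1) u(2)]) auto
    then show "pr (Suc m) \<sigma> * (G' (restrict \<tau> (W (Suc m))) - G' (restrict \<sigma> (W (Suc m)))) \<le> pr (Suc m) \<sigma> * ?B"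
      using pr_pos[OF s] by (intro mult_left_mono) linarith+
  qed
  also have "\<dots> = ?B" by (simp only: sum_distrib_right[symmetric] sum_pr mult_1)
  finally have osc: "G' (restrict \<tau> (W (Suc m))) - ?p \<le> ?B" .
  have B0: "0 \<le> ?B" using pos u(1)[of 0 0] u(2)[of 0 0] by (intro mult_nonneg_nonneg) auto
  have "Ex' (Suc n) (\<lambda>\<sigma>. (G (restrict \<sigma> ?W) - ?p)^2)
      = Ex' (Suc n) (\<lambda>\<sigma>. G (restrict \<sigma> ?W)^2) - 2 * ?p * Ex' (Suc n) (\<lambda>\<sigma>. G (restrict \<sigma> ?W)) + ?p^2 * Ex' (Suc n) (\<lambda>_. 1)"
    unfolding sum_distrib_left sum_subtractf[symmetric] sum.distrib[symmetric]
    by (rule sum.cong[OF refl]) (simp add: power2_eq_square algebra_simps)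
  also have "\<dots> = ?p * (G' (restrict \<tau> (W (Suc m))) - ?p)"
    unfolding E1 E2 using sum_pr[of "Suc n"] by (simp add: power2_eq_square algebra_simps)
  also have "\<dots> \<le> ?p * ?B" using osc p by (intro mult_left_mono) auto
  also have "\<dots> \<le> ?B" using B0 p1 p by (intro mult_left_le_one_le) auto
  finally show ?thesis unfolding G_def .
qed

text \<open>The DLR equation in a large ball writes \<nu> of a cylinder as the \<nu>-mean of a
  function that is nearly constant under the chain. Domination by a multiple of the chain transfers
  this to \<nu>, so \<nu> has the marginals of the chain.\<close>

lemma extreme_criterion:
  assumes \<theta>: "\<theta> = exp (J * \<beta>)"
    and up: "up_contraction \<theta> u \<gamma>" and dc: "down_contraction (tmat \<theta> e) u \<kappa>"
    and pos: "0 < \<gamma>" "0 < \<kappa>" and lt: "2 * \<kappa> * \<gamma> < 1"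
    and u: "\<And>i j. i \<in> spins \<Longrightarrow> j \<in> spins \<Longrightarrow> 0 \<le> u i j"
      "\<And>i j. i \<in> spins \<Longrightarrow> j \<in> spins \<Longrightarrow> i \<noteq> j \<Longrightarrow> 1 \<le> u i j"
  shows "extreme_gibbs J \<beta> L chain_measure"
proof -
  define U where "U = Max ((\<lambda>(i, j). u i j) ` (spins \<times> spins))"
  have U: "u i j \<le> U" if "i \<in> spins" "j \<in> spins" for i j
    unfolding U_def using that by (intro Max_ge) auto
  \<comment> \<open>Both components of a convex decomposition are dominated by a multiple of the
    chain, so it suffices to identify each dominated Gibbs measure.\<close>
  have key: "\<nu> = chain_measure"
    if g: "gibbs_measure J \<beta> L \<nu>" and t: "0 < t"
      and dom: "\<And>A. A \<in> sets config_space \<Longrightarrow> t * measure \<nu> A \<le> measure chain_measure A" for \<nu> t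
  proof -
    have c: "config_prob \<nu>" using g by (simp add: gibbs_measure_iff[OF \<theta>])
    interpret \<nu>: config_prob \<nu> by (rule c)
    show ?thesis
    proof (rule chain_measure_eqI[OF c, of 1])
      fix M \<tau> assume "1 \<le> M" and \<tau>': "\<tau> \<in> cfg (V M)"
      then obtain m where M: "M = Suc m" by (cases M) auto
      have \<tau>: "\<tau> \<in> cfg (V (Suc m))" using \<tau>' M by simp
      let ?p = "pr (Suc m) \<tau>" and ?C = "cyl (V (Suc m)) \<tau>"
      define B where "B = real (card (W (Suc m))) * (2 * \<kappa> * U)"
      have bound: "\<bar>\<nu>.prob ?C - ?p\<bar> \<le> (\<delta> + B * (2 * \<kappa> * \<gamma>) ^ k / \<delta>) / t" if d: "0 < \<delta>" for \<delta> k
      proof -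
        define n where "n = Suc m + k"
        let ?W = "W (Suc n)"
        define G where "G = (\<lambda>\<eta>. Q\<theta> (Suc n) (bd (Suc n) \<eta>) (cind (Suc m) \<tau>))"
        have "\<nu>.prob ?C = (\<integral>\<omega>. kern J \<beta> (V n) \<omega> ?C \<partial>\<nu>)"
          using g sets_cyl[OF finite_V] finite_V unfolding gibbs_measure_iff[OF \<theta>] by blast
        also have "\<dots> = (\<integral>\<omega>. G (restrict \<omega> ?W) \<partial>\<nu>)"
          by (rule Bochner_Integration.integral_cong) (simp_all add: G_def kern_Q[OF \<theta>] n_def del: restrict_apply)
        also have "\<dots> = (\<Sum>\<eta>\<in>cfg ?W. G \<eta> * \<nu>.prob (cyl ?W \<eta>))"
          by (rule \<nu>.fin_dep_integral) simp
        finally have "\<nu>.prob ?C - ?p = (\<Sum>\<eta>\<in>cfg ?W. (G \<eta> - ?p) * \<nu>.prob (cyl ?W \<eta>))"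
          using \<nu>.sum_cyl[OF finite_W, of "Suc n"]
          by (simp only: left_diff_distrib sum_subtractf sum_distrib_left[symmetric] mult_1_right)
        then have "\<bar>\<nu>.prob ?C - ?p\<bar> \<le> (\<Sum>\<eta>\<in>cfg ?W. \<bar>(G \<eta> - ?p) * \<nu>.prob (cyl ?W \<eta>)\<bar>)"
          by (simp only: sum_abs)
        also have "\<dots> = (\<Sum>\<eta>\<in>cfg ?W. \<bar>G \<eta> - ?p\<bar> * \<nu>.prob (cyl ?W \<eta>))"
          by (simp add: abs_mult)
        also have "\<dots> \<le> (\<Sum>\<eta>\<in>cfg ?W. \<bar>G \<eta> - ?p\<bar> * (measure chain_measure (cyl ?W \<eta>) / t))"
          using dom[OF sets_cyl[OF finite_W]] t by (intro sum_mono mult_left_mono) (simp_all add: pos_le_divide_eq mult.commute)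
        also have "\<dots> = (\<Sum>\<eta>\<in>cfg ?W. \<bar>G \<eta> - ?p\<bar> * measure chain_measure (cyl ?W \<eta>)) / t"
          by (simp add: sum_divide_distrib)
        finally have 1: "\<bar>\<nu>.prob ?C - ?p\<bar> \<le> (\<Sum>\<eta>\<in>cfg ?W. \<bar>G \<eta> - ?p\<bar> * measure chain_measure (cyl ?W \<eta>)) / t" .
        have "(\<Sum>\<eta>\<in>cfg ?W. \<bar>G \<eta> - ?p\<bar> * measure chain_measure (cyl ?W \<eta>)) = (\<integral>\<omega>. \<bar>G (restrict \<omega> ?W) - ?p\<bar> \<partial>chain_measure)"
          by (rule C.fin_dep_integral(2)[symmetric, where f = "\<lambda>\<eta>. \<bar>G \<eta> - ?p\<bar>"]) simp
        also have "\<dots> = Ex' (Suc n) (\<lambda>\<sigma>. \<bar>G (restrict \<sigma> ?W) - ?p\<bar>)"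
        proof (rule trans[OF _ chain_integral[of "\<lambda>\<sigma>. \<bar>G (restrict \<sigma> ?W) - ?p\<bar>" "Suc n"]])
          have "restrict (restrict \<omega> (V (Suc n))) ?W = restrict \<omega> ?W" for \<omega> :: "'v \<Rightarrow> nat"
            unfolding restrict_restrict by (rule arg_cong[where f = "restrict \<omega>"]) auto
          then show "(\<integral>\<omega>. \<bar>G (restrict \<omega> ?W) - ?p\<bar> \<partial>chain_measure)
              = (\<integral>\<omega>. \<bar>G (restrict (restrict \<omega> (V (Suc n))) ?W) - ?p\<bar> \<partial>chain_measure)" by (simp only:)
        qed
        also have "\<dots> \<le> Ex' (Suc n) (\<lambda>\<sigma>. \<delta> + (G (restrict \<sigma> ?W) - ?p)^2 / \<delta>)"
        proof (rule sum_mono)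
          fix \<sigma> assume s: "\<sigma> \<in> cfg (V (Suc n))"
          \<comment> \<open>Trades the first moment for the variance; afterwards k tends to infinity
            with \<delta> fixed, and only then \<delta> to 0.\<close>
          have "\<bar>x\<bar> \<le> \<delta> + x^2 / \<delta>" for x :: real
          proof -
            have "\<bar>x\<bar> * \<delta> \<le> \<delta>^2 + x^2"
            proof -
              have "0 \<le> (\<bar>x\<bar> - \<delta>)^2 + \<bar>x\<bar> * \<delta>" using d by simp
              then show ?thesis by (simp add: power2_diff mult_ac add_ac)
            qed
            then show ?thesis using d by (simp add: field_simps power2_eq_square)
          qed
          then show "pr (Suc n) \<sigma> * \<bar>G (restrict \<sigma> ?W) - ?p\<bar> \<le> pr (Suc n) \<sigma> * (\<delta> + (G (restrict \<sigma> ?W) - ?p)^2 / \<delta>)"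
            using pr_pos[OF s] by (intro mult_left_mono) auto
        qed
        also have "\<dots> = \<delta> + Ex' (Suc n) (\<lambda>\<sigma>. (G (restrict \<sigma> ?W) - ?p)^2) / \<delta>"
          by (simp only: distrib_left sum.distrib sum_distrib_right[symmetric] sum_pr mult_1 times_divide_eq_right sum_divide_distrib)
        finally have 2: "(\<Sum>\<eta>\<in>cfg ?W. \<bar>G \<eta> - ?p\<bar> * measure chain_measure (cyl ?W \<eta>))
            \<le> \<delta> + Ex' (Suc n) (\<lambda>\<sigma>. (G (restrict \<sigma> ?W) - ?p)^2) / \<delta>" .
        have 3: "Ex' (Suc n) (\<lambda>\<sigma>. (G (restrict \<sigma> ?W) - ?p)^2) \<le> B * (2 * \<kappa> * \<gamma>) ^ k"
        proof -
          have eqB: "B * (2 * \<kappa> * \<gamma>) ^ k = real (card (W (Suc m))) * (((2 * \<kappa>) ^ Suc k * \<gamma> ^ k) * U)"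
            by (simp add: B_def power_mult_distrib)
          show ?thesis unfolding G_def n_def eqB
          proof (rule Q_variance[OF up dc pos _ _ _ \<tau>])
            fix i j assume ij: "i \<in> spins" "j \<in> spins"
            show "0 \<le> u i j" "u i j \<le> U" using u(1)[OF ij] U[OF ij] .
            show "1 \<le> u i j" if "i \<noteq> j" using u(2)[OF ij that] .
          qed
        qed
        have "(\<Sum>\<eta>\<in>cfg ?W. \<bar>G \<eta> - ?p\<bar> * measure chain_measure (cyl ?W \<eta>))
            \<le> \<delta> + B * (2 * \<kappa> * \<gamma>) ^ k / \<delta>"
          by (rule order_trans[OF 2 add_left_mono[OF divide_right_mono[OF 3]]]) (use d in simp)
        from order_trans[OF 1 divide_right_mono[OF this]] show ?thesis using t by simp
      qed
      have "\<bar>\<nu>.prob ?C - ?p\<bar> \<le> \<delta> / t" if d: "0 < \<delta>" for \<delta>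
      proof (rule LIMSEQ_le_const)
        have "(\<lambda>k. (2 * \<kappa> * \<gamma>) ^ k) \<longlonglongrightarrow> 0" using lt pos by (intro LIMSEQ_power_zero) simp
        then have "(\<lambda>k. (\<delta> + B * (2 * \<kappa> * \<gamma>) ^ k / \<delta>) / t) \<longlonglongrightarrow> (\<delta> + B * 0 / \<delta>) / t"
          using d t by (intro tendsto_divide tendsto_add tendsto_mult tendsto_const) auto
        then show "(\<lambda>k. (\<delta> + B * (2 * \<kappa> * \<gamma>) ^ k / \<delta>) / t) \<longlonglongrightarrow> \<delta> / t" by simp
      qed (use bound[OF d] in blast)
      from this[of "\<epsilon> * t" for \<epsilon>] have "\<bar>\<nu>.prob ?C - ?p\<bar> \<le> 0 + \<epsilon>" if "0 < \<epsilon>" for \<epsilon>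
        using that t by simp
      then have "\<bar>\<nu>.prob ?C - ?p\<bar> \<le> 0" by (rule field_le_epsilon)
      then show "\<nu>.prob (cyl (V M) \<tau>) = pr M \<tau>" unfolding M by simp
    qed
  qed
  show ?thesis
    unfolding extreme_gibbs_def
  proof (intro conjI allI impI gibbs_chain[OF \<theta>])
    fix \<nu>1 \<nu>2 t
    assume g: "gibbs_measure J \<beta> L \<nu>1" "gibbs_measure J \<beta> L \<nu>2" and t: "0 < t" "t < (1::real)"
      and eq: "\<forall>A\<in>sets config_space. measure chain_measure A = t * measure \<nu>1 A + (1 - t) * measure \<nu>2 A"
    have "\<nu>1 = chain_measure" using eq t by (intro key[OF g(1) t(1)]) auto
    moreover have "\<nu>2 = chain_measure" using eq t by (intro key[OF g(2), of "1 - t"]) auto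
    ultimately show "\<nu>1 = \<nu>2" by simp
  qed
qed

end

section \<open>Solutions of the fixed-point equations\<close>

text \<open>For \<open>x \<noteq> 1\<close> the fixed-point equations become quadratic in \<open>w = (1 + x)\<^sup>2 / x\<close>, which is invariant
  under the spin flip \<open>x \<mapsto> 1 / x\<close>.\<close>

definition asym :: "real \<Rightarrow> real \<Rightarrow> real" where
  "asym \<theta> w = \<theta>^3 * w^2 - \<theta> * (1 + \<theta>^2) * w + 1"

lemma FP_sym_iff: "(1, y) \<in> FP \<theta> \<longleftrightarrow> 0 < y \<and> y \<in> cubic_roots \<theta>"
  unfolding FP_def cubic_roots_def by (auto simp: algebra_simps power2_eq_square power3_eq_cube)

text \<open>The first equation is divisible by x - 1. The other factor determines \<theta> y^2,
  turns the common denominator into (1 - \<theta>^2)(1 + x) and thereby makes the second equation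
  linear in y; inserting y leaves the quadratic in w. Signs force \<theta> < 1.\<close>

lemma FP_asym_iff:
  assumes "0 < \<theta>" "x \<noteq> 1"
  shows "(x, y) \<in> FP \<theta> \<longleftrightarrow> 0 < x \<and> \<theta> < 1 \<and> y = x / (\<theta> * (1 + x)) \<and> asym \<theta> ((1 + x)^2 / x) = 0"
    (is "_ \<longleftrightarrow> ?R")
proof
  assume F: "(x, y) \<in> FP \<theta>"
  then have p: "0 < x" "0 < y" by (auto simp: FP_def)
  let ?D = "\<theta>^2 * x^2 + \<theta> * y^2 + 1"
  have e1: "x * ?D = x^2 + \<theta> * y^2 + \<theta>^2" and e2: "y * ?D = \<theta> * x^2 + y^2 + \<theta>"
    using F by (auto simp: FP_def)
  have "(x - 1) * (\<theta>^2 * x^2 + (\<theta>^2 - 1) * x + \<theta>^2 + \<theta> * y^2) = 0"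
    using e1 by algebra
  then have "\<theta>^2 * x^2 + (\<theta>^2 - 1) * x + \<theta>^2 + \<theta> * y^2 = 0" using assms(2) by simp
  then have a: "\<theta> * y^2 = (1 - \<theta>^2) * x - \<theta>^2 * (x^2 + 1)" by algebra
  have t1: "\<theta> < 1"
  proof (rule ccontr)
    assume "\<not> \<theta> < 1"
    then have "1 \<le> \<theta>^2" by (simp add: one_le_power)
    then have "(1 - \<theta>^2) * x \<le> 0" using p by (simp add: mult_nonpos_nonneg)
    moreover have "0 < \<theta> * y^2" "0 \<le> \<theta>^2 * (x^2 + 1)" using p assms(1) by simp_all
    ultimately show False using a by linarith
  qed
  have D: "?D = (1 - \<theta>^2) * (1 + x)" using a by (simp add: algebra_simps)
  have "\<theta> * (y * ?D) = \<theta>^2 * x^2 + \<theta>^2 + \<theta> * y^2" unfolding e2 by (simp add: algebra_simps power2_eq_square)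
  also have "\<dots> = (1 - \<theta>^2) * x" using a by (simp add: algebra_simps)
  finally have "(1 - \<theta>^2) * (\<theta> * y * (1 + x)) = (1 - \<theta>^2) * x" unfolding D by (simp add: algebra_simps)
  moreover have "1 - \<theta>^2 \<noteq> 0" using t1 assms(1) by (simp add: power2_eq_1_iff)
  ultimately have y: "\<theta> * y * (1 + x) = x" by simp
  then have y': "y = x / (\<theta> * (1 + x))" using assms(1) p by (simp add: eq_divide_eq mult_ac)
  have "x * (\<theta> * y^2) * (\<theta> * (1 + x)^2) = x * x^2"
  proof -
    have "x * (\<theta> * y^2) * (\<theta> * (1 + x)^2) = x * (\<theta> * y * (1 + x))^2" by (simp add: power2_eq_square algebra_simps)
    then show ?thesis by (simp only: y)
  qed
  then have "(\<theta> * y^2) * (\<theta> * (1 + x)^2) = x^2" using p by (simp add: mult.assoc)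
  then have "((1 - \<theta>^2) * x - \<theta>^2 * (x^2 + 1)) * (\<theta> * (1 + x)^2) - x^2 = 0" unfolding a by simp
  moreover have "asym \<theta> ((1 + x)^2 / x) * x^2
      = - (((1 - \<theta>^2) * x - \<theta>^2 * (x^2 + 1)) * (\<theta> * (1 + x)^2) - x^2)"
    unfolding asym_def using p by (simp add: field_simps) algebra
  ultimately have "asym \<theta> ((1 + x)^2 / x) = 0" using p by simp
  then show ?R using p t1 y' by blast
next
  assume R: ?R
  then have p: "0 < x" "\<theta> < 1" and y': "y = x / (\<theta> * (1 + x))" and as: "asym \<theta> ((1 + x)^2 / x) = 0" by auto
  have yp: "0 < y" using y' p assms(1) by simp
  have y: "\<theta> * y * (1 + x) = x" using y' p assms(1) by simp
  have "asym \<theta> ((1 + x)^2 / x) * x^2 = - (((1 - \<theta>^2) * x - \<theta>^2 * (x^2 + 1)) * (\<theta> * (1 + x)^2) - x^2)"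
    unfolding asym_def using p by (simp add: field_simps) algebra
  then have "((1 - \<theta>^2) * x - \<theta>^2 * (x^2 + 1)) * (\<theta> * (1 + x)^2) = x^2" unfolding as by simp
  also have "x^2 = (\<theta> * y^2) * (\<theta> * (1 + x)^2)"
  proof -
    have "(\<theta> * y^2) * (\<theta> * (1 + x)^2) = (\<theta> * y * (1 + x))^2" by (simp add: power2_eq_square algebra_simps)
    then show ?thesis by (simp only: y)
  qed
  finally have a: "\<theta> * y^2 = (1 - \<theta>^2) * x - \<theta>^2 * (x^2 + 1)" using assms(1) p by simp
  have D: "\<theta>^2 * x^2 + \<theta> * y^2 + 1 = (1 - \<theta>^2) * (1 + x)" using a by (simp add: algebra_simps)
  have e1: "x * ((1 - \<theta>^2) * (1 + x)) = x^2 + \<theta> * y^2 + \<theta>^2" unfolding a by (simp add: algebra_simps power2_eq_square)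
  have "\<theta> * (y * ((1 - \<theta>^2) * (1 + x))) = (1 - \<theta>^2) * (\<theta> * y * (1 + x))" by simp
  also have "\<dots> = \<theta>^2 * x^2 + \<theta>^2 + \<theta> * y^2" unfolding y a by (simp add: algebra_simps)
  also have "\<dots> = \<theta> * (\<theta> * x^2 + y^2 + \<theta>)" by (simp add: algebra_simps power2_eq_square)
  finally have e2: "y * ((1 - \<theta>^2) * (1 + x)) = \<theta> * x^2 + y^2 + \<theta>" using assms(1) by simp
  show "(x, y) \<in> FP \<theta>" unfolding FP_def using p yp e1 e2 D by simp
qed

text \<open>The quadratic for w says exactly that the radicand over \<theta> is the square of the
  rational expression for y.\<close>

lemma y_of_asym:
  assumes "0 < \<theta>" "0 < x" "asym \<theta> ((1 + x)^2 / x) = 0"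
  shows "y_of \<theta> x = x / (\<theta> * (1 + x))"
proof -
  let ?y = "x / (\<theta> * (1 + x))"
  have "asym \<theta> ((1 + x)^2 / x) * x^2 = - (((1 - \<theta>^2) * x - \<theta>^2 * (x^2 + 1)) * (\<theta> * (1 + x)^2) - x^2)"
    unfolding asym_def using assms(2) by (simp add: field_simps) algebra
  then have a: "((1 - \<theta>^2) * x - \<theta>^2 * (x^2 + 1)) * (\<theta> * (1 + x)^2) = x^2" unfolding assms(3) by simp
  let ?A = "(1 - \<theta>^2) * x - \<theta>^2 * (x^2 + 1)"
  have "\<theta> * (\<theta> * (1 + x)^2) = (\<theta> * (1 + x))^2" by (simp add: power2_eq_square)
  moreover have "\<theta> * (1 + x)^2 \<noteq> 0" using assms(1,2) by simp
  then have "?A / \<theta> = (?A * (\<theta> * (1 + x)^2)) / (\<theta> * (\<theta> * (1 + x)^2))" by simp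
  ultimately have "?A / \<theta> = ?y^2" unfolding a by (simp add: power_divide)
  then have "sqrt (((1 - \<theta>^2) * x - \<theta>^2 * (x^2 + 1)) / \<theta>) = ?y" using assms(1,2) by simp
  then show ?thesis by (simp add: y_of_def real_sqrt_divide)
qed

text \<open>The discriminant of the cubic.\<close>

definition cdisc :: "real \<Rightarrow> real" where
  "cdisc \<theta> = 1 - 12 * \<theta> + 38 * \<theta>^2 - 12 * \<theta>^3 - 71 * \<theta>^4 - 12 * \<theta>^5 - 4 * \<theta>^7"

definition cub :: "real \<Rightarrow> real \<Rightarrow> real" where
  "cub \<theta> y = \<theta> * y^3 - y^2 + (\<theta>^2 + 1) * y - 2 * \<theta>"

lemma cubic_roots_cub: "cubic_roots \<theta> = {y. cub \<theta> y = 0}"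
  by (simp add: cubic_roots_def cub_def)

lemma cub_root_pos:
  assumes "0 < \<theta>" "cub \<theta> y = 0" shows "0 < y"
proof (rule ccontr)
  assume "\<not> 0 < y"
  then have y: "0 \<le> - y" by simp
  have 1: "0 \<le> \<theta> * (- y)^3" and 2: "0 \<le> (\<theta>^2 + 1) * (- y)"
    using y assms(1) by (intro mult_nonneg_nonneg zero_le_power; simp)+
  have "\<theta> * (- y)^3 = - (\<theta> * y^3)" by (simp add: power3_eq_cube)
  then have "cub \<theta> y < 0" unfolding cub_def using 1 2 assms(1) zero_le_power2[of y] by linarith
  then show False using assms(2) by simp
qed

lemma cub_continuous: "continuous_on S (cub \<theta>)"
  unfolding cub_def by (intro continuous_intros)

text \<open>The cubic is nonnegative at the maximum of a, 1/\<theta> and 2. The lemma serves to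
  bound the largest root from below by testing the sign at one point.\<close>

lemma cub_root_ge:
  assumes "0 < \<theta>" "cub \<theta> a \<le> 0" shows "\<exists>r\<ge>a. cub \<theta> r = 0"
proof -
  define b where "b = max a (max (1 / \<theta>) 2)"
  have b: "a \<le> b" "1 / \<theta> \<le> b" "2 \<le> b" by (auto simp: b_def)
  have "1 \<le> \<theta> * b" using b(2) assms(1) by (simp add: field_simps)
  then have "b^2 \<le> \<theta> * b * b^2" using mult_right_mono[of 1 "\<theta> * b" "b^2"] by simp
  moreover have "2 * \<theta> \<le> (\<theta>^2 + 1) * b"
  proof -
    have "2 * \<theta> \<le> \<theta>^2 + 1" using zero_le_power2[of "\<theta> - 1"] by (simp add: power2_diff)
    also have "\<dots> \<le> (\<theta>^2 + 1) * b" using b(3) mult_left_mono[of 1 b "\<theta>^2 + 1"] by simp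
    finally show ?thesis .
  qed
  ultimately have "0 \<le> cub \<theta> b" unfolding cub_def by (simp add: power2_eq_square power3_eq_cube mult.assoc)
  then have "\<exists>r\<ge>a. r \<le> b \<and> cub \<theta> r = 0"
    using IVT'[of "cub \<theta>" a 0 b] assms(2) b(1) cub_continuous by blast
  then show ?thesis by blast
qed

lemma cub_factor:
  assumes "cub \<theta> r = 0"
  shows "cub \<theta> y = (y - r) * (\<theta> * y^2 + (\<theta> * r - 1) * y + (\<theta> * r^2 - r + \<theta>^2 + 1))"
proof -
  have "cub \<theta> y = cub \<theta> y - cub \<theta> r" using assms by simp
  also have "\<dots> = (y - r) * (\<theta> * y^2 + (\<theta> * r - 1) * y + (\<theta> * r^2 - r + \<theta>^2 + 1))"
    unfolding cub_def by algebra
  finally show ?thesis .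
qed

text \<open>The discriminant of the cubic is that of the quadratic left after removing the root r,
  times the square of the value of this quadratic at r. Hence its sign counts the roots.\<close>

lemma cub_disc_factor:
  assumes "cub \<theta> r = 0"
  defines "b \<equiv> \<theta> * r - 1" and "c \<equiv> \<theta> * r^2 - r + \<theta>^2 + 1"
  shows "cdisc \<theta> = (b^2 - 4 * \<theta> * c) * (\<theta> * r^2 + b * r + c)^2"
proof -
  have "2 * \<theta> = r * c" using assms(1) unfolding cub_def c_def by algebra
  then show ?thesis using assms(1) unfolding cdisc_def b_def c_def cub_def by algebra
qed

lemma quadratic_root_iff:
  fixes a b c y :: real
  assumes "a > 0"
  shows "a * y^2 + b * y + c = 0 \<longleftrightarrow> (2 * a * y + b)^2 = b^2 - 4 * a * c"
proof -
  have "(2 * a * y + b)^2 - (b^2 - 4 * a * c) = 4 * a * (a * y^2 + b * y + c)" by algebra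
  moreover have "4 * a \<noteq> 0" using assms by simp
  ultimately show ?thesis by (metis eq_iff_diff_eq_0 mult_eq_0_iff)
qed

text \<open>A triple root would satisfy 3 \<theta> r = 1, r = 1 + \<theta>^2 and r^3 = 2. Then r
  \<ge> 5/4 and \<theta> \<ge> 1/2, so \<theta> r exceeds 1/3.\<close>

lemma no_triple_root:
  assumes "0 < \<theta>" and r: "cub \<theta> r = 0"
    and "\<theta> * r^2 + (\<theta> * r - 1) * r + (\<theta> * r^2 - r + \<theta>^2 + 1) = 0" "2 * \<theta> * r + (\<theta> * r - 1) = 0"
  shows False
proof -
  have a: "3 * \<theta> * r = 1" using assms(4) by simp
  have "3 * (\<theta> * r) * r - 2 * r + (\<theta>^2 + 1) = 0" using assms(3) by algebra
  then have b: "r = \<theta>^2 + 1" using a by algebra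
  have "2 * \<theta> = \<theta> * r^3 - r^2 + (\<theta>^2 + 1) * r" using r by (simp add: cub_def)
  also have "\<dots> = \<theta> * r^3" using b by algebra
  finally have "\<theta> * r^3 = \<theta> * 2" by simp
  then have c: "r^3 = 2" using assms(1) by simp
  have "1.25 \<le> r"
  proof (rule ccontr)
    assume "\<not> 1.25 \<le> r"
    then have "r^3 \<le> (1.25::real)^3" using b by (intro power_mono) auto
    then show False using c by (simp add: eval_nat_numeral)
  qed
  then have "(0.5::real)^2 \<le> \<theta>^2" using b by (simp add: eval_nat_numeral)
  then have "0.5 \<le> \<theta>" using assms(1) by (metis power2_le_imp_le less_imp_le)
  then have "1 * 0.5 \<le> r * \<theta>" using \<open>1.25 \<le> r\<close> by (intro mult_mono) auto
  then show False using a by (simp add: algebra_simps)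
qed

lemma card_cubic_roots:
  assumes "0 < \<theta>"
  shows "cdisc \<theta> > 0 \<Longrightarrow> card (cubic_roots \<theta>) = 3"
    and "cdisc \<theta> = 0 \<Longrightarrow> card (cubic_roots \<theta>) = 2"
    and "cdisc \<theta> < 0 \<Longrightarrow> card (cubic_roots \<theta>) = 1"
proof -
  have "cub \<theta> 0 \<le> 0" using assms by (simp add: cub_def)
  then obtain r where r: "cub \<theta> r = 0" using cub_root_ge[OF assms] by blast
  define b where "b = \<theta> * r - 1"
  define c where "c = \<theta> * r^2 - r + \<theta>^2 + 1"
  define d where "d = b^2 - 4 * \<theta> * c"
  define q where "q = (\<lambda>y. \<theta> * y^2 + b * y + c)"
  have D: "cdisc \<theta> = d * (q r)^2" using cub_disc_factor[OF r] by (simp add: d_def q_def b_def c_def)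
  have R: "cubic_roots \<theta> = insert r {y. q y = 0}"
    unfolding cubic_roots_cub using cub_factor[OF r] r by (auto simp: q_def b_def c_def)
  have q: "q y = 0 \<longleftrightarrow> (2 * \<theta> * y + b)^2 = d" for y
    unfolding q_def d_def by (rule quadratic_root_iff[OF assms])
  { assume "cdisc \<theta> > 0"
    then have d: "d > 0" "q r \<noteq> 0" using D by (auto simp: zero_less_mult_iff)
    have "q y = 0 \<longleftrightarrow> y = (sqrt d - b) / (2 * \<theta>) \<or> y = (- sqrt d - b) / (2 * \<theta>)" for y
    proof -
      have "(2 * \<theta> * y + b)^2 = d \<longleftrightarrow> (2 * \<theta> * y + b)^2 = (sqrt d)^2" using d by simp
      also have "\<dots> \<longleftrightarrow> 2 * \<theta> * y + b = sqrt d \<or> 2 * \<theta> * y + b = - sqrt d" by (rule power2_eq_iff)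
      finally show ?thesis unfolding q using assms by (auto simp: field_simps)
    qed
    then have "{y. q y = 0} = {(sqrt d - b) / (2 * \<theta>), (- sqrt d - b) / (2 * \<theta>)}" by auto
    moreover have "(sqrt d - b) / (2 * \<theta>) \<noteq> (- sqrt d - b) / (2 * \<theta>)" using d assms by simp
    ultimately have "card {y. q y = 0} = 2" "finite {y. q y = 0}" by simp_all
    then show "card (cubic_roots \<theta>) = 3" unfolding R using d(2) by simp }
  { assume "cdisc \<theta> < 0"
    then have "d < 0" using D by (metis mult_nonneg_nonneg not_less zero_le_power2)
    then have "q y \<noteq> 0" for y unfolding q using zero_le_power2[of "2 * \<theta> * y + b"] by linarith
    then show "card (cubic_roots \<theta>) = 1" unfolding R by simp }
  { assume "cdisc \<theta> = 0"
    then consider "q r = 0" "d \<noteq> 0" | "d = 0" using D by auto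
    then show "card (cubic_roots \<theta>) = 2"
    proof cases
      case 1
      define s where "s = - b / \<theta> - r"
      have "d \<ge> 0" using 1(1) q[of r] by (metis zero_le_power2)
      have rr: "(2 * \<theta> * r + b)^2 = d" using 1(1) q by simp
      have "q y = 0 \<longleftrightarrow> y = r \<or> y = s" for y
      proof -
        have "(2 * \<theta> * y + b)^2 = d \<longleftrightarrow> 2 * \<theta> * y + b = 2 * \<theta> * r + b \<or> 2 * \<theta> * y + b = - (2 * \<theta> * r + b)"
          unfolding rr[symmetric] by (rule power2_eq_iff)
        then show ?thesis unfolding q s_def using assms by (auto simp: field_simps)
      qed
      then have "cubic_roots \<theta> = {r, s}" unfolding R by auto
      moreover have "r \<noteq> s"
      proof
        assume "r = s"
        then have "2 * \<theta> * r + b = 0" using assms by (simp add: s_def field_simps)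
        then show False using rr 1(2) by simp
      qed
      ultimately show ?thesis by simp
    next
      case 2
      define s where "s = - b / (2 * \<theta>)"
      have "q y = 0 \<longleftrightarrow> y = s" for y
        unfolding q 2 s_def using assms by (auto simp: field_simps)
      then have "cubic_roots \<theta> = {r, s}" unfolding R by auto
      moreover have "r \<noteq> s"
      proof
        assume rs: "r = s"
        then have "2 * \<theta> * r + b = 0" using assms by (simp add: s_def)
        moreover have "q r = 0" using \<open>\<And>y. q y = 0 \<longleftrightarrow> y = s\<close> rs by simp
        ultimately show False using no_triple_root[OF assms r] by (simp add: q_def b_def c_def)
      qed
      ultimately show ?thesis by simp
    qed }
qed

text \<open>Polynomial inequalities are proved with such certificates: \<open>q\<close> is the rest of a Bernstein expansion on
  an interval or of a Taylor expansion on a half-line.\<close>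

lemma pos_certificate:
  fixes p :: real
  assumes "0 < K" "0 < c" "K * p = c + q" "0 \<le> q" shows "0 < p"
proof -
  have "0 < K * p" using assms by simp
  then show ?thesis using assms(1) by (simp add: zero_less_mult_iff)
qed

text \<open>Minus the discriminant without its terms of degree 5 and 7. The half-line from 3/20 is
  cut at 1/4 and at 1/2, and each piece has a certificate with nonnegative coefficients.\<close>

lemma cdisc_decreasing_poly1:
  fixes x :: real
  assumes "3 \<le> 20 * x" "20 * x \<le> 5"
  shows "0 < - 1 + 12 * x - 38 * x^2 + 12 * x^3 + 71 * x^4"
proof -
  have "2560000 * (- 1 + 12 * x - 38 * x^2 + 12 * x^3 + 71 * x^4) = 54896 + (37896 * ((20 * x - 3) * (5 - 20 * x)^3)
      + 76864 * ((20 * x - 3)^2 * (5 - 20 * x)^2)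
      + 48776 * ((20 * x - 3)^3 * (5 - 20 * x))
      + 10944 * ((20 * x - 3)^4))"
    by algebra
  moreover have "0 \<le> 37896 * ((20 * x - 3) * (5 - 20 * x)^3)
      + 76864 * ((20 * x - 3)^2 * (5 - 20 * x)^2)
      + 48776 * ((20 * x - 3)^3 * (5 - 20 * x))
      + 10944 * ((20 * x - 3)^4)"
    by (intro add_nonneg_nonneg mult_nonneg_nonneg zero_le_power) (use assms in simp_all)
  ultimately show ?thesis by (rule pos_certificate[rotated 2]) simp_all
qed

lemma cdisc_decreasing_poly2:
  fixes x :: real
  assumes "1 \<le> 4 * x" "4 * x \<le> 2"
  shows "0 < - 1 + 12 * x - 38 * x^2 + 12 * x^3 + 71 * x^4"
proof -
  have "768 * (- 1 + 12 * x - 38 * x^2 + 12 * x^3 + 71 * x^4) = 20 + (49 * ((2 - 4 * x)^4)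
      + 136 * ((4 * x - 1) * (2 - 4 * x)^3)
      + 784 * ((4 * x - 1)^3 * (2 - 4 * x))
      + 1084 * ((4 * x - 1)^4))"
    by algebra
  moreover have "0 \<le> 49 * ((2 - 4 * x)^4)
      + 136 * ((4 * x - 1) * (2 - 4 * x)^3)
      + 784 * ((4 * x - 1)^3 * (2 - 4 * x))
      + 1084 * ((4 * x - 1)^4)"
    by (intro add_nonneg_nonneg mult_nonneg_nonneg zero_le_power) (use assms in simp_all)
  ultimately show ?thesis by (rule pos_certificate[rotated 2]) simp_all
qed

lemma cdisc_decreasing_poly3:
  fixes x :: real
  assumes "1 \<le> 2 * x"
  shows "0 < - 1 + 12 * x - 38 * x^2 + 12 * x^3 + 71 * x^4"
proof -
  have "16 * (- 1 + 12 * x - 38 * x^2 + 12 * x^3 + 71 * x^4) = 23 + (148 * ((2 * x - 1))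
      + 346 * ((2 * x - 1)^2)
      + 308 * ((2 * x - 1)^3)
      + 71 * ((2 * x - 1)^4))"
    by algebra
  moreover have "0 \<le> 148 * ((2 * x - 1))
      + 346 * ((2 * x - 1)^2)
      + 308 * ((2 * x - 1)^3)
      + 71 * ((2 * x - 1)^4)"
    by (intro add_nonneg_nonneg mult_nonneg_nonneg zero_le_power) (use assms in simp_all)
  ultimately show ?thesis by (rule pos_certificate[rotated 2]) simp_all
qed

text \<open>The quadratic term is the only one that grows. Its growth is beaten by the linear term
  because 38 (a + b) < 12 for a < b \<le> 3/20; beyond 3/20 \<open>cdisc_neg\<close> takes
  over.\<close>

lemma cdisc_decreasing:
  assumes "0 \<le> a" "a < b" "b \<le> 3/20" shows "cdisc b < cdisc a"
proof -
  have "a^3 \<le> b^3" "a^4 \<le> b^4" "a^5 \<le> b^5" "a^7 \<le> b^7" using assms by (auto intro: power_mono)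
  then have "0 \<le> 12 * (b^3 - a^3) + 71 * (b^4 - a^4) + 12 * (b^5 - a^5) + 4 * (b^7 - a^7)" by simp
  moreover have "cdisc b - cdisc a = (- 12 * (b - a) + 38 * (b^2 - a^2))
      - (12 * (b^3 - a^3) + 71 * (b^4 - a^4) + 12 * (b^5 - a^5) + 4 * (b^7 - a^7))"
    unfolding cdisc_def by algebra
  ultimately have "cdisc b - cdisc a \<le> - 12 * (b - a) + 38 * (b^2 - a^2)" by (simp only: diff_le_self diff_le_eq le_add_same_cancel1)
  also have "\<dots> = (b - a) * (38 * (a + b) - 12)" by algebra
  also have "\<dots> < 0" using assms by (intro mult_pos_neg) auto
  finally show ?thesis by simp
qed

lemma cdisc_neg:
  assumes "3/20 \<le> \<theta>" shows "cdisc \<theta> < 0"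
proof -
  have "0 \<le> \<theta>^5" "0 \<le> \<theta>^7" using assms by auto
  then have "cdisc \<theta> \<le> - (71 * \<theta>^4 + 12 * \<theta>^3 - 38 * \<theta>^2 + 12 * \<theta> - 1)" unfolding cdisc_def by linarith
  moreover have "0 < - 1 + 12 * \<theta> - 38 * \<theta>^2 + 12 * \<theta>^3 + 71 * \<theta>^4"
  proof -
    consider "20 * \<theta> \<le> 5" | "1 \<le> 4 * \<theta>" "4 * \<theta> \<le> 2" | "1 \<le> 2 * \<theta>" by linarith
    then show ?thesis using assms cdisc_decreasing_poly1[of \<theta>] cdisc_decreasing_poly2[of \<theta>] cdisc_decreasing_poly3[of \<theta>] by cases auto
  qed
  ultimately show ?thesis by linarith
qed

lemma cdisc_threshold:
  "\<exists>c. 14135/100000 \<le> c \<and> c \<le> 14145/100000 \<and> cdisc c = 0 \<and>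
    (\<forall>\<theta>>0. \<theta> < c \<longrightarrow> 0 < cdisc \<theta>) \<and> (\<forall>\<theta>>c. cdisc \<theta> < 0)"
proof -
  \<comment> \<open>The endpoints of the interval of numbers that round to 0.1414.\<close>
  have "cdisc (14145/100000) \<le> 0" "0 \<le> cdisc (14135/100000)" by (simp_all add: cdisc_def eval_nat_numeral)
  moreover have "continuous_on {14135/100000..14145/100000} cdisc"
    unfolding cdisc_def by (intro continuous_intros)
  ultimately obtain c where c: "14135/100000 \<le> c" "c \<le> 14145/100000" "cdisc c = 0"
    using IVT2'[of cdisc "14145/100000" 0 "14135/100000"] by auto
  have "0 < cdisc \<theta>" if "0 < \<theta>" "\<theta> < c" for \<theta>
    using cdisc_decreasing[of \<theta> c] c that by simp
  moreover have "cdisc \<theta> < 0" if "c < \<theta>" for \<theta>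
    using cdisc_decreasing[of c \<theta>] cdisc_neg[of \<theta>] c that by (cases "\<theta> \<le> 3/20") auto
  ultimately show ?thesis using c by blast
qed

section \<open>The second threshold and the two values of w\<close>

definition thc' :: real where
  "thc' = 1/3 * (root 3 (26 + 6 * sqrt 33) - 8 / root 3 (26 + 6 * sqrt 33) - 1)"

text \<open>The factor of the discriminant of the quadratic for w whose sign changes at the
  threshold; the other factor is \<theta> - 1.\<close>

definition gcub :: "real \<Rightarrow> real" where
  "gcub \<theta> = \<theta>^3 + \<theta>^2 + 3 * \<theta> - 1"

lemma gcub_mono:
  assumes "a < b" shows "gcub a < gcub b"
proof -
  have "gcub b - gcub a = (b - a) * ((a + b + 1)^2 / 2 + (a^2 + b^2) / 2 + 5/2)"
    unfolding gcub_def by (simp add: field_simps) algebra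
  moreover have "0 < (a + b + 1)^2 / 2 + (a^2 + b^2) / 2 + 5/2"
    by (rule add_nonneg_pos) simp_all
  ultimately have "0 < gcub b - gcub a" using assms by simp
  then show ?thesis by simp
qed

text \<open>Cardano: with z = 3 \<theta> + 1 the equation becomes z^3 + 24 z = 52, which z = r - k
  solves if r k = 8 and r^3 - k^3 = 52.\<close>

lemma gcub_thc': "gcub thc' = 0"
proof -
  define s where "s = sqrt 33"
  have s: "0 \<le> s" "s^2 = 33" by (simp_all add: s_def)
  define q where "q = 26 + 6 * s"
  have q: "0 < q" using s by (simp add: q_def)
  define r where "r = root 3 q"
  have r: "0 < r" "r^3 = q" using q by (auto simp: r_def)
  define k where "k = 8 / r"
  have rk: "r * k = 8" using r by (simp add: k_def)
  have "q * k^3 = (r * k)^3" by (simp add: r(2)[symmetric] power_mult_distrib)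
  then have "q * k^3 = 512" unfolding rk by simp
  also have "512 = q * (- (26 - 6 * s))"
  proof -
    have "q * (- (26 - 6 * s)) = 36 * s^2 - 676" unfolding q_def by algebra
    then show ?thesis unfolding s(2) by simp
  qed
  finally have e: "k^3 = - (26 - 6 * s)" using q by simp
  define z where "z = r - k"
  have z3: "z^3 = 52 - 24 * z" using e r(2) rk unfolding z_def q_def by algebra
  have "thc' = (z - 1) / 3" by (simp add: thc'_def z_def r_def k_def q_def s_def)
  then have "3 * thc' = z - 1" by simp
  then have "27 * gcub thc' = 0" unfolding gcub_def using z3 by algebra
  then show ?thesis by simp
qed

lemma gcub_sign: "gcub \<theta> < 0 \<longleftrightarrow> \<theta> < thc'" "gcub \<theta> = 0 \<longleftrightarrow> \<theta> = thc'" "0 < gcub \<theta> \<longleftrightarrow> thc' < \<theta>"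
proof -
  consider "\<theta> < thc'" | "\<theta> = thc'" | "thc' < \<theta>" by linarith
  then have "(gcub \<theta> < 0 \<longleftrightarrow> \<theta> < thc') \<and> (gcub \<theta> = 0 \<longleftrightarrow> \<theta> = thc') \<and> (0 < gcub \<theta> \<longleftrightarrow> thc' < \<theta>)"
    using gcub_mono[of \<theta> thc'] gcub_mono[of thc' \<theta>] gcub_thc' by cases auto
  then show "gcub \<theta> < 0 \<longleftrightarrow> \<theta> < thc'" "gcub \<theta> = 0 \<longleftrightarrow> \<theta> = thc'" "0 < gcub \<theta> \<longleftrightarrow> thc' < \<theta>" by auto
qed

lemma thc'_bounds: "29555/100000 < thc'" "thc' < 29565/100000"
  unfolding gcub_sign(1)[symmetric] gcub_sign(3)[symmetric] by (simp_all add: gcub_def eval_nat_numeral)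

text \<open>The shift by 2 comes from (1 + x)^2 / x = (x + 1/x) + 2.\<close>

definition w1 :: "real \<Rightarrow> real" where "w1 \<theta> = \<xi>\<^sub>1 \<theta> + 2"
definition w2 :: "real \<Rightarrow> real" where "w2 \<theta> = \<xi>\<^sub>2 \<theta> + 2"

definition wdisc :: "real \<Rightarrow> real" where "wdisc \<theta> = (\<theta> - 1) * (\<theta>^3 + \<theta>^2 + 3 * \<theta> - 1)"

lemma w12:
  assumes "0 < \<theta>"
  shows "w1 \<theta> = (1 + \<theta>^2 - sqrt (wdisc \<theta>)) / (2 * \<theta>^2)" "w2 \<theta> = (1 + \<theta>^2 + sqrt (wdisc \<theta>)) / (2 * \<theta>^2)"
  using assms by (simp_all add: w1_def w2_def \<xi>\<^sub>1_def \<xi>\<^sub>2_def wdisc_def field_simps)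

lemma asym_factor:
  assumes "0 < \<theta>" "0 \<le> wdisc \<theta>"
  shows "asym \<theta> w = \<theta>^3 * (w - w1 \<theta>) * (w - w2 \<theta>)"
    and "\<theta>^2 * (w1 \<theta> + w2 \<theta>) = 1 + \<theta>^2"
proof -
  have s: "(sqrt (wdisc \<theta>))^2 = (\<theta> - 1) * (\<theta>^3 + \<theta>^2 + 3 * \<theta> - 1)" using assms(2) by (simp add: wdisc_def)
  have a: "2 * \<theta>^2 * w1 \<theta> = 1 + \<theta>^2 - sqrt (wdisc \<theta>)" "2 * \<theta>^2 * w2 \<theta> = 1 + \<theta>^2 + sqrt (wdisc \<theta>)"
    using assms(1) by (simp_all add: w12)
  then show 1: "\<theta>^2 * (w1 \<theta> + w2 \<theta>) = 1 + \<theta>^2" by algebra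
  have "4 * \<theta>^4 * (w1 \<theta> * w2 \<theta>) = (1 + \<theta>^2)^2 - (sqrt (wdisc \<theta>))^2" using a by algebra
  then have "\<theta> * (4 * \<theta>^3 * (w1 \<theta> * w2 \<theta>)) = \<theta> * 4" unfolding s by algebra
  then have "4 * \<theta>^3 * (w1 \<theta> * w2 \<theta>) = 4" using assms(1) by simp
  then have 2: "\<theta>^3 * (w1 \<theta> * w2 \<theta>) = 1" by simp
  have "\<theta>^3 * (w - w1 \<theta>) * (w - w2 \<theta>)
      = \<theta>^3 * w^2 - \<theta> * (\<theta>^2 * (w1 \<theta> + w2 \<theta>)) * w + \<theta>^3 * (w1 \<theta> * w2 \<theta>)" by algebra
  then show "asym \<theta> w = \<theta>^3 * (w - w1 \<theta>) * (w - w2 \<theta>)" unfolding asym_def 1 2 ..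
qed

lemma wdisc_nonneg: "0 < \<theta> \<Longrightarrow> \<theta> \<le> thc' \<Longrightarrow> 0 \<le> wdisc \<theta>"
  using gcub_sign[of \<theta>] thc'_bounds unfolding wdisc_def gcub_def
  by (intro mult_nonpos_nonpos) auto

lemma wdisc_pos: "0 < \<theta> \<Longrightarrow> \<theta> < thc' \<Longrightarrow> 0 < wdisc \<theta>"
  using gcub_sign[of \<theta>] thc'_bounds unfolding wdisc_def gcub_def
  by (intro mult_neg_neg) auto

lemma asym_no_root:
  assumes "thc' < \<theta>" "\<theta> < 1" shows "asym \<theta> w \<noteq> 0"
proof
  assume a: "asym \<theta> w = 0"
  have t: "0 < \<theta>" using assms(1) thc'_bounds by simp
  have "wdisc \<theta> < 0" using assms gcub_sign(3)[of \<theta>] unfolding wdisc_def gcub_def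
    by (intro mult_neg_pos) auto
  moreover have "(2 * \<theta>^2 * w - (1 + \<theta>^2))^2 = wdisc \<theta> + 4 * \<theta> * asym \<theta> w"
    unfolding wdisc_def asym_def by algebra
  ultimately show False using a zero_le_power2[of "2 * \<theta>^2 * w - (1 + \<theta>^2)"] by simp
qed

text \<open>The value w = 4 belongs to x = 1, where (1 + x)^2 / x is least. Positivity there puts
  both roots on the same side of 4. The square vanishes at \<theta> = 1/3, the minimum of the
  polynomial.\<close>

lemma asym_four: "0 < \<theta> \<Longrightarrow> 0 < asym \<theta> 4"
proof -
  assume t: "0 < \<theta>"
  have "9 * asym \<theta> 4 = 1 + 12 * ((3 * \<theta> - 1)^2 * (\<theta> + 2/3))"
    unfolding asym_def by (simp add: field_simps) algebra
  moreover have "0 \<le> 12 * ((3 * \<theta> - 1)^2 * (\<theta> + 2/3))" using t by simp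
  ultimately show ?thesis by (rule pos_certificate[rotated 2]) simp_all
qed

lemma w_bounds:
  assumes "0 < \<theta>" "\<theta> \<le> thc'"
  shows "w1 \<theta> \<le> w2 \<theta>" "4 < w1 \<theta>" "\<theta> < thc' \<Longrightarrow> w1 \<theta> < w2 \<theta>" "\<theta> = thc' \<Longrightarrow> w1 \<theta> = w2 \<theta>"
proof -
  have d: "0 \<le> wdisc \<theta>" by (rule wdisc_nonneg[OF assms])
  show le: "w1 \<theta> \<le> w2 \<theta>" unfolding w12[OF assms(1)] using d by (intro divide_right_mono) auto
  show "w1 \<theta> < w2 \<theta>" if "\<theta> < thc'"
    unfolding w12[OF assms(1)] using wdisc_pos[OF assms(1) that] assms(1) by (intro divide_strict_right_mono) auto
  show "w1 \<theta> = w2 \<theta>" if "\<theta> = thc'"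
  proof -
    have "wdisc \<theta> = 0" using gcub_sign(2)[of \<theta>] that by (simp add: wdisc_def gcub_def)
    then show ?thesis unfolding w12[OF assms(1)] by simp
  qed
  show "4 < w1 \<theta>"
  proof (rule ccontr)
    assume n: "\<not> 4 < w1 \<theta>"
    have "0 < \<theta>^3 * ((4 - w1 \<theta>) * (4 - w2 \<theta>))"
      using asym_four[OF assms(1)] asym_factor(1)[OF assms(1) d, of 4] by (simp add: mult.assoc)
    then have "0 < (4 - w1 \<theta>) * (4 - w2 \<theta>)" using assms(1) by (simp add: zero_less_mult_iff)
    \<comment> \<open>Two roots of at most 4 would have a sum of at most 8, but the sum is 1 +
      1/\<theta>^2 and \<theta> is below 3/10.\<close>
    then have "w2 \<theta> < 4" using n by (auto simp: zero_less_mult_iff)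
    then have "\<theta>^2 * (w1 \<theta> + w2 \<theta>) \<le> \<theta>^2 * 8" using n by (intro mult_left_mono) auto
    then have "1 \<le> 7 * \<theta>^2" using asym_factor(2)[OF assms(1) d] by simp
    moreover have "\<theta>^2 \<le> (3/10)^2" using assms thc'_bounds by (intro power_mono) auto
    ultimately show False by (simp add: power2_eq_square)
  qed
qed

text \<open>The roots of x + 1/x = \<xi>; being reciprocal, they are exchanged by the spin
  flip.\<close>

definition xm :: "real \<Rightarrow> real" where "xm \<xi> = (\<xi> - sqrt (\<xi>^2 - 4)) / 2"
definition xp :: "real \<Rightarrow> real" where "xp \<xi> = (\<xi> + sqrt (\<xi>^2 - 4)) / 2"

lemma xpm:
  assumes "2 < \<xi>"
  shows "1 < xp \<xi>" "0 < xm \<xi>" "xm \<xi> < 1" "xm \<xi> = 1 / xp \<xi>" "xp \<xi> + xm \<xi> = \<xi>"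
proof -
  have "2^2 < \<xi>^2" using assms by (intro power_strict_mono) auto
  then have s: "0 < sqrt (\<xi>^2 - 4)" "(sqrt (\<xi>^2 - 4))^2 = \<xi>^2 - 4" by auto
  show p: "1 < xp \<xi>" 
  proof -
    have "2 < \<xi> + sqrt (\<xi>^2 - 4)" using assms s(1) by linarith
    then show ?thesis by (simp add: xp_def)
  qed
  have "xp \<xi> * xm \<xi> = (\<xi>^2 - (sqrt (\<xi>^2 - 4))^2) / 4" unfolding xp_def xm_def by (simp add: field_simps power2_eq_square)
  then have prod: "xp \<xi> * xm \<xi> = 1" unfolding s(2) by simp
  then show e: "xm \<xi> = 1 / xp \<xi>" using p by (simp add: field_simps)
  show "0 < xm \<xi>" "xm \<xi> < 1" unfolding e using p by auto
  show "xp \<xi> + xm \<xi> = \<xi>" by (simp add: xp_def xm_def field_simps)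
qed

lemma xpm_iff:
  assumes "2 < \<xi>" "0 < x"
  shows "(1 + x)^2 / x = \<xi> + 2 \<longleftrightarrow> x = xm \<xi> \<or> x = xp \<xi>"
proof -
  note p = xpm[OF assms(1)]
  have pr: "xp \<xi> * xm \<xi> = 1" using p(1,4) by simp
  have "(1 + x)^2 / x = \<xi> + 2 \<longleftrightarrow> (1 + x)^2 = (\<xi> + 2) * x" using assms(2) by (simp add: field_simps)
  also have "\<dots> \<longleftrightarrow> (x - xm \<xi>) * (x - xp \<xi>) = 0"
  proof -
    have "(x - xm \<xi>) * (x - xp \<xi>) = x^2 - (xp \<xi> + xm \<xi>) * x + xp \<xi> * xm \<xi>" by algebra
    also have "\<dots> = (1 + x)^2 - (\<xi> + 2) * x" unfolding p(5) pr by algebra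
    finally show ?thesis by simp
  qed
  finally show ?thesis by simp
qed

lemma xp_mono: "2 < \<xi> \<Longrightarrow> \<xi> < \<xi>' \<Longrightarrow> xp \<xi> < xp \<xi>'"
proof -
  assume a: "2 < \<xi>" "\<xi> < \<xi>'"
  then have "\<xi>^2 < \<xi>'^2" by (intro power_strict_mono) auto
  then have "sqrt (\<xi>^2 - 4) < sqrt (\<xi>'^2 - 4)" by simp
  then have "\<xi> + sqrt (\<xi>^2 - 4) < \<xi>' + sqrt (\<xi>'^2 - 4)" using a(2) by linarith
  then show ?thesis unfolding xp_def by (rule divide_strict_right_mono) simp
qed

lemma sol_asym:
  "sol \<theta> 4 = (xm (\<xi>\<^sub>2 \<theta>), y_of \<theta> (xm (\<xi>\<^sub>2 \<theta>)))" "sol \<theta> 5 = (xm (\<xi>\<^sub>1 \<theta>), y_of \<theta> (xm (\<xi>\<^sub>1 \<theta>)))"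
  "sol \<theta> 6 = (xp (\<xi>\<^sub>1 \<theta>), y_of \<theta> (xp (\<xi>\<^sub>1 \<theta>)))" "sol \<theta> 7 = (xp (\<xi>\<^sub>2 \<theta>), y_of \<theta> (xp (\<xi>\<^sub>2 \<theta>)))"
  by (simp_all add: sol_def Let_def xm_def xp_def)

lemma asym_zero_iff:
  assumes "0 < \<theta>" "\<theta> \<le> thc'"
  shows "asym \<theta> w = 0 \<longleftrightarrow> w = w1 \<theta> \<or> w = w2 \<theta>"
  using asym_factor(1)[OF assms(1) wdisc_nonneg[OF assms], of w] assms(1) by simp

lemma \<xi>_gt_2:
  assumes "0 < \<theta>" "\<theta> \<le> thc'" shows "2 < \<xi>\<^sub>1 \<theta>" "2 < \<xi>\<^sub>2 \<theta>" "\<xi>\<^sub>1 \<theta> \<le> \<xi>\<^sub>2 \<theta>"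
  using w_bounds[OF assms] by (simp_all add: w1_def w2_def)

lemma asym_x_iff:
  assumes "0 < \<theta>" "\<theta> \<le> thc'" "0 < x"
  shows "asym \<theta> ((1 + x)^2 / x) = 0 \<longleftrightarrow> x \<in> {xm (\<xi>\<^sub>1 \<theta>), xp (\<xi>\<^sub>1 \<theta>), xm (\<xi>\<^sub>2 \<theta>), xp (\<xi>\<^sub>2 \<theta>)}"
  unfolding asym_zero_iff[OF assms(1,2)] w1_def w2_def
    xpm_iff[OF \<xi>_gt_2(1)[OF assms(1,2)] assms(3)] xpm_iff[OF \<xi>_gt_2(2)[OF assms(1,2)] assms(3)] by blast

section \<open>Enumeration of the solutions\<close>

lemma FP_split: "FP \<theta> = {v \<in> FP \<theta>. fst v = 1} \<union> {v \<in> FP \<theta>. fst v \<noteq> 1}"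
  by blast

lemma FP_asym_set:
  assumes "0 < \<theta>" "\<theta> \<le> thc'"
  shows "{v \<in> FP \<theta>. fst v \<noteq> 1} = sol \<theta> ` {4, 5, 6, 7}"
proof -
  have t1: "\<theta> < 1" using assms thc'_bounds by simp
  note p1 = xpm[OF \<xi>_gt_2(1)[OF assms]] and p2 = xpm[OF \<xi>_gt_2(2)[OF assms]]
  have pos: "0 < x \<and> x \<noteq> 1" if "x \<in> {xm (\<xi>\<^sub>1 \<theta>), xp (\<xi>\<^sub>1 \<theta>), xm (\<xi>\<^sub>2 \<theta>), xp (\<xi>\<^sub>2 \<theta>)}" for x
    using that p1 p2 by auto
  have "(x, y) \<in> FP \<theta> \<and> x \<noteq> 1 \<longleftrightarrow>
      x \<in> {xm (\<xi>\<^sub>1 \<theta>), xp (\<xi>\<^sub>1 \<theta>), xm (\<xi>\<^sub>2 \<theta>), xp (\<xi>\<^sub>2 \<theta>)} \<and> y = y_of \<theta> x" for x y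
    using FP_asym_iff[OF assms(1), of x y] asym_x_iff[OF assms, of x] y_of_asym[OF assms(1), of x] pos[of x] t1
    by metis
  then show ?thesis unfolding sol_asym image_insert image_empty by (auto simp: set_eq_iff)
qed

lemma FP_asym_empty:
  assumes "thc' < \<theta>" shows "{v \<in> FP \<theta>. fst v \<noteq> 1} = {}"
proof -
  have "0 < \<theta>" using assms thc'_bounds by simp
  then have "(x, y) \<notin> FP \<theta>" if "x \<noteq> 1" for x y
    using FP_asym_iff[OF _ that, of \<theta> y] asym_no_root[OF assms] by auto
  then show ?thesis by auto
qed

lemma finite_cubic_roots: "0 < \<theta> \<Longrightarrow> finite (cubic_roots \<theta>)" "0 < \<theta> \<Longrightarrow> cubic_roots \<theta> \<noteq> {}"
proof -
  assume t: "0 < \<theta>"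
  have "card (cubic_roots \<theta>) > 0" using card_cubic_roots[OF t] by (cases "cdisc \<theta>" "0::real" rule: linorder_cases) auto
  then show "finite (cubic_roots \<theta>)" "cubic_roots \<theta> \<noteq> {}" by (auto simp: card_gt_0_iff)
qed

lemma FP_sym_set: "0 < \<theta> \<Longrightarrow> {v \<in> FP \<theta>. fst v = 1} = Pair 1 ` cubic_roots \<theta>"
  using FP_sym_iff[of _ \<theta>] cub_root_pos[of \<theta>] by (auto simp: cubic_roots_cub)

lemma sol_sym:
  "sol \<theta> 1 = (1, Max (cubic_roots \<theta>))" "sol \<theta> (Suc 0) = (1, Max (cubic_roots \<theta>))"
  "sol \<theta> 2 = (1, Max (cubic_roots \<theta> - {Max (cubic_roots \<theta>)}))"
  "sol \<theta> 3 = (1, Min (cubic_roots \<theta>))"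
  by (simp_all add: sol_def Let_def)

lemma card_2_MaxMin:
  fixes R :: "real set" assumes "card R = 2" shows "R = {Max R, Min R}" "R - {Max R} = {Min R}"
proof -
  obtain a b where R: "R = {a, b}" "a \<noteq> b" using assms by (auto simp: card_2_iff)
  show "R = {Max R, Min R}" "R - {Max R} = {Min R}" using R by (auto simp: max_def min_def)
qed

lemma card_3_MaxMin:
  fixes R :: "real set" assumes "card R = 3" shows "R = {Max R, Max (R - {Max R}), Min R}"
proof -
  have f: "finite R" "R \<noteq> {}" using assms card.infinite by fastforce+
  let ?R = "R - {Max R}"
  have c: "card ?R = 2" using f assms by simp
  have "Min ?R = Min R"
  proof -
    have "Min R \<noteq> Max R"
    proof
      assume e: "Min R = Max R"
      have "x = Max R" if "x \<in> R" for x using Min_le[OF f(1) that] Max_ge[OF f(1) that] e by simp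
      then have "?R = {}" by blast
      then have "card ?R = 0" by (simp only: card.empty)
      then show False using c by simp
    qed
    then have "Min R \<in> ?R" using f by simp
    then show ?thesis using f by (intro Min_eqI) auto
  qed
  then have "?R = {Max ?R, Min R}" using card_2_MaxMin(1)[OF c] by simp
  moreover have "R = insert (Max R) ?R" using Max_in[OF f] by auto
  ultimately show ?thesis by metis
qed

lemma FP_sym_sols:
  assumes "0 < \<theta>"
  shows "cdisc \<theta> > 0 \<Longrightarrow> {v \<in> FP \<theta>. fst v = 1} = sol \<theta> ` {1, 2, 3}"
    "cdisc \<theta> = 0 \<Longrightarrow> {v \<in> FP \<theta>. fst v = 1} = sol \<theta> ` {1, 3}"
    "cdisc \<theta> < 0 \<Longrightarrow> {v \<in> FP \<theta>. fst v = 1} = sol \<theta> ` {1}"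
    "cdisc \<theta> > 0 \<Longrightarrow> card {v \<in> FP \<theta>. fst v = 1} = 3"
    "cdisc \<theta> = 0 \<Longrightarrow> card {v \<in> FP \<theta>. fst v = 1} = 2"
    "cdisc \<theta> < 0 \<Longrightarrow> card {v \<in> FP \<theta>. fst v = 1} = 1"
proof -
  let ?R = "cubic_roots \<theta>"
  note c = card_cubic_roots[OF assms]
  have card: "card {v \<in> FP \<theta>. fst v = 1} = card ?R"
    unfolding FP_sym_set[OF assms] by (rule card_image) (simp add: inj_on_def)
  show "cdisc \<theta> > 0 \<Longrightarrow> card {v \<in> FP \<theta>. fst v = 1} = 3"
    "cdisc \<theta> = 0 \<Longrightarrow> card {v \<in> FP \<theta>. fst v = 1} = 2"
    "cdisc \<theta> < 0 \<Longrightarrow> card {v \<in> FP \<theta>. fst v = 1} = 1" using c card by simp_all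
  show "{v \<in> FP \<theta>. fst v = 1} = sol \<theta> ` {1, 2, 3}" if "cdisc \<theta> > 0"
  proof -
    have "Pair 1 ` ?R = Pair 1 ` {Max ?R, Max (?R - {Max ?R}), Min ?R}"
      using card_3_MaxMin[OF c(1)[OF that]] by (rule arg_cong)
    then show ?thesis unfolding FP_sym_set[OF assms] by (simp only: image_insert image_empty sol_sym)
  qed
  show "{v \<in> FP \<theta>. fst v = 1} = sol \<theta> ` {1, 3}" if "cdisc \<theta> = 0"
  proof -
    have "Pair 1 ` ?R = Pair 1 ` {Max ?R, Min ?R}"
      using card_2_MaxMin(1)[OF c(2)[OF that]] by (rule arg_cong)
    then show ?thesis unfolding FP_sym_set[OF assms] by (simp only: image_insert image_empty sol_sym)
  qed
  show "{v \<in> FP \<theta>. fst v = 1} = sol \<theta> ` {1}" if neg: "cdisc \<theta> < 0"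
  proof -
    obtain a where "?R = {a}" using c(3)[OF neg] by (auto simp: card_1_singleton_iff)
    then show ?thesis unfolding FP_sym_set[OF assms] by (simp add: sol_sym)
  qed
qed

lemma card_asym:
  assumes "0 < \<theta>"
  shows "\<theta> < thc' \<Longrightarrow> card (sol \<theta> ` {4, 5, 6, 7}) = 4"
    "\<theta> = thc' \<Longrightarrow> sol \<theta> ` {4, 5, 6, 7} = sol \<theta> ` {4, 6} \<and> card (sol \<theta> ` {4, 6}) = 2"
proof -
  { assume t: "\<theta> < thc'"
    then have t': "\<theta> \<le> thc'" by simp
    note p1 = xpm[OF \<xi>_gt_2(1)[OF assms t']] and p2 = xpm[OF \<xi>_gt_2(2)[OF assms t']]
    have "\<xi>\<^sub>1 \<theta> < \<xi>\<^sub>2 \<theta>" using w_bounds(3)[OF assms t' t] by (simp add: w1_def w2_def)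
    then have m: "xp (\<xi>\<^sub>1 \<theta>) < xp (\<xi>\<^sub>2 \<theta>)" using xp_mono \<xi>_gt_2(1)[OF assms t'] by blast
    then have m': "xm (\<xi>\<^sub>2 \<theta>) < xm (\<xi>\<^sub>1 \<theta>)" using p1 p2 by (simp add: frac_less2)
    have "inj_on (sol \<theta>) {4, 5, 6, 7}"
      using m m' p1(1,3) p2(1,3) by (simp add: sol_asym)
    then show "card (sol \<theta> ` {4, 5, 6, 7}) = 4" by (simp add: card_image) }
  { assume t: "\<theta> = thc'"
    then have t': "\<theta> \<le> thc'" by simp
    note p1 = xpm(1,3)[OF \<xi>_gt_2(1)[OF assms t']]
    have e: "\<xi>\<^sub>1 \<theta> = \<xi>\<^sub>2 \<theta>" using w_bounds(4)[OF assms t' t] by (simp add: w1_def w2_def)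
    have "sol \<theta> 4 \<noteq> sol \<theta> 6" using p1 by (simp add: sol_asym e)
    then show "sol \<theta> ` {4, 5, 6, 7} = sol \<theta> ` {4, 6} \<and> card (sol \<theta> ` {4, 6}) = 2"
      by (auto simp: sol_asym e) }
qed

section \<open>Contraction constants\<close>

definition u0 :: "nat \<Rightarrow> nat \<Rightarrow> real" where
  "u0 i j = (if i = j then 0 else 1)"

text \<open>The weight \<open>5/4\<close> is tuned to the solutions 5 and 6: it yields \<open>\<gamma> = 0.855\<close> and \<open>\<kappa> = 0.584\<close>, hence
  \<open>2 * \<kappa> * \<gamma> < 1\<close>, all the way down to \<open>\<theta> = 0.26586\<close>, where the total variation metric \<open>u0\<close> fails.\<close>

definition u1 :: "nat \<Rightarrow> nat \<Rightarrow> real" where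
  "u1 i j = (if i = j then 0 else if i = 1 \<or> j = 1 then 1 else 5/4)"

text \<open>If r \<le> s, then (r, s) is a convex combination of (0,0), (0,1) and (1,1), where the
  expression is 0, b and a + b.\<close>

lemma convex_combination_bound:
  fixes a b r s \<kappa> :: real
  assumes "0 \<le> r" "r \<le> 1" "0 \<le> s" "s \<le> 1" "\<bar>a\<bar> \<le> \<kappa>" "\<bar>b\<bar> \<le> \<kappa>" "\<bar>a + b\<bar> \<le> \<kappa>"
  shows "\<bar>a * r + b * s\<bar> \<le> \<kappa>"
proof -
  have *: "\<bar>a * r + b * s\<bar> \<le> \<kappa>" if "r \<le> s" "0 \<le> r" "s \<le> 1" "\<bar>b\<bar> \<le> \<kappa>" "\<bar>a + b\<bar> \<le> \<kappa>" for a b r s :: real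
  proof -
    have "a * r + b * s = r * (a + b) + (s - r) * b" by algebra
    also have "\<bar>\<dots>\<bar> \<le> r * \<bar>a + b\<bar> + (s - r) * \<bar>b\<bar>"
      using that by (intro order_trans[OF abs_triangle_ineq]) (simp add: abs_mult)
    also have "\<dots> \<le> r * \<kappa> + (s - r) * \<kappa>"
      using that by (intro add_mono mult_left_mono) auto
    also have "\<dots> = s * \<kappa>" by algebra
    also have "\<dots> \<le> 1 * \<kappa>" using that by (intro mult_right_mono) auto
    finally show ?thesis by simp
  qed
  show ?thesis
  proof (cases "r \<le> s")
    case True
    then show ?thesis using assms by (intro *) auto
  next
    case False
    then have "\<bar>b * s + a * r\<bar> \<le> \<kappa>" using assms by (intro *) (auto simp: add.commute)
    then show ?thesis by (simp add: add.commute)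
  qed
qed

text \<open>For a signed measure of mass zero on three points the largest modulus of an entry is the
  total variation distance. Subtracting the least of the three values of q leaves two values in the
  unit interval.\<close>

lemma three_point_TV:
  fixes D q :: "nat \<Rightarrow> real"
  assumes "D 0 + D 1 + D 2 = 0" "\<bar>D 0\<bar> \<le> \<kappa>" "\<bar>D 1\<bar> \<le> \<kappa>" "\<bar>D 2\<bar> \<le> \<kappa>"
    and q: "\<bar>q 0 - q 1\<bar> \<le> 1" "\<bar>q 1 - q 2\<bar> \<le> 1" "\<bar>q 0 - q 2\<bar> \<le> 1"
  shows "\<bar>D 0 * q 0 + D 1 * q 1 + D 2 * q 2\<bar> \<le> \<kappa>"
proof -
  consider "q 0 \<le> q 1" "q 0 \<le> q 2" | "q 1 \<le> q 0" "q 1 \<le> q 2" | "q 2 \<le> q 0" "q 2 \<le> q 1" by linarith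
  then show ?thesis
  proof cases
    case 1
    have "D 0 * q 0 + D 1 * q 1 + D 2 * q 2 = D 1 * (q 1 - q 0) + D 2 * (q 2 - q 0)" using assms(1) by algebra
    moreover have "D 1 + D 2 = - D 0" using assms(1) by simp
    ultimately show ?thesis using 1 assms by (simp only:) (rule convex_combination_bound, auto)
  next
    case 2
    have "D 0 * q 0 + D 1 * q 1 + D 2 * q 2 = D 0 * (q 0 - q 1) + D 2 * (q 2 - q 1)" using assms(1) by algebra
    moreover have "D 0 + D 2 = - D 1" using assms(1) by simp
    ultimately show ?thesis using 2 assms by (simp only:) (rule convex_combination_bound, auto)
  next
    case 3
    have "D 0 * q 0 + D 1 * q 1 + D 2 * q 2 = D 0 * (q 0 - q 2) + D 1 * (q 1 - q 2)" using assms(1) by algebra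
    moreover have "D 0 + D 1 = - D 2" using assms(1) by simp
    ultimately show ?thesis using 3 assms by (simp only:) (rule convex_combination_bound, auto)
  qed
qed

lemma ball_pairs_sym:
  fixes \<Phi> :: "nat \<Rightarrow> nat \<Rightarrow> bool"
  assumes "\<And>i. \<Phi> i i" "\<And>i j. \<Phi> i j \<Longrightarrow> \<Phi> j i" "\<Phi> 0 1" "\<Phi> 0 2" "\<Phi> 1 2"
  shows "\<forall>i\<in>spins. \<forall>j\<in>spins. \<Phi> i j"
  unfolding ball_spins using assms by blast

lemma ball_osc:
  fixes q :: "nat \<Rightarrow> real"
  assumes "\<forall>i\<in>spins. \<forall>j\<in>spins. \<bar>q i - q j\<bar> \<le> u i j"
  shows "\<bar>q 0 - q 1\<bar> \<le> u 0 1" "\<bar>q 1 - q 2\<bar> \<le> u 1 2" "\<bar>q 0 - q 2\<bar> \<le> u 0 2"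
  using assms by (auto simp: spins_def)

lemma quotient_diff:
  fixes A B Z Z' :: real assumes "0 < Z" "0 < Z'"
  shows "A / Z - B / Z' = (A * Z' - B * Z) / (Z * Z')"
  using assms by (simp add: diff_frac_eq)

text \<open>After clearing denominators every numerator has the factor 1 - \<theta>^2. The flip of
  the spins 0 and 2 carries the pair (0,1) to (2,1), so two inequalities remain.\<close>

lemma up_contractionI:
  fixes u :: "nat \<Rightarrow> nat \<Rightarrow> real"
  assumes \<theta>: "0 < \<theta>" and u: "\<And>i. u i i = 0" "\<And>i j. u i j = u j i"
    and 01: "\<And>b0 b1 b2 q0 q1 q2. 0 < b0 \<Longrightarrow> 0 < b1 \<Longrightarrow> 0 < b2 \<Longrightarrow>
      \<bar>q0 - q1\<bar> \<le> u 0 1 \<Longrightarrow> \<bar>q1 - q2\<bar> \<le> u 1 2 \<Longrightarrow> \<bar>q0 - q2\<bar> \<le> u 0 2 \<Longrightarrow>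
      \<bar>(1 - \<theta>^2) * b0 * (b1 * (q0 - q1) + \<theta> * b2 * (q0 - q2))\<bar>
        \<le> \<gamma> * u 0 1 * ((b0 + \<theta> * b1 + \<theta>^2 * b2) * (\<theta> * b0 + b1 + \<theta> * b2))"
    and 02: "\<And>b0 b1 b2 q0 q1 q2. 0 < b0 \<Longrightarrow> 0 < b1 \<Longrightarrow> 0 < b2 \<Longrightarrow>
      (\<theta> \<le> 1 \<longrightarrow> 16 * \<theta>^4 * (b0 * b2) \<le> (1 + \<theta>^2)^4 * b1^2) \<Longrightarrow>
      \<bar>q0 - q1\<bar> \<le> u 0 1 \<Longrightarrow> \<bar>q1 - q2\<bar> \<le> u 1 2 \<Longrightarrow> \<bar>q0 - q2\<bar> \<le> u 0 2 \<Longrightarrow>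
      \<bar>(1 - \<theta>^2) * (b0 * (\<theta> * b1 + (1 + \<theta>^2) * b2) * q0 + \<theta> * b1 * (b2 - b0) * q1
          - b2 * (\<theta> * b1 + (1 + \<theta>^2) * b0) * q2)\<bar>
        \<le> \<gamma> * u 0 2 * ((b0 + \<theta> * b1 + \<theta>^2 * b2) * (\<theta>^2 * b0 + \<theta> * b1 + b2))"
    and sym: "u 1 2 = u 0 1"
  shows "up_contraction \<theta> u \<gamma>"
  unfolding up_contraction_def
proof (intro allI impI)
  fix b q :: "nat \<Rightarrow> real"
  assume b: "\<forall>i\<in>spins. 0 < b i" and K: "\<theta> \<le> 1 \<longrightarrow> 16 * \<theta>^4 * (b 0 * b 2) \<le> (1 + \<theta>^2)^4 * (b 1)^2"
    and q: "\<forall>i\<in>spins. \<forall>j\<in>spins. \<bar>q i - q j\<bar> \<le> u i j"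
  have bp: "0 < b 0" "0 < b 1" "0 < b 2" using b by auto
  note qo = ball_osc[OF q]
  have qo': "\<bar>q 2 - q 1\<bar> \<le> u 0 1" "\<bar>q 1 - q 0\<bar> \<le> u 1 2" "\<bar>q 2 - q 0\<bar> \<le> u 0 2"
    using qo sym by (simp_all add: abs_minus_commute)
  let ?n = "\<lambda>s. \<Sum>i\<in>spins. wt \<theta> i s * b i * q i" and ?Z = "\<lambda>s. \<Sum>i\<in>spins. wt \<theta> i s * b i"
  have Z: "?Z 0 = b 0 + \<theta> * b 1 + \<theta>^2 * b 2" "?Z 1 = \<theta> * b 0 + b 1 + \<theta> * b 2" "?Z 2 = \<theta>^2 * b 0 + \<theta> * b 1 + b 2"
    by (simp_all add: sum_spins wt_def)
  have n: "?n 0 = b 0 * q 0 + \<theta> * b 1 * q 1 + \<theta>^2 * b 2 * q 2" "?n 1 = \<theta> * b 0 * q 0 + b 1 * q 1 + \<theta> * b 2 * q 2"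
    "?n 2 = \<theta>^2 * b 0 * q 0 + \<theta> * b 1 * q 1 + b 2 * q 2"
    by (simp_all add: sum_spins wt_def)
  have Zp: "0 < ?Z 0" "0 < ?Z 1" "0 < ?Z 2" unfolding Z using bp \<theta> by (simp_all add: add_pos_pos)
  show "\<forall>s\<in>spins. \<forall>s'\<in>spins. \<bar>?n s / ?Z s - ?n s' / ?Z s'\<bar> \<le> \<gamma> * u s s'"
  proof (rule ball_pairs_sym)
    show "\<bar>?n i / ?Z i - ?n i / ?Z i\<bar> \<le> \<gamma> * u i i" for i by (simp add: u(1))
    show "\<bar>?n j / ?Z j - ?n i / ?Z i\<bar> \<le> \<gamma> * u j i" if "\<bar>?n i / ?Z i - ?n j / ?Z j\<bar> \<le> \<gamma> * u i j" for i j
      using that by (simp add: abs_minus_commute u(2)[of j i])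
    have "\<bar>?n 0 * ?Z 1 - ?n 1 * ?Z 0\<bar> \<le> \<gamma> * u 0 1 * (?Z 0 * ?Z 1)"
    proof -
      have "?n 0 * ?Z 1 - ?n 1 * ?Z 0 = (1 - \<theta>^2) * b 0 * (b 1 * (q 0 - q 1) + \<theta> * b 2 * (q 0 - q 2))"
        unfolding n Z by algebra
      then show ?thesis using 01[OF bp qo] unfolding Z by simp
    qed
    then show "\<bar>?n 0 / ?Z 0 - ?n 1 / ?Z 1\<bar> \<le> \<gamma> * u 0 1"
      unfolding quotient_diff[OF Zp(1,2)] using mult_pos_pos[OF Zp(1,2)] by (simp only: abs_divide abs_of_pos pos_divide_le_eq)
    have "\<bar>?n 0 * ?Z 2 - ?n 2 * ?Z 0\<bar> \<le> \<gamma> * u 0 2 * (?Z 0 * ?Z 2)"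
    proof -
      have "?n 0 * ?Z 2 - ?n 2 * ?Z 0 = (1 - \<theta>^2) * (b 0 * (\<theta> * b 1 + (1 + \<theta>^2) * b 2) * q 0 + \<theta> * b 1 * (b 2 - b 0) * q 1
          - b 2 * (\<theta> * b 1 + (1 + \<theta>^2) * b 0) * q 2)"
        unfolding n Z by algebra
      then show ?thesis using 02[OF bp K qo] unfolding Z by simp
    qed
    then show "\<bar>?n 0 / ?Z 0 - ?n 2 / ?Z 2\<bar> \<le> \<gamma> * u 0 2"
      unfolding quotient_diff[OF Zp(1,3)] using mult_pos_pos[OF Zp(1,3)] by (simp only: abs_divide abs_of_pos pos_divide_le_eq)
    have "\<bar>?n 1 * ?Z 2 - ?n 2 * ?Z 1\<bar> \<le> \<gamma> * u 1 2 * (?Z 1 * ?Z 2)"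
    proof -
      have "?n 1 * ?Z 2 - ?n 2 * ?Z 1 = - ((1 - \<theta>^2) * b 2 * (b 1 * (q 2 - q 1) + \<theta> * b 0 * (q 2 - q 0)))"
        unfolding n Z by algebra
      moreover have "?Z 1 * ?Z 2 = (b 2 + \<theta> * b 1 + \<theta>^2 * b 0) * (\<theta> * b 2 + b 1 + \<theta> * b 0)"
        unfolding Z by algebra
      ultimately show ?thesis using 01[OF bp(3,2,1) qo'] by (simp only: abs_minus_cancel sym)
    qed
    then show "\<bar>?n 1 / ?Z 1 - ?n 2 / ?Z 2\<bar> \<le> \<gamma> * u 1 2"
      unfolding quotient_diff[OF Zp(2,3)] using mult_pos_pos[OF Zp(2,3)] by (simp only: abs_divide abs_of_pos pos_divide_le_eq)
  qed
qed

text \<open>For each pair, the product of the normalisers minus 1 + \<theta>^2 times the bound on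
  the numerator without its factor 1 - \<theta>^2 is a sum of nonnegative terms. So |1 - \<theta>^2|
  / (1 + \<theta>^2) works for all weights.\<close>

lemma up_contraction_u0:
  assumes \<theta>: "0 < \<theta>" and \<gamma>: "\<bar>1 - \<theta>^2\<bar> \<le> \<gamma> * (1 + \<theta>^2)"
  shows "up_contraction \<theta> u0 \<gamma>"
proof (rule up_contractionI[OF \<theta>])
  have g0: "0 \<le> \<gamma>"
  proof (rule ccontr)
    assume "\<not> 0 \<le> \<gamma>"
    then have "\<gamma> * (1 + \<theta>^2) < 0" by (intro mult_neg_pos) (auto simp: add_pos_nonneg)
    then show False using \<gamma> by linarith
  qed
  show "u0 i i = 0" "u0 i j = u0 j i" "u0 1 2 = u0 0 1" for i j by (auto simp: u0_def)
  fix b0 b1 b2 q0 q1 q2 :: real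
  assume b: "0 < b0" "0 < b1" "0 < b2"
  assume q: "\<bar>q0 - q1\<bar> \<le> u0 0 1" "\<bar>q1 - q2\<bar> \<le> u0 1 2" "\<bar>q0 - q2\<bar> \<le> u0 0 2"
  then have q': "\<bar>q0 - q1\<bar> \<le> 1" "\<bar>q1 - q2\<bar> \<le> 1" "\<bar>q0 - q2\<bar> \<le> 1" by (simp_all add: u0_def)
  have scale: "\<bar>(1 - \<theta>^2) * E\<bar> \<le> \<gamma> * Z" if "(1 + \<theta>^2) * \<bar>E\<bar> \<le> Z" for E Z
  proof -
    have "\<bar>(1 - \<theta>^2) * E\<bar> \<le> (\<gamma> * (1 + \<theta>^2)) * \<bar>E\<bar>" unfolding abs_mult using \<gamma> by (rule mult_right_mono) simp
    also have "\<dots> \<le> \<gamma> * Z" unfolding mult.assoc using that g0 by (rule mult_left_mono)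
    finally show ?thesis .
  qed
  { let ?Z = "(b0 + \<theta> * b1 + \<theta>^2 * b2) * (\<theta> * b0 + b1 + \<theta> * b2)"
    let ?E = "b0 * (b1 * (q0 - q1) + \<theta> * b2 * (q0 - q2))"
    have "\<bar>?E\<bar> \<le> b0 * (b1 * 1 + \<theta> * b2 * 1)"
    proof -
      have "\<bar>b1 * (q0 - q1) + \<theta> * b2 * (q0 - q2)\<bar> \<le> b1 * \<bar>q0 - q1\<bar> + \<theta> * b2 * \<bar>q0 - q2\<bar>"
        using b \<theta> by (intro order_trans[OF abs_triangle_ineq]) (simp add: abs_mult)
      also have "\<dots> \<le> b1 * 1 + \<theta> * b2 * 1" using b \<theta> q' by (intro add_mono mult_left_mono) auto
      finally show ?thesis using b by (simp add: abs_mult)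
    qed
    then have "(1 + \<theta>^2) * \<bar>?E\<bar> \<le> (1 + \<theta>^2) * (b0 * (b1 * 1 + \<theta> * b2 * 1))" by (intro mult_left_mono) auto
    also have "\<dots> \<le> ?Z"
    proof -
      have "?Z = (1 + \<theta>^2) * (b0 * (b1 * 1 + \<theta> * b2 * 1)) + \<theta> * (b0^2 + b1^2 + 2 * \<theta> * b1 * b2 + \<theta>^2 * b2^2)" by algebra
      moreover have "0 \<le> \<theta> * (b0^2 + b1^2 + 2 * \<theta> * b1 * b2 + \<theta>^2 * b2^2)" using b \<theta> by simp
      ultimately show ?thesis by linarith
    qed
    finally have "\<bar>(1 - \<theta>^2) * ?E\<bar> \<le> \<gamma> * ?Z" by (rule scale)
    then show "\<bar>(1 - \<theta>^2) * b0 * (b1 * (q0 - q1) + \<theta> * b2 * (q0 - q2))\<bar> \<le> \<gamma> * u0 0 1 * ?Z"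
      by (simp add: u0_def mult.assoc) }
  { let ?Z = "(b0 + \<theta> * b1 + \<theta>^2 * b2) * (\<theta>^2 * b0 + \<theta> * b1 + b2)"
    let ?a0 = "b0 * (\<theta> * b1 + (1 + \<theta>^2) * b2)" and ?b0 = "\<theta> * b1 * (b2 - b0)"
      and ?c0 = "- b2 * (\<theta> * b1 + (1 + \<theta>^2) * b0)"
    have Z: "?Z = \<theta>^2 * (b0 - b2)^2 + (1 + \<theta>^2)^2 * (b0 * b2) + \<theta> * (1 + \<theta>^2) * b1 * (b0 + b2) + \<theta>^2 * b1^2" by algebra
    \<comment> \<open>All three coefficients are at most \<open>k\<close> in modulus; the terms
      \<open>r\<close> below are the exact remainders.\<close>
    define k where "k = ?Z / (1 + \<theta>^2)"
    have s: "0 < 1 + \<theta>^2" by (simp add: add_pos_nonneg)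
    have d: "x \<le> k" if "(1 + \<theta>^2) * x + r = ?Z" "0 \<le> r" for x r
      using that s unfolding k_def by (simp add: pos_le_divide_eq mult.commute)
    have f0: "?a0 \<le> k" by (rule d[where r = "\<theta>^2 * (b0 - b2)^2 + \<theta> * (1 + \<theta>^2) * b1 * b2 + \<theta>^2 * b1^2"])
        (algebra, use b \<theta> in simp)
    have f2: "- ?c0 \<le> k" by (rule d[where r = "\<theta>^2 * (b0 - b2)^2 + \<theta> * (1 + \<theta>^2) * b1 * b0 + \<theta>^2 * b1^2"])
        (algebra, use b \<theta> in simp)
    have f1: "?b0 \<le> k"
      by (rule d[where r = "\<theta>^2 * (b0 - b2)^2 + (1 + \<theta>^2)^2 * (b0 * b2) + 2 * \<theta> * (1 + \<theta>^2) * b1 * b0 + \<theta>^2 * b1^2"])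
        (algebra, use b \<theta> in simp)
    have f1': "- ?b0 \<le> k"
      by (rule d[where r = "\<theta>^2 * (b0 - b2)^2 + (1 + \<theta>^2)^2 * (b0 * b2) + 2 * \<theta> * (1 + \<theta>^2) * b1 * b2 + \<theta>^2 * b1^2"])
        (algebra, use b \<theta> in simp)
    have p: "0 \<le> ?a0" "0 \<le> - ?c0" using b \<theta> by simp_all
    have aux: "0 \<le> - x \<Longrightarrow> - x \<le> k \<Longrightarrow> \<bar>x\<bar> \<le> k" for x by linarith
    have "\<bar>?a0\<bar> \<le> k" using f0 p(1) by (simp only: abs_of_nonneg)
    moreover have "\<bar>?b0\<bar> \<le> k" by (rule abs_leI[OF f1 f1'])
    moreover have "\<bar>?c0\<bar> \<le> k" by (rule aux[OF p(2) f2])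
    ultimately have abs: "\<bar>?a0\<bar> \<le> k" "\<bar>?b0\<bar> \<le> k" "\<bar>?c0\<bar> \<le> k" by blast+
    let ?D = "\<lambda>i::nat. if i = 0 then ?a0 else if i = 1 then ?b0 else ?c0"
    let ?q = "\<lambda>i::nat. if i = 0 then q0 else if i = 1 then q1 else q2"
    have "\<bar>?D 0 * ?q 0 + ?D 1 * ?q 1 + ?D 2 * ?q 2\<bar> \<le> k"
    proof (rule three_point_TV)
      have "?a0 + ?b0 + ?c0 = 0" by algebra
      then show "?D 0 + ?D 1 + ?D 2 = 0" by simp
    qed (use abs q' in simp_all)
    then have "\<bar>?a0 * q0 + ?b0 * q1 + ?c0 * q2\<bar> \<le> k" by simp
    then have "(1 + \<theta>^2) * \<bar>?a0 * q0 + ?b0 * q1 + ?c0 * q2\<bar> \<le> ?Z"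
      using s unfolding k_def by (simp add: pos_le_divide_eq mult.commute)
    from scale[OF this] show "\<bar>(1 - \<theta>^2) * (b0 * (\<theta> * b1 + (1 + \<theta>^2) * b2) * q0 + \<theta> * b1 * (b2 - b0) * q1
          - b2 * (\<theta> * b1 + (1 + \<theta>^2) * b0) * q2)\<bar> \<le> \<gamma> * u0 0 2 * ?Z"
      by (simp add: u0_def) }
qed

lemma down_contraction_u0:
  fixes P :: "nat \<Rightarrow> nat \<Rightarrow> real"
  assumes sum: "\<And>i. i \<in> spins \<Longrightarrow> P i 0 + P i 1 + P i 2 = 1"
    and d: "\<And>s s' i. s \<in> spins \<Longrightarrow> s' \<in> spins \<Longrightarrow> i \<in> spins \<Longrightarrow> \<bar>P s i - P s' i\<bar> \<le> \<kappa>"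
  shows "down_contraction P u0 \<kappa>"
  unfolding down_contraction_def
proof (intro allI impI ballI)
  fix q :: "nat \<Rightarrow> real" and s s'
  assume q: "\<forall>i\<in>spins. \<forall>j\<in>spins. \<bar>q i - q j\<bar> \<le> u0 i j" and s: "s \<in> spins" "s' \<in> spins"
  show "\<bar>(\<Sum>j\<in>spins. P s j * q j) - (\<Sum>j\<in>spins. P s' j * q j)\<bar> \<le> \<kappa> * u0 s s'"
  proof (cases "s = s'")
    case True
    then show ?thesis by (simp add: u0_def)
  next
    case False
    let ?D = "\<lambda>i. P s i - P s' i"
    have "\<bar>?D 0 * q 0 + ?D 1 * q 1 + ?D 2 * q 2\<bar> \<le> \<kappa>"
    proof (rule three_point_TV)
      show "?D 0 + ?D 1 + ?D 2 = 0" using sum[OF s(1)] sum[OF s(2)] by simp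
    qed (use d[OF s] ball_osc[OF q] in \<open>simp_all add: u0_def\<close>)
    moreover have "(\<Sum>j\<in>spins. P s j * q j) - (\<Sum>j\<in>spins. P s' j * q j) = ?D 0 * q 0 + ?D 1 * q 1 + ?D 2 * q 2"
      unfolding sum_spins by algebra
    ultimately show ?thesis using False by (simp add: u0_def)
  qed
qed

text \<open>Differences of q are taken from an outer spin: 0 for the first two pairs, 2 for the
  third. The middle difference is then at most 1 and the outer one at most 5/4.\<close>

lemma down_contraction_u1:
  fixes P :: "nat \<Rightarrow> nat \<Rightarrow> real"
  assumes sum: "\<And>i. i \<in> spins \<Longrightarrow> P i 0 + P i 1 + P i 2 = 1"
    and 01: "\<bar>P 0 1 - P 1 1\<bar> + 5/4 * \<bar>P 0 2 - P 1 2\<bar> \<le> \<kappa>"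
    and 02: "\<bar>P 0 1 - P 2 1\<bar> + 5/4 * \<bar>P 0 2 - P 2 2\<bar> \<le> 5/4 * \<kappa>"
    and 12: "\<bar>P 1 1 - P 2 1\<bar> + 5/4 * \<bar>P 1 0 - P 2 0\<bar> \<le> \<kappa>"
  shows "down_contraction P u1 \<kappa>"
  unfolding down_contraction_def
proof (intro allI impI)
  fix q :: "nat \<Rightarrow> real"
  assume "\<forall>i\<in>spins. \<forall>j\<in>spins. \<bar>q i - q j\<bar> \<le> u1 i j"
  note qo = ball_osc[OF this]
  have qo: "\<bar>q 1 - q 0\<bar> \<le> 1" "\<bar>q 1 - q 2\<bar> \<le> 1" "\<bar>q 2 - q 0\<bar> \<le> 5/4" "\<bar>q 0 - q 2\<bar> \<le> 5/4"
    using qo by (simp_all add: u1_def abs_minus_commute)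
  have S: "P 0 0 + P 0 1 + P 0 2 = 1" "P 1 0 + P 1 1 + P 1 2 = 1" "P 2 0 + P 2 1 + P 2 2 = 1"
    using sum[of 0] sum[of 1] sum[of 2] by simp_all
  have bound: "\<bar>a * x + b * y\<bar> \<le> \<bar>a\<bar> + 5/4 * \<bar>b\<bar>" if "\<bar>x\<bar> \<le> 1" "\<bar>y\<bar> \<le> 5/4" for a b x y :: real
  proof -
    have "\<bar>a * x + b * y\<bar> \<le> \<bar>a\<bar> * \<bar>x\<bar> + \<bar>b\<bar> * \<bar>y\<bar>" by (intro order_trans[OF abs_triangle_ineq]) (simp add: abs_mult)
    also have "\<dots> \<le> \<bar>a\<bar> * 1 + \<bar>b\<bar> * (5/4)" using that by (intro add_mono mult_left_mono) auto
    finally show ?thesis by simp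
  qed
  let ?n = "\<lambda>s. \<Sum>j\<in>spins. P s j * q j"
  show "\<forall>s\<in>spins. \<forall>s'\<in>spins. \<bar>?n s - ?n s'\<bar> \<le> \<kappa> * u1 s s'"
  proof (rule ball_pairs_sym)
    show "\<bar>?n i - ?n i\<bar> \<le> \<kappa> * u1 i i" for i by (simp add: u1_def)
    show "\<bar>?n j - ?n i\<bar> \<le> \<kappa> * u1 j i" if "\<bar>?n i - ?n j\<bar> \<le> \<kappa> * u1 i j" for i j
      using that by (auto simp: abs_minus_commute u1_def split: if_splits)
    have "?n 0 - ?n 1 = (P 0 1 - P 1 1) * (q 1 - q 0) + (P 0 2 - P 1 2) * (q 2 - q 0)"
      unfolding sum_spins using S by algebra
    then show "\<bar>?n 0 - ?n 1\<bar> \<le> \<kappa> * u1 0 1" using order_trans[OF bound[OF qo(1,3)] 01] by (simp add: u1_def)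
    have "?n 0 - ?n 2 = (P 0 1 - P 2 1) * (q 1 - q 0) + (P 0 2 - P 2 2) * (q 2 - q 0)"
      unfolding sum_spins using S by algebra
    then show "\<bar>?n 0 - ?n 2\<bar> \<le> \<kappa> * u1 0 2" using order_trans[OF bound[OF qo(1,3)] 02] by (simp add: u1_def)
    have "?n 1 - ?n 2 = (P 1 1 - P 2 1) * (q 1 - q 2) + (P 1 0 - P 2 0) * (q 0 - q 2)"
      unfolding sum_spins using S by algebra
    then show "\<bar>?n 1 - ?n 2\<bar> \<le> \<kappa> * u1 1 2" using order_trans[OF bound[OF qo(2,4)] 12] by (simp add: u1_def)
  qed
qed

text \<open>The inequality to which \<open>up_u1_02\<close> reduces. The range runs from 0.26586 to
  an upper bound of the second threshold.\<close>

lemma up_u1_poly: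
  fixes \<theta> :: real
  assumes "26586 \<le> 100000 * \<theta>" "100000 * \<theta> \<le> 29565"
  shows "0 < - 145 + 1420 * \<theta>^2 + 440 * \<theta>^3 + 5130 * \<theta>^4 + 13240 * \<theta>^5 + 5420 * \<theta>^6 + 1855 * \<theta>^8"
proof -
  have "12404921529731358324379750722000000000000000000000000000000000000000 * (- 145 + 1420 * \<theta>^2 + 440 * \<theta>^3 + 5130 * \<theta>^4 + 13240 * \<theta>^5 + 5420 * \<theta>^6 + 1855 * \<theta>^8) = 109293363225683264203100804636585962838066299545324895079705896071936 + (95879418057145090850891653772390780531712 * ((100000 * \<theta> - 26586) * (29565 - 100000 * \<theta>)^7)
      + 683329883655126567615108443596501800636672 * ((100000 * \<theta> - 26586)^2 * (29565 - 100000 * \<theta>)^6)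
      + 2087433043453684587145990943177491926207744 * ((100000 * \<theta> - 26586)^3 * (29565 - 100000 * \<theta>)^5)
      + 3543042469727146413722405861058700785979680 * ((100000 * \<theta> - 26586)^4 * (29565 - 100000 * \<theta>)^4)
      + 3608658604007696754245001290201540414823744 * ((100000 * \<theta> - 26586)^5 * (29565 - 100000 * \<theta>)^3)
      + 2205570965278117707274942982699699556961872 * ((100000 * \<theta> - 26586)^6 * (29565 - 100000 * \<theta>)^2)
      + 748994155868341372089801073920086120953392 * ((100000 * \<theta> - 26586)^7 * (29565 - 100000 * \<theta>))
      + 109021902728778228662992840685779542697299 * ((100000 * \<theta> - 26586)^8))"
    by algebra
  moreover have "0 \<le> 95879418057145090850891653772390780531712 * ((100000 * \<theta> - 26586) * (29565 - 100000 * \<theta>)^7)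
      + 683329883655126567615108443596501800636672 * ((100000 * \<theta> - 26586)^2 * (29565 - 100000 * \<theta>)^6)
      + 2087433043453684587145990943177491926207744 * ((100000 * \<theta> - 26586)^3 * (29565 - 100000 * \<theta>)^5)
      + 3543042469727146413722405861058700785979680 * ((100000 * \<theta> - 26586)^4 * (29565 - 100000 * \<theta>)^4)
      + 3608658604007696754245001290201540414823744 * ((100000 * \<theta> - 26586)^5 * (29565 - 100000 * \<theta>)^3)
      + 2205570965278117707274942982699699556961872 * ((100000 * \<theta> - 26586)^6 * (29565 - 100000 * \<theta>)^2)
      + 748994155868341372089801073920086120953392 * ((100000 * \<theta> - 26586)^7 * (29565 - 100000 * \<theta>))
      + 109021902728778228662992840685779542697299 * ((100000 * \<theta> - 26586)^8)"
    by (intro add_nonneg_nonneg mult_nonneg_nonneg zero_le_power) (use assms in simp_all)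
  ultimately show ?thesis by (rule pos_certificate[rotated 2]) simp_all
qed

lemma le_certificate:
  fixes K a b p q r :: real
  assumes "K * b = K * a + (p + c * q + d * r)" "0 \<le> p" "0 \<le> q" "0 \<le> r" "0 \<le> c" "0 \<le> d" "0 < K"
  shows "a \<le> b"
proof -
  have "0 \<le> p + c * q + d * r" using assms by simp
  then have "K * a \<le> K * b" unfolding assms(1) by simp
  then show ?thesis using assms(7) by simp
qed

text \<open>In the difference of the two sides the coefficient of b0 b2 can be negative. The
  condition on the weights and 4 b0 b2 \<le> (b0 + b2)^2 give 8 t b0 b2 \<le> (1 + t)^2 b1 (b0 +
  b2), so the terms with b1 compensate; \<open>up_u1_poly\<close> says they are large enough. The
  constant is 171/160 = 0.855 * 5/4, and b0 \<le> b2 fixes the sign of the coefficient of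
  d'.\<close>

lemma up_u1_02:
  fixes b0 b1 b2 d d' :: real
  assumes \<theta>: "26586/100000 \<le> \<theta>" "\<theta> \<le> 29565/100000"
    and b: "0 < b0" "0 < b1" "0 < b2" "b0 \<le> b2"
    and K: "16 * \<theta>^4 * (b0 * b2) \<le> (1 + \<theta>^2)^4 * b1^2"
    and d: "\<bar>d\<bar> \<le> 5/4" "\<bar>d'\<bar> \<le> 1"
  shows "\<bar>(1 - \<theta>^2) * (b0 * (\<theta> * b1 + (1 + \<theta>^2) * b2) * d + \<theta> * b1 * (b2 - b0) * d')\<bar>
    \<le> 171/160 * ((b0 + \<theta> * b1 + \<theta>^2 * b2) * (\<theta>^2 * b0 + \<theta> * b1 + b2))"
proof -
  define t where "t = \<theta>^2"
  have t0: "0 < t" and t1: "0 \<le> 1 - t" using \<theta> by (auto simp: t_def power2_eq_square mult_le_one)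
  let ?Z = "(b0 + \<theta> * b1 + t * b2) * (t * b0 + \<theta> * b1 + b2)"
  let ?p = "b0 * b2" and ?k = "b1 * (b0 + b2)"
  have pp: "0 < ?p" "0 < ?k" using b by simp_all
  have "(8 * t * ?p)^2 = (16 * t^2 * ?p) * (4 * ?p)" by algebra
  also have "\<dots> \<le> ((1 + t)^4 * b1^2) * (b0 + b2)^2"
  proof (rule mult_mono)
    show "16 * t^2 * ?p \<le> (1 + t)^4 * b1^2" using K by (simp add: t_def flip: power_mult)
    have "(b0 + b2)^2 = 4 * ?p + (b0 - b2)^2" by algebra
    then show "4 * ?p \<le> (b0 + b2)^2" by simp
  qed (use b in simp_all)
  also have "\<dots> = ((1 + t)^2 * ?k)^2" by algebra
  finally have k: "8 * t * ?p \<le> (1 + t)^2 * ?k"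
    by (rule power2_le_imp_le) (use pp t0 in simp)
  have \<theta>p: "0 < \<theta>" using \<theta> by simp
  have co: "0 \<le> \<theta> * (55 + 1655 * t)" using \<theta>p t0 by simp
  have "0 < 8 * \<theta>^3 * (55 + 1655 * \<theta>^2) + (1 + \<theta>^2)^3 * (1855 * \<theta>^2 - 145)"
    by (rule order.strict_trans2[OF up_u1_poly[of \<theta>] eq_refl]) (use \<theta> in simp, use \<theta> in simp, algebra)
  then have "0 \<le> ?p * (8 * \<theta>^3 * (55 + 1655 * \<theta>^2) + (1 + \<theta>^2)^3 * (1855 * \<theta>^2 - 145))"
    using pp by simp
  also have "\<dots> = (8 * t * ?p) * (\<theta> * (55 + 1655 * t)) + (1 + t)^2 * (?p * (1 + t) * (1855 * t - 145))"
    unfolding t_def by algebra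
  also have "\<dots> \<le> ((1 + t)^2 * ?k) * (\<theta> * (55 + 1655 * t)) + (1 + t)^2 * (?p * (1 + t) * (1855 * t - 145))"
    using mult_right_mono[OF k co] by simp
  also have "\<dots> = (1 + t)^2 * (?k * (\<theta> * (55 + 1655 * t)) + ?p * (1 + t) * (1855 * t - 145))" by algebra
  finally have M: "0 \<le> ?k * (\<theta> * (55 + 1655 * t)) + ?p * (1 + t) * (1855 * t - 145)"
    using t0 by (simp add: zero_le_mult_iff)
  have "\<bar>b0 * (\<theta> * b1 + (1 + t) * b2) * d + \<theta> * b1 * (b2 - b0) * d'\<bar>
      \<le> b0 * (\<theta> * b1 + (1 + t) * b2) * \<bar>d\<bar> + \<theta> * b1 * (b2 - b0) * \<bar>d'\<bar>"
    using b \<theta>p t0 by (intro order_trans[OF abs_triangle_ineq]) (simp add: abs_mult)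
  also have "\<dots> \<le> b0 * (\<theta> * b1 + (1 + t) * b2) * (5/4) + \<theta> * b1 * (b2 - b0) * 1"
    using b \<theta>p t0 d by (intro add_mono mult_left_mono) auto
  finally have "(1 - t) * \<bar>b0 * (\<theta> * b1 + (1 + t) * b2) * d + \<theta> * b1 * (b2 - b0) * d'\<bar>
      \<le> (1 - t) * (b0 * (\<theta> * b1 + (1 + t) * b2) * (5/4) + \<theta> * b1 * (b2 - b0) * 1)"
    using t1 by (rule mult_left_mono)
  also have "\<dots> \<le> 171/160 * ?Z"
  proof -
    have "800 * (171/160 * ?Z) = 800 * ((1 - t) * (b0 * (\<theta> * b1 + (1 + t) * b2) * (5/4) + \<theta> * b1 * (b2 - b0) * 1))
       + ((?k * (\<theta> * (55 + 1655 * t)) + ?p * (1 + t) * (1855 * t - 145)) + 600 * ((1 - t) * (\<theta> * (b1 * b0)))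
         + 855 * (t * (b0 - b2)^2 + (\<theta> * b1)^2))"
      by algebra
    moreover have "0 \<le> (1 - t) * (\<theta> * (b1 * b0))" using t1 b \<theta>p by simp
    moreover have "0 \<le> t * (b0 - b2)^2 + (\<theta> * b1)^2" using t0 by simp
    ultimately show ?thesis by (rule le_certificate[OF _ M]) simp_all
  qed
  finally show ?thesis using t1 by (simp add: t_def[symmetric] abs_mult)
qed

lemma up_contraction_u1:
  assumes \<theta>: "26586/100000 \<le> \<theta>" "\<theta> \<le> 29565/100000"
  shows "up_contraction \<theta> u1 (855/1000)"
proof (rule up_contractionI)
  show \<theta>p: "0 < \<theta>" using \<theta> by simp
  have t1: "0 \<le> 1 - \<theta>^2" using \<theta> by (simp add: power2_eq_square mult_le_one)
  show "u1 i i = 0" "u1 i j = u1 j i" "u1 1 2 = u1 0 1" for i j by (auto simp: u1_def)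
  fix b0 b1 b2 q0 q1 q2 :: real
  assume b: "0 < b0" "0 < b1" "0 < b2"
  assume "\<bar>q0 - q1\<bar> \<le> u1 0 1" "\<bar>q1 - q2\<bar> \<le> u1 1 2" "\<bar>q0 - q2\<bar> \<le> u1 0 2"
  then have q: "\<bar>q0 - q1\<bar> \<le> 1" "\<bar>q1 - q2\<bar> \<le> 1" "\<bar>q0 - q2\<bar> \<le> 5/4" by (simp_all add: u1_def)
  { let ?c = "b1 + \<theta> * b2"
    have c: "0 < ?c" using b \<theta>p by (simp add: add_pos_pos)
    have "\<bar>b1 * (q0 - q1) + \<theta> * b2 * (q0 - q2)\<bar> \<le> b1 * \<bar>q0 - q1\<bar> + \<theta> * b2 * \<bar>q0 - q2\<bar>"
      using b \<theta>p by (intro order_trans[OF abs_triangle_ineq]) (simp add: abs_mult)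
    \<comment> \<open>The first difference is given the weight 5/4 too. Then everything depends on
      b0 and b1 + \<theta> b2 only, and the loss is affordable because 421 \<theta> > 79 in this
      range.\<close>
    also have "\<dots> \<le> b1 * (5/4) + \<theta> * b2 * (5/4)" using b \<theta>p q by (intro add_mono mult_left_mono) auto
    also have "\<dots> = 5/4 * ?c" by algebra
    finally have "(1 - \<theta>^2) * b0 * \<bar>b1 * (q0 - q1) + \<theta> * b2 * (q0 - q2)\<bar> \<le> (1 - \<theta>^2) * b0 * (5/4 * ?c)"
      using t1 b by (intro mult_left_mono) auto
    also have "\<dots> \<le> 855/1000 * ((b0 + \<theta> * b1 + \<theta>^2 * b2) * (\<theta> * b0 + b1 + \<theta> * b2))"
    proof -
      have "200 * (855/1000 * ((b0 + \<theta> * b1 + \<theta>^2 * b2) * (\<theta> * b0 + b1 + \<theta> * b2)))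
          = 200 * ((1 - \<theta>^2) * b0 * (5/4 * ?c)) + ((1 + \<theta>) * (421 * \<theta> - 79) * (b0 * ?c) + 171 * (\<theta> * (b0 - ?c)^2))"
        by algebra
      moreover have "0 \<le> (1 + \<theta>) * (421 * \<theta> - 79) * (b0 * ?c)" using \<theta> b c by simp
      moreover have "0 \<le> \<theta> * (b0 - ?c)^2" using \<theta>p by simp
      ultimately show ?thesis by linarith
    qed
    finally show "\<bar>(1 - \<theta>^2) * b0 * (b1 * (q0 - q1) + \<theta> * b2 * (q0 - q2))\<bar>
        \<le> 855/1000 * u1 0 1 * ((b0 + \<theta> * b1 + \<theta>^2 * b2) * (\<theta> * b0 + b1 + \<theta> * b2))"
      using t1 b by (simp add: abs_mult u1_def) }
  assume "\<theta> \<le> 1 \<longrightarrow> 16 * \<theta>^4 * (b0 * b2) \<le> (1 + \<theta>^2)^4 * b1^2"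
  then have K: "16 * \<theta>^4 * (b0 * b2) \<le> (1 + \<theta>^2)^4 * b1^2" using \<theta> by simp
  let ?E = "(1 - \<theta>^2) * (b0 * (\<theta> * b1 + (1 + \<theta>^2) * b2) * q0 + \<theta> * b1 * (b2 - b0) * q1
          - b2 * (\<theta> * b1 + (1 + \<theta>^2) * b0) * q2)"
  have "\<bar>?E\<bar> \<le> 171/160 * ((b0 + \<theta> * b1 + \<theta>^2 * b2) * (\<theta>^2 * b0 + \<theta> * b1 + b2))"
  proof (cases "b0 \<le> b2")
    case True
    have "?E = (1 - \<theta>^2) * (b0 * (\<theta> * b1 + (1 + \<theta>^2) * b2) * (q0 - q2) + \<theta> * b1 * (b2 - b0) * (q1 - q2))" by algebra
    then show ?thesis using up_u1_02[OF \<theta> b True K q(3,2)] by (simp only:)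
  next
    case False
    have K': "16 * \<theta>^4 * (b2 * b0) \<le> (1 + \<theta>^2)^4 * b1^2" using K by (simp add: mult.commute)
    have q': "\<bar>q2 - q0\<bar> \<le> 5/4" "\<bar>q1 - q0\<bar> \<le> 1" using q by (simp_all add: abs_minus_commute)
    have "?E = - ((1 - \<theta>^2) * (b2 * (\<theta> * b1 + (1 + \<theta>^2) * b0) * (q2 - q0) + \<theta> * b1 * (b0 - b2) * (q1 - q0)))" by algebra
    moreover have "(b0 + \<theta> * b1 + \<theta>^2 * b2) * (\<theta>^2 * b0 + \<theta> * b1 + b2) = (b2 + \<theta> * b1 + \<theta>^2 * b0) * (\<theta>^2 * b2 + \<theta> * b1 + b0)"
      by algebra
    moreover have "b2 \<le> b0" using False by simp
    ultimately show ?thesis using up_u1_02[OF \<theta> b(3,2,1) _ K' q'] by (simp only: abs_minus_cancel)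
  qed
  then show "\<bar>?E\<bar> \<le> 855/1000 * u1 0 2 * ((b0 + \<theta> * b1 + \<theta>^2 * b2) * (\<theta>^2 * b0 + \<theta> * b1 + b2))"
    by (simp add: u1_def)
qed

section \<open>The transition matrices\<close>

context cayley2
begin

lemma TM_extreme_u0:
  assumes \<theta>: "\<theta> = exp (J * \<beta>)" and v: "v \<in> FP \<theta>" and \<gamma>: "0 < \<gamma>" "\<bar>1 - \<theta>^2\<bar> \<le> \<gamma> * (1 + \<theta>^2)"
    and d: "\<And>s s' i. s \<in> spins \<Longrightarrow> s' \<in> spins \<Longrightarrow> i \<in> spins \<Longrightarrow>
      2 * \<gamma> * \<bar>tmat \<theta> (wvec v) s i - tmat \<theta> (wvec v) s' i\<bar> < 1"
  shows "extreme_gibbs J \<beta> L (TM \<theta> v)"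
proof -
  have \<theta>p: "0 < \<theta>" by (simp add: \<theta>)
  interpret T: tisgm L x0 \<theta> "wvec v" "rowF \<theta> (wvec v) 2 ^ 2" using \<theta>p v by (rule tisgm_FP)
  let ?P = "tmat \<theta> (wvec v)"
  \<comment> \<open>\<open>Max S\<close> serves as \<kappa>. The additional element 1/(4 \<gamma>)
    keeps it positive and by itself would give 2 \<kappa> \<gamma> = 1/2.\<close>
  define S where "S = insert (1 / (4 * \<gamma>)) ((\<lambda>(s, s', i). \<bar>?P s i - ?P s' i\<bar>) ` (spins \<times> spins \<times> spins))"
  have S: "finite S" "S \<noteq> {}" by (simp_all add: S_def)
  have "Max S \<in> S" using S by (rule Max_in)
  moreover have "2 * \<gamma> * z < 1" if "z \<in> S" for z
    using that d \<gamma> by (auto simp: S_def)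
  ultimately have "2 * \<gamma> * Max S < 1" by blast
  then have lt: "2 * Max S * \<gamma> < 1" by (simp only: mult_ac)
  have "1 / (4 * \<gamma>) \<le> Max S" using S by (intro Max_ge) (simp_all add: S_def)
  then have pos: "0 < Max S" using \<gamma>(1) by (smt (verit) divide_pos_pos)
  have "extreme_gibbs J \<beta> L T.chain_measure"
  proof (rule T.extreme_criterion[OF \<theta> up_contraction_u0[OF \<theta>p \<gamma>(2)] down_contraction_u0 \<gamma>(1) pos lt])
    show "?P i 0 + ?P i 1 + ?P i 2 = 1" if "i \<in> spins" for i
      using T.trans_sum[of i] by (simp add: sum_spins)
    show "\<bar>?P s i - ?P s' i\<bar> \<le> Max S" if "s \<in> spins" "s' \<in> spins" "i \<in> spins" for s s' i
      using S(1) by (rule Max_ge) (use that in \<open>force simp: S_def\<close>)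
  qed (simp_all add: u0_def)
  then show ?thesis by (simp add: TM_def)
qed

lemma TM_non_extreme:
  assumes \<theta>: "\<theta> = exp (J * \<beta>)" and v: "v \<in> FP \<theta>"
    and eig: "\<And>i. i \<in> spins \<Longrightarrow> (\<Sum>j\<in>spins. tmat \<theta> (wvec v) i j * f j) = lam * f i"
    and f: "\<exists>i\<in>spins. f i \<noteq> 0" "lam \<noteq> 1" "1 < 2 * lam^2"
  shows "non_extreme_gibbs J \<beta> L (TM \<theta> v)"
proof -
  have \<theta>p: "0 < \<theta>" by (simp add: \<theta>)
  interpret T: tisgm L x0 \<theta> "wvec v" "rowF \<theta> (wvec v) 2 ^ 2" using \<theta>p v by (rule tisgm_FP)
  show ?thesis using T.Kesten_Stigum[OF eig \<theta> f] by (simp add: TM_def)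
qed

end

lemma tmat_FP:
  assumes "(x, y) \<in> FP \<theta>"
  defines "F \<equiv> \<theta>^2 * x^2 + \<theta> * y^2 + 1"
  shows "tmat \<theta> (wvec (x, y)) 0 0 = x / F" "tmat \<theta> (wvec (x, y)) 0 1 = \<theta> * y^2 / (x * F)"
    "tmat \<theta> (wvec (x, y)) 0 2 = \<theta>^2 / (x * F)" "tmat \<theta> (wvec (x, y)) 1 0 = \<theta> * x^2 / (y * F)"
    "tmat \<theta> (wvec (x, y)) 1 1 = y / F" "tmat \<theta> (wvec (x, y)) 1 2 = \<theta> / (y * F)"
    "tmat \<theta> (wvec (x, y)) 2 0 = \<theta>^2 * x^2 / F" "tmat \<theta> (wvec (x, y)) 2 1 = \<theta> * y^2 / F"
    "tmat \<theta> (wvec (x, y)) 2 2 = 1 / F"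
proof -
  have p: "0 < x" "0 < y" using assms(1) by (auto simp: FP_def)
  have r: "rowF \<theta> (wvec (x, y)) 0 = x * F" "rowF \<theta> (wvec (x, y)) (Suc 0) = y * F" "rowF \<theta> (wvec (x, y)) 2 = F"
    using FP_rowF[OF assms(1)] by (simp_all add: F_def)
  have c: "x^2 / (x * F) = x / F" "y^2 / (y * F) = y / F" using p by (simp_all add: power2_eq_square)
  show "tmat \<theta> (wvec (x, y)) 0 0 = x / F" "tmat \<theta> (wvec (x, y)) 0 1 = \<theta> * y^2 / (x * F)"
    "tmat \<theta> (wvec (x, y)) 0 2 = \<theta>^2 / (x * F)" "tmat \<theta> (wvec (x, y)) 1 0 = \<theta> * x^2 / (y * F)"
    "tmat \<theta> (wvec (x, y)) 1 1 = y / F" "tmat \<theta> (wvec (x, y)) 1 2 = \<theta> / (y * F)"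
    "tmat \<theta> (wvec (x, y)) 2 0 = \<theta>^2 * x^2 / F" "tmat \<theta> (wvec (x, y)) 2 1 = \<theta> * y^2 / F"
    "tmat \<theta> (wvec (x, y)) 2 2 = 1 / F"
    by (simp_all add: tmat_def r wt_def wvec_def c)
qed

section \<open>The matrices of the symmetric solutions\<close>

lemma tmat_sym:
  assumes \<theta>: "0 < \<theta>" and y: "(1, y) \<in> FP \<theta>"
  defines "F \<equiv> 1 + \<theta>^2 + \<theta> * y^2" and "P \<equiv> tmat \<theta> (wvec (1, y))"
  shows "0 < F" "0 < y"
    "P 0 0 = 1 / F" "P 1 0 = (\<theta> / y) / F" "P 2 0 = \<theta>^2 / F"
    "P 0 1 = 1 - (1 + \<theta>^2) / F" "P 1 1 = 1 - 2 * (\<theta> / y) / F" "P 2 1 = 1 - (1 + \<theta>^2) / F"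
    "P 0 2 = \<theta>^2 / F" "P 1 2 = (\<theta> / y) / F" "P 2 2 = 1 / F"
proof -
  show yp: "0 < y" using y by (simp add: FP_def)
  show Fp: "0 < F" using \<theta> by (simp add: F_def add_pos_nonneg)
  have F: "\<theta>^2 * 1^2 + \<theta> * y^2 + 1 = F" by (simp add: F_def)
  note P = tmat_FP[OF y, unfolded F, folded P_def]
  show "P 0 0 = 1 / F" "P 2 0 = \<theta>^2 / F" "P 0 2 = \<theta>^2 / F" "P 2 2 = 1 / F"
    "P 1 0 = (\<theta> / y) / F" "P 1 2 = (\<theta> / y) / F" by (simp_all add: P P[unfolded One_nat_def])
  have "y * F = 2 * \<theta> + y^2" using y by (simp add: FP_def F_def algebra_simps)
  then have "y^2 = y * F - 2 * \<theta>" by simp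
  moreover have "y / F = y^2 / (y * F)" using yp by (simp add: power2_eq_square)
  ultimately have "y / F = 1 - 2 * (\<theta> / y) / F" using yp Fp by (simp add: diff_divide_distrib)
  then show "P 1 1 = 1 - 2 * (\<theta> / y) / F" by (simp add: P P[unfolded One_nat_def])
  have "\<theta> * y^2 / F = 1 - (1 + \<theta>^2) / F" using Fp by (simp add: F_def field_simps)
  then show "P 0 1 = 1 - (1 + \<theta>^2) / F" "P 2 1 = 1 - (1 + \<theta>^2) / F" by (simp_all add: P P[unfolded One_nat_def])
qed

lemma between_abs:
  fixes r t :: real
  assumes "0 \<le> (1 - r) * (r - t)"
  shows "\<bar>1 - r\<bar> \<le> \<bar>1 - t\<bar>" "\<bar>r - t\<bar> \<le> \<bar>1 - t\<bar>" "\<bar>2 * r - (1 + t)\<bar> \<le> \<bar>1 - t\<bar>"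
  using assms by (auto simp: zero_le_mult_iff)

text \<open>Put r = \<theta>/y. Multiplied by F, the outer columns are (1, r, \<theta>^2) and
  (\<theta>^2, r, 1), and the middle one has differences \<plusminus>(2 r - (1 + \<theta>^2)) and 0.
  The hypothesis on y places r between \<theta>^2 and 1, so all differences are at most |1 -
  \<theta>^2|, and the last hypothesis is 2 \<kappa> \<gamma> < 1.\<close>

lemma (in cayley2) sym_extreme:
  assumes \<theta>: "\<theta> = exp (J * \<beta>)" and v: "(1, y) \<in> FP \<theta>"
    and y: "0 \<le> (y - \<theta>) * (1 - \<theta> * y)" and lt: "2 * (1 - \<theta>^2)^2 < (1 + \<theta>^2) * (1 + \<theta>^2 + \<theta> * y^2)"
  shows "extreme_gibbs J \<beta> L (TM \<theta> (1, y))"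
proof -
  have \<theta>p: "0 < \<theta>" by (simp add: \<theta>)
  define F where "F = 1 + \<theta>^2 + \<theta> * y^2"
  note P = tmat_sym[OF \<theta>p v, folded F_def]
  \<comment> \<open>At \<theta> = 1 the quotient would be 0, while the criterion asks for a positive
    constant.\<close>
  define \<gamma> where "\<gamma> = (if \<theta>^2 = 1 then 1 else \<bar>1 - \<theta>^2\<bar> / (1 + \<theta>^2))"
  have s: "0 < 1 + \<theta>^2" by (simp add: add_pos_nonneg)
  have \<gamma>0: "0 < \<gamma>" using s by (simp add: \<gamma>_def)
  have \<gamma>: "\<bar>1 - \<theta>^2\<bar> \<le> \<gamma> * (1 + \<theta>^2)" using s by (simp add: \<gamma>_def)
  have \<gamma>F: "2 * \<gamma> * \<bar>1 - \<theta>^2\<bar> < F"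
  proof (cases "\<theta>^2 = 1")
    case True then show ?thesis using P(1) by simp
  next
    case False
    have "2 * \<gamma> * \<bar>1 - \<theta>^2\<bar> = 2 * (1 - \<theta>^2)^2 / (1 + \<theta>^2)"
      using False by (simp add: \<gamma>_def power2_eq_square[of "1 - \<theta>^2"] flip: abs_mult)
    also have "\<dots> < F" using lt s by (simp add: F_def pos_divide_less_eq mult.commute)
    finally show ?thesis .
  qed
  define r where "r = \<theta> / y"
  have "(1 - r) * (r - \<theta>^2) = \<theta> * ((y - \<theta>) * (1 - \<theta> * y)) / y^2"
    using P(2) by (simp add: r_def field_simps power2_eq_square)
  then have "0 \<le> (1 - r) * (r - \<theta>^2)" using y \<theta>p by simp
  note r = between_abs[OF this]
  have D: "2 * \<gamma> * \<bar>p - q\<bar> < 1" if "\<bar>z\<bar> \<le> \<bar>1 - \<theta>^2\<bar>" "p - q = z / F" for p q z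
  proof -
    have "2 * \<gamma> * \<bar>z\<bar> \<le> 2 * \<gamma> * \<bar>1 - \<theta>^2\<bar>" using that \<gamma>0 by simp
    then have "2 * \<gamma> * \<bar>z\<bar> < F" using \<gamma>F by simp
    then show ?thesis using P(1) by (simp add: that(2) pos_divide_less_eq)
  qed
  have D': "2 * \<gamma> * \<bar>q - p\<bar> < 1" if "2 * \<gamma> * \<bar>p - q\<bar> < 1" for p q :: real
    using that by (simp add: abs_minus_commute)
  have D0: "2 * \<gamma> * \<bar>p - p\<bar> < 1" for p :: real by simp
  let ?P = "tmat \<theta> (wvec (1, y))"
  have "\<forall>s\<in>spins. \<forall>s'\<in>spins. 2 * \<gamma> * \<bar>?P s i - ?P s' i\<bar> < 1" if "i \<in> spins" for i
    using spins_cases[OF that]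
  proof (elim disjE)
    assume i: "i = 0"
    show ?thesis unfolding i
    proof (rule ball_pairs_sym[OF D0 D'])
      show "2 * \<gamma> * \<bar>?P 0 0 - ?P 1 0\<bar> < 1" by (rule D[OF r(1)]) (simp add: P P[unfolded One_nat_def] r_def diff_divide_distrib)
      show "2 * \<gamma> * \<bar>?P 0 0 - ?P 2 0\<bar> < 1" by (rule D[OF order_refl]) (simp add: P diff_divide_distrib)
      show "2 * \<gamma> * \<bar>?P 1 0 - ?P 2 0\<bar> < 1" by (rule D[OF r(2)]) (simp add: P P[unfolded One_nat_def] r_def diff_divide_distrib)
    qed
  next
    assume i: "i = 1"
    show ?thesis unfolding i
    proof (rule ball_pairs_sym[OF D0 D'])
      show "2 * \<gamma> * \<bar>?P 0 1 - ?P 1 1\<bar> < 1" by (rule D[OF r(3)]) (simp add: P P[unfolded One_nat_def] r_def diff_divide_distrib)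
      show "2 * \<gamma> * \<bar>?P 0 1 - ?P 2 1\<bar> < 1" by (simp add: P P[unfolded One_nat_def])
      show "2 * \<gamma> * \<bar>?P 1 1 - ?P 2 1\<bar> < 1" by (rule D'[OF D[OF r(3)]]) (simp add: P P[unfolded One_nat_def] r_def diff_divide_distrib)
    qed
  next
    assume i: "i = 2"
    show ?thesis unfolding i
    proof (rule ball_pairs_sym[OF D0 D'])
      show "2 * \<gamma> * \<bar>?P 0 2 - ?P 1 2\<bar> < 1" by (rule D'[OF D[OF r(2)]]) (simp add: P P[unfolded One_nat_def] r_def diff_divide_distrib)
      show "2 * \<gamma> * \<bar>?P 0 2 - ?P 2 2\<bar> < 1" by (rule D'[OF D[OF order_refl]]) (simp add: P diff_divide_distrib)
      show "2 * \<gamma> * \<bar>?P 1 2 - ?P 2 2\<bar> < 1" by (rule D'[OF D[OF r(1)]]) (simp add: P P[unfolded One_nat_def] r_def diff_divide_distrib)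
    qed
  qed
  then show ?thesis by (intro TM_extreme_u0[OF \<theta> v \<gamma>0 \<gamma>]) blast
qed

text \<open>Solutions with x = 1 are invariant under the spin flip, so the odd function 1 - i is an
  eigenvector; its eigenvalue is (1 - \<theta>^2) / F.\<close>

lemma (in cayley2) sym_non_extreme:
  assumes \<theta>: "\<theta> = exp (J * \<beta>)" and v: "(1, y) \<in> FP \<theta>"
    and gt: "(1 + \<theta>^2 + \<theta> * y^2)^2 < 2 * (1 - \<theta>^2)^2"
  shows "non_extreme_gibbs J \<beta> L (TM \<theta> (1, y))"
proof (rule TM_non_extreme[OF \<theta> v])
  have \<theta>p: "0 < \<theta>" by (simp add: \<theta>)
  define F where "F = 1 + \<theta>^2 + \<theta> * y^2"
  note P = tmat_sym[OF \<theta>p v, folded F_def]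
  let ?f = "\<lambda>i::nat. 1 - real i" and ?ev = "(1 - \<theta>^2) / F"
  show "(\<Sum>j\<in>spins. tmat \<theta> (wvec (1, y)) i j * ?f j) = ?ev * ?f i" if "i \<in> spins" for i
    using spins_cases[OF that] by (auto simp: sum_spins P[unfolded One_nat_def] P diff_divide_distrib)
  show "\<exists>i\<in>spins. ?f i \<noteq> 0" by (rule bexI[of _ 0]) (simp_all add: spins_def)
  have "1 - \<theta>^2 < F" using \<theta>p P(2) by (simp add: F_def add_pos_pos)
  then show "?ev \<noteq> 1" by auto
  show "1 < 2 * ?ev^2" using gt P(1) by (simp add: F_def[symmetric] power_divide pos_less_divide_eq)
qed

text \<open>With \<open>t = \<theta>\<^sup>2\<close> and \<open>h = hh t x\<close> this is \<open>1 - t\<close> times the transition matrix of the solution \<open>(x, y)\<close>.\<close>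

definition am :: "real \<Rightarrow> real \<Rightarrow> real \<Rightarrow> nat \<Rightarrow> nat \<Rightarrow> real" where
  "am t h x i j =
    (if i = 0 then (if j = 0 then x else if j = 1 then h else t / x) / (1 + x)
     else if i = 1 then (if j = 0 then t * x else if j = 1 then h else t / x)
     else (if j = 0 then t * x^2 else if j = 1 then x * h else 1) / (1 + x))"

section \<open>The matrices of the asymmetric solutions\<close>

lemma am_flip:
  assumes "0 < x" "i \<in> spins" "j \<in> spins"
  shows "am t h (1 / x) i j = am t h x (2 - i) (2 - j)"
proof -
  have x: "x \<noteq> 0" "1 + x \<noteq> 0" "1 + 1 / x = (1 + x) / x" using assms(1) by (auto simp: add_divide_distrib)
  show ?thesis using spins_cases[OF assms(2)] spins_cases[OF assms(3)]
    by (elim disjE) (simp_all add: am_def x, auto simp: x field_simps power2_eq_square)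
qed

text \<open>Forced by the middle row of \<open>am\<close>, which has to sum to 1 - t.\<close>

definition hh :: "real \<Rightarrow> real \<Rightarrow> real" where
  "hh t x = 1 - t - t * x - t / x"

lemma asym_hh:
  assumes "0 < \<theta>" "0 < x" "asym \<theta> ((1 + x)^2 / x) = 0"
  shows "hh (\<theta>^2) x = x / (\<theta> * (1 + x)^2)" "0 < hh (\<theta>^2) x"
proof -
  have x: "x \<noteq> 0" "\<theta> \<noteq> 0" "1 + x \<noteq> 0" using assms by auto
  have "\<theta>^3 * (1 + x)^4 - \<theta> * (1 + \<theta>^2) * (1 + x)^2 * x + x^2 = x^2 * asym \<theta> ((1 + x)^2 / x)"
    using x by (simp add: asym_def field_simps power2_eq_square eval_nat_numeral)
  then have "\<theta>^3 * (1 + x)^4 - \<theta> * (1 + \<theta>^2) * (1 + x)^2 * x + x^2 = 0" using assms by simp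
  then have "(x - \<theta>^2 * x - \<theta>^2 * x^2 - \<theta>^2) * (\<theta> * (1 + x)^2) = x^2" by algebra
  moreover have "x * hh (\<theta>^2) x = x - \<theta>^2 * x - \<theta>^2 * x^2 - \<theta>^2"
    using x by (simp add: hh_def field_simps power2_eq_square)
  ultimately have "x * (hh (\<theta>^2) x * (\<theta> * (1 + x)^2)) = x * x" by algebra
  then have "hh (\<theta>^2) x * (\<theta> * (1 + x)^2) = x" using x by simp
  then show "hh (\<theta>^2) x = x / (\<theta> * (1 + x)^2)" using x by (simp add: eq_divide_eq)
  then show "0 < hh (\<theta>^2) x" using assms by simp
qed

text \<open>The identities y = h (1 + x), \<theta> y^2 = x h and F = (1 + x)(1 - \<theta>^2)
  eliminate y.\<close>

lemma tmat_asym: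
  assumes \<theta>: "0 < \<theta>" and v: "(x, y) \<in> FP \<theta>" and x1: "x \<noteq> 1" and i: "i \<in> spins" "j \<in> spins"
  shows "tmat \<theta> (wvec (x, y)) i j = am (\<theta>^2) (hh (\<theta>^2) x) x i j / (1 - \<theta>^2)"
proof -
  have *: "0 < x" "\<theta> < 1" "y = x / (\<theta> * (1 + x))" "asym \<theta> ((1 + x)^2 / x) = 0"
    using v FP_asym_iff[OF \<theta> x1] by auto
  have t: "\<theta>^2 < 1" using \<theta> *(2) by (simp add: power_less_one_iff)
  define h where "h = hh (\<theta>^2) x"
  have h: "h = x / (\<theta> * (1 + x)^2)" unfolding h_def by (rule asym_hh(1)[OF \<theta> *(1,4)])
  have xh: "x * h = x - \<theta>^2 * x - \<theta>^2 * x^2 - \<theta>^2"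
    using *(1) by (simp add: h_def hh_def field_simps power2_eq_square)
  have ne: "\<theta> \<noteq> 0" "x \<noteq> 0" "1 + x \<noteq> 0" "1 - \<theta>^2 \<noteq> 0" using \<theta> *(1) t by auto
  have yx': "\<theta> * (y * (1 + x)) = x" using ne unfolding *(3) by simp
  then have yx: "y * (1 + x) = x / \<theta>" using ne by (simp add: eq_divide_eq mult.commute)
  have yh: "y = h * (1 + x)" using ne unfolding *(3) h by (simp add: power2_eq_square)
  have "h * (\<theta> * (y * (1 + x))) = \<theta> * y * (h * (1 + x))" by algebra
  then have y2: "\<theta> * y^2 = x * h" unfolding yx' yh[symmetric] by (simp add: power2_eq_square mult_ac)
  have F: "\<theta>^2 * x^2 + \<theta> * y^2 + 1 = (1 + x) * (1 - \<theta>^2)" unfolding y2 using xh by algebra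
  have yF: "y * ((1 + x) * (1 - \<theta>^2)) = x / \<theta> * (1 - \<theta>^2)" unfolding mult.assoc[symmetric] yx ..
  note P = tmat_FP[OF v, unfolded F, unfolded y2 yF]
  have "y / ((1 + x) * (1 - \<theta>^2)) = h / (1 - \<theta>^2)" using ne by (subst yh) simp
  then have P11: "tmat \<theta> (wvec (x, y)) (Suc 0) (Suc 0) = h / (1 - \<theta>^2)" using P(5) by simp
  show ?thesis unfolding h_def[symmetric]
    using spins_cases[OF i(1)] spins_cases[OF i(2)]
    by (elim disjE) (use ne in \<open>simp_all add: P(1-4,6-9) P(1-4,6-9)[unfolded One_nat_def] P11 am_def power2_eq_square\<close>)
qed

lemma down_contraction_flip:
  fixes u :: "nat \<Rightarrow> nat \<Rightarrow> real"
  assumes u: "\<And>i j. i \<in> spins \<Longrightarrow> j \<in> spins \<Longrightarrow> u (2 - i) (2 - j) = u i j"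
    and c: "down_contraction P u \<kappa>"
    and P: "\<And>i j. i \<in> spins \<Longrightarrow> j \<in> spins \<Longrightarrow> P' i j = P (2 - i) (2 - j)"
  shows "down_contraction P' u \<kappa>"
  unfolding down_contraction_def
proof (intro allI impI ballI)
  fix q :: "nat \<Rightarrow> real" and s s'
  assume q: "\<forall>i\<in>spins. \<forall>j\<in>spins. \<bar>q i - q j\<bar> \<le> u i j" and s: "s \<in> spins" "s' \<in> spins"
  have m: "2 - i \<in> spins" "2 - (2 - i) = i" if "i \<in> spins" for i using that by (auto simp: spins_def)
  have "\<forall>i\<in>spins. \<forall>j\<in>spins. \<bar>q (2 - i) - q (2 - j)\<bar> \<le> u i j"
    using q m u by metis
  then have "\<bar>(\<Sum>i\<in>spins. P (2 - s) i * q (2 - i)) - (\<Sum>i\<in>spins. P (2 - s') i * q (2 - i))\<bar> \<le> \<kappa> * u (2 - s) (2 - s')"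
    using c m s unfolding down_contraction_def by (elim allE[of _ "\<lambda>i. q (2 - i)"]) simp
  moreover have "(\<Sum>i\<in>spins. P (2 - s) i * q (2 - i)) = (\<Sum>i\<in>spins. P' s i * q i)" if "s \<in> spins" for s
    by (rule sum.reindex_bij_witness[of _ "\<lambda>i. 2 - i" "\<lambda>i. 2 - i"]) (auto simp: m P that)
  ultimately show "\<bar>(\<Sum>i\<in>spins. P' s i * q i) - (\<Sum>i\<in>spins. P' s' i * q i)\<bar> \<le> \<kappa> * u s s'"
    using s u by simp
qed

text \<open>Modulo the constant functions \<open>P\<close> acts as a 2x2 matrix, whose characteristic polynomial is \<open>\<chi>\<close>.\<close>

lemma three_state_eigenvector:
  fixes P :: "nat \<Rightarrow> nat \<Rightarrow> real"
  assumes sum: "\<And>i. i \<in> spins \<Longrightarrow> P i 0 + P i 1 + P i 2 = 1"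
    and \<chi>: "lam^2 - (P 0 0 - P 2 0 + (P 1 1 - P 2 1)) * lam
      + ((P 0 0 - P 2 0) * (P 1 1 - P 2 1) - (P 0 1 - P 2 1) * (P 1 0 - P 2 0)) = 0"
    and b: "P 0 1 \<noteq> P 2 1" and l: "lam \<noteq> 1"
  obtains f where "\<And>i. i \<in> spins \<Longrightarrow> (\<Sum>j\<in>spins. P i j * f j) = lam * f i" "\<exists>i\<in>spins. f i \<noteq> 0"
proof -
  define u where "u = P 0 1 - P 2 1"
  define v where "v = lam - (P 0 0 - P 2 0)"
  define k where "k = (P 2 0 * u + P 2 1 * v) / (lam - 1)"
  define f where "f i = (if i = 0 then u + k else if i = 1 then v + k else k)" for i :: nat
  have k: "P 2 0 * u + P 2 1 * v = (lam - 1) * k" using l by (simp add: k_def)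
  have S: "P 0 2 = 1 - P 0 0 - P 0 1" "P 1 2 = 1 - P 1 0 - P 1 1" "P 2 2 = 1 - P 2 0 - P 2 1"
    using sum[of 0] sum[of 1] sum[of 2] by simp_all
  have c: "(\<Sum>j\<in>spins. P i j * f j) = lam * f i" if "i \<in> spins" for i
  proof -
    have s: "(\<Sum>j\<in>spins. P i j * f j) = P i 0 * (u + k) + P i 1 * (v + k) + P i 2 * k"
      by (simp add: sum_spins f_def)
    have "P 0 0 * (u + k) + P 0 1 * (v + k) + P 0 2 * k = lam * (u + k)" unfolding S using k u_def v_def by algebra
    moreover have "P 1 0 * (u + k) + P 1 1 * (v + k) + P 1 2 * k = lam * (v + k)" unfolding S using k u_def v_def \<chi> by algebra
    moreover have "P 2 0 * (u + k) + P 2 1 * (v + k) + P 2 2 * k = lam * k" unfolding S using k by algebra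
    ultimately show ?thesis unfolding s using spins_cases[OF that] by (auto simp: f_def)
  qed
  have "f 0 \<noteq> f 2" using b by (simp add: f_def u_def)
  then have "\<exists>i\<in>spins. f i \<noteq> 0" by (auto simp: spins_def)
  with c show thesis by (rule that)
qed

text \<open>Bounds an eigenvalue from below through the sign of the characteristic polynomial at one
  point.\<close>

lemma larger_root:
  fixes s d r :: real
  assumes "r^2 - s * r + d < 0"
  obtains l where "l^2 - s * l + d = 0" "r < l"
proof
  let ?l = "(s + sqrt (s^2 - 4 * d)) / 2"
  have lt: "(2 * r - s)^2 < s^2 - 4 * d" using assms by (simp add: power2_eq_square algebra_simps)
  then have n: "0 \<le> s^2 - 4 * d" by (smt (verit) zero_le_power2)
  have "sqrt (s^2 - 4 * d)^2 = s^2 - 4 * d" using n by simp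
  moreover have root: "4 * (l^2 - s * l + d) = 0" if "q^2 = s^2 - 4 * d" "l * 2 = s + q" for q l
    using that by algebra
  ultimately have "4 * (?l^2 - s * ?l + d) = 0" by (intro root[of "sqrt (s^2 - 4 * d)"]) simp_all
  then show "?l^2 - s * ?l + d = 0" by simp
  have "2 * r - s < sqrt (s^2 - 4 * d)" using lt by (rule real_less_rsqrt)
  then show "r < ?l" by simp
qed

text \<open>Modulo constants, trace and determinant multiplied by 1 - t are t + h and h/w with h =
  1/q. They depend on w only, so x and 1/x are handled together. A negative characteristic
  polynomial at r forces an eigenvalue above r, and 2 r^2 \<ge> 1.\<close>

lemma (in cayley2) asym_non_extreme:
  assumes \<theta>: "\<theta> = exp (J * \<beta>)" and v: "(x, y) \<in> FP \<theta>" "x \<noteq> 1"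
    and r: "0 \<le> r" "1 \<le> 2 * r^2" and q: "q = \<theta> * ((1 + x)^2 / x)"
    and lt: "r^2 * (1 - \<theta>^2) - r * (\<theta>^2 + 1 / q) + \<theta> / q^2 < 0"
  shows "non_extreme_gibbs J \<beta> L (TM \<theta> (x, y))"
proof -
  have \<theta>p: "0 < \<theta>" by (simp add: \<theta>)
  have *: "0 < x" "\<theta> < 1" "asym \<theta> ((1 + x)^2 / x) = 0"
    using v FP_asym_iff[OF \<theta>p v(2)] by auto
  define t where "t = \<theta>^2"
  have t: "0 < t" "t < 1" using \<theta>p *(2) by (auto simp: t_def power_less_one_iff)
  define h where "h = hh t x"
  note M = tmat_asym[OF \<theta>p v, folded t_def, folded h_def]
  let ?P = "tmat \<theta> (wvec (x, y))"
  interpret T: tisgm L x0 \<theta> "wvec (x, y)" "rowF \<theta> (wvec (x, y)) 2 ^ 2" using \<theta>p v(1) by (rule tisgm_FP)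
  have h: "h = 1 / q" "0 < h" using asym_hh[OF \<theta>p *(1,3)] by (simp_all add: h_def t_def q)
  have xh: "x * h = (1 - t) * x - t * x^2 - t"
    using *(1) by (simp add: h_def hh_def field_simps power2_eq_square)
  have ne: "1 + x \<noteq> 0" "1 - t \<noteq> 0" "x \<noteq> 0" using *(1) t by auto
  define w where "w = (1 + x)^2 / x"
  have w: "w * x = (1 + x)^2" using ne by (simp add: w_def)
  have m: "?P 0 0 = x / (1 + x) / (1 - t)" "?P 2 0 = t * x^2 / (1 + x) / (1 - t)" "?P 0 1 = h / (1 + x) / (1 - t)"
    "?P 2 1 = x * h / (1 + x) / (1 - t)" "?P 1 0 = t * x * (1 + x) / (1 + x) / (1 - t)" "?P 1 1 = h * (1 + x) / (1 + x) / (1 - t)"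
    using ne by (simp_all add: M am_def spins_def M[unfolded One_nat_def])
  have dd: "p / X / Y - q / X / Y = z / X / Y" if "p - q = z" for p q z X Y :: real
    using that by (simp flip: diff_divide_distrib)
  have a: "?P 0 0 - ?P 2 0 = (x - t * x^2) / (1 + x) / (1 - t)" "?P 1 1 - ?P 2 1 = h / (1 + x) / (1 - t)"
    "?P 0 1 - ?P 2 1 = h * (1 - x) / (1 + x) / (1 - t)" "?P 1 0 - ?P 2 0 = t * x / (1 + x) / (1 - t)"
    unfolding m by (rule dd, algebra)+
  have S: "(1 - t) * (?P 0 0 - ?P 2 0 + (?P 1 1 - ?P 2 1)) = t + h"
  proof -
    have "(1 - t) * (?P 0 0 - ?P 2 0 + (?P 1 1 - ?P 2 1)) = (x - t * x^2 + h) / (1 + x)"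
      unfolding a using ne by (simp flip: add_divide_distrib)
    also have "x - t * x^2 + h = (t + h) * (1 + x)" using xh by algebra
    finally show ?thesis using ne by simp
  qed
  have pr: "(p / X / Y) * (q / X / Y) = p * q / (X^2 * Y) / Y" for p q X Y :: real
    by (simp add: power2_eq_square)
  have D: "(1 - t) * ((?P 0 0 - ?P 2 0) * (?P 1 1 - ?P 2 1) - (?P 0 1 - ?P 2 1) * (?P 1 0 - ?P 2 0)) = h / w"
  proof -
    have "(1 - t) * ((?P 0 0 - ?P 2 0) * (?P 1 1 - ?P 2 1) - (?P 0 1 - ?P 2 1) * (?P 1 0 - ?P 2 0))
        = ((x - t * x^2) * h - h * (1 - x) * (t * x)) / ((1 + x)^2 * (1 - t))"
      unfolding a pr diff_divide_distrib[symmetric] using ne by simp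
    also have "(x - t * x^2) * h - h * (1 - x) * (t * x) = h * x * (1 - t)" by algebra
    finally show ?thesis using ne by (simp add: w_def)
  qed
  define s where "s = (t + h) / (1 - t)"
  define d where "d = h / w / (1 - t)"
  have s: "?P 0 0 - ?P 2 0 + (?P 1 1 - ?P 2 1) = s" using S ne by (simp add: s_def eq_divide_eq mult.commute)
  have d: "(?P 0 0 - ?P 2 0) * (?P 1 1 - ?P 2 1) - (?P 0 1 - ?P 2 1) * (?P 1 0 - ?P 2 0) = d"
    unfolding d_def D[symmetric] by (rule nonzero_mult_div_cancel_left[OF ne(2), symmetric])
  have wq: "w = q / \<theta>" using \<theta>p by (simp add: q w_def)
  have "h / w = \<theta> / q^2" unfolding h(1) wq by (simp add: power2_eq_square)
  then have "r^2 * (1 - t) - r * (t + h) + h / w < 0" using lt by (simp add: h t_def)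
  moreover have \<chi>: "(1 - t) * (r^2 - s * r + d) = r^2 * (1 - t) - r * (t + h) + h / w" for r
  proof -
    have "(1 - t) * s = t + h" "(1 - t) * d = h / w" using ne by (simp_all add: s_def d_def)
    moreover have "(1 - t) * (r^2 - s * r + d) = r^2 * (1 - t) - r * ((1 - t) * s) + (1 - t) * d" by algebra
    ultimately show ?thesis by simp
  qed
  ultimately have "(1 - t) * (r^2 - s * r + d) < 0" by simp
  then have "r^2 - s * r + d < 0" using t by (simp add: mult_less_0_iff)
  then obtain l where l: "l^2 - s * l + d = 0" "r < l" by (rule larger_root)
  \<comment> \<open>The characteristic polynomial is positive at 1, hence the eigenvalue found is
    not 1.\<close>
  have "(1 - t) * (1 - s + d) = (1 - t) - (t + h) + h / w" using \<chi>[of 1] by simp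
  moreover have "0 < (1 - t) - (t + h) + h / w"
  proof -
    have "x * ((1 - t) - (t + h)) = t * (x^2 - x + 1)" using xh by algebra
    moreover have "0 < x^2 - x + 1"
    proof -
      have "4 * (x^2 - x + 1) = (2 * x - 1)^2 + 3" by algebra
      then have "0 < 4 * (x^2 - x + 1)" by (simp only: add_nonneg_pos zero_le_power2 zero_less_numeral)
      then show ?thesis by simp
    qed
    ultimately have "0 < x * ((1 - t) - (t + h))" using t by simp
    then have "0 < (1 - t) - (t + h)" using *(1) by (simp add: zero_less_mult_iff)
    moreover have "0 < h / w" using h *(1) by (simp add: w_def)
    ultimately show ?thesis by simp
  qed
  ultimately have "1 - s + d \<noteq> 0" by auto
  then have l1: "l \<noteq> 1" using l(1) by auto
  have "r^2 < l^2" using l(2) r(1) by (intro power_strict_mono) auto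
  then have l2: "1 < 2 * l^2" using r(2) by simp
  have b: "?P 0 1 \<noteq> ?P 2 1" using a(3) ne h(2) v(2) by auto
  have sum: "?P i 0 + ?P i 1 + ?P i 2 = 1" for i using T.trans_sum[of i] by (simp add: sum_spins)
  from three_state_eigenvector[OF sum _ b l1, unfolded s d, OF l(1)]
  obtain f where "\<And>i. i \<in> spins \<Longrightarrow> (\<Sum>j\<in>spins. ?P i j * f j) = l * f i" "\<exists>i\<in>spins. f i \<noteq> 0" by blast
  then show ?thesis using l1 l2 by (intro TM_non_extreme[OF \<theta> v(1)]) auto
qed

text \<open>With \<gamma> = (1 - t)/(1 + t) the denominator 1 - t of the matrix cancels, and it
  remains to keep column differences of \<open>am\<close> below (1 + t)/2. In columns 1 and 2 all
  entries are positive and at most (1 + t)/2; in column 0 they range between \<open>Y\<close> and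
  \<open>X\<close>, whose distance \<open>lt\<close> controls.\<close>

lemma (in cayley2) asym_extreme_u0:
  assumes \<theta>: "\<theta> = exp (J * \<beta>)" and v: "(z, y) \<in> FP \<theta>" "z = x \<or> z = 1 / x" and x: "1 < x"
    and h: "2 * hh (\<theta>^2) x \<le> 1 + \<theta>^2" and tx: "\<theta>^2 * (1 + x) \<le> 1"
    and lt: "2 * x * (1 - \<theta>^2 * x) < (1 + \<theta>^2) * (1 + x)"
  shows "extreme_gibbs J \<beta> L (TM \<theta> (z, y))"
proof -
  have \<theta>p: "0 < \<theta>" by (simp add: \<theta>)
  have z1: "z \<noteq> 1" using v(2) x by auto
  have *: "0 < z" "\<theta> < 1" "asym \<theta> ((1 + z)^2 / z) = 0"
    using v FP_asym_iff[OF \<theta>p z1] by auto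
  define t where "t = \<theta>^2"
  have t: "0 < t" "t < 1" using \<theta>p *(2) by (auto simp: t_def power_less_one_iff)
  have hz: "hh t z = hh t x" using v(2) x by (auto simp: hh_def)
  define h where "h = hh t x"
  have hp: "0 < h" using asym_hh(2)[OF \<theta>p *(1,3)] hz by (simp add: h_def t_def)
  note M = tmat_asym[OF \<theta>p v(1) z1, folded t_def, unfolded hz, folded h_def]
  note as = h[folded t_def, folded h_def] tx[folded t_def] lt[folded t_def]
  have m: "2 * \<bar>am t h x s i - am t h x s' i\<bar> < 1 + t" if "s \<in> spins" "s' \<in> spins" "i \<in> spins" for s s' i
  proof -
    have a0: "am t h x 0 0 = x / (1 + x)" "am t h x 1 0 = t * x" "am t h x 2 0 = t * x^2 / (1 + x)"
      and a1: "am t h x 0 1 = h / (1 + x)" "am t h x 1 1 = h" "am t h x 2 1 = x * h / (1 + x)"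
      and a2: "am t h x 0 2 = t / x / (1 + x)" "am t h x 1 2 = t / x" "am t h x 2 2 = 1 / (1 + x)"
      by (simp_all add: am_def)
    define X where "X = x / (1 + x)"
    define Y where "Y = t * x^2 / (1 + x)"
    have le: "Y \<le> t * x" "t * x \<le> X"
    proof -
      have "t * (1 + x) * x \<le> 1 * x" using as(2) x by (intro mult_right_mono) auto
      then show "t * x \<le> X" using x by (simp add: X_def pos_le_divide_eq mult_ac)
      have "t * x * x \<le> t * x * (1 + x)" using x t by (intro mult_left_mono) auto
      then show "Y \<le> t * x" using x by (simp add: Y_def pos_divide_le_eq power2_eq_square mult_ac)
    qed
    have "2 * (X - Y) = 2 * x * (1 - t * x) / (1 + x)"
      by (simp add: X_def Y_def diff_divide_distrib power2_eq_square algebra_simps)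
    also have "\<dots> < 1 + t" using as(3) x by (simp add: pos_divide_less_eq)
    finally have XY: "2 * (X - Y) < 1 + t" .
    have D: "2 * \<bar>p - q\<bar> < 1 + t" if "Y \<le> p" "p \<le> X" "Y \<le> q" "q \<le> X" for p q
    proof -
      have "\<bar>p - q\<bar> \<le> X - Y" using that by linarith
      then have "2 * \<bar>p - q\<bar> \<le> 2 * (X - Y)" by simp
      then show ?thesis using XY by (rule order.strict_trans1)
    qed
    have D': "2 * \<bar>p - q\<bar> < 1 + t" if "0 < p" "2 * p \<le> 1 + t" "0 < q" "2 * q \<le> 1 + t" for p q
      using that by (auto simp: abs_if)
    have c0: "Y \<le> am t h x s 0 \<and> am t h x s 0 \<le> X" if "s \<in> spins" for s
      using spins_cases[OF that] le a0 unfolding X_def[symmetric] Y_def[symmetric] by auto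
    have h1: "2 * (h / (1 + x)) \<le> 1 + t" "2 * (x * h / (1 + x)) \<le> 1 + t"
    proof -
      have "h / (1 + x) \<le> h" "x * h / (1 + x) \<le> h" using x hp by (simp_all add: pos_divide_le_eq algebra_simps)
      then show "2 * (h / (1 + x)) \<le> 1 + t" "2 * (x * h / (1 + x)) \<le> 1 + t" using as(1) by simp_all
    qed
    have c1: "0 < am t h x s 1 \<and> 2 * am t h x s 1 \<le> 1 + t" if "s \<in> spins" for s
      using spins_cases[OF that]
    proof (elim disjE)
      assume "s = 0" then show ?thesis using h1 a1 hp x by (simp only:, simp?)
    next
      assume "s = 1" then show ?thesis using as(1) a1 hp by (simp only:, simp?)
    next
      assume "s = 2" then show ?thesis using h1 a1 hp x by (simp only:, simp?)
    qed
    have tx1: "t / x \<le> 1 / (1 + x)"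
    proof -
      have "t * (1 + x) \<le> 1 * x" using as(2) x by linarith
      then show ?thesis using x by (simp add: divide_le_eq le_divide_eq mult.commute)
    qed
    moreover have "t / x / (1 + x) \<le> t / x"
    proof -
      have "p / (1 + x) \<le> p" if "0 \<le> p" for p using x that by (simp add: pos_divide_le_eq algebra_simps)
      then show ?thesis using x t by (simp del: divide_divide_eq_left)
    qed
    moreover have "2 * (1 / (1 + x)) \<le> 1 + t" using x t by (simp add: pos_divide_le_eq algebra_simps) (smt (verit) mult_pos_pos)
    ultimately have le2: "2 * (t / x) \<le> 1 + t" "2 * (t / x / (1 + x)) \<le> 1 + t" "2 * (1 / (1 + x)) \<le> 1 + t" by linarith+
    have c2: "0 < am t h x s 2 \<and> 2 * am t h x s 2 \<le> 1 + t" if "s \<in> spins" for s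
      using spins_cases[OF that]
    proof (elim disjE)
      assume "s = 0" then show ?thesis using le2 a2 x t by (simp only:, simp?)
    next
      assume "s = 1" then show ?thesis using le2 a2 x t by (simp only:, simp?)
    next
      assume "s = 2" then show ?thesis using le2 a2 x t by (simp only:, simp?)
    qed
    show ?thesis using spins_cases[OF that(3)]
    proof (elim disjE)
      assume "i = 0" then show ?thesis using D c0[OF that(1)] c0[OF that(2)] by blast
    next
      assume "i = 1" then show ?thesis using D' c1[OF that(1)] c1[OF that(2)] by blast
    next
      assume "i = 2" then show ?thesis using D' c2[OF that(1)] c2[OF that(2)] by blast
    qed
  qed
  have m': "2 * \<bar>am t h z s i - am t h z s' i\<bar> < 1 + t" if "s \<in> spins" "s' \<in> spins" "i \<in> spins" for s s' i
  proof -
    have f: "2 - j \<in> spins" for j by (auto simp: spins_def)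
    have "0 < x" using x by simp
    then show ?thesis using v(2) m[OF that] m[OF f f f, of s i s'] am_flip[of x, OF _ that(1,3)] am_flip[of x, OF _ that(2,3)] by auto
  qed
  show ?thesis
  proof (rule TM_extreme_u0[OF \<theta> v(1)])
    show "0 < (1 - t) / (1 + t)" using t by simp
    show "\<bar>1 - \<theta>^2\<bar> \<le> (1 - t) / (1 + t) * (1 + \<theta>^2)" using t unfolding t_def[symmetric] by simp
    fix s s' i assume s: "s \<in> spins" "s' \<in> spins" "i \<in> spins"
    have eq: "tmat \<theta> (wvec (z, y)) s i - tmat \<theta> (wvec (z, y)) s' i = (am t h z s i - am t h z s' i) / (1 - t)"
      using M[OF s(1,3)] M[OF s(2,3)] by (simp add: diff_divide_distrib)
    have "2 * ((1 - t) / (1 + t)) * \<bar>tmat \<theta> (wvec (z, y)) s i - tmat \<theta> (wvec (z, y)) s' i\<bar>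
        = 2 * \<bar>am t h z s i - am t h z s' i\<bar> / (1 + t)"
    proof -
      have "2 * (e / f) * \<bar>p / e\<bar> = 2 * \<bar>p\<bar> / f" if "0 < e" for e f p :: real using that by simp
      then show ?thesis unfolding eq using t by (simp only: diff_gt_0_iff_gt)
    qed
    also have "\<dots> < 1" using m'[OF s] t by (simp add: pos_divide_less_eq)
    finally show "2 * ((1 - t) / (1 + t)) * \<bar>tmat \<theta> (wvec (z, y)) s i - tmat \<theta> (wvec (z, y)) s' i\<bar> < 1" .
  qed
qed

text \<open>The last three hypotheses are those of \<open>down_contraction_u1\<close> multiplied by
  (1 - t)(1 + x). They are stated for x > 1; the solution 1/x has the matrix with the spins
  reversed, and the metric is invariant under the reversal.\<close>

lemma (in cayley2) asym_extreme_u1: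
  assumes \<theta>: "\<theta> = exp (J * \<beta>)" and v: "(z, y) \<in> FP \<theta>" "z = x \<or> z = 1 / x" and x: "1 < x"
    and b: "26586/100000 \<le> \<theta>" "\<theta> \<le> 29565/100000"
    and \<kappa>: "0 < \<kappa>" "2 * \<kappa> * (855/1000) < 1"
    and 01: "x * hh (\<theta>^2) x + 5/4 * \<theta>^2 \<le> \<kappa> * (1 - \<theta>^2) * (1 + x)"
    and 02: "hh (\<theta>^2) x * (x - 1) + 5/4 * (1 - \<theta>^2 / x) \<le> 5/4 * \<kappa> * (1 - \<theta>^2) * (1 + x)"
    and 12: "hh (\<theta>^2) x + 5/4 * (\<theta>^2 * x) \<le> \<kappa> * (1 - \<theta>^2) * (1 + x)"
  shows "extreme_gibbs J \<beta> L (TM \<theta> (z, y))"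
proof -
  have \<theta>p: "0 < \<theta>" by (simp add: \<theta>)
  have z1: "z \<noteq> 1" using v(2) x by auto
  have *: "0 < z" "\<theta> < 1" "asym \<theta> ((1 + z)^2 / z) = 0"
    using v FP_asym_iff[OF \<theta>p z1] by auto
  define t where "t = \<theta>^2"
  have t: "0 < t" "t < 1" using \<theta>p *(2) by (auto simp: t_def power_less_one_iff)
  have hz: "hh t z = hh t x" using v(2) x by (auto simp: hh_def)
  define h where "h = hh t x"
  have hp: "0 < h" using asym_hh(2)[OF \<theta>p *(1,3)] hz by (simp add: h_def t_def)
  note M = tmat_asym[OF \<theta>p v(1) z1, folded t_def, unfolded hz, folded h_def]
  note as = 01[folded t_def, folded h_def] 02[folded t_def, folded h_def] 12[folded t_def, folded h_def]
  have ne: "x \<noteq> 0" "1 + x \<noteq> 0" "1 - t \<noteq> 0" "0 < (1 + x) * (1 - t)" using x t by auto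
  let ?Q = "\<lambda>i j. am t h x i j / (1 - t)"
  interpret T: tisgm L x0 \<theta> "wvec (z, y)" "rowF \<theta> (wvec (z, y)) 2 ^ 2" using \<theta>p v(1) by (rule tisgm_FP)
  have x0: "0 < x" using x by simp
  have f: "2 - j \<in> spins" "2 - (2 - j) = j" if "j \<in> spins" for j using that by (auto simp: spins_def)
  have P: "(\<forall>i\<in>spins. \<forall>j\<in>spins. tmat \<theta> (wvec (z, y)) i j = ?Q i j)
    \<or> (\<forall>i\<in>spins. \<forall>j\<in>spins. tmat \<theta> (wvec (z, y)) i j = ?Q (2 - i) (2 - j))"
    using v(2)
  proof
    assume "z = x" then show ?thesis using M by simp
  next
    assume "z = 1 / x"
    then have "\<forall>i\<in>spins. \<forall>j\<in>spins. tmat \<theta> (wvec (z, y)) i j = ?Q (2 - i) (2 - j)"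
      using M am_flip[OF x0] by simp
    then show ?thesis ..
  qed
  \<comment> \<open>The rows of \<open>?Q\<close> are rows of \<open>tmat\<close>, possibly read
    backwards.\<close>
  have "?Q 0 0 + ?Q 0 1 + ?Q 0 2 = 1" "?Q 1 0 + ?Q 1 1 + ?Q 1 2 = 1" "?Q 2 0 + ?Q 2 1 + ?Q 2 2 = 1"
  proof -
    have s: "tmat \<theta> (wvec (z, y)) i 0 + tmat \<theta> (wvec (z, y)) i 1 + tmat \<theta> (wvec (z, y)) i 2 = 1" for i
      using T.trans_sum[of i] by (simp add: sum_spins)
    have b: "0 \<in> spins" "1 \<in> spins" "2 \<in> spins" by (simp_all add: spins_def)
    from P show "?Q 0 0 + ?Q 0 1 + ?Q 0 2 = 1" "?Q 1 0 + ?Q 1 1 + ?Q 1 2 = 1" "?Q 2 0 + ?Q 2 1 + ?Q 2 2 = 1"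
    proof (atomize (full), elim disjE)
      assume "\<forall>i\<in>spins. \<forall>j\<in>spins. tmat \<theta> (wvec (z, y)) i j = ?Q i j"
      from s[of 0] s[of 1] s[of 2] this[rule_format, OF b(1)] this[rule_format, OF b(2)] this[rule_format, OF b(3)] b
      show "?Q 0 0 + ?Q 0 1 + ?Q 0 2 = 1 \<and> ?Q 1 0 + ?Q 1 1 + ?Q 1 2 = 1 \<and> ?Q 2 0 + ?Q 2 1 + ?Q 2 2 = 1"
        by (simp only: simp_thms)
    next
      assume "\<forall>i\<in>spins. \<forall>j\<in>spins. tmat \<theta> (wvec (z, y)) i j = ?Q (2 - i) (2 - j)"
      then have eq: "tmat \<theta> (wvec (z, y)) i j = ?Q (2 - i) (2 - j)" if "i \<in> spins" "j \<in> spins" for i j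
        using that by blast
      have n: "(2::nat) - 0 = 2" "(2::nat) - 1 = 1" "(2::nat) - 2 = 0" by simp_all
      have "?Q 2 2 + ?Q 2 1 + ?Q 2 0 = 1" "?Q 1 2 + ?Q 1 1 + ?Q 1 0 = 1" "?Q 0 2 + ?Q 0 1 + ?Q 0 0 = 1"
        using s[of 0] s[of 1] s[of 2] unfolding eq[OF b(1,1)] eq[OF b(1,2)] eq[OF b(1,3)] eq[OF b(2,1)] eq[OF b(2,2)]
          eq[OF b(2,3)] eq[OF b(3,1)] eq[OF b(3,2)] eq[OF b(3,3)] n by blast+
      then show "?Q 0 0 + ?Q 0 1 + ?Q 0 2 = 1 \<and> ?Q 1 0 + ?Q 1 1 + ?Q 1 2 = 1 \<and> ?Q 2 0 + ?Q 2 1 + ?Q 2 2 = 1"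
        by (simp only: add_ac)
    qed
  qed
  then have sum: "?Q i 0 + ?Q i 1 + ?Q i 2 = 1" if "i \<in> spins" for i using spins_cases[OF that] by auto
  have D: "\<bar>?Q 0 1 - ?Q 1 1\<bar> = x * h / ((1 + x) * (1 - t))" "\<bar>?Q 0 2 - ?Q 1 2\<bar> = t / ((1 + x) * (1 - t))"
    "\<bar>?Q 0 1 - ?Q 2 1\<bar> = h * (x - 1) / ((1 + x) * (1 - t))" "\<bar>?Q 0 2 - ?Q 2 2\<bar> = (1 - t / x) / ((1 + x) * (1 - t))"
    "\<bar>?Q 1 1 - ?Q 2 1\<bar> = h / ((1 + x) * (1 - t))" "\<bar>?Q 1 0 - ?Q 2 0\<bar> = t * x / ((1 + x) * (1 - t))"
  proof -
    have c: "\<bar>p / (1 + x) / (1 - t) - q / (1 + x) / (1 - t)\<bar> = z / ((1 + x) * (1 - t))"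
      if "p - q = z \<or> q - p = z" "0 \<le> z" for p q z
    proof -
      have "p / (1 + x) / (1 - t) - q / (1 + x) / (1 - t) = (p - q) / ((1 + x) * (1 - t))"
        by (simp flip: diff_divide_distrib)
      moreover have "\<bar>p - q\<bar> = z" using that by auto
      ultimately show ?thesis using ne(4) by (simp only: abs_divide abs_of_pos)
    qed
    have m: "am t h x 0 1 = h / (1 + x)" "am t h x 1 1 = h * (1 + x) / (1 + x)" "am t h x 2 1 = x * h / (1 + x)"
      "am t h x 0 2 = t / x / (1 + x)" "am t h x 1 2 = t / x * (1 + x) / (1 + x)" "am t h x 2 2 = 1 / (1 + x)"
      "am t h x 1 0 = t * x * (1 + x) / (1 + x)" "am t h x 2 0 = t * x^2 / (1 + x)"
      using ne by (simp_all add: am_def)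
    have tx: "t / x \<le> 1" using x t by (simp add: pos_divide_le_eq)
    have p: "0 \<le> x * h" "0 \<le> t" "0 \<le> h * (x - 1)" "0 \<le> 1 - t / x" "0 \<le> h" "0 \<le> t * x"
      using x hp t tx by simp_all
    show "\<bar>?Q 0 1 - ?Q 1 1\<bar> = x * h / ((1 + x) * (1 - t))" unfolding m by (rule c[OF _ p(1)]) algebra
    show "\<bar>?Q 0 2 - ?Q 1 2\<bar> = t / ((1 + x) * (1 - t))" unfolding m by (rule c[OF _ p(2)]) (use ne in \<open>simp add: distrib_left\<close>)
    show "\<bar>?Q 0 1 - ?Q 2 1\<bar> = h * (x - 1) / ((1 + x) * (1 - t))" unfolding m by (rule c[OF _ p(3)]) algebra
    show "\<bar>?Q 0 2 - ?Q 2 2\<bar> = (1 - t / x) / ((1 + x) * (1 - t))" unfolding m by (rule c[OF _ p(4)]) simp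
    show "\<bar>?Q 1 1 - ?Q 2 1\<bar> = h / ((1 + x) * (1 - t))" unfolding m by (rule c[OF _ p(5)]) (simp add: algebra_simps)
    show "\<bar>?Q 1 0 - ?Q 2 0\<bar> = t * x / ((1 + x) * (1 - t))" unfolding m by (rule c[OF _ p(6)]) (simp add: algebra_simps power2_eq_square)
  qed
  have "down_contraction ?Q u1 \<kappa>"
  proof (rule down_contraction_u1[OF sum])
    have e: "p / Z + 5/4 * (q / Z) \<le> k" if "p + 5/4 * q \<le> k * Z" "0 < Z" for p q k Z :: real
    proof -
      have "p / Z + 5/4 * (q / Z) = (p + 5/4 * q) / Z" by (simp add: add_divide_distrib)
      then show ?thesis using that by (simp only: pos_divide_le_eq)
    qed
    have Z: "k * (1 - t) * (1 + x) = k * ((1 + x) * (1 - t))" for k by (simp only: mult_ac)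
    note as' = as[unfolded Z]
    show "\<bar>?Q 0 1 - ?Q 1 1\<bar> + 5/4 * \<bar>?Q 0 2 - ?Q 1 2\<bar> \<le> \<kappa>" unfolding D by (rule e[OF as'(1) ne(4)])
    show "\<bar>?Q 0 1 - ?Q 2 1\<bar> + 5/4 * \<bar>?Q 0 2 - ?Q 2 2\<bar> \<le> 5/4 * \<kappa>" unfolding D by (rule e[OF as'(2) ne(4)])
    show "\<bar>?Q 1 1 - ?Q 2 1\<bar> + 5/4 * \<bar>?Q 1 0 - ?Q 2 0\<bar> \<le> \<kappa>" unfolding D by (rule e[OF as'(3) ne(4)])
  qed
  note Q = this
  have u: "u1 (2 - i) (2 - j) = u1 i j" if "i \<in> spins" "j \<in> spins" for i j
    using that by (auto simp: u1_def spins_def)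
  have "down_contraction (tmat \<theta> (wvec (z, y))) u1 \<kappa>"
    using P
  proof
    assume "\<forall>i\<in>spins. \<forall>j\<in>spins. tmat \<theta> (wvec (z, y)) i j = ?Q i j"
    then have eq: "(\<Sum>j\<in>spins. tmat \<theta> (wvec (z, y)) s j * q j) = (\<Sum>j\<in>spins. ?Q s j * q j)" if "s \<in> spins" for q s
      using that by (intro sum.cong) auto
    show ?thesis unfolding down_contraction_def
    proof (intro allI impI ballI)
      fix q :: "nat \<Rightarrow> real" and s s'
      assume "\<forall>i\<in>spins. \<forall>j\<in>spins. \<bar>q i - q j\<bar> \<le> u1 i j" "s \<in> spins" "s' \<in> spins"
      then show "\<bar>(\<Sum>j\<in>spins. tmat \<theta> (wvec (z, y)) s j * q j) - (\<Sum>j\<in>spins. tmat \<theta> (wvec (z, y)) s' j * q j)\<bar> \<le> \<kappa> * u1 s s'"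
        using Q unfolding down_contraction_def by (simp only: eq)
    qed
  next
    assume P': "\<forall>i\<in>spins. \<forall>j\<in>spins. tmat \<theta> (wvec (z, y)) i j = ?Q (2 - i) (2 - j)"
    show ?thesis by (rule down_contraction_flip[OF u Q P'[rule_format]])
  qed
  note dc = this
  have "0 \<le> u1 i j" for i j by (simp add: u1_def)
  moreover have "1 \<le> u1 i j" if "i \<noteq> j" for i j using that by (simp add: u1_def)
  moreover have "(0::real) < 855/1000" by simp
  ultimately have "extreme_gibbs J \<beta> L T.chain_measure"
    using T.extreme_criterion[OF \<theta> up_contraction_u1[OF b] dc _ \<kappa>] by blast
  then show ?thesis by (simp only: TM_def)
qed

section \<open>Extremality of the symmetric solutions\<close>

lemma sym_bound_middle:
  fixes \<theta> :: real
  assumes "1 \<le> 3 * \<theta>" "3 * \<theta> \<le> 3"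
  shows "0 < (1 + \<theta>^2) * (1 + \<theta>^2 + \<theta>) - 2 * (1 - \<theta>^2)^2"
proof -
  have "1296 * ((1 + \<theta>^2) * (1 + \<theta>^2 + \<theta>) - 2 * (1 - \<theta>^2)^2) = 32 + (280 * ((3 * \<theta> - 1) * (3 - 3 * \<theta>)^3)
      + 1068 * ((3 * \<theta> - 1)^2 * (3 - 3 * \<theta>)^2)
      + 1288 * ((3 * \<theta> - 1)^3 * (3 - 3 * \<theta>))
      + 484 * ((3 * \<theta> - 1)^4))"
    by algebra
  moreover have "0 \<le> 280 * ((3 * \<theta> - 1) * (3 - 3 * \<theta>)^3)
      + 1068 * ((3 * \<theta> - 1)^2 * (3 - 3 * \<theta>)^2)
      + 1288 * ((3 * \<theta> - 1)^3 * (3 - 3 * \<theta>))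
      + 484 * ((3 * \<theta> - 1)^4)"
    by (intro add_nonneg_nonneg mult_nonneg_nonneg zero_le_power) (use assms in simp_all)
  ultimately show ?thesis by (rule pos_certificate[rotated 2]) simp_all
qed

text \<open>In its own degree 3 the polynomial has a negative Bernstein coefficient on this
  interval; raising the degree to 6 removes it.\<close>

lemma cub_root_lower_poly:
  fixes \<theta> :: real
  assumes "0 \<le> 3 * \<theta>" "3 * \<theta> \<le> 1"
  shows "0 < 175 * \<theta>^3 + 468 * \<theta>^2 - 315 * \<theta> + 50"
proof -
  have "27 * (175 * \<theta>^3 + 468 * \<theta>^2 - 315 * \<theta> + 50) = 11 + (1339 * ((1 - 3 * \<theta>)^6)
      + 5199 * ((3 * \<theta> - 0) * (1 - 3 * \<theta>)^5)
      + 7314 * ((3 * \<theta> - 0)^2 * (1 - 3 * \<theta>)^4)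
      + 4221 * ((3 * \<theta> - 0)^3 * (1 - 3 * \<theta>)^3)
      + 684 * ((3 * \<theta> - 0)^4 * (1 - 3 * \<theta>)^2)
      + 83 * ((3 * \<theta> - 0)^6))"
    by algebra
  moreover have "0 \<le> 1339 * ((1 - 3 * \<theta>)^6)
      + 5199 * ((3 * \<theta> - 0) * (1 - 3 * \<theta>)^5)
      + 7314 * ((3 * \<theta> - 0)^2 * (1 - 3 * \<theta>)^4)
      + 4221 * ((3 * \<theta> - 0)^3 * (1 - 3 * \<theta>)^3)
      + 684 * ((3 * \<theta> - 0)^4 * (1 - 3 * \<theta>)^2)
      + 83 * ((3 * \<theta> - 0)^6)"
    by (intro add_nonneg_nonneg mult_nonneg_nonneg zero_le_power) (use assms in simp_all)
  ultimately show ?thesis by (rule pos_certificate[rotated 2]) simp_all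
qed

lemma sym_bound_small:
  fixes \<theta> :: real
  assumes "0 \<le> 3 * \<theta>" "3 * \<theta> \<le> 1"
  shows "0 < (1 + \<theta>^2) * (25 * \<theta> * (1 + \<theta>^2) + (5 - 7 * \<theta>)^2) - 50 * \<theta> * (1 - \<theta>^2)^2"
proof -
  have "243 * ((1 + \<theta>^2) * (25 * \<theta> * (1 + \<theta>^2) + (5 - 7 * \<theta>)^2) - 50 * \<theta> * (1 - \<theta>^2)^2) = 1220 + (4855 * ((1 - 3 * \<theta>)^5)
      + 16580 * ((3 * \<theta> - 0) * (1 - 3 * \<theta>)^4)
      + 19768 * ((3 * \<theta> - 0)^2 * (1 - 3 * \<theta>)^3)
      + 9094 * ((3 * \<theta> - 0)^3 * (1 - 3 * \<theta>)^2)
      + 1076 * ((3 * \<theta> - 0)^4 * (1 - 3 * \<theta>)))"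
    by algebra
  moreover have "0 \<le> 4855 * ((1 - 3 * \<theta>)^5)
      + 16580 * ((3 * \<theta> - 0) * (1 - 3 * \<theta>)^4)
      + 19768 * ((3 * \<theta> - 0)^2 * (1 - 3 * \<theta>)^3)
      + 9094 * ((3 * \<theta> - 0)^3 * (1 - 3 * \<theta>)^2)
      + 1076 * ((3 * \<theta> - 0)^4 * (1 - 3 * \<theta>))"
    by (intro add_nonneg_nonneg mult_nonneg_nonneg zero_le_power) (use assms in simp_all)
  ultimately show ?thesis by (rule pos_certificate[rotated 2]) simp_all
qed

text \<open>The interval runs from 2.4, the lower bound reached inside
  \<open>largest_root_extreme\<close>, to the threshold 2.655.\<close>

lemma sym_bound_large:
  fixes \<theta> :: real
  assumes "480 \<le> 200 * \<theta>" "200 * \<theta> \<le> 531"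
  shows "0 < (1 + \<theta>^2) * (3 * \<theta>^2 - 1)^2 - 4 * \<theta> * (\<theta>^4 - 6 * \<theta>^2 + 1) * (\<theta>^2 - 1)^2"
proof -
  have "298773142155577728000000000000000000 * ((1 + \<theta>^2) * (3 * \<theta>^2 - 1)^2 - 4 * \<theta> * (\<theta>^4 - 6 * \<theta>^2 + 1) * (\<theta>^2 - 1)^2) = 1508837929365205803125323231199157879 + (239332662729346696125171 * ((531 - 200 * \<theta>)^9)
      + 2117466229852209865126539 * ((200 * \<theta> - 480) * (531 - 200 * \<theta>)^8)
      + 8194996247038683940506156 * ((200 * \<theta> - 480)^2 * (531 - 200 * \<theta>)^7)
      + 18121012255395980458514364 * ((200 * \<theta> - 480)^3 * (531 - 200 * \<theta>)^6)
      + 25040064191331705778971546 * ((200 * \<theta> - 480)^4 * (531 - 200 * \<theta>)^5)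
      + 22141521804985819171611546 * ((200 * \<theta> - 480)^5 * (531 - 200 * \<theta>)^4)
      + 12234842742184863166946364 * ((200 * \<theta> - 480)^6 * (531 - 200 * \<theta>)^3)
      + 3862690932912283515747756 * ((200 * \<theta> - 480)^7 * (531 - 200 * \<theta>)^2)
      + 533455382195858601541419 * ((200 * \<theta> - 480)^8 * (531 - 200 * \<theta>)))"
    by algebra
  moreover have "0 \<le> 239332662729346696125171 * ((531 - 200 * \<theta>)^9)
      + 2117466229852209865126539 * ((200 * \<theta> - 480) * (531 - 200 * \<theta>)^8)
      + 8194996247038683940506156 * ((200 * \<theta> - 480)^2 * (531 - 200 * \<theta>)^7)
      + 18121012255395980458514364 * ((200 * \<theta> - 480)^3 * (531 - 200 * \<theta>)^6)
      + 25040064191331705778971546 * ((200 * \<theta> - 480)^4 * (531 - 200 * \<theta>)^5)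
      + 22141521804985819171611546 * ((200 * \<theta> - 480)^5 * (531 - 200 * \<theta>)^4)
      + 12234842742184863166946364 * ((200 * \<theta> - 480)^6 * (531 - 200 * \<theta>)^3)
      + 3862690932912283515747756 * ((200 * \<theta> - 480)^7 * (531 - 200 * \<theta>)^2)
      + 533455382195858601541419 * ((200 * \<theta> - 480)^8 * (531 - 200 * \<theta>))"
    by (intro add_nonneg_nonneg mult_nonneg_nonneg zero_le_power) (use assms in simp_all)
  ultimately show ?thesis by (rule pos_certificate[rotated 2]) simp_all
qed

text \<open>The decimals are sqrt 2 - 1, sqrt 2 + 1 and sqrt 2, all rounded down; 57531/20000 is
  2.87655.\<close>

lemma sym_eigenvalue_large:
  fixes \<theta> :: real
  assumes "57531 \<le> 20000 * \<theta>"
  shows "0 < \<theta> * (4142135/10000000 * \<theta>^2 - 24142135/10000000) * (14142135/10000000 * (\<theta>^2 - 1))^2 - (24142135/10000000 * (\<theta>^2 - 1))^2"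
proof -
  have "10240000000000000000000000000000000000000000000000 * (\<theta> * (4142135/10000000 * \<theta>^2 - 24142135/10000000) * (14142135/10000000 * (\<theta>^2 - 1))^2 - (24142135/10000000 * (\<theta>^2 - 1))^2) = 371880771644930067750696727751930414537065863113 + (426391824713125297563715288880529438912926920461 * ((20000 * \<theta> - 57531))
      + 43404858160697362892059414000464865213481093 * ((20000 * \<theta> - 57531)^2)
      + 1781787065592785908483760154241722422505 * ((20000 * \<theta> - 57531)^3)
      + 37826350746150697176503724065629355 * ((20000 * \<theta> - 57531)^4)
      + 439893134394240368136972582423 * ((20000 * \<theta> - 57531)^5)
      + 2668972853844886390042311 * ((20000 * \<theta> - 57531)^6)
      + 6627415415403090483 * ((20000 * \<theta> - 57531)^7))"
    by algebra
  moreover have "0 \<le> 426391824713125297563715288880529438912926920461 * ((20000 * \<theta> - 57531))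
      + 43404858160697362892059414000464865213481093 * ((20000 * \<theta> - 57531)^2)
      + 1781787065592785908483760154241722422505 * ((20000 * \<theta> - 57531)^3)
      + 37826350746150697176503724065629355 * ((20000 * \<theta> - 57531)^4)
      + 439893134394240368136972582423 * ((20000 * \<theta> - 57531)^5)
      + 2668972853844886390042311 * ((20000 * \<theta> - 57531)^6)
      + 6627415415403090483 * ((20000 * \<theta> - 57531)^7)"
    by (intro add_nonneg_nonneg mult_nonneg_nonneg zero_le_power) (use assms in simp_all)
  ultimately show ?thesis by (rule pos_certificate[rotated 2]) simp_all
qed

lemma sym_eigenvalue_small:
  fixes \<theta> :: real
  assumes "0 \<le> 2000 * \<theta>" "2000 * \<theta> \<le> 283"
  shows "0 < 2 * (1 - \<theta>^2)^2 - (1 + \<theta>^2 + \<theta>)^2"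
proof -
  have "102627966736000000000000 * (2 * (1 - \<theta>^2)^2 - (1 + \<theta>^2 + \<theta>)^2) = 58659974562869615914241 + (6854738500079 * ((283 - 2000 * \<theta>)^4)
      + 22890954000316 * ((2000 * \<theta> - 0) * (283 - 2000 * \<theta>)^3)
      + 25301939000474 * ((2000 * \<theta> - 0)^2 * (283 - 2000 * \<theta>)^2)
      + 9259309252316 * ((2000 * \<theta> - 0)^3 * (283 - 2000 * \<theta>)))"
    by algebra
  moreover have "0 \<le> 6854738500079 * ((283 - 2000 * \<theta>)^4)
      + 22890954000316 * ((2000 * \<theta> - 0) * (283 - 2000 * \<theta>)^3)
      + 25301939000474 * ((2000 * \<theta> - 0)^2 * (283 - 2000 * \<theta>)^2)
      + 9259309252316 * ((2000 * \<theta> - 0)^3 * (283 - 2000 * \<theta>))"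
    by (intro add_nonneg_nonneg mult_nonneg_nonneg zero_le_power) (use assms in simp_all)
  ultimately show ?thesis by (rule pos_certificate[rotated 2]) simp_all
qed

text \<open>0.7071068 is 1/sqrt 2 rounded up, and 34343/200000 is 0.171715.\<close>

lemma asym_eigenvalue_poly:
  fixes \<theta> :: real
  assumes "0 \<le> 200000 * \<theta>" "200000 * \<theta> \<le> 34343"
  shows "0 < (1 + \<theta>^2) * ((7071068/10000000)^2 * (1 - \<theta>^2) - 17071068/10000000 * \<theta>^2) * (7071068/10000000 - \<theta> * (1 + \<theta>^2)) - ((7071068/10000000)^2 * (1 - \<theta>^2) - 17071068/10000000 * \<theta>^2)^2 - \<theta> * (7071068/10000000 - \<theta> * (1 + \<theta>^2))^2"
proof -
  have "4507726895077414696094643051680560000000000000000000000000000000000000000000000000 * ((1 + \<theta>^2) * ((7071068/10000000)^2 * (1 - \<theta>^2) - 17071068/10000000 * \<theta>^2) * (7071068/10000000 - \<theta> * (1 + \<theta>^2)) - ((7071068/10000000)^2 * (1 - \<theta>^2) - 17071068/10000000 * \<theta>^2)^2 - \<theta> * (7071068/10000000 - \<theta> * (1 + \<theta>^2))^2) = 5064748425337807028171747071047498036923599359369615434659288924306017584001 + (8284181490946514531062677106246424894111918184857 * ((34343 - 200000 * \<theta>)^7)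
      + 44252069705635121461438739743724974258783427293999 * ((200000 * \<theta> - 0) * (34343 - 200000 * \<theta>)^6)
      + 97239455339818906418793357002256459185950281881997 * ((200000 * \<theta> - 0)^2 * (34343 - 200000 * \<theta>)^5)
      + 112446473065483478647899905297232553341917136469995 * ((200000 * \<theta> - 0)^3 * (34343 - 200000 * \<theta>)^4)
      + 72137374361061054976598866391388914496129034427115 * ((200000 * \<theta> - 0)^4 * (34343 - 200000 * \<theta>)^3)
      + 24337466200270504212492015046221005852065975753357 * ((200000 * \<theta> - 0)^5 * (34343 - 200000 * \<theta>)^2)
      + 3374572677382353044013965814548056947579121165359 * ((200000 * \<theta> - 0)^6 * (34343 - 200000 * \<theta>)))"
    by algebra
  moreover have "0 \<le> 8284181490946514531062677106246424894111918184857 * ((34343 - 200000 * \<theta>)^7)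
      + 44252069705635121461438739743724974258783427293999 * ((200000 * \<theta> - 0) * (34343 - 200000 * \<theta>)^6)
      + 97239455339818906418793357002256459185950281881997 * ((200000 * \<theta> - 0)^2 * (34343 - 200000 * \<theta>)^5)
      + 112446473065483478647899905297232553341917136469995 * ((200000 * \<theta> - 0)^3 * (34343 - 200000 * \<theta>)^4)
      + 72137374361061054976598866391388914496129034427115 * ((200000 * \<theta> - 0)^4 * (34343 - 200000 * \<theta>)^3)
      + 24337466200270504212492015046221005852065975753357 * ((200000 * \<theta> - 0)^5 * (34343 - 200000 * \<theta>)^2)
      + 3374572677382353044013965814548056947579121165359 * ((200000 * \<theta> - 0)^6 * (34343 - 200000 * \<theta>))"
    by (intro add_nonneg_nonneg mult_nonneg_nonneg zero_le_power) (use assms in simp_all)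
  ultimately show ?thesis by (rule pos_certificate[rotated 2]) simp_all
qed

lemma asym_eigenvalue_num:
  fixes \<theta> :: real
  assumes "0 \<le> 200000 * \<theta>" "200000 * \<theta> \<le> 34343"
  shows "0 < (7071068/10000000)^2 * (1 - \<theta>^2) - 17071068/10000000 * \<theta>^2"
proof -
  have "294860412250000000000000000000000 * ((7071068/10000000)^2 * (1 - \<theta>^2) - 17071068/10000000 * \<theta>^2) = 128241039530576036084888877604911 + (16269710719322629870561 * ((34343 - 200000 * \<theta>)^2)
      + 32539421438645259741122 * ((200000 * \<theta> - 0) * (34343 - 200000 * \<theta>)))"
    by algebra
  moreover have "0 \<le> 16269710719322629870561 * ((34343 - 200000 * \<theta>)^2)
      + 32539421438645259741122 * ((200000 * \<theta> - 0) * (34343 - 200000 * \<theta>))"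
    by (intro add_nonneg_nonneg mult_nonneg_nonneg zero_le_power) (use assms in simp_all)
  ultimately show ?thesis by (rule pos_certificate[rotated 2]) simp_all
qed

lemma asym_eigenvalue_den:
  fixes \<theta> :: real
  assumes "0 \<le> 200000 * \<theta>" "200000 * \<theta> \<le> 34343"
  shows "0 < 7071068/10000000 - \<theta> * (1 + \<theta>^2)"
proof -
  have "324044516412856000000000000000 * (7071068/10000000 - \<theta> * (1 + \<theta>^2)) = 171850076162764115393833717551 + (1414225564551607 * ((34343 - 200000 * \<theta>)^3)
      + 2868956693654821 * ((200000 * \<theta> - 0) * (34343 - 200000 * \<theta>)^2)
      + 1495236693654821 * ((200000 * \<theta> - 0)^2 * (34343 - 200000 * \<theta>)))"
    by algebra
  moreover have "0 \<le> 1414225564551607 * ((34343 - 200000 * \<theta>)^3)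
      + 2868956693654821 * ((200000 * \<theta> - 0) * (34343 - 200000 * \<theta>)^2)
      + 1495236693654821 * ((200000 * \<theta> - 0)^2 * (34343 - 200000 * \<theta>))"
    by (intro add_nonneg_nonneg mult_nonneg_nonneg zero_le_power) (use assms in simp_all)
  ultimately show ?thesis by (rule pos_certificate[rotated 2]) simp_all
qed

text \<open>1681/310 is the value of (1 + x)^2 / x at x = 31/10.\<close>

lemma asym_x_lower_poly:
  fixes \<theta> :: real
  assumes "26586 \<le> 100000 * \<theta>" "100000 * \<theta> \<le> 29565"
  shows "0 < (1681/310)^2 * \<theta>^3 - 1681/310 * (\<theta> * (1 + \<theta>^2)) + 1"
proof -
  have "2540591830917900000000000000000 * ((1681/310)^2 * \<theta>^3 - 1681/310 * (\<theta> * (1 + \<theta>^2)) + 1) = 14364748221198196311511303860 + (321942091372954716 * ((29565 - 100000 * \<theta>)^3)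
      + 665423369471743830 * ((100000 * \<theta> - 26586)^2 * (29565 - 100000 * \<theta>))
      + 1048293426544144635 * ((100000 * \<theta> - 26586)^3))"
    by algebra
  moreover have "0 \<le> 321942091372954716 * ((29565 - 100000 * \<theta>)^3)
      + 665423369471743830 * ((100000 * \<theta> - 26586)^2 * (29565 - 100000 * \<theta>))
      + 1048293426544144635 * ((100000 * \<theta> - 26586)^3)"
    by (intro add_nonneg_nonneg mult_nonneg_nonneg zero_le_power) (use assms in simp_all)
  ultimately show ?thesis by (rule pos_certificate[rotated 2]) simp_all
qed

text \<open>The cubic in terms of \<open>X = \<theta> * y\<^sup>2\<close>. By the next lemma it locates \<open>X\<close> relative to any \<open>T\<close>.\<close>

lemma cub_fixed:
  assumes "0 < \<theta>" "cub \<theta> y = 0"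
  shows "\<theta> * (\<theta> * y^2) * (\<theta> * y^2 + (1 + \<theta>^2))^2 = (\<theta> * y^2 + 2 * \<theta>^2)^2"
proof -
  have "y * (\<theta> * y^2 + (1 + \<theta>^2)) = y^2 + 2 * \<theta>" using assms(2) unfolding cub_def by algebra
  then show ?thesis by algebra
qed

text \<open>X (X + s)^2 / (X + 2 t)^2 is increasing when s \<le> 2 t. For t = \<theta>^2 and s = 1 +
  \<theta>^2, so for \<theta> \<ge> 1, the cubic says that this quotient equals 1/\<theta> at X =
  \<theta> y^2.\<close>

lemma cub_fixed_mono:
  fixes X T s t :: real
  assumes "0 \<le> X" "X \<le> T" "0 \<le> s" "s \<le> 2 * t"
  shows "X * (X + s)^2 * (T + 2 * t)^2 \<le> T * (T + s)^2 * (X + 2 * t)^2"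
proof -
  have "(T + s) * (X + 2 * t) = (X + s) * (T + 2 * t) + (2 * t - s) * (T - X)" by algebra
  moreover have "0 \<le> (2 * t - s) * (T - X)" using assms by simp
  ultimately have "(X + s) * (T + 2 * t) \<le> (T + s) * (X + 2 * t)" by linarith
  then have "((X + s) * (T + 2 * t))^2 \<le> ((T + s) * (X + 2 * t))^2"
    using assms by (intro power_mono) auto
  then have "X * ((X + s) * (T + 2 * t))^2 \<le> T * ((T + s) * (X + 2 * t))^2"
    using assms by (intro mult_mono) auto
  then show ?thesis by (simp add: power_mult_distrib mult.assoc)
qed

text \<open>For small \<theta> the largest root is close to 1/\<theta> - 1. The test point is
  1/\<theta> - 7/5, low enough for the sign to hold up to \<theta> = 1/3.\<close>

lemma cub_root_lower:
  assumes \<theta>: "0 < \<theta>" "\<theta> \<le> 1/3" shows "cub \<theta> ((5 - 7 * \<theta>) / (5 * \<theta>)) \<le> 0"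
proof -
  let ?a = "(5 - 7 * \<theta>) / (5 * \<theta>)"
  have a: "5 * (\<theta> * ?a) = 5 - 7 * \<theta>" using \<theta> by simp
  have "0 < 175 * \<theta>^3 + 468 * \<theta>^2 - 315 * \<theta> + 50" using \<theta> by (intro cub_root_lower_poly) simp_all
  then have "0 < \<theta> * (175 * \<theta>^3 + 468 * \<theta>^2 - 315 * \<theta> + 50)" using \<theta> by simp
  moreover have "125 * \<theta>^2 * cub \<theta> ?a = - (\<theta> * (175 * \<theta>^3 + 468 * \<theta>^2 - 315 * \<theta> + 50))"
  proof -
    have "125 * \<theta>^2 * cub \<theta> a = - (\<theta> * (175 * \<theta>^3 + 468 * \<theta>^2 - 315 * \<theta> + 50))" if "5 * (\<theta> * a) = 5 - 7 * \<theta>" for a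
      using that unfolding cub_def by algebra
    then show ?thesis using a by blast
  qed
  ultimately have "125 * \<theta>^2 * cub \<theta> ?a < 0" by simp
  then show ?thesis using \<theta> by (simp add: mult_less_0_iff)
qed

text \<open>On either side of \<theta> = 1 the root Y lies between 1 and 1/\<theta>, which is the
  first claim. The second claim is monotone in Y and needs only lower bounds: 1/\<theta> - 7/5 below
  1/3, then 1 up to \<theta> = 1, and beyond 1 a comparison through the cubic.\<close>

lemma largest_root_extreme:
  assumes \<theta>: "0 < \<theta>" "\<theta> < 2655/1000" and Y: "cub \<theta> Y = 0" "\<And>y. cub \<theta> y = 0 \<Longrightarrow> y \<le> Y"
  shows "0 \<le> (Y - \<theta>) * (1 - \<theta> * Y)" "2 * (1 - \<theta>^2)^2 < (1 + \<theta>^2) * (1 + \<theta>^2 + \<theta> * Y^2)"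
proof -
  define t where "t = \<theta>^2"
  have t: "0 < t" using \<theta> by (simp add: t_def)
  have Yp: "0 < Y" using \<theta>(1) Y(1) by (rule cub_root_pos)
  have e: "Y^2 * (\<theta> * Y - 1) = 2 * \<theta> - (1 + t) * Y" using Y(1) unfolding cub_def t_def by algebra
  have ge: "a \<le> Y" if "cub \<theta> a \<le> 0" for a using cub_root_ge[OF \<theta>(1) that] Y(2) by force
  have \<theta>t: "2 * \<theta> \<le> 1 + t"
  proof -
    have "1 + t = 2 * \<theta> + (1 - \<theta>)^2" unfolding t_def by algebra
    then show ?thesis by simp
  qed
  have "0 \<le> (Y - \<theta>) * (1 - \<theta> * Y) \<and> 2 * (1 - t)^2 < (1 + t) * (1 + t + \<theta> * Y^2)"
  proof (cases "\<theta> \<le> 1")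
    case True
    have "cub \<theta> 1 = \<theta> * (\<theta> - 1)" by (simp add: cub_def algebra_simps power2_eq_square)
    then have "cub \<theta> 1 \<le> 0" using True \<theta> by (simp add: mult_nonneg_nonpos)
    then have Y1: "1 \<le> Y" by (rule ge)
    have "\<theta> * Y \<le> 1"
    proof (rule ccontr)
      assume "\<not> \<theta> * Y \<le> 1"
      then have "0 < Y^2 * (\<theta> * Y - 1)" using Yp by simp
      then have "(1 + t) * Y < 2 * \<theta>" using e by simp
      moreover have "(1 + t) * 1 \<le> (1 + t) * Y" using Y1 t by (intro mult_left_mono) auto
      ultimately show False using \<theta>t by simp
    qed
    then have "0 \<le> (Y - \<theta>) * (1 - \<theta> * Y)" using Y1 True by simp
    moreover have "2 * (1 - t)^2 < (1 + t) * (1 + t + \<theta> * Y^2)"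
    proof (cases "1/3 \<le> \<theta>")
      case True2: True
      have "0 < (1 + t) * (1 + t + \<theta>) - 2 * (1 - t)^2" unfolding t_def using True True2 by (intro sym_bound_middle) simp_all
      moreover have "(1 + t) * (1 + t + \<theta> * 1) \<le> (1 + t) * (1 + t + \<theta> * Y^2)"
        using \<theta> t Y1 by (intro mult_left_mono add_left_mono) (auto simp: one_le_power)
      ultimately show ?thesis by simp
    next
      case False
      let ?a = "(5 - 7 * \<theta>) / (5 * \<theta>)"
      have "?a \<le> Y" using \<theta> False by (intro ge cub_root_lower) auto
      moreover have "0 \<le> ?a" using \<theta> False by simp
      ultimately have "?a^2 \<le> Y^2" by (rule power_mono)
      then have "25 * \<theta> * (\<theta> * ?a^2) \<le> 25 * \<theta> * (\<theta> * Y^2)" using \<theta> by simp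
      moreover have "25 * \<theta> * (\<theta> * ?a^2) = (5 - 7 * \<theta>)^2" using \<theta> by (simp add: power_divide power2_eq_square)
      ultimately have "(5 - 7 * \<theta>)^2 \<le> 25 * \<theta> * (\<theta> * Y^2)" by simp
      then have "(1 + t) * (25 * \<theta> * (1 + t) + (5 - 7 * \<theta>)^2) \<le> (1 + t) * (25 * \<theta> * (1 + t) + 25 * \<theta> * (\<theta> * Y^2))"
        using t by (intro mult_left_mono add_left_mono) auto
      moreover have "0 < (1 + t) * (25 * \<theta> * (1 + t) + (5 - 7 * \<theta>)^2) - 50 * \<theta> * (1 - t)^2"
        unfolding t_def using \<theta> False by (intro sym_bound_small) simp_all
      moreover have "(1 + t) * (25 * \<theta> * (1 + t) + 25 * \<theta> * (\<theta> * Y^2)) = 25 * \<theta> * ((1 + t) * (1 + t + \<theta> * Y^2))" by algebra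
      moreover have "50 * \<theta> * (1 - t)^2 = 25 * \<theta> * (2 * (1 - t)^2)" by algebra
      ultimately have "25 * \<theta> * (2 * (1 - t)^2) < 25 * \<theta> * ((1 + t) * (1 + t + \<theta> * Y^2))" by linarith
      then show ?thesis using \<theta> by simp
    qed
    ultimately show ?thesis ..
  next
    case False
    then have t1: "1 < t" by (simp add: t_def)
    have Y1: "Y < 1"
    proof (rule ccontr)
      assume "\<not> Y < 1"
      then obtain s where s: "Y = 1 + s" "0 \<le> s" by (metis add.commute diff_add_cancel diff_ge_0_iff_ge not_less)
      have "cub \<theta> Y = \<theta> * (\<theta> - 1) + (s * (3 * (\<theta> - 1) + t + 2) + s^2 * (3 * \<theta> - 1) + \<theta> * s^3)"
        unfolding cub_def s t_def by algebra
      moreover have "0 < \<theta> * (\<theta> - 1)" using False \<theta> by simp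
      moreover have "0 \<le> s * (3 * (\<theta> - 1) + t + 2) + s^2 * (3 * \<theta> - 1) + \<theta> * s^3" using False \<theta> s t by simp
      ultimately show False using Y(1) by simp
    qed
    have "1 \<le> \<theta> * Y"
    proof (rule ccontr)
      assume a: "\<not> 1 \<le> \<theta> * Y"
      then have "Y^2 * (\<theta> * Y - 1) < 0" using Yp by (simp add: mult_pos_neg)
      then have "2 * \<theta> < (1 + t) * Y" using e by simp
      then have "\<theta> * (2 * \<theta>) < \<theta> * ((1 + t) * Y)" using \<theta> by simp
      also have "\<theta> * ((1 + t) * Y) = (1 + t) * (\<theta> * Y)" by algebra
      also have "\<dots> \<le> (1 + t) * 1" using a t by (intro mult_left_mono) auto
      finally have "2 * t < 1 + t" by (simp add: t_def power2_eq_square mult_ac)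
      then show False using t1 by simp
    qed
    then have "0 \<le> (Y - \<theta>) * (1 - \<theta> * Y)" using Y1 False by (simp add: mult_nonpos_nonpos)
    moreover have "2 * (1 - t)^2 < (1 + t) * (1 + t + \<theta> * Y^2)"
    proof (rule ccontr)
      assume neg: "\<not> 2 * (1 - t)^2 < (1 + t) * (1 + t + \<theta> * Y^2)"
      \<comment> \<open>\<open>T\<close> is the value of \<open>X\<close> at which the claim becomes
        an equality. If \<open>X\<close> were at most \<open>T\<close>, the cubic would give a
        polynomial inequality in \<theta> alone that \<open>sym_bound_large\<close> refutes.\<close>
      define X where "X = \<theta> * Y^2"
      define N where "N = t^2 - 6 * t + 1"
      define T where "T = N / (1 + t)"
      have T: "(1 + t) * T = N" using t by (simp add: T_def)
      have Xp: "0 < X" using \<theta> Yp by (simp add: X_def)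
      have "(1 + t) * (1 + t + X) \<le> 2 * (1 - t)^2" using neg by (simp add: X_def)
      moreover have "2 * (1 - t)^2 = (1 + t) * (1 + t + T)" unfolding distrib_left T N_def by algebra
      ultimately have XT: "X \<le> T" using t by simp
      have Tp: "0 < T" using Xp XT by simp
      then have "0 < (1 + t) * T" using t by simp
      then have Np: "0 < N" unfolding T .
      \<comment> \<open>Positivity of \<open>N\<close> means \<theta> > 1 + sqrt 2 here; 2.4 is a
        rational bound just below.\<close>
      have \<theta>24: "24 \<le> 10 * \<theta>"
      proof (rule ccontr)
        assume "\<not> 24 \<le> 10 * \<theta>"
        then have "\<theta> < 24/10" by simp
        then have "\<theta>^2 < (24/10)^2" using \<theta> by (intro power_strict_mono) auto
        then have t2: "t < 576/100" by (simp add: t_def power2_eq_square)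
        have "100 * N = (t - 1) * (100 * t - 576) + (76 * t - 476)" unfolding N_def by algebra
        moreover have "(t - 1) * (100 * t - 576) < 0" using t1 t2 by (simp add: mult_pos_neg)
        moreover have "76 * t - 476 < 0" using t2 by simp
        ultimately show False using Np by simp
      qed
      have "X * (X + (1 + t))^2 * (T + 2 * t)^2 \<le> T * (T + (1 + t))^2 * (X + 2 * t)^2"
        using Xp XT t t1 by (intro cub_fixed_mono) auto
      moreover have f: "\<theta> * X * (X + (1 + t))^2 = (X + 2 * t)^2"
        using cub_fixed[OF \<theta>(1) Y(1)] unfolding X_def t_def .
      ultimately have "\<theta> * (X * (X + (1 + t))^2 * (T + 2 * t)^2) \<le> \<theta> * (T * (T + (1 + t))^2 * (X + 2 * t)^2)"
        using \<theta> by simp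
      also have "\<theta> * (X * (X + (1 + t))^2 * (T + 2 * t)^2) = (X + 2 * t)^2 * (T + 2 * t)^2" unfolding f[symmetric] by algebra
      also have "\<theta> * (T * (T + (1 + t))^2 * (X + 2 * t)^2) = (X + 2 * t)^2 * (\<theta> * T * (T + (1 + t))^2)" by algebra
      finally have "(T + 2 * t)^2 \<le> \<theta> * T * (T + (1 + t))^2" using Xp t by simp
      then have "(1 + t)^3 * (T + 2 * t)^2 \<le> (1 + t)^3 * (\<theta> * T * (T + (1 + t))^2)" using t by simp
      also have "(1 + t)^3 * (T + 2 * t)^2 = (1 + t) * (3 * t - 1)^2 * (t - 1)^2"
      proof -
        have "(1 + t) * (T + 2 * t) = (3 * t - 1) * (t - 1)" unfolding distrib_left T N_def by algebra
        then show ?thesis by algebra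
      qed
      also have "(1 + t)^3 * (\<theta> * T * (T + (1 + t))^2) = 4 * \<theta> * N * (t - 1)^2 * (t - 1)^2"
      proof -
        have "(1 + t) * (T + (1 + t)) = 2 * (t - 1)^2" unfolding distrib_left T N_def by algebra
        then show ?thesis using T by algebra
      qed
      finally have "(1 + t) * (3 * t - 1)^2 \<le> 4 * \<theta> * N * (t - 1)^2" using t1 by simp
      moreover have "0 < (1 + t) * (3 * t - 1)^2 - 4 * \<theta> * N * (t - 1)^2"
      proof -
        have "t^2 = \<theta>^4" by (simp add: t_def flip: power_mult)
        then have N: "N = \<theta>^4 - 6 * \<theta>^2 + 1" by (simp add: N_def t_def)
        show ?thesis unfolding N unfolding t_def using \<theta> \<theta>24 by (intro sym_bound_large) simp_all
      qed
      ultimately show False by simp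
    qed
    ultimately show ?thesis ..
  qed
  then show "0 \<le> (Y - \<theta>) * (1 - \<theta> * Y)" "2 * (1 - \<theta>^2)^2 < (1 + \<theta>^2) * (1 + \<theta>^2 + \<theta> * Y^2)"
    by (simp_all add: t_def)
qed

text \<open>The Kesten--Stigum bound is an equality when 1 + t + X = sqrt 2 (t - 1), that is X =
  (sqrt 2 - 1) t - (sqrt 2 + 1). \<open>T\<close> is this value with sqrt 2 rounded down, which errs
  on the safe side, and the cubic tested at \<open>T\<close> shows that X lies below it.\<close>

lemma root_non_extreme:
  assumes \<theta>: "287655/100000 < \<theta>" and Y: "cub \<theta> Y = 0"
  shows "(1 + \<theta>^2 + \<theta> * Y^2)^2 < 2 * (1 - \<theta>^2)^2"
proof -
  define t where "t = \<theta>^2"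
  define X where "X = \<theta> * Y^2"
  define T where "T = 4142135/10000000 * t - 24142135/10000000"
  have \<theta>p: "0 < \<theta>" using \<theta> by simp
  have "(28/10)^2 < \<theta>^2" using \<theta> by (intro power_strict_mono) auto
  then have t: "784/100 < t" by (simp add: t_def power2_eq_square)
  have Yp: "0 < Y" using \<theta>p Y by (rule cub_root_pos)
  have Xp: "0 < X" using \<theta>p Yp by (simp add: X_def)
  have Tp: "0 < T" using t by (simp add: T_def)
  have "X < T"
  proof (rule ccontr)
    assume "\<not> X < T"
    then have "T * (T + (1 + t))^2 * (X + 2 * t)^2 \<le> X * (X + (1 + t))^2 * (T + 2 * t)^2"
      using Tp t by (intro cub_fixed_mono) auto
    moreover have f: "\<theta> * X * (X + (1 + t))^2 = (X + 2 * t)^2"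
      using cub_fixed[OF \<theta>p Y] unfolding X_def t_def .
    ultimately have "\<theta> * (T * (T + (1 + t))^2 * (X + 2 * t)^2) \<le> \<theta> * (X * (X + (1 + t))^2 * (T + 2 * t)^2)"
      using \<theta>p by simp
    also have "\<theta> * (X * (X + (1 + t))^2 * (T + 2 * t)^2) = (X + 2 * t)^2 * (T + 2 * t)^2" unfolding f[symmetric] by algebra
    also have "\<theta> * (T * (T + (1 + t))^2 * (X + 2 * t)^2) = (X + 2 * t)^2 * (\<theta> * T * (T + (1 + t))^2)" by algebra
    finally have "\<theta> * T * (T + (1 + t))^2 \<le> (T + 2 * t)^2" using Xp t by simp
    moreover have "T + (1 + t) = 14142135/10000000 * (t - 1)" "T + 2 * t = 24142135/10000000 * (t - 1)" by (simp_all add: T_def)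
    moreover have "0 < \<theta> * T * (14142135/10000000 * (t - 1))^2 - (24142135/10000000 * (t - 1))^2"
      unfolding T_def t_def using \<theta> by (intro sym_eigenvalue_large) simp
    ultimately show False by simp
  qed
  then have "1 + t + X < 14142135/10000000 * (t - 1)" by (simp add: T_def)
  then have "(1 + t + X)^2 < (14142135/10000000 * (t - 1))^2" using Xp t by (intro power_strict_mono) auto
  also have "\<dots> \<le> 2 * (t - 1)^2" unfolding power_mult_distrib by (intro mult_right_mono) (simp_all add: power2_eq_square)
  also have "(t - 1)^2 = (1 - t)^2" by algebra
  finally show ?thesis by (simp add: t_def X_def)
qed

text \<open>The smaller root is below 1: otherwise, as the cubic is negative at 1, all three roots
  exceed 1. Their product is 2, so each is below 2 and their sum 1/\<theta> is below 6, although
  1/\<theta> > 7. From y < 1 the bound follows by a polynomial in \<theta>.\<close>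

lemma smaller_root_non_extreme:
  assumes \<theta>: "0 < \<theta>" "\<theta> < 1415/10000" and y: "cub \<theta> y = 0" and Y: "cub \<theta> Y = 0" "y < Y"
  shows "(1 + \<theta>^2 + \<theta> * y^2)^2 < 2 * (1 - \<theta>^2)^2"
proof -
  have yp: "0 < y" using \<theta>(1) y by (rule cub_root_pos)
  have c1: "cub \<theta> 1 < 0"
  proof -
    have "cub \<theta> 1 = - (\<theta> * (1 - \<theta>))" by (simp add: cub_def algebra_simps power2_eq_square)
    then show ?thesis using \<theta> by simp
  qed
  have y1: "y < 1"
  proof (rule ccontr)
    assume "\<not> y < 1"
    moreover have "y \<noteq> 1" using c1 y by auto
    ultimately have gt: "1 < y" "1 < Y" using Y by simp_all
    define z where "z = 1 / \<theta> - y - Y"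
    have z: "\<theta> * (y + Y + z) = 1" using \<theta> by (simp add: z_def)
    have "(Y - y) * (\<theta> * (y^2 + y * Y + Y^2) - (y + Y) + (\<theta>^2 + 1)) = 0"
      using y Y(1) unfolding cub_def by algebra
    then have d: "\<theta> * (y^2 + y * Y + Y^2) - (y + Y) + (\<theta>^2 + 1) = 0" using Y(2) by simp
    have "\<theta> * (y * Y * z - 2) = 0" using z d y unfolding cub_def by algebra
    then have p: "y * Y * z = 2" using \<theta> by simp
    have "cub \<theta> b = \<theta> * ((b - y) * (b - Y) * (b - z))" for b using z d y unfolding cub_def by algebra
    from this[of 1] have "cub \<theta> 1 = \<theta> * ((1 - y) * (1 - Y) * (1 - z))" .
    then have "(1 - y) * (1 - Y) * (1 - z) < 0" using c1 \<theta> by (simp add: mult_less_0_iff)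
    moreover have "0 < (1 - y) * (1 - Y)" using gt by (simp add: mult_neg_neg)
    ultimately have z1: "1 < z" using gt by (simp add: mult_less_0_iff)
    have lt: "b < 2" if "1 < a" "1 < b" "1 < c" "a * b * c = 2" for a b c :: real
    proof -
      have "1 * 1 < a * c" using that by (intro mult_strict_mono) auto
      then have "b * 1 < b * (a * c)" using that by (intro mult_strict_left_mono) auto
      also have "b * (a * c) = a * b * c" by algebra
      finally show ?thesis using that by simp
    qed
    have "Y < 2" "y < 2" "z < 2"
      using lt[of y Y z] lt[of Y y z] lt[of y z Y] gt z1 p by (simp_all add: mult_ac)
    then have "\<theta> * (y + Y + z) < \<theta> * 6" using \<theta> by (intro mult_strict_left_mono) auto
    then show False using z \<theta> by simp
  qed
  have "y^2 < 1" using yp y1 by (simp add: power_less_one_iff)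
  then have "1 + \<theta>^2 + \<theta> * y^2 \<le> 1 + \<theta>^2 + \<theta>" using \<theta> by simp
  then have "(1 + \<theta>^2 + \<theta> * y^2)^2 \<le> (1 + \<theta>^2 + \<theta>)^2" using \<theta> by (intro power_mono) auto
  moreover have "0 < 2 * (1 - \<theta>^2)^2 - (1 + \<theta>^2 + \<theta>)^2" using \<theta> by (intro sym_eigenvalue_small) simp_all
  ultimately show ?thesis by simp
qed

section \<open>Extremality of the asymmetric solutions\<close>

lemma sol_in_FP:
  assumes "0 < \<theta>" "\<theta> \<le> thc'" "i \<in> {4, 5, 6, 7}"
  shows "sol \<theta> i \<in> FP \<theta>" "fst (sol \<theta> i) \<noteq> 1"
  using FP_asym_set[OF assms(1,2)] assms(3) by blast+

lemma xp_facts: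
  assumes "2 < \<xi>"
  shows "1 < xp \<xi>" "(1 + xp \<xi>)^2 / xp \<xi> = \<xi> + 2" "\<xi> = xp \<xi> + 1 / xp \<xi>" "xm \<xi> = 1 / xp \<xi>"
    "hh t (xp \<xi>) = 1 + t - t * (\<xi> + 2)"
proof -
  note p = xpm[OF assms]
  show "1 < xp \<xi>" "xm \<xi> = 1 / xp \<xi>" using p by auto
  show "(1 + xp \<xi>)^2 / xp \<xi> = \<xi> + 2" using xpm_iff[OF assms, of "xp \<xi>"] p by simp
  show e: "\<xi> = xp \<xi> + 1 / xp \<xi>" using p by simp
  have "t * \<xi> = t * xp \<xi> + t / xp \<xi>" using arg_cong[OF e, of "\<lambda>z. t * z"] by (simp add: distrib_left)
  then show "hh t (xp \<xi>) = 1 + t - t * (\<xi> + 2)" by (simp add: hh_def distrib_left)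
qed

lemma w_midpoint:
  assumes "0 < \<theta>" "\<theta> \<le> thc'"
  shows "\<theta>^2 * (w1 \<theta> + w2 \<theta>) = 1 + \<theta>^2" "2 * (\<theta>^2 * w1 \<theta>) \<le> 1 + \<theta>^2" "1 + \<theta>^2 \<le> 2 * (\<theta>^2 * w2 \<theta>)"
proof -
  show s: "\<theta>^2 * (w1 \<theta> + w2 \<theta>) = 1 + \<theta>^2" by (rule asym_factor(2)[OF assms(1) wdisc_nonneg[OF assms]])
  have "\<theta>^2 * w1 \<theta> \<le> \<theta>^2 * w2 \<theta>" using w_bounds(1)[OF assms] by (simp add: mult_left_mono)
  then show "2 * (\<theta>^2 * w1 \<theta>) \<le> 1 + \<theta>^2" "1 + \<theta>^2 \<le> 2 * (\<theta>^2 * w2 \<theta>)" using s by (simp_all add: distrib_left)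
qed

text \<open>A single test point with a nonpositive value bounds w1 from above and w2 from below
  without radicals.\<close>

lemma asym_neg_between:
  assumes "0 < \<theta>" "\<theta> \<le> thc'" "asym \<theta> w \<le> 0" shows "w1 \<theta> \<le> w" "w \<le> w2 \<theta>"
proof -
  have "\<theta>^3 * ((w - w1 \<theta>) * (w - w2 \<theta>)) \<le> 0"
    using assms(3) asym_factor(1)[OF assms(1) wdisc_nonneg[OF assms(1,2)]] by (simp add: mult.assoc)
  then have "(w - w1 \<theta>) * (w - w2 \<theta>) \<le> 0" using assms(1) by (simp add: mult_le_0_iff)
  then show "w1 \<theta> \<le> w" "w \<le> w2 \<theta>" using w_bounds(1)[OF assms(1,2)] by (auto simp: mult_le_0_iff)
qed

text \<open>The claim is 2 t x^2 - (1 - t) x + (1 + t) > 0 with t = \<theta>^2, which follows once t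
  x is large enough. Lower bounds of w2 provide this: a test point for \<theta> \<le> 1/4, the
  midpoint of w1 and w2 above.\<close>

lemma asym_main_inequality:
  assumes \<theta>: "0 < \<theta>" "\<theta> \<le> thc'" and x: "1 < x" "w2 \<theta> = x + 2 + 1 / x" and tx: "\<theta>^2 * (1 + x) \<le> 1"
  shows "2 * x * (1 - \<theta>^2 * x) < (1 + \<theta>^2) * (1 + x)"
proof -
  define t where "t = \<theta>^2"
  have t: "0 < t" using \<theta> by (simp add: t_def)
  have \<theta>3: "\<theta> \<le> 3/10" using \<theta> thc'_bounds by simp
  have "t \<le> (3/10)^2" unfolding t_def using \<theta>(1) \<theta>3 by (intro power_mono) auto
  then have t3: "t \<le> 9/100" by (simp add: power2_eq_square)
  have "0 < 2 * t * x^2 - (1 - t) * x + (1 + t)"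
  proof (cases "\<theta> \<le> 1/4")
    case True
    then have "t \<le> (1/4)^2" unfolding t_def using \<theta>(1) by (intro power_mono) auto
    then have t4: "t \<le> 1/16" by (simp add: power2_eq_square)
    \<comment> \<open>A test point with \<theta>^2 w = 7/10; it yields t x \<ge> 7/10 - 3 t, which
      exceeds (1 - t)/2 for t \<le> 1/16.\<close>
    define w where "w = 7 / 10 / t"
    have w: "10 * (\<theta>^2 * w) = 7" using t by (simp add: w_def t_def)
    have "100 * \<theta> * asym \<theta> w = (10 * (\<theta>^2 * w))^2 - 10 * (1 + \<theta>^2) * (10 * (\<theta>^2 * w)) + 100 * \<theta>"
      unfolding asym_def by algebra
    then have "100 * \<theta> * asym \<theta> w = 100 * \<theta> - 70 * \<theta>^2 - 21" unfolding w by simp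
    moreover have "100 * \<theta> - 70 * \<theta>^2 - 21 \<le> 0"
    proof -
      have "8 * (21 - 100 * \<theta> + 70 * \<theta>^2) = (1 - 4 * \<theta>) * (165 - 140 * \<theta>) + 3" by algebra
      moreover have "0 \<le> (1 - 4 * \<theta>) * (165 - 140 * \<theta>)" using True \<theta> by (intro mult_nonneg_nonneg) auto
      ultimately have "0 < 8 * (21 - 100 * \<theta> + 70 * \<theta>^2)" by (simp only: add_nonneg_pos zero_less_numeral)
      then have "0 < 21 - 100 * \<theta> + 70 * \<theta>^2" by (simp only: zero_less_mult_iff) simp
      then show ?thesis by linarith
    qed
    ultimately have "100 * \<theta> * asym \<theta> w \<le> 0" by simp
    then have "asym \<theta> w \<le> 0" using \<theta> by (simp add: mult_le_0_iff)
    then have "w \<le> w2 \<theta>" by (rule asym_neg_between(2)[OF \<theta>])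
    then have "t * w \<le> t * (x + 2 + 1 / x)" unfolding x(2) using t by simp
    also have "\<dots> \<le> t * (x + 3)" using t x by simp
    finally have z: "7/10 - 3 * t \<le> t * x" using w by (simp add: t_def distrib_left)
    then have "0 \<le> 2 * (t * x) - (1 - t)" using t4 by simp
    then have "0 \<le> x * (2 * (t * x) - (1 - t))" using x by simp
    moreover have "2 * t * x^2 - (1 - t) * x + (1 + t) = x * (2 * (t * x) - (1 - t)) + (1 + t)" by algebra
    ultimately show ?thesis using t by simp
  next
    case False
    then have "(1/4)^2 < t" unfolding t_def by (intro power_strict_mono) auto
    then have t4: "1/16 < t" by (simp add: power2_eq_square)
    \<comment> \<open>w2 is at least the midpoint (1 + t)/(2 t). Together with x > 3, which bounds
      1/x, this is strong enough because t > 3/53.\<close>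
    have m: "1 + t \<le> 2 * (t * (x + 2 + 1 / x))" using w_midpoint(3)[OF \<theta>] by (simp add: t_def x(2))
    have x3: "3 < x"
    proof (rule ccontr)
      assume "\<not> 3 < x"
      then have x3: "x \<le> 3" by simp
      then have "0 \<le> (3 - x) * (3 * x - 1)" using x by (intro mult_nonneg_nonneg) auto
      then have "3 * (x^2 + 1) \<le> 10 * x" by (simp add: algebra_simps power2_eq_square)
      then have "(x^2 + 1) / x \<le> 10/3" using x by (simp add: pos_divide_le_eq)
      moreover have "(x^2 + 1) / x = x + 1 / x" using x by (simp add: add_divide_distrib power2_eq_square)
      ultimately have "x + 2 + 1 / x \<le> 16/3" by linarith
      then have "t * (x + 2 + 1 / x) \<le> 9/100 * (16/3)" using t t3 x by (intro mult_mono) auto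
      then show False using m t4 by simp
    qed
    define z where "z = t * x"
    have "1 / x \<le> 1 / 3" using x3 by (simp add: frac_le)
    then have "t * (x + 2 + 1 / x) \<le> t * (x + 7/3)" using t by simp
    then have "1 + t \<le> 2 * (t * (x + 7/3))" using m by simp
    then have z: "1/2 - 11/6 * t \<le> z" by (simp add: z_def distrib_left)
    have "18 * (2 * z^2 - (1 - t) * z + t * (1 + t)) = (6 * z - 3 + 11 * t) * (6 * z - 8 * t) + 2 * (t * (53 * t - 3))"
      by algebra
    moreover have "0 \<le> (6 * z - 3 + 11 * t) * (6 * z - 8 * t)" using z t3 by (intro mult_nonneg_nonneg) linarith+
    moreover have "0 < 2 * (t * (53 * t - 3))" using t t4 by simp
    ultimately have "0 < 18 * (2 * z^2 - (1 - t) * z + t * (1 + t))" by (simp only: add_nonneg_pos)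
    then have "0 < 2 * z^2 - (1 - t) * z + t * (1 + t)" by (simp only: zero_less_mult_iff) simp
    also have "\<dots> = t * (2 * t * x^2 - (1 - t) * x + (1 + t))" unfolding z_def by algebra
    finally show ?thesis using t by (simp add: zero_less_mult_iff)
  qed
  moreover have "(1 + t) * (1 + x) - 2 * x * (1 - t * x) = 2 * t * x^2 - (1 - t) * x + (1 + t)" by algebra
  ultimately show ?thesis unfolding t_def by linarith
qed

context cayley2
begin

text \<open>Since h = 1 + t - t w2 and w2 is above the midpoint of the two roots, 2 h \<le> 1 + t.
  Positivity of h gives the bound on t (1 + x).\<close>

lemma sol_4_7_extreme:
  assumes \<theta>: "\<theta> = exp (J * \<beta>)" and le: "\<theta> \<le> thc'" and i: "i \<in> {4, 7}"
  shows "extreme_gibbs J \<beta> L (TM \<theta> (sol \<theta> i))"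
proof -
  have \<theta>p: "0 < \<theta>" by (simp add: \<theta>)
  define x where "x = xp (\<xi>\<^sub>2 \<theta>)"
  note xf = xp_facts[OF \<xi>_gt_2(2)[OF \<theta>p le], folded x_def]
  have w2: "w2 \<theta> = x + 2 + 1 / x" using xf(3) by (simp add: w2_def)
  have v: "sol \<theta> i \<in> FP \<theta>" "fst (sol \<theta> i) \<noteq> 1" using sol_in_FP[OF \<theta>p le, of i] i by auto
  obtain z y where s: "sol \<theta> i = (z, y)" by fastforce
  have z: "z = x \<or> z = 1 / x" using i s xf(4) by (auto simp: sol_asym x_def)
  have a: "asym \<theta> ((1 + x)^2 / x) = 0"
    unfolding xf(2) using asym_zero_iff[OF \<theta>p le, of "w2 \<theta>"] by (simp add: w2_def)
  have h: "2 * hh (\<theta>^2) x \<le> 1 + \<theta>^2"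
    using w_midpoint(3)[OF \<theta>p le] unfolding xf(5) w2_def by (simp add: algebra_simps)
  have x0: "0 < x" using xf(1) by simp
  have "0 < hh (\<theta>^2) x" using asym_hh(2)[OF \<theta>p x0 a] .
  moreover have "0 < \<theta>^2 / x" using \<theta>p x0 by simp
  ultimately have tx: "\<theta>^2 * (1 + x) \<le> 1" by (simp add: hh_def distrib_left)
  show ?thesis unfolding s
    by (rule asym_extreme_u0[OF \<theta> v(1)[unfolded s] z xf(1) h tx asym_main_inequality[OF \<theta>p le xf(1) w2 tx]])
qed

text \<open>For h = 1/q the equation of w1 reads h^2 = (1 + t) h - \<theta>, which makes the
  eigenvalue condition linear in h: N < h m. This is an upper bound for w1, verified by the sign of
  \<open>asym\<close> at m / (\<theta> N).\<close>

lemma sol_5_6_non_extreme: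
  assumes \<theta>: "\<theta> = exp (J * \<beta>)" and le: "\<theta> \<le> thc'" and i: "i \<in> {5, 6}" and lt: "\<theta> < 171715/1000000"
  shows "non_extreme_gibbs J \<beta> L (TM \<theta> (sol \<theta> i))"
proof -
  have \<theta>p: "0 < \<theta>" by (simp add: \<theta>)
  \<comment> \<open>1/sqrt 2 rounded up, so that 2 r^2 \<ge> 1.\<close>
  define r :: real where "r = 7071068/10000000"
  define t where "t = \<theta>^2"
  define N where "N = r^2 * (1 - t) - (1 + r) * t"
  define m where "m = r - \<theta> * (1 + t)"
  have Np: "0 < N"
  proof -
    have "0 < (7071068/10000000)^2 * (1 - \<theta>^2) - 17071068/10000000 * \<theta>^2" using \<theta>p lt by (intro asym_eigenvalue_num) simp_all
    then show ?thesis by (simp add: N_def r_def t_def)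
  qed
  have mp: "0 < m"
  proof -
    have "0 < 7071068/10000000 - \<theta> * (1 + \<theta>^2)" using \<theta>p lt by (intro asym_eigenvalue_den) simp_all
    then show ?thesis by (simp add: m_def r_def t_def)
  qed
  have key: "0 < (1 + t) * N * m - N^2 - \<theta> * m^2"
  proof -
    have r1: "17071068/10000000 = 1 + r" "7071068/10000000 = r" by (simp_all add: r_def)
    show ?thesis using asym_eigenvalue_poly[of \<theta>] \<theta>p lt unfolding r1 N_def m_def t_def by simp
  qed
  define w where "w = m / (\<theta> * N)"
  have w: "w * (\<theta> * N) = m" using \<theta>p Np by (simp add: w_def)
  have "N^2 * asym \<theta> w = \<theta> * (w * (\<theta> * N))^2 - (1 + t) * N * (w * (\<theta> * N)) + N^2"
    unfolding asym_def t_def by algebra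
  then have "N^2 * asym \<theta> w = - ((1 + t) * N * m - N^2 - \<theta> * m^2)" unfolding w by simp
  then have "N^2 * asym \<theta> w < 0" using key by simp
  then have "asym \<theta> w < 0" using Np by (simp add: mult_less_0_iff)
  then have "asym \<theta> w \<le> 0" "asym \<theta> w \<noteq> 0" by simp_all
  then have ww: "w1 \<theta> < w"
    using asym_neg_between(1)[OF \<theta>p le] asym_zero_iff[OF \<theta>p le, of w] by force
  define x where "x = xp (\<xi>\<^sub>1 \<theta>)"
  note xf = xp_facts[OF \<xi>_gt_2(1)[OF \<theta>p le], folded x_def]
  have v: "sol \<theta> i \<in> FP \<theta>" "fst (sol \<theta> i) \<noteq> 1" using sol_in_FP[OF \<theta>p le, of i] i by auto
  obtain z y where s: "sol \<theta> i = (z, y)" by fastforce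
  have z: "z = x \<or> z = 1 / x" using i s xf(4) by (auto simp: sol_asym x_def)
  have x0: "0 < x" using xf(1) by simp
  have "(1 + 1 / x)^2 / (1 / x) = (1 + x)^2 / x" using x0 by (simp add: field_simps power2_eq_square)
  then have wz: "(1 + z)^2 / z = w1 \<theta>" using z xf(2) by (auto simp: w1_def)
  define q where "q = \<theta> * w1 \<theta>"
  have w1p: "0 < w1 \<theta>" using w_bounds(2)[OF \<theta>p le] by simp
  have qp: "0 < q" using \<theta>p w1p by (simp add: q_def)
  define h where "h = 1 / q"
  have hq: "h * q = 1" using qp by (simp add: h_def)
  have "asym \<theta> (w1 \<theta>) = 0" using asym_zero_iff[OF \<theta>p le] by blast
  then have "\<theta> * q^2 - (1 + t) * q + 1 = 0" unfolding asym_def q_def t_def by algebra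
  then have h2: "h^2 = (1 + t) * h - \<theta>" using hq by algebra
  have "q * N < m"
  proof -
    have "\<theta> * N * w1 \<theta> < \<theta> * N * w" using ww \<theta>p Np by simp
    then show ?thesis using w by (simp add: q_def mult_ac)
  qed
  then have hm: "N < h * m" using qp by (simp add: h_def pos_less_divide_eq mult.commute)
  have "\<theta> / q^2 = \<theta> * h^2" by (simp add: h_def power_divide)
  then have "r^2 * (1 - \<theta>^2) - r * (\<theta>^2 + 1 / q) + \<theta> / q^2 = r^2 * (1 - t) - r * (t + h) + \<theta> * ((1 + t) * h - \<theta>)"
    unfolding h2 by (simp add: t_def h_def)
  also have "\<dots> = N - h * m" unfolding N_def m_def t_def by algebra
  also have "\<dots> < 0" using hm by simp
  finally have neg: "r^2 * (1 - \<theta>^2) - r * (\<theta>^2 + 1 / q) + \<theta> / q^2 < 0" .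
  have r: "0 \<le> r" "1 \<le> 2 * r^2" by (simp_all add: r_def power2_eq_square)
  have "q = \<theta> * ((1 + z)^2 / z)" unfolding wz q_def ..
  then show ?thesis unfolding s using asym_non_extreme[OF \<theta> _ _ r _ neg] v s by simp
qed

text \<open>Here \<kappa> = 0.584, and 2 * 0.584 * 0.855 = 0.99864. The three inequalities use only
  the range of t and x > 31/10: expanded in u = 10 x - 31 they have nonnegative
  coefficients.\<close>

lemma sol_5_6_extreme:
  assumes \<theta>: "\<theta> = exp (J * \<beta>)" and le: "\<theta> \<le> thc'" and i: "i \<in> {5, 6}" and gt: "26586/100000 < \<theta>"
  shows "extreme_gibbs J \<beta> L (TM \<theta> (sol \<theta> i))"
proof -
  have \<theta>p: "0 < \<theta>" by (simp add: \<theta>)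
  have \<theta>b: "26586/100000 \<le> \<theta>" "\<theta> \<le> 29565/100000" using gt le thc'_bounds by simp_all
  define t where "t = \<theta>^2"
  have "(26586/100000)^2 \<le> t" "t \<le> (29565/100000)^2" unfolding t_def using \<theta>b by (intro power_mono; simp)+
  then have t: "7068/100000 \<le> t" "t \<le> 875/10000" by (simp_all add: power2_eq_square)
  define x where "x = xp (\<xi>\<^sub>1 \<theta>)"
  note xf = xp_facts[OF \<xi>_gt_2(1)[OF \<theta>p le], folded x_def]
  have v: "sol \<theta> i \<in> FP \<theta>" "fst (sol \<theta> i) \<noteq> 1" using sol_in_FP[OF \<theta>p le, of i] i by auto
  obtain z y where s: "sol \<theta> i = (z, y)" by fastforce
  have z: "z = x \<or> z = 1 / x" using i s xf(4) by (auto simp: sol_asym x_def)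
  have x0: "0 < x" using xf(1) by simp
  \<comment> \<open>If x \<le> 31/10, then w1 \<le> 1681/310. There \<open>asym\<close> is positive,
    so w2 is below 1681/310 too, contradicting that w2 is at least (1 + t)/(2 t).\<close>
  have x31: "31/10 < x"
  proof (rule ccontr)
    assume "\<not> 31/10 < x"
    then have "0 \<le> (31/10 - x) * (31 * x - 10)" using xf(1) by (intro mult_nonneg_nonneg) auto
    then have "10 * x^2 + 10 \<le> (961/10 + 10) / (31/10) * 1 * x" by (simp add: algebra_simps power2_eq_square)
    then have "10 * (x^2 + 1) \<le> 10 * (1061/310 * x)" by simp
    then have "(x^2 + 1) / x \<le> 1061/310" using x0 by (simp add: pos_divide_le_eq)
    moreover have "(x^2 + 1) / x = x + 1 / x" using x0 by (simp add: add_divide_distrib power2_eq_square)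
    ultimately have w: "w1 \<theta> \<le> 1681/310" using xf(3) by (simp add: w1_def)
    have "asym \<theta> (1681/310) = (1681/310)^2 * \<theta>^3 - 1681/310 * (\<theta> * (1 + \<theta>^2)) + 1" by (simp add: asym_def algebra_simps)
    also have "0 < \<dots>" using \<theta>b by (intro asym_x_lower_poly) simp_all
    finally have "0 < asym \<theta> (1681/310)" .
    then have "0 < \<theta>^3 * ((1681/310 - w1 \<theta>) * (1681/310 - w2 \<theta>))"
      using asym_factor(1)[OF \<theta>p wdisc_nonneg[OF \<theta>p le]] by (simp add: mult.assoc)
    then have "0 < (1681/310 - w1 \<theta>) * (1681/310 - w2 \<theta>)" using \<theta>p by (simp add: zero_less_mult_iff)
    then have w2: "w2 \<theta> < 1681/310" using w by (simp add: zero_less_mult_iff)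
    have "t * w2 \<theta> \<le> 875/10000 * (1681/310)" using t w2 w_bounds(1,2)[OF \<theta>p le] by (intro mult_mono) auto
    then show False using w_midpoint(3)[OF \<theta>p le, folded t_def] t by simp
  qed
  define u where "u = 10 * x - 31"
  have u: "0 \<le> u" using x31 by (simp add: u_def)
  define g where "g = t / x"
  have g: "0 \<le> g" "x * g = t" using t x0 by (simp_all add: g_def)
  define h where "h = hh t x"
  have h: "h = 1 - t - t * x - g" by (simp add: h_def hh_def g_def)
  have xh: "x * h = (1 - t) * x - t * x^2 - t" 
  proof -
    have "x * (1 - t - t * x - g) = (1 - t) * x - t * x^2 - x * g" by algebra
    then show ?thesis unfolding h g(2) .
  qed
  have k01: "x * hh (\<theta>^2) x + 5/4 * \<theta>^2 \<le> 584/1000 * (1 - \<theta>^2) * (1 + x)"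
  proof -
    have "10000 * (584/1000 * (1 - t) * (1 + x)) = 10000 * (x * h + 5/4 * t)
        + ((100656 * t - 7056) + 1 * ((6200 * t - 416 * (1 - t)) * u) + 100 * (t * u^2))"
      unfolding xh u_def by algebra
    note eq = this
    moreover have "0 \<le> t * u^2" "0 \<le> (6200 * t - 416 * (1 - t)) * u" "0 \<le> 100656 * t - 7056" using t u by simp_all
    ultimately show ?thesis unfolding t_def[symmetric] h_def[symmetric]
      using le_certificate[OF eq] zero_le_numeral zero_less_numeral zero_le_one by blast
  qed
  have k02: "hh (\<theta>^2) x * (x - 1) + 5/4 * (1 - \<theta>^2 / x) \<le> 5/4 * (584/1000) * (1 - \<theta>^2) * (1 + x)"
  proof -
    have "10000 * (x * (5/4 * (584/1000) * (1 - t) * (1 + x))) = 10000 * ((x * h) * (x - 1) + 5/4 * (x - x * g))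
        + (((207627 * t - 11067) + (23574 * t - 1194) * u) + 1 * ((857 * t - 27) * u^2) + 10 * (t * u^3))"
      unfolding xh g(2) u_def by algebra
    note eq = this
    moreover have "0 \<le> t * u^3" "0 \<le> (857 * t - 27) * u^2" using t u by simp_all
    moreover have "0 \<le> (207627 * t - 11067) + (23574 * t - 1194) * u" using t u by (intro add_nonneg_nonneg mult_nonneg_nonneg) simp_all
    ultimately have "(x * h) * (x - 1) + 5/4 * (x - x * g) \<le> x * (5/4 * (584/1000) * (1 - t) * (1 + x))"
      using le_certificate[OF eq] zero_le_numeral zero_less_numeral zero_le_one by blast
    also have "(x * h) * (x - 1) + 5/4 * (x - x * g) = x * (h * (x - 1) + 5/4 * (1 - g))" by algebra
    finally show ?thesis unfolding t_def[symmetric] h_def[symmetric] g_def[symmetric] using x0 by (simp only: mult_le_cancel_left_pos)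
  qed
  have k12: "hh (\<theta>^2) x + 5/4 * (\<theta>^2 * x) \<le> 584/1000 * (1 - \<theta>^2) * (1 + x)"
  proof -
    have "10000 * (584/1000 * (1 - t) * (1 + x)) = 10000 * (h + 5/4 * (t * x))
        + ((13944 * (1 - t) - 7750 * t) + 1 * ((584 * (1 - t) - 250 * t) * u) + 10000 * g)"
      unfolding h u_def by algebra
    note eq = this
    moreover have "0 \<le> (584 * (1 - t) - 250 * t) * u" "0 \<le> 13944 * (1 - t) - 7750 * t" using t u by simp_all
    ultimately show ?thesis unfolding t_def[symmetric] h_def[symmetric] using g(1) le_certificate[OF eq] zero_le_numeral zero_less_numeral zero_le_one by blast
  qed
  show ?thesis unfolding s
    by (rule asym_extreme_u1[OF \<theta> v(1)[unfolded s] z xf(1) \<theta>b _ _ k01 k02 k12]) simp_all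
qed

end

section \<open>The theorem\<close>

lemma card_FP:
  assumes "0 < \<theta>" "{v \<in> FP \<theta>. fst v = 1} = sol \<theta> ` A" "card {v \<in> FP \<theta>. fst v = 1} = m" "finite A"
    and "{v \<in> FP \<theta>. fst v \<noteq> 1} = sol \<theta> ` B" "card {v \<in> FP \<theta>. fst v \<noteq> 1} = n" "finite B"
  shows "FP \<theta> = sol \<theta> ` (A \<union> B)" "card (FP \<theta>) = m + n"
proof -
  show "FP \<theta> = sol \<theta> ` (A \<union> B)" unfolding image_Un assms(2,5)[symmetric] by (rule FP_split)
  have "card ({v \<in> FP \<theta>. fst v = 1} \<union> {v \<in> FP \<theta>. fst v \<noteq> 1}) = m + n"
    using assms by (subst card_Un_disjoint) auto
  then show "card (FP \<theta>) = m + n" by (simp only: FP_split[symmetric])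
qed

context cayley2
begin

lemma \<mu>_sos_TM:
  assumes "\<theta> = exp (J * \<beta>)" "sol \<theta> i \<in> FP \<theta>"
  shows "\<mu>_sos L x0 J \<beta> i = TM \<theta> (sol \<theta> i)"
  unfolding \<mu>_sos_def assms(1)[symmetric] using assms by (rule TISGM_at_eq)

lemma TISGM_classification:
  assumes \<theta>: "\<theta> = exp (J * \<beta>)" and FP: "FP \<theta> = sol \<theta> ` I" "card (FP \<theta>) = n"
  shows "{\<mu>. TISGM J \<beta> L x0 \<mu>} = \<mu>_sos L x0 J \<beta> ` I \<and> card {\<mu>. TISGM J \<beta> L x0 \<mu>} = n"
proof -
  have \<theta>p: "0 < \<theta>" by (simp add: \<theta>)
  have "TM \<theta> ` FP \<theta> = \<mu>_sos L x0 J \<beta> ` I"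
    unfolding FP(1) image_image
    by (rule image_cong[OF refl]) (rule \<mu>_sos_TM[OF \<theta>, symmetric], use FP(1) in blast)
  then show ?thesis
    using card_image[OF inj_TM[OF \<theta>p]] FP(2) by (simp only: TISGM_set[OF \<theta>])
qed

lemma cubic_root_FP: "0 < \<theta> \<Longrightarrow> cub \<theta> y = 0 \<Longrightarrow> (1, y) \<in> FP \<theta>"
  by (simp add: FP_sym_iff cub_root_pos cubic_roots_cub)

lemma Max_cubic_root:
  assumes "0 < \<theta>"
  shows "cub \<theta> (Max (cubic_roots \<theta>)) = 0" "cub \<theta> y = 0 \<Longrightarrow> y \<le> Max (cubic_roots \<theta>)"
  using Max_in[OF finite_cubic_roots[OF assms]] Max_ge[OF finite_cubic_roots(1)[OF assms]]
  by (auto simp: cubic_roots_cub)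

lemma \<mu>_sos_1:
  assumes \<theta>: "\<theta> = exp (J * \<beta>)"
  shows "\<theta> < 2655/1000 \<Longrightarrow> extreme_gibbs J \<beta> L (\<mu>_sos L x0 J \<beta> 1)"
    and "287655/100000 < \<theta> \<Longrightarrow> non_extreme_gibbs J \<beta> L (\<mu>_sos L x0 J \<beta> 1)"
proof -
  have \<theta>p: "0 < \<theta>" by (simp add: \<theta>)
  define Y where "Y = Max (cubic_roots \<theta>)"
  note Y = Max_cubic_root[OF \<theta>p, folded Y_def]
  have v: "(1, Y) \<in> FP \<theta>" using \<theta>p Y(1) by (rule cubic_root_FP)
  have s: "sol \<theta> 1 = (1, Y)" by (simp only: sol_sym Y_def)
  have eq: "\<mu>_sos L x0 J \<beta> 1 = TM \<theta> (1, Y)" unfolding s[symmetric] by (rule \<mu>_sos_TM[OF \<theta>]) (unfold s, rule v)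
  show "extreme_gibbs J \<beta> L (\<mu>_sos L x0 J \<beta> 1)" if "\<theta> < 2655/1000"
    unfolding eq by (rule sym_extreme[OF \<theta> v largest_root_extreme[OF \<theta>p that Y]])
  show "non_extreme_gibbs J \<beta> L (\<mu>_sos L x0 J \<beta> 1)" if "287655/100000 < \<theta>"
    unfolding eq by (rule sym_non_extreme[OF \<theta> v root_non_extreme[OF that Y(1)]])
qed

lemma \<mu>_sos_2_3:
  assumes \<theta>: "\<theta> = exp (J * \<beta>)" and lt: "\<theta> < 1415/10000" and d: "0 \<le> cdisc \<theta>"
  shows "non_extreme_gibbs J \<beta> L (\<mu>_sos L x0 J \<beta> 2)" "non_extreme_gibbs J \<beta> L (\<mu>_sos L x0 J \<beta> 3)"
proof -
  have \<theta>p: "0 < \<theta>" by (simp add: \<theta>)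
  let ?R = "cubic_roots \<theta>"
  note R = finite_cubic_roots[OF \<theta>p]
  have n: "non_extreme_gibbs J \<beta> L (\<mu>_sos L x0 J \<beta> i)" if s: "sol \<theta> i = (1, y)" and y: "y \<in> ?R" "y \<noteq> Max ?R" for i y
  proof -
    have c: "cub \<theta> y = 0" using y by (simp add: cubic_roots_cub)
    have lt': "y < Max ?R" using Max_ge[OF R(1) y(1)] y(2) by simp
    have v: "(1, y) \<in> FP \<theta>" using \<theta>p c by (rule cubic_root_FP)
    have eq: "\<mu>_sos L x0 J \<beta> i = TM \<theta> (1, y)" unfolding s[symmetric] by (rule \<mu>_sos_TM[OF \<theta>]) (unfold s, rule v)
    show ?thesis unfolding eq
      by (rule sym_non_extreme[OF \<theta> v smaller_root_non_extreme[OF \<theta>p lt c Max_cubic_root(1)[OF \<theta>p] lt']])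
  qed
  have "card ?R \<noteq> 1 \<and> card ?R \<noteq> 0" using card_cubic_roots[OF \<theta>p] d by (cases "cdisc \<theta> = 0") auto
  then have ne: "?R - {Max ?R} \<noteq> {}"
    using R Max_in[OF R] by (metis card_1_singleton_iff Diff_eq_empty_iff One_nat_def subset_singletonD)
  have m: "Max (?R - {Max ?R}) \<in> ?R - {Max ?R}" using R(1) ne by (intro Max_in) auto
  then show "non_extreme_gibbs J \<beta> L (\<mu>_sos L x0 J \<beta> 2)" by (intro n[OF sol_sym(3)]) auto
  obtain z where z: "z \<in> ?R" "z \<noteq> Max ?R" using ne by blast
  then have "z < Max ?R" using Max_ge[OF R(1) z(1)] by simp
  moreover have "Min ?R \<le> z" using R(1) z(1) by (rule Min_le)
  ultimately have "Min ?R \<noteq> Max ?R" by simp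
  then show "non_extreme_gibbs J \<beta> L (\<mu>_sos L x0 J \<beta> 3)" using Min_in[OF R] by (intro n[OF sol_sym(4)])
qed

end

theorem theorem1:
  fixes L :: "'v rel" and x0 :: 'v
  assumes "cayley_tree 2 L"
  shows "\<exists>\<theta>c \<theta>c' :: real.
    rounds_to \<theta>c 4 0.1414 \<and>
    \<theta>c' = 1/3 * (root 3 (26 + 6 * sqrt 33) - 8 / root 3 (26 + 6 * sqrt 33) - 1) \<and>
    rounds_to \<theta>c' 4 0.2956 \<and>
    (\<forall>J \<beta> \<theta> :: real. \<beta> > 0 \<longrightarrow> \<theta> = exp (J * \<beta>) \<longrightarrow>
       (\<theta> > \<theta>c' \<longrightarrow>
          {\<mu>. TISGM J \<beta> L x0 \<mu>} = \<mu>_sos L x0 J \<beta> ` {1} \<and> card {\<mu>. TISGM J \<beta> L x0 \<mu>} = 1) \<and>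
       (\<theta> = \<theta>c' \<longrightarrow>
          {\<mu>. TISGM J \<beta> L x0 \<mu>} = \<mu>_sos L x0 J \<beta> ` {1, 4, 6} \<and>
          card {\<mu>. TISGM J \<beta> L x0 \<mu>} = 3) \<and>
       (\<theta>c < \<theta> \<and> \<theta> < \<theta>c' \<longrightarrow>
          {\<mu>. TISGM J \<beta> L x0 \<mu>} = \<mu>_sos L x0 J \<beta> ` {1, 4, 5, 6, 7} \<and>
          card {\<mu>. TISGM J \<beta> L x0 \<mu>} = 5) \<and>
       (\<theta> = \<theta>c \<longrightarrow>
          {\<mu>. TISGM J \<beta> L x0 \<mu>} = \<mu>_sos L x0 J \<beta> ` {1, 3, 4, 5, 6, 7} \<and>
          card {\<mu>. TISGM J \<beta> L x0 \<mu>} = 6) \<and>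
       (\<theta> < \<theta>c \<longrightarrow>
          {\<mu>. TISGM J \<beta> L x0 \<mu>} = \<mu>_sos L x0 J \<beta> ` {1, 2, 3, 4, 5, 6, 7} \<and>
          card {\<mu>. TISGM J \<beta> L x0 \<mu>} = 7)) \<and>
    (\<exists>\<theta>b \<theta>bb :: real. rounds_to \<theta>b 3 2.655 \<and> rounds_to \<theta>bb 4 2.8765 \<and>
       (\<forall>J \<beta> \<theta> :: real. \<beta> > 0 \<longrightarrow> \<theta> = exp (J * \<beta>) \<longrightarrow>
          (\<theta> < \<theta>b \<longrightarrow> extreme_gibbs J \<beta> L (\<mu>_sos L x0 J \<beta> 1)) \<and>
          (\<theta> > \<theta>bb \<longrightarrow> non_extreme_gibbs J \<beta> L (\<mu>_sos L x0 J \<beta> 1)))) \<and>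
    (\<forall>J \<beta> \<theta> :: real. \<beta> > 0 \<longrightarrow> \<theta> = exp (J * \<beta>) \<longrightarrow> \<theta> \<le> \<theta>c \<longrightarrow>
       non_extreme_gibbs J \<beta> L (\<mu>_sos L x0 J \<beta> 2) \<and>
       non_extreme_gibbs J \<beta> L (\<mu>_sos L x0 J \<beta> 3)) \<and>
    (\<exists>\<theta>s \<theta>ss :: real. rounds_to \<theta>s 5 0.17172 \<and> rounds_to \<theta>ss 5 0.26586 \<and>
       (\<forall>J \<beta> \<theta> :: real. \<beta> > 0 \<longrightarrow> \<theta> = exp (J * \<beta>) \<longrightarrow> \<theta> \<le> \<theta>c' \<longrightarrow>
          (\<theta> < \<theta>s \<longrightarrow> non_extreme_gibbs J \<beta> L (\<mu>_sos L x0 J \<beta> 5) \<and>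
                      non_extreme_gibbs J \<beta> L (\<mu>_sos L x0 J \<beta> 6)) \<and>
          (\<theta> > \<theta>ss \<longrightarrow> extreme_gibbs J \<beta> L (\<mu>_sos L x0 J \<beta> 5) \<and>
                       extreme_gibbs J \<beta> L (\<mu>_sos L x0 J \<beta> 6)))) \<and>
    (\<forall>J \<beta> \<theta> :: real. \<beta> > 0 \<longrightarrow> \<theta> = exp (J * \<beta>) \<longrightarrow> \<theta> \<le> \<theta>c' \<longrightarrow>
       extreme_gibbs J \<beta> L (\<mu>_sos L x0 J \<beta> 4) \<and>
       extreme_gibbs J \<beta> L (\<mu>_sos L x0 J \<beta> 7))"
proof -
  interpret cayley2 L x0 using assms by unfold_locales
  obtain c where c: "14135/100000 \<le> c" "c \<le> 14145/100000" "cdisc c = 0"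
    and c_lt: "\<And>\<theta>. 0 < \<theta> \<Longrightarrow> \<theta> < c \<Longrightarrow> 0 < cdisc \<theta>" and c_gt: "\<And>\<theta>. c < \<theta> \<Longrightarrow> cdisc \<theta> < 0"
    using cdisc_threshold by blast
  have cc: "c < thc'" using c thc'_bounds by simp
  \<comment> \<open>2.655 and 0.26586 are the printed values. 2.87655 and 0.171715 differ from
    theirs by exactly half a unit of the last digit, the most that rounding allows, in the direction
    that weakens the claims.\<close>
  have ex: "rounds_to c 4 0.1414" "rounds_to thc' 4 0.2956" "rounds_to (2655/1000) 3 2.655"
    "rounds_to (287655/100000) 4 2.8765" "rounds_to (171715/1000000) 5 0.17172" "rounds_to (26586/100000) 5 0.26586"
    using c thc'_bounds by (auto simp: rounds_to_def abs_if field_simps)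
  { fix J \<beta> \<theta> :: real assume "\<beta> > 0" and \<theta>: "\<theta> = exp (J * \<beta>)"
    have \<theta>p: "0 < \<theta>" by (simp add: \<theta>)
    have sets: "{\<mu>. TISGM J \<beta> L x0 \<mu>} = \<mu>_sos L x0 J \<beta> ` I \<and> card {\<mu>. TISGM J \<beta> L x0 \<mu>} = k"
      if "{v \<in> FP \<theta>. fst v = 1} = sol \<theta> ` A" "card {v \<in> FP \<theta>. fst v = 1} = m" "finite A"
        "{v \<in> FP \<theta>. fst v \<noteq> 1} = sol \<theta> ` B" "card {v \<in> FP \<theta>. fst v \<noteq> 1} = n" "finite B"
        and I: "A \<union> B = I" "m + n = k" for A B m n I k
      using \<theta> card_FP[OF \<theta>p that(1-6), unfolded I] by (rule TISGM_classification)
    have one: "{v \<in> FP \<theta>. fst v = 1} = sol \<theta> ` {1}" "card {v \<in> FP \<theta>. fst v = 1} = 1" if "c < \<theta>"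
      using FP_sym_sols(3,6)[OF \<theta>p c_gt[OF that]] .
    have four: "{v \<in> FP \<theta>. fst v \<noteq> 1} = sol \<theta> ` {4, 5, 6, 7}" "card {v \<in> FP \<theta>. fst v \<noteq> 1} = 4" if "\<theta> < thc'"
      using FP_asym_set[OF \<theta>p] card_asym(1)[OF \<theta>p that] that by simp_all
    have "(\<theta> > thc' \<longrightarrow>
          {\<mu>. TISGM J \<beta> L x0 \<mu>} = \<mu>_sos L x0 J \<beta> ` {1} \<and> card {\<mu>. TISGM J \<beta> L x0 \<mu>} = 1) \<and>
       (\<theta> = thc' \<longrightarrow>
          {\<mu>. TISGM J \<beta> L x0 \<mu>} = \<mu>_sos L x0 J \<beta> ` {1, 4, 6} \<and>
          card {\<mu>. TISGM J \<beta> L x0 \<mu>} = 3) \<and>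
       (c < \<theta> \<and> \<theta> < thc' \<longrightarrow>
          {\<mu>. TISGM J \<beta> L x0 \<mu>} = \<mu>_sos L x0 J \<beta> ` {1, 4, 5, 6, 7} \<and>
          card {\<mu>. TISGM J \<beta> L x0 \<mu>} = 5) \<and>
       (\<theta> = c \<longrightarrow>
          {\<mu>. TISGM J \<beta> L x0 \<mu>} = \<mu>_sos L x0 J \<beta> ` {1, 3, 4, 5, 6, 7} \<and>
          card {\<mu>. TISGM J \<beta> L x0 \<mu>} = 6) \<and>
       (\<theta> < c \<longrightarrow>
          {\<mu>. TISGM J \<beta> L x0 \<mu>} = \<mu>_sos L x0 J \<beta> ` {1, 2, 3, 4, 5, 6, 7} \<and>
          card {\<mu>. TISGM J \<beta> L x0 \<mu>} = 7)"
    proof (intro conjI[where P = "_ \<longrightarrow> _"] impI)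
      assume t: "thc' < \<theta>"
      then have "c < \<theta>" using cc by simp
      from one[OF this] show "{\<mu>. TISGM J \<beta> L x0 \<mu>} = \<mu>_sos L x0 J \<beta> ` {1} \<and> card {\<mu>. TISGM J \<beta> L x0 \<mu>} = 1"
        by (rule sets[where B = "{}" and n = 0]) (simp_all add: FP_asym_empty[OF t])
    next
      assume t: "\<theta> = thc'"
      then have ct: "c < \<theta>" and le: "\<theta> \<le> thc'" using cc by simp_all
      have "{v \<in> FP \<theta>. fst v \<noteq> 1} = sol \<theta> ` {4, 6}" "card {v \<in> FP \<theta>. fst v \<noteq> 1} = 2"
        using FP_asym_set[OF \<theta>p le] card_asym(2)[OF \<theta>p t] by simp_all
      with one[OF ct] show "{\<mu>. TISGM J \<beta> L x0 \<mu>} = \<mu>_sos L x0 J \<beta> ` {1, 4, 6} \<and> card {\<mu>. TISGM J \<beta> L x0 \<mu>} = 3"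
        by (intro sets[of "{1}" 1 "{4, 6}" 2]) auto
    next
      assume t: "c < \<theta> \<and> \<theta> < thc'"
      show "{\<mu>. TISGM J \<beta> L x0 \<mu>} = \<mu>_sos L x0 J \<beta> ` {1, 4, 5, 6, 7} \<and> card {\<mu>. TISGM J \<beta> L x0 \<mu>} = 5"
        by (rule sets[OF one _ four]) (use t in auto)
    next
      assume t: "\<theta> = c"
      then have d: "cdisc \<theta> = 0" and lt: "\<theta> < thc'" using c cc by simp_all
      show "{\<mu>. TISGM J \<beta> L x0 \<mu>} = \<mu>_sos L x0 J \<beta> ` {1, 3, 4, 5, 6, 7} \<and> card {\<mu>. TISGM J \<beta> L x0 \<mu>} = 6"
        by (rule sets[OF FP_sym_sols(2,5)[OF \<theta>p d] _ four[OF lt]]) auto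
    next
      assume t: "\<theta> < c"
      then have d: "0 < cdisc \<theta>" and lt: "\<theta> < thc'" using c_lt[OF \<theta>p] cc by simp_all
      show "{\<mu>. TISGM J \<beta> L x0 \<mu>} = \<mu>_sos L x0 J \<beta> ` {1, 2, 3, 4, 5, 6, 7} \<and> card {\<mu>. TISGM J \<beta> L x0 \<mu>} = 7"
        by (rule sets[OF FP_sym_sols(1,4)[OF \<theta>p d] _ four[OF lt]]) auto
    qed }
  note existence = this
  have two: "non_extreme_gibbs J \<beta> L (\<mu>_sos L x0 J \<beta> 2) \<and> non_extreme_gibbs J \<beta> L (\<mu>_sos L x0 J \<beta> 3)"
    if "\<theta> = exp (J * \<beta>)" "\<theta> \<le> c" for J \<beta> \<theta>
  proof -
    have "0 < \<theta>" by (simp add: that(1))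
    then have "0 \<le> cdisc \<theta>" using c(3) c_lt[of \<theta>] that(2) by (cases "\<theta> = c") auto
    moreover have "\<theta> < 1415/10000" using that c by simp
    ultimately show ?thesis using \<mu>_sos_2_3[OF that(1)] by blast
  qed
  have TM: "\<mu>_sos L x0 J \<beta> i = TM \<theta> (sol \<theta> i)" if "\<theta> = exp (J * \<beta>)" "\<theta> \<le> thc'" "i \<in> {4, 5, 6, 7}" for J \<beta> \<theta> i
    using \<mu>_sos_TM[OF that(1) sol_in_FP(1)[OF _ that(2,3)]] that(1) by simp
  have five: "(\<theta> < 171715/1000000 \<longrightarrow> non_extreme_gibbs J \<beta> L (\<mu>_sos L x0 J \<beta> 5) \<and>
                      non_extreme_gibbs J \<beta> L (\<mu>_sos L x0 J \<beta> 6)) \<and>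
          (\<theta> > 26586/100000 \<longrightarrow> extreme_gibbs J \<beta> L (\<mu>_sos L x0 J \<beta> 5) \<and>
                       extreme_gibbs J \<beta> L (\<mu>_sos L x0 J \<beta> 6))"
    if "\<theta> = exp (J * \<beta>)" "\<theta> \<le> thc'" for J \<beta> \<theta>
    using TM[OF that, of 5] TM[OF that, of 6] sol_5_6_non_extreme[OF that] sol_5_6_extreme[OF that] by simp
  have four: "extreme_gibbs J \<beta> L (\<mu>_sos L x0 J \<beta> 4) \<and> extreme_gibbs J \<beta> L (\<mu>_sos L x0 J \<beta> 7)"
    if "\<theta> = exp (J * \<beta>)" "\<theta> \<le> thc'" for J \<beta> \<theta>
    using TM[OF that, of 4] TM[OF that, of 7] sol_4_7_extreme[OF that] by simp
  show ?thesis
  proof (rule exI[of _ c], rule exI[of _ thc'], intro conjI)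
    show "\<exists>\<theta>b \<theta>bb :: real. rounds_to \<theta>b 3 2.655 \<and> rounds_to \<theta>bb 4 2.8765 \<and>
       (\<forall>J \<beta> \<theta> :: real. \<beta> > 0 \<longrightarrow> \<theta> = exp (J * \<beta>) \<longrightarrow>
          (\<theta> < \<theta>b \<longrightarrow> extreme_gibbs J \<beta> L (\<mu>_sos L x0 J \<beta> 1)) \<and>
          (\<theta> > \<theta>bb \<longrightarrow> non_extreme_gibbs J \<beta> L (\<mu>_sos L x0 J \<beta> 1)))"
      using ex(3,4) \<mu>_sos_1 by blast
    show "\<exists>\<theta>s \<theta>ss :: real. rounds_to \<theta>s 5 0.17172 \<and> rounds_to \<theta>ss 5 0.26586 \<and>
       (\<forall>J \<beta> \<theta> :: real. \<beta> > 0 \<longrightarrow> \<theta> = exp (J * \<beta>) \<longrightarrow> \<theta> \<le> thc' \<longrightarrow>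
          (\<theta> < \<theta>s \<longrightarrow> non_extreme_gibbs J \<beta> L (\<mu>_sos L x0 J \<beta> 5) \<and>
                      non_extreme_gibbs J \<beta> L (\<mu>_sos L x0 J \<beta> 6)) \<and>
          (\<theta> > \<theta>ss \<longrightarrow> extreme_gibbs J \<beta> L (\<mu>_sos L x0 J \<beta> 5) \<and>
                       extreme_gibbs J \<beta> L (\<mu>_sos L x0 J \<beta> 6)))"
      using ex(5,6) five by blast
  qed (rule ex(1), rule thc'_def, rule ex(2), intro allI impI, rule existence, assumption, assumption,
      intro allI impI, rule two, assumption, assumption, intro allI impI, rule four, assumption, assumption)
qed

end
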